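(* Let $f$ be a (normalized) cuspidal Hecke eigenform of level one and weight $2n$, let $K_f\subset\mathbb{R}$ be the field generated by its Fourier coefficients, and let $P_f$ be a period matrix of $f$. Then $$\det(P_f)\in(2\pi i)^{2n-1}K_f^{\times}.$$
   Context: For $m\in\mathbb{Z}$, $M_m^!$ is the $\mathbb{Q}$-vector space of weakly holomorphic modular forms of weight $m$ for $\mathrm{SL}_2(\mathbb{Z})$ (holomorphic on the upper half plane $\mathfrak{H}$, meromorphic at the cusp) with rational Fourier coefficients, $\mathcal{D}=q\frac{d}{dq}$, $q=e^{2\pi iz}$; by Bol's identity $\mathcal{D}^{2n-1}$ maps $M^!_{2-2n}$ into $M^!_{2n}$. Put $H^{dR}=M_{2n}^!/\mathcal{D}^{2n-1}M_{2-2n}^!$. Hecke operators act on it via $T_p\sum_m a_mq^m=\sum_m(a_{pm}+p^{2n-1}a_{m/p})q^m$ for $p$ prime, where $a_{m/p}=0$ if $p\nmid m$. $V^B=\mathbb{Q}\mathbf{a}\oplus\mathbb{Q}\mathbf{b}$ and $V^B_{2n-2}=\mathrm{Sym}^{2n-2}V^B$. Integer matrices $g=\begin{pmatrix}\alpha&\beta\\c&\delta\end{pmatrix}$ of positive determinant act on the right by $\mathbf{a}|g=\delta\mathbf{a}+c\mathbf{b}$, $\mathbf{b}|g=\beta\mathbf{a}+\alpha\mathbf{b}$; one-cocycles of $\mathrm{SL}_2(\mathbb{Z})$ satisfy $\kappa(\gamma\gamma')=\kappa(\gamma)|\gamma'+\kappa(\gamma')$. Put $H^B=H^1(\mathrm{SL}_2(\mathbb{Z});V^B_{2n-2})$.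 The Hecke operator $T_p$ acts on $H^B$ as follows: if $g_i$ are representatives of $\mathrm{SL}_2(\mathbb{Z})\backslash\{g\in M_2(\mathbb{Z}):\det g=p\}$ and $g_i\gamma=\gamma_ig_{\sigma(i)}$ with $\gamma_i\in\mathrm{SL}_2(\mathbb{Z})$, then $(T_p\kappa)(\gamma)=\sum_i\kappa(\gamma_i)|g_{\sigma(i)}$. The real Frobenius (complex conjugation) is the involution of $H^B$ induced by $\kappa\mapsto(\gamma\mapsto\epsilon(\kappa(\epsilon\gamma\epsilon)))$, where $\epsilon=\mathrm{diag}(1,-1)$ and $\epsilon$ acts on $V^B$ by $\mathbf{a}\mapsto\mathbf{a}$, $\mathbf{b}\mapsto-\mathbf{b}$. There is a Hecke-equivariant isomorphism $\mathrm{comp}_{B,dR}:H^{dR}\otimes_{\mathbb{Q}}\mathbb{C}\to H^B\otimes_{\mathbb{Q}}\mathbb{C}$ sending $g\in M_{2n}^!$ to the class of the cocycle $\gamma\mapsto(2\pi i)^{2n-1}\int_{\gamma^{-1}z_0}^{z_0}g(z)(z\mathbf{a}-\mathbf{b})^{2n-2}dz$ (independent of $z_0\in\mathfrak{H}$). Let $V_f^{dR}\subset H^{dR}\otimes_{\mathbb{Q}}K_f$ and $V_f^B\subset H^B\otimes_{\mathbb{Q}}K_f$ be the Hecke eigenspaces with the same Hecke eigenvalues as $f$. Both are two-dimensional over $K_f$, and $\mathrm{comp}_{B,dR}$ restricts to an isomorphism $V_f^{dR}\otimes_{K_f}\mathbb{C}\cong V_f^B\otimes_{K_f}\mathbb{C}$.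 $V_f^B$ is the direct sum of its one-dimensional $\pm1$ eigenspaces under the real Frobenius. A period matrix $P_f$ is the matrix of this isomorphism with respect to a $K_f$-basis of $V_f^{dR}$ whose second element spans the line generated by $f$ and a $K_f$-basis of $V_f^B$ consisting of a $+1$ eigenvector followed by a $-1$ eigenvector (columns are the coordinates of the images of the basis of $V_f^{dR}$); it has the form $P_f=\begin{pmatrix}\eta_f^+&\omega_f^+\\ i\eta_f^-&i\omega_f^-\end{pmatrix}$ with $\eta_f^\pm,\omega_f^\pm\in\mathbb{R}$. *)

theory Defs
  imports "HOL-Complex_Analysis.Complex_Analysis" "HOL-Library.Function_Algebras"
begin

(* Addition, subtraction and finite sums of functions are pointwise (Function_Algebras). *)

section \<open>Subfields of the complex numbers and extension of scalars\<close>

definition complex_subfield :: "complex set \<Rightarrow> bool" where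
  "complex_subfield K \<longleftrightarrow> 0 \<in> K \<and> 1 \<in> K \<and>
     (\<forall>x\<in>K. \<forall>y\<in>K. x + y \<in> K \<and> x * y \<in> K) \<and> (\<forall>x\<in>K. - x \<in> K \<and> inverse x \<in> K)"

definition field_generated :: "complex set \<Rightarrow> complex set" where
  "field_generated S = \<Inter>{K. complex_subfield K \<and> S \<subseteq> K}"

(* Extension of scalars: all rational spaces U below consist of functions which are determined by
   rational data (rational Fourier coefficients, rational values) inside a complex vector space,
   so the tensor product of U with K over the rationals is the K-span of U. Correspondingly
   (U / U') tensor K is represented by span_over K s U modulo span_over K s U'. *)
definition span_over :: "complex set \<Rightarrow> (complex \<Rightarrow> 'v \<Rightarrow> 'v) \<Rightarrow> 'v set \<Rightarrow> 'v::comm_monoid_add set" where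
  "span_over K s U = {(\<Sum>u\<in>T. s (c u) u) | c T. finite T \<and> T \<subseteq> U \<and> c ` T \<subseteq> K}"

(* The classes of e1, e2 form a K-basis of the image of V in the quotient by E. *)
definition basis2_mod ::
  "complex set \<Rightarrow> (complex \<Rightarrow> 'v \<Rightarrow> 'v) \<Rightarrow> 'v set \<Rightarrow> 'v set \<Rightarrow> 'v::ab_group_add \<Rightarrow> 'v \<Rightarrow> bool" where
  "basis2_mod K s V E e1 e2 \<longleftrightarrow> e1 \<in> V \<and> e2 \<in> V \<and>
     (\<forall>v\<in>V. \<exists>x\<in>K. \<exists>y\<in>K. v - (s x e1 + s y e2) \<in> E) \<and>
     (\<forall>x\<in>K. \<forall>y\<in>K. s x e1 + s y e2 \<in> E \<longrightarrow> x = 0 \<and> y = 0)"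


section \<open>The modular group\<close>

(* g $ 1 $ 1, g $ 1 $ 2, g $ 2 $ 1, g $ 2 $ 2 are alpha, beta, c, delta. *)

definition SL2Z :: "(int^2^2) set" where
  "SL2Z = {g. det g = 1}"

definition moebius :: "int^2^2 \<Rightarrow> complex \<Rightarrow> complex" where
  "moebius g z = (of_int (g $ 1 $ 1) * z + of_int (g $ 1 $ 2)) /
                 (of_int (g $ 2 $ 1) * z + of_int (g $ 2 $ 2))"

definition hecke_reps :: "nat \<Rightarrow> (int^2^2) set \<Rightarrow> bool" where
  "hecke_reps p R \<longleftrightarrow> R \<subseteq> {g. det g = int p} \<and>
     (\<forall>m. det m = int p \<longrightarrow> (\<exists>!r. r \<in> R \<and> (\<exists>\<gamma>\<in>SL2Z. m = \<gamma> ** r)))"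


section \<open>Weakly holomorphic modular forms and de Rham classes\<close>

(* A function on the upper half plane is represented by its extension by zero to all of the
   complex plane, so that equality of functions is equality on the upper half plane. *)

definition fscale :: "complex \<Rightarrow> (complex \<Rightarrow> complex) \<Rightarrow> complex \<Rightarrow> complex" where
  "fscale c g = (\<lambda>z. c * g z)"

definition has_fourier :: "(complex \<Rightarrow> complex) \<Rightarrow> (int \<Rightarrow> complex) \<Rightarrow> bool" where
  "has_fourier g a \<longleftrightarrow>
     (\<forall>z. Im z > 0 \<longrightarrow> ((\<lambda>m. a m * exp (2 * of_real pi * \<i> * z) powi m) has_sum g z) UNIV)"

definition fourier_coeff :: "(complex \<Rightarrow> complex) \<Rightarrow> int \<Rightarrow> complex" where
  "fourier_coeff g = (THE a. has_fourier g a)"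

(* Weakly holomorphic modular forms of weight k with complex Fourier coefficients. *)
definition weak_forms_complex :: "int \<Rightarrow> (complex \<Rightarrow> complex) set" where
  "weak_forms_complex k = {g.
     g holomorphic_on {z. Im z > 0} \<and> (\<forall>z. Im z \<le> 0 \<longrightarrow> g z = 0) \<and>
     (\<forall>\<gamma>\<in>SL2Z. \<forall>z. Im z > 0 \<longrightarrow>
        g (moebius \<gamma> z) = (of_int (\<gamma> $ 2 $ 1) * z + of_int (\<gamma> $ 2 $ 2)) powi k * g z) \<and>
     (\<exists>a. has_fourier g a \<and> finite {m. m < 0 \<and> a m \<noteq> 0})}"

definition weak_forms :: "int \<Rightarrow> (complex \<Rightarrow> complex) set" where
  "weak_forms k = {g \<in> weak_forms_complex k. \<forall>m. fourier_coeff g m \<in> \<rat>}"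

(* q d/dq = (2 pi i)^(-1) d/dz *)
definition qderiv :: "(complex \<Rightarrow> complex) \<Rightarrow> complex \<Rightarrow> complex" where
  "qderiv g = (\<lambda>z. if Im z > 0 then deriv g z / (2 * of_real pi * \<i>) else 0)"

(* The Hecke operator in weight 2n, for p prime. *)
definition hecke_dR :: "nat \<Rightarrow> nat \<Rightarrow> (complex \<Rightarrow> complex) \<Rightarrow> complex \<Rightarrow> complex" where
  "hecke_dR n p g = (\<lambda>z. if Im z > 0 then
     infsum (\<lambda>m. (fourier_coeff g (int p * m) +
                of_nat p ^ (2*n-1) * (if int p dvd m then fourier_coeff g (m div int p) else 0)) *
              exp (2 * of_real pi * \<i> * z) powi m) UNIV
     else 0)"

(* H_dR tensor K is dR_forms n K modulo dR_exact n K. *)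
definition dR_forms :: "nat \<Rightarrow> complex set \<Rightarrow> (complex \<Rightarrow> complex) set" where
  "dR_forms n K = span_over K fscale (weak_forms (2 * int n))"

definition dR_exact :: "nat \<Rightarrow> complex set \<Rightarrow> (complex \<Rightarrow> complex) set" where
  "dR_exact n K = span_over K fscale ((qderiv ^^ (2*n-1)) ` weak_forms (2 - 2 * int n))"


section \<open>Symmetric powers, cocycles and Betti classes\<close>

(* Sym^w of the span of a and b is the space of homogeneous polynomials of degree w in a and b.
   In a bivariate polynomial P the outer variable is b and the inner variable is a:
   coeff (coeff P j) i is the coefficient of a^i b^j. *)

abbreviation var_a :: "complex poly poly" where "var_a \<equiv> [:[:0, 1:]:]"
abbreviation var_b :: "complex poly poly" where "var_b \<equiv> [:0, 1:]"

definition Sym_rat :: "nat \<Rightarrow> complex poly poly set" where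
  "Sym_rat w = {P. (\<forall>i j. coeff (coeff P j) i \<noteq> 0 \<longrightarrow> i + j = w) \<and>
                   (\<forall>i j. coeff (coeff P j) i \<in> \<rat>)}"

definition subst_ab ::
  "complex poly poly \<Rightarrow> complex poly poly \<Rightarrow> complex poly poly \<Rightarrow> complex poly poly" where
  "subst_ab A B P =
     (\<Sum>j\<le>degree P. \<Sum>i\<le>degree (coeff P j). smult [:coeff (coeff P j) i:] (A ^ i * B ^ j))"

definition slash :: "complex poly poly \<Rightarrow> int^2^2 \<Rightarrow> complex poly poly" where
  "slash P g = subst_ab (of_int (g $ 2 $ 2) * var_a + of_int (g $ 2 $ 1) * var_b)
                        (of_int (g $ 1 $ 2) * var_a + of_int (g $ 1 $ 1) * var_b) P"

type_synonym cochain = "int^2^2 \<Rightarrow> complex poly poly"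

definition cscale :: "complex \<Rightarrow> cochain \<Rightarrow> cochain" where
  "cscale c \<kappa> = (\<lambda>\<gamma>. smult [:c:] (\<kappa> \<gamma>))"

(* Cochains on SL2Z are extended by zero to all integer matrices. *)

definition cocycles :: "nat \<Rightarrow> cochain set" where
  "cocycles w = {\<kappa>. (\<forall>\<gamma>\<in>SL2Z. \<kappa> \<gamma> \<in> Sym_rat w) \<and> (\<forall>\<gamma>. \<gamma> \<notin> SL2Z \<longrightarrow> \<kappa> \<gamma> = 0) \<and>
     (\<forall>\<gamma>\<in>SL2Z. \<forall>\<gamma>'\<in>SL2Z. \<kappa> (\<gamma> ** \<gamma>') = slash (\<kappa> \<gamma>) \<gamma>' + \<kappa> \<gamma>')}"

definition coboundaries :: "nat \<Rightarrow> cochain set" where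
  "coboundaries w = {(\<lambda>\<gamma>. if \<gamma> \<in> SL2Z then slash v \<gamma> - v else 0) | v. v \<in> Sym_rat w}"

(* H_B tensor K is B_cocycles n K modulo B_coboundaries n K. *)
definition B_cocycles :: "nat \<Rightarrow> complex set \<Rightarrow> cochain set" where
  "B_cocycles n K = span_over K cscale (cocycles (2*n-2))"

definition B_coboundaries :: "nat \<Rightarrow> complex set \<Rightarrow> cochain set" where
  "B_coboundaries n K = span_over K cscale (coboundaries (2*n-2))"

(* The Hecke operator T_p on cocycles, computed with a system R of representatives satisfying
   hecke_reps p R. On cohomology it does not depend on R. *)
definition hecke_B :: "(int^2^2) set \<Rightarrow> cochain \<Rightarrow> cochain" where
  "hecke_B R \<kappa> = (\<lambda>\<gamma>. if \<gamma> \<in> SL2Z then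
     (\<Sum>g\<in>R. case (THE (\<gamma>', h). \<gamma>' \<in> SL2Z \<and> h \<in> R \<and> g ** \<gamma> = \<gamma>' ** h) of
        (\<gamma>', h) \<Rightarrow> slash (\<kappa> \<gamma>') h)
     else 0)"

definition eps :: "int^2^2" where
  "eps = vector [vector [1, 0], vector [0, -1]]"

definition frob :: "cochain \<Rightarrow> cochain" where
  "frob \<kappa> = (\<lambda>\<gamma>. subst_ab var_a (- var_b) (\<kappa> (eps ** \<gamma> ** eps)))"

(* A cocycle representing the image of the class of g under the comparison isomorphism. The
   formula is linear in g, so it also gives the complex linear extension of the comparison.
   The vector-valued integral is taken coefficientwise, along the segment in the upper half
   plane; the class does not depend on the base point z0. *)
definition comp_cocycle :: "nat \<Rightarrow> complex \<Rightarrow> (complex \<Rightarrow> complex) \<Rightarrow> cochain" where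
  "comp_cocycle n z0 g = (\<lambda>\<gamma>. if \<gamma> \<in> SL2Z then
     smult [:(2 * of_real pi * \<i>) ^ (2*n-1):]
       (\<Sum>i\<le>2*n-2. \<Sum>j\<le>2*n-2.
          smult [:contour_integral (linepath (moebius (matrix_inv \<gamma>) z0) z0)
                    (\<lambda>z. g z * coeff (coeff (([:[:z:]:] * var_a - var_b) ^ (2*n-2)) j) i):]
                (var_a ^ i * var_b ^ j))
     else 0)"


section \<open>Eigenforms and period matrices\<close>

definition cusp_forms :: "int \<Rightarrow> (complex \<Rightarrow> complex) set" where
  "cusp_forms k = {g \<in> weak_forms_complex k. \<forall>m\<le>0. fourier_coeff g m = 0}"

definition normalized_cuspidal_eigenform :: "nat \<Rightarrow> (complex \<Rightarrow> complex) \<Rightarrow> bool" where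
  "normalized_cuspidal_eigenform n f \<longleftrightarrow>
     f \<in> cusp_forms (2 * int n) \<and> fourier_coeff f 1 = 1 \<and>
     (\<forall>p. prime p \<longrightarrow> (\<exists>l. hecke_dR n p f = fscale l f))"

definition hecke_eigenvalue :: "nat \<Rightarrow> (complex \<Rightarrow> complex) \<Rightarrow> nat \<Rightarrow> complex" where
  "hecke_eigenvalue n f p = (THE l. hecke_dR n p f = fscale l f)"

definition coeff_field :: "(complex \<Rightarrow> complex) \<Rightarrow> complex set" where
  "coeff_field f = field_generated (range (fourier_coeff f))"

(* Representatives of the classes in the eigenspaces V_f; equality of classes is equality modulo
   dR_exact n (coeff_field f) and B_coboundaries n (coeff_field f), respectively. *)

definition eigenspace_dR :: "nat \<Rightarrow> (complex \<Rightarrow> complex) \<Rightarrow> (complex \<Rightarrow> complex) set" where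
  "eigenspace_dR n f = {g \<in> dR_forms n (coeff_field f). \<forall>p. prime p \<longrightarrow>
     hecke_dR n p g - fscale (hecke_eigenvalue n f p) g \<in> dR_exact n (coeff_field f)}"

definition eigenspace_B :: "nat \<Rightarrow> (complex \<Rightarrow> complex) \<Rightarrow> cochain set" where
  "eigenspace_B n f = {\<kappa> \<in> B_cocycles n (coeff_field f). \<forall>p R. prime p \<and> hecke_reps p R \<longrightarrow>
     hecke_B R \<kappa> - cscale (hecke_eigenvalue n f p) \<kappa> \<in> B_coboundaries n (coeff_field f)}"

definition period_matrix :: "nat \<Rightarrow> complex \<Rightarrow> (complex \<Rightarrow> complex) \<Rightarrow> complex^2^2 \<Rightarrow> bool" where
  "period_matrix n z0 f P \<longleftrightarrow> (\<exists>e1 e2 c1 c2.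
     basis2_mod (coeff_field f) fscale (eigenspace_dR n f) (dR_exact n (coeff_field f)) e1 e2 \<and>
     (\<exists>l\<in>coeff_field f. l \<noteq> 0 \<and> e2 - fscale l f \<in> dR_exact n (coeff_field f)) \<and>
     basis2_mod (coeff_field f) cscale (eigenspace_B n f) (B_coboundaries n (coeff_field f)) c1 c2 \<and>
     frob c1 - c1 \<in> B_coboundaries n (coeff_field f) \<and>
     frob c2 + c2 \<in> B_coboundaries n (coeff_field f) \<and>
     comp_cocycle n z0 e1 - (cscale (P $ 1 $ 1) c1 + cscale (P $ 2 $ 1) c2)
       \<in> B_coboundaries n UNIV \<and>
     comp_cocycle n z0 e2 - (cscale (P $ 1 $ 2) c1 + cscale (P $ 2 $ 2) c2)
       \<in> B_coboundaries n UNIV)"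

end

theory Submission imports Defs
begin

text \<open>The determinant is computed by playing two pairings against each other. On the de Rham side,
  \<open>residue(g\<^sub>2 \<cdot> D\<^sup>-\<^sup>(\<^sup>2\<^sup>n\<^sup>-\<^sup>1\<^sup>) g\<^sub>1)\<close>, the constant coefficient of the product of \<open>g\<^sub>2\<close> with the \<open>(2n - 1)\<close>-fold
  formal integral of \<open>g\<^sub>1\<close>, is defined over every field containing the Fourier coefficients, is
  alternating, kills exact forms, and makes the Hecke operators self-adjoint. On the Betti side,
  parabolic cocycles have a Haberland pairing, which is alternating and defined over \<open>\<rat>\<close>. The formula
  \<open>haberland\<close> says that the comparison isomorphism carries one into the other up to the factor
  \<open>(2 \<pi> i)\<^sup>2\<^sup>n\<^sup>-\<^sup>1\<close> and a nonzero rational number: a primitive of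
  the product of \<open>g\<^sub>2\<close> with the \<open>(2n - 1)\<close>-fold integral of \<open>g\<^sub>1\<close> changes under \<open>z \<mapsto> z + 1\<close> by the
  residue and under \<open>z \<mapsto> -1/z\<close> by a term that pairs a period polynomial with the Eichler integral of
  \<open>g\<^sub>2\<close>; its values at the elliptic points i and \<open>\<rho>\<close> relate the two.
  As the space is two-dimensional and both pairings are alternating, passing from the basis \<open>c\<^sub>1, c\<^sub>2\<close> to the images of \<open>e\<^sub>1, e\<^sub>2\<close> multiplies the Betti pairing by \<open>det P\<close>
  (\<open>period_determinant\<close>).
  Hence \<open>det P = (2 \<pi> i)\<^sup>2\<^sup>n\<^sup>-\<^sup>1 k\<close> with k in \<open>K\<^sub>f\<close>, once the residue pairing of \<open>e\<^sub>1\<close> and \<open>e\<^sub>2\<close> is known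
  to be nonzero. That \<open>c\<^sub>1, c\<^sub>2\<close> become parabolic after subtracting coboundaries over \<open>K\<^sub>f\<close> is part of
  the same argument: if \<open>det P\<close> were zero, a combination of the two period polynomials would be a
  coboundary and their pairing would vanish.

  Non-vanishing (\<open>eigenclass_pairing\<close>) is the analytic part. If \<open>e\<^sub>1\<close> were orthogonal to f, then by
  Hecke equivariance and multiplicity one it would be orthogonal to all cusp forms
  (\<open>eigenfunctional_zero\<close>). This uses the diagonalizability of the Hecke operators, that is, the
  Petersson inner product. Orthogonality allows all poles of \<open>e\<^sub>1\<close> to be removed by exact forms
  (\<open>reduce_poles\<close>), whose modularity is Bol's identity; the constant term vanishes because the
  eigenvalues of f are not those of an Eisenstein series. So \<open>e\<^sub>1\<close> would be a multiple of f modulo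
  exact forms, contradicting the independence of the basis.

  The classical facts on modular forms behind this are derived from a Sturm bound: rationality of
  \<open>E\<^sub>4\<close> and \<open>E\<^sub>6\<close> from \<open>E\<^sub>4\<^sup>2 = E\<^sub>8\<close> and \<open>E\<^sub>4 E\<^sub>6 = E\<^sub>1\<^sub>0\<close>, and the absence of zeros of \<open>\<Delta>\<close> from a
  second-order differential equation.\<close>

(* Vector and matrix entries are written with the same symbol. *)
no_notation fps_nth (infixl "$" 75)

section \<open>Fourier expansions\<close>

abbreviation upper :: "complex set" where "upper \<equiv> {z. Im z > 0}"

definition nome :: "complex \<Rightarrow> complex" where
  "nome z = exp (2 * of_real pi * \<i> * z)"

lemma nome_nonzero [simp]: "nome z \<noteq> 0"
  by (simp add: nome_def)

lemma norm_nome: "norm (nome z) = exp (- 2 * pi * Im z)"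
  by (simp add: nome_def)

lemma norm_nome_less_1: "Im z > 0 \<Longrightarrow> norm (nome z) < 1"
  by (simp add: norm_nome)

lemma nome_add: "nome (x + y) = nome x * nome y"
  by (simp add: nome_def exp_add ring_distribs)

lemma nome_of_int [simp]: "nome (of_int m) = 1"
proof -
  have "nome (of_int m) = exp (2 * of_real pi * \<i>) powi m"
    unfolding nome_def by (simp add: exp_power_int mult_ac)
  thus ?thesis by simp
qed

lemma nome_plus_1 [simp]: "nome (z + 1) = nome z"
  using nome_of_int[of 1] by (simp add: nome_add del: nome_of_int)

lemma nome_surj:
  assumes "x \<noteq> 0" "norm x < 1"
  obtains z where "Im z > 0" "nome z = x"
proof
  show "nome (Ln x / (2 * of_real pi * \<i>)) = x"
    using assms by (simp add: nome_def)
  have "Im (Ln x / (2 * of_real pi * \<i>)) = - ln (norm x) / (2 * pi)"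
    using assms by (simp add: Im_divide power2_eq_square)
  also have "\<dots> > 0"
    using assms by (simp add: divide_simps)
  finally show "Im (Ln x / (2 * of_real pi * \<i>)) > 0" .
qed

lemma nome_powi: "nome z powi m = nome (of_int m * z)"
proof -
  have "nome z powi m = exp (of_int m * (2 * of_real pi * \<i> * z))"
    unfolding nome_def by (simp add: exp_power_int)
  thus ?thesis by (simp add: nome_def mult_ac)
qed

lemma nome_power: "nome z ^ m = nome (of_nat m * z)"
  using nome_powi[of z "int m"] by simp

lemma has_field_derivative_nome:
  "(nome has_field_derivative 2 * of_real pi * \<i> * nome z) (at z within A)"
  unfolding nome_def by (auto intro!: derivative_eq_intros)

lemma holomorphic_nome [holomorphic_intros]: "nome holomorphic_on A"
  unfolding nome_def by (intro holomorphic_intros)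

lemma root_of_unity_sum:
  fixes m :: int
  assumes "M > 0"
  shows "(\<Sum>j<M. nome (of_int m * of_nat j / of_nat M)) = (if int M dvd m then of_nat M else 0)"
proof -
  define w where "w = nome (of_int m / of_nat M)"
  have w: "nome (of_int m * of_nat j / of_nat M) = w ^ j" for j
    by (simp add: w_def nome_power mult_ac)
  have "w ^ M = 1"
    using assms by (simp add: w_def nome_power)
  have "w = 1 \<longleftrightarrow> int M dvd m"
  proof
    assume "w = 1"
    then obtain n :: int where "Im (2 * of_real pi * \<i> * (of_int m / of_nat M)) = of_int (2 * n) * pi"
      unfolding w_def nome_def exp_eq_1 by blast
    hence "2 * pi * (of_int m / of_nat M) = of_int (2 * n) * pi"
      by (simp add: Im_divide_of_nat)
    hence "(of_int m :: real) = of_int (n * int M)"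
      using assms by (simp add: field_simps)
    hence "m = n * int M" by (simp only: of_int_eq_iff)
    thus "int M dvd m" by simp
  next
    assume "int M dvd m"
    then obtain n where "m = int M * n" by auto
    thus "w = 1" using assms nome_of_int[of n] by (simp add: w_def)
  qed
  moreover have "(w - 1) * (\<Sum>j<M. w ^ j) = 0"
    using power_diff_1_eq[of w M] \<open>w ^ M = 1\<close> by simp
  ultimately show ?thesis by (auto simp: w)
qed

lemma has_sum_finite_sum:
  fixes f :: "'i \<Rightarrow> 'a \<Rightarrow> complex"
  assumes "finite J" "\<And>j. j \<in> J \<Longrightarrow> (f j has_sum s j) A"
  shows "((\<lambda>x. \<Sum>j\<in>J. f j x) has_sum (\<Sum>j\<in>J. s j)) A"
  using assms by (induction J rule: finite_induct) (auto intro!: has_sum_add)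

text \<open>Averaging over the translates by j/M isolates the coefficients in one residue class; this
  serves for the uniqueness of Fourier expansions and for the Hecke operators.\<close>
lemma has_fourier_average:
  assumes "has_fourier g a" "Im z > 0" "M > 0"
  shows "((\<lambda>m. if int M dvd m - l then a m * nome z powi m else 0) has_sum
           (\<Sum>j<M. nome (- (of_int l * of_nat j / of_nat M)) * g (z + of_nat j / of_nat M)) / of_nat M) UNIV"
proof -
  have "((\<lambda>m. (\<Sum>j<M. nome (- (of_int l * of_nat j / of_nat M)) *
              (a m * nome (z + of_nat j / of_nat M) powi m)) * (1 / of_nat M)) has_sum
          (\<Sum>j<M. nome (- (of_int l * of_nat j / of_nat M)) * g (z + of_nat j / of_nat M)) * (1 / of_nat M)) UNIV"
    using assms
    by (intro has_sum_cmult_left has_sum_finite_sum has_sum_cmult_right)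
       (auto simp: has_fourier_def nome_def)
  moreover have "(\<Sum>j<M. nome (- (of_int l * of_nat j / of_nat M)) *
              (a m * nome (z + of_nat j / of_nat M) powi m)) * (1 / of_nat M) =
            (if int M dvd m - l then a m * nome z powi m else 0)" for m
  proof -
    have "nome (- (of_int l * of_nat j / of_nat M)) * (a m * nome (z + of_nat j / of_nat M) powi m)
        = a m * nome z powi m * nome (of_int (m - l) * of_nat j / of_nat M)" for j
    proof -
      have "nome (- (of_int l * of_nat j / of_nat M)) * nome (z + of_nat j / of_nat M) powi m =
            nome z powi m * nome (of_int (m - l) * of_nat j / of_nat M)"
        unfolding nome_powi nome_add[symmetric]
        by (rule arg_cong[of _ _ nome]) (simp add: algebra_simps diff_divide_distrib add_divide_distrib)
      thus ?thesis by (simp add: mult_ac)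
    qed
    hence "(\<Sum>j<M. nome (- (of_int l * of_nat j / of_nat M)) *
              (a m * nome (z + of_nat j / of_nat M) powi m)) =
           a m * nome z powi m * (\<Sum>j<M. nome (of_int (m - l) * of_nat j / of_nat M))"
      by (simp only: sum_distrib_left)
    thus ?thesis using assms(3) by (subst (asm) root_of_unity_sum) auto
  qed
  ultimately show ?thesis by simp
qed

lemma has_sum_subtract:
  fixes f g :: "'a \<Rightarrow> complex"
  assumes "(f has_sum s) A" "(g has_sum t) A"
  shows "((\<lambda>x. f x - g x) has_sum (s - t)) A"
  using has_sum_add[OF assms(1) has_sum_uminusI[OF assms(2)]] by simp

text \<open>For large M, all terms in the residue class of l modulo M other than the l-th lie outside a finite
  set that carries almost all of the absolutely convergent sum.\<close>
lemma has_fourier_unique: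
  assumes "has_fourier g a" "has_fourier g b"
  shows "a = b"
proof
  fix l :: int
  have "has_fourier (\<lambda>z. 0) (\<lambda>m. a m - b m)"
    unfolding has_fourier_def
  proof (intro allI impI)
    fix z :: complex assume "Im z > 0"
    hence "((\<lambda>m. a m * exp (2 * of_real pi * \<i> * z) powi m - b m * exp (2 * of_real pi * \<i> * z) powi m)
             has_sum (g z - g z)) UNIV"
      using assms by (intro has_sum_subtract) (auto simp: has_fourier_def)
    thus "((\<lambda>m. (a m - b m) * exp (2 * of_real pi * \<i> * z) powi m) has_sum 0) UNIV"
      by (simp add: algebra_simps)
  qed
  then have c: "has_fourier (\<lambda>z. 0) (\<lambda>m. a m - b m)" .
  define t where "t m = (a m - b m) * nome \<i> powi m" for m
  have t0: "(t has_sum 0) UNIV"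
    using c by (auto simp: has_fourier_def t_def[abs_def] nome_def)
  hence "(\<lambda>m. norm (t m)) summable_on UNIV"
    using summable_on_iff_abs_summable_on_complex has_sum_imp_summable by blast
  then obtain T where T: "((\<lambda>m. norm (t m)) has_sum T) UNIV"
    by (auto simp: summable_on_def)
  have "norm (t l) \<le> e" if e: "e > 0" for e
  proof -
    obtain F where F: "finite F" "dist (sum (\<lambda>m. norm (t m)) F) T \<le> e"
      using has_sum_finite_approximation[OF T e] by auto
    define F' where "F' = insert l F"
    have F': "finite F'" using F by (simp add: F'_def)
    have FF': "sum (\<lambda>m. norm (t m)) F \<le> sum (\<lambda>m. norm (t m)) F'"
      using F by (intro sum_mono2) (auto simp: F'_def)
    define M where "M = Suc (nat (\<Sum>m\<in>F'. \<bar>m - l\<bar>))"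
    have M: "m = l" if "m \<in> F'" "int M dvd m - l" for m
    proof (rule ccontr)
      assume "m \<noteq> l"
      hence "int M \<le> \<bar>m - l\<bar>" using that(2) by (intro zdvd_imp_le) auto
      also have "\<dots> \<le> (\<Sum>m\<in>F'. \<bar>m - l\<bar>)" using that F' by (intro member_le_sum) auto
      finally show False by (simp add: M_def)
    qed
    let ?u = "\<lambda>m. if int M dvd m - l then t m else 0"
    have u0: "(?u has_sum 0) UNIV"
      using has_fourier_average[OF c, of \<i> M l] unfolding t_def[symmetric] by (simp add: M_def)
    have "(?u has_sum (0 - sum ?u F')) (UNIV - F')"
      using F' by (intro has_sum_Diff u0 has_sum_finite) auto
    moreover have "sum ?u F' = t l"
    proof -
      have "sum ?u F' = sum ?u {l}"
        using F' M by (intro sum.mono_neutral_right) (auto simp: F'_def)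
      thus ?thesis by simp
    qed
    ultimately have 1: "(?u has_sum - t l) (UNIV - F')" by simp
    have 2: "((\<lambda>m. norm (t m)) has_sum (T - sum (\<lambda>m. norm (t m)) F')) (UNIV - F')"
      using F' by (intro has_sum_Diff T has_sum_finite) auto
    have "norm (- t l) \<le> T - sum (\<lambda>m. norm (t m)) F'"
      by (rule norm_infsum_le[OF 1 2]) auto
    also have "\<dots> \<le> e" using F(2) FF' by (auto simp: dist_real_def)
    finally show ?thesis by simp
  qed
  hence "norm (t l) \<le> 0" by (metis dense_ge)
  thus "a l = b l" by (simp add: t_def power_int_eq_0_iff)
qed

lemma fourier_coeff_eq: "has_fourier g a \<Longrightarrow> fourier_coeff g = a"
  unfolding fourier_coeff_def using has_fourier_unique by blast

text \<open>The modular forms below are meromorphic at the cusp, so formal Laurent series in q carry their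
  expansions, and analytic statements become algebra in the field of Laurent series.\<close>
definition qexp :: "(complex \<Rightarrow> complex) \<Rightarrow> complex fls \<Rightarrow> bool" where
  "qexp g F \<longleftrightarrow> fls_conv_radius F \<ge> 1 \<and> (\<forall>z. Im z > 0 \<longrightarrow> g z = eval_fls F (nome z))"

lemma qexp_radius: "qexp g F \<Longrightarrow> Im z > 0 \<Longrightarrow> ereal (norm (nome z)) < fls_conv_radius F"
  unfolding qexp_def using norm_nome_less_1[of z] 
  by (metis ereal_less(3) order_less_le_trans)

lemma qexp_eval: "qexp g F \<Longrightarrow> Im z > 0 \<Longrightarrow> g z = eval_fls F (nome z)"
  by (simp add: qexp_def)

lemma qexp_has_fourier:
  assumes "qexp g F"
  shows "has_fourier g (fls_nth F)"
  unfolding has_fourier_def nome_def[symmetric]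
proof (intro allI impI)
  fix z :: complex assume z: "Im z > 0"
  let ?n = "fls_subdegree F"
  let ?q = "nome z"
  have r: "ereal (norm ?q) < fls_conv_radius F" by (rule qexp_radius[OF assms z])
  let ?f = "\<lambda>k. fls_nth F (int k + ?n) * ?q powi (int k + ?n)"
  have s: "?f sums g z"
    using sums_eval_fls[of ?q F] r qexp_eval[OF assms z] by simp
  have "summable (\<lambda>k. norm (fls_nth F (int k + ?n) * ?q ^ k) * norm (?q powi ?n))"
    by (intro summable_mult2 norm_summable_fls' r)
  hence "summable (\<lambda>k. norm (?f k))"
    by (simp add: norm_mult power_int_add mult_ac)
  from norm_summable_imp_has_sum[OF this s] have "(?f has_sum g z) UNIV" .
  also have "?this \<longleftrightarrow> ((\<lambda>m. fls_nth F m * ?q powi m) has_sum g z) {?n..}"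
    by (intro has_sum_reindex_bij_witness[of _ "\<lambda>m. nat (m - ?n)" "\<lambda>k. int k + ?n"]) auto
  also have "\<dots> \<longleftrightarrow> ((\<lambda>m. fls_nth F m * ?q powi m) has_sum g z) UNIV"
    by (intro has_sum_cong_neutral) auto
  finally show "((\<lambda>m. fls_nth F m * ?q powi m) has_sum g z) UNIV" .
qed

lemma fourier_coeff_qexp: "qexp g F \<Longrightarrow> fourier_coeff g = fls_nth F"
  by (intro fourier_coeff_eq qexp_has_fourier)

lemma qexp_unique: "qexp g F \<Longrightarrow> qexp g G \<Longrightarrow> F = G"
  by (metis fourier_coeff_qexp fls_eqI)

lemma has_fourier_qexp:
  assumes a: "has_fourier g a" and fin: "finite {m. m < 0 \<and> a m \<noteq> 0}"
  obtains F where "qexp g F" "fls_nth F = a"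
proof -
  have "\<forall>\<^sub>\<infinity>n. a (- int n) = 0"
  proof -
    have "{n. a (- int n) \<noteq> 0} \<subseteq> insert 0 ((\<lambda>m. nat (- m)) ` {m. m < 0 \<and> a m \<noteq> 0})"
    proof
      fix n assume "n \<in> {n. a (- int n) \<noteq> 0}"
      hence "n = 0 \<or> (- int n \<in> {m. m < 0 \<and> a m \<noteq> 0} \<and> n = nat (- (- int n)))" by auto
      thus "n \<in> insert 0 ((\<lambda>m. nat (- m)) ` {m. m < 0 \<and> a m \<noteq> 0})" by blast
    qed
    thus ?thesis unfolding MOST_iff_cofinite using fin by (auto intro: finite_subset)
  qed
  define F where "F = Abs_fls a"
  have nth: "fls_nth F = a"
    unfolding F_def using \<open>\<forall>\<^sub>\<infinity>n. a (- int n) = 0\<close> by (simp add: Abs_fls_inverse)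
  have sm: "(\<lambda>m. a m * nome z powi m) summable_on UNIV" if "Im z > 0" for z
    using a that by (auto simp: has_fourier_def nome_def summable_on_def)
  have "fls_conv_radius F \<ge> 1"
    unfolding fls_conv_radius_def fps_conv_radius_def
  proof (rule conv_radius_geI_ex)
    fix r :: real assume r: "r > 0" "ereal r < 1"
    then obtain z where z: "Im z > 0" "nome z = of_real r"
      using nome_surj[of "of_real r"] by auto
    have "(\<lambda>m. a m * nome z powi m) summable_on range int"
      using sm[OF z(1)] by (rule summable_on_subset_banach) auto
    hence "(\<lambda>n. a (int n) * of_real r ^ n) summable_on UNIV"
      by (subst (asm) summable_on_reindex) (auto simp: o_def z(2))
    hence "summable (\<lambda>n. a (int n) * of_real r ^ n)"
      by (rule summable_on_imp_summable)
    thus "\<exists>z. norm z = r \<and> summable (\<lambda>n. fps_nth (fls_regpart F) n * z ^ n)"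
      using r by (intro exI[of _ "of_real r"]) (simp add: nth)
  qed
  define h where "h z = eval_fls F (nome z)" for z
  have "qexp h F" using \<open>fls_conv_radius F \<ge> 1\<close> by (simp add: qexp_def h_def)
  hence "has_fourier h a" using qexp_has_fourier nth by metis
  hence "g z = h z" if "Im z > 0" for z
    using a that has_sum_unique unfolding has_fourier_def by blast
  hence "qexp g F" using \<open>qexp h F\<close> by (simp add: qexp_def)
  thus ?thesis using nth that by blast
qed

lemma qexp_cong: "qexp g F \<Longrightarrow> (\<And>z. Im z > 0 \<Longrightarrow> g z = h z) \<Longrightarrow> qexp h F"
  by (simp add: qexp_def)

lemma fls_conv_radius_const: "fls_conv_radius (fls_const c) = \<infinity>"
  by (metis fls_conv_radius_fps_to_fls fps_const_to_fls fps_conv_radius_const)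

lemma qexp_const: "qexp (\<lambda>z. c) (fls_const c)"
  by (simp add: qexp_def fls_conv_radius_const)

lemma qexp_zero: "qexp (\<lambda>z. 0) 0"
  by (simp add: qexp_def)

lemma qexp_add:
  assumes "qexp g F" "qexp h G"
  shows "qexp (\<lambda>z. g z + h z) (F + G)"
  unfolding qexp_def
proof (intro conjI allI impI)
  show "fls_conv_radius (F + G) \<ge> 1"
    using fls_conv_radius_add[of F G] assms by (auto simp: qexp_def min_def split: if_splits)
next
  fix z :: complex assume "Im z > 0"
  thus "g z + h z = eval_fls (F + G) (nome z)"
    using assms by (subst eval_fls_add) (auto simp: qexp_radius qexp_eval)
qed

lemma qexp_diff:
  assumes "qexp g F" "qexp h G"
  shows "qexp (\<lambda>z. g z - h z) (F - G)"
  unfolding qexp_def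
proof (intro conjI allI impI)
  show "fls_conv_radius (F - G) \<ge> 1"
    using fls_conv_radius_diff[of F G] assms by (auto simp: qexp_def min_def split: if_splits)
next
  fix z :: complex assume "Im z > 0"
  thus "g z - h z = eval_fls (F - G) (nome z)"
    using assms by (subst eval_fls_diff) (auto simp: qexp_radius qexp_eval)
qed

lemma qexp_mult:
  assumes "qexp g F" "qexp h G"
  shows "qexp (\<lambda>z. g z * h z) (F * G)"
  unfolding qexp_def
proof (intro conjI allI impI)
  show "fls_conv_radius (F * G) \<ge> 1"
    using fls_conv_radius_mult[of F G] assms by (auto simp: qexp_def min_def split: if_splits)
next
  fix z :: complex assume "Im z > 0"
  thus "g z * h z = eval_fls (F * G) (nome z)"
    using assms by (subst eval_fls_mult) (auto simp: qexp_radius qexp_eval)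
qed

lemma qexp_cmult: "qexp g F \<Longrightarrow> qexp (\<lambda>z. c * g z) (fls_const c * F)"
  by (intro qexp_mult qexp_const)

lemma qexp_power: "qexp g F \<Longrightarrow> qexp (\<lambda>z. g z ^ n) (F ^ n)"
proof (induction n)
  case 0
  show ?case using qexp_const[of 1] by simp
next
  case (Suc n)
  thus ?case using qexp_mult[of g F "\<lambda>z. g z ^ n" "F ^ n"] by simp
qed

lemma qexp_holomorphic:
  assumes "qexp g F"
  shows "g holomorphic_on upper"
proof -
  have "(\<lambda>z. eval_fls F (nome z)) holomorphic_on upper"
    by (rule holomorphic_on_eval_fls')
       (use qexp_radius[OF assms] in \<open>auto intro!: holomorphic_intros\<close>)
  thus ?thesis
    by (rule holomorphic_transform) (use assms in \<open>auto simp: qexp_def\<close>)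
qed

lemma open_upper: "open upper"
  by (rule open_halfspace_Im_gt)

lemma convex_upper: "convex upper"
  by (rule convex_halfspace_Im_gt)

lemma qexp_has_field_derivative:
  assumes "qexp g F" "Im z > 0"
  shows "(g has_field_derivative 2 * of_real pi * \<i> * eval_fls (fls_X * fls_deriv F) (nome z)) (at z)"
proof -
  have q: "ereal (norm (nome z)) < fls_conv_radius F" by (rule qexp_radius[OF assms])
  have "((\<lambda>z. eval_fls F (nome z)) has_field_derivative
          eval_fls (fls_deriv F) (nome z) * (2 * of_real pi * \<i> * nome z)) (at z)"
    by (rule DERIV_chain2[OF has_field_derivative_eval_fls has_field_derivative_nome]) (use q in auto)
  also have "eval_fls (fls_deriv F) (nome z) * (2 * of_real pi * \<i> * nome z) =
             2 * of_real pi * \<i> * eval_fls (fls_X * fls_deriv F) (nome z)"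
  proof (subst eval_fls_mult)
    show "ereal (norm (nome z)) < fls_conv_radius (fls_deriv F)"
      using q fls_conv_radius_deriv by (metis order_less_le_trans)
    show "ereal (norm (nome z)) < fls_conv_radius fls_X"
      by simp
  qed (auto simp: mult_ac)
  finally show ?thesis
    by (rule DERIV_cong_ev[THEN iffD1, rotated 3])
       (use assms open_upper in \<open>auto simp: qexp_def eventually_nhds intro!: exI[of _ upper]\<close>)
qed

lemma qexp_deriv:
  assumes "qexp g F"
  shows "qexp (qderiv g) (fls_X * fls_deriv F)"
  unfolding qexp_def
proof (intro conjI allI impI)
  have "1 \<le> fls_conv_radius F" using assms by (simp add: qexp_def)
  also have "\<dots> \<le> fls_conv_radius (fls_deriv F)" by simp
  finally have "1 \<le> fls_conv_radius (fls_deriv F)" .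
  moreover have "fls_conv_radius fls_X = \<infinity>"
    by simp
  ultimately show "1 \<le> fls_conv_radius (fls_X * fls_deriv F)"
    by (intro order.trans[OF _ fls_conv_radius_mult]) auto
next
  fix z :: complex assume z: "Im z > 0"
  show "qderiv g z = eval_fls (fls_X * fls_deriv F) (nome z)"
    using DERIV_imp_deriv[OF qexp_has_field_derivative[OF assms z]] z by (simp add: qderiv_def)
qed

lemma fls_nth_X_deriv [simp]: "fls_nth (fls_X * fls_deriv F) m = of_int m * fls_nth F m"
  by (simp add: fls_X_times_conv_shift)

lemma qexp_has_field_derivative_qderiv:
  assumes "qexp g F" "Im z > 0"
  shows "(g has_field_derivative 2 * of_real pi * \<i> * qderiv g z) (at z)"
  using qexp_has_field_derivative[OF assms] qexp_eval[OF qexp_deriv[OF assms(1)] assms(2)] by simp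

lemma eball_subset:
  assumes "r \<le> s"
  shows "eball (x :: complex) r \<subseteq> eball x s"
  using assms less_le_trans by (force simp: eball_def)

text \<open>A function without zeros in the upper half plane corresponds to one without zeros in the punctured
  disc, so the inverse Laurent series converges there.\<close>
lemma qexp_inverse:
  assumes "qexp g F" "\<And>z. Im z > 0 \<Longrightarrow> g z \<noteq> 0"
  shows "qexp (\<lambda>z. inverse (g z)) (inverse F)"
proof -
  have rad: "1 \<le> fls_conv_radius F" using assms by (simp add: qexp_def)
  have ex: "eval_fls F has_laurent_expansion F"
    by (intro eval_fls_has_laurent_expansion less_le_trans[OF _ rad]) simp
  have "(\<lambda>x. inverse (eval_fls F x)) has_laurent_expansion inverse F"
    by (intro has_laurent_expansion_inverse ex)
  moreover have "(\<lambda>x. inverse (eval_fls F x)) holomorphic_on eball 0 1 - {0}"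
  proof (intro holomorphic_intros)
    show "(\<lambda>x::complex. x) ` (eball 0 1 - {0}) \<subseteq> eball 0 (fls_conv_radius F) - (if 0 \<le> fls_subdegree F then {} else {0})"
      using eball_subset[OF rad] by (auto split: if_splits)
    fix x :: complex assume "x \<in> eball 0 1 - {0}"
    then obtain z where "Im z > 0" "nome z = x" using nome_surj[of x] by auto
    thus "eval_fls F x \<noteq> 0" using assms by (auto simp: qexp_def)
  qed
  ultimately have "fls_conv_radius (inverse F) \<ge> 1" 
      "\<And>x. x \<in> eball 0 1 - {0} \<Longrightarrow> eval_fls (inverse F) x = inverse (eval_fls F x)"
    using fls_conv_radius_ge eval_fls_eqI by blast+
  thus ?thesis
    using assms norm_nome_less_1 by (auto simp: qexp_def)
qed

text \<open>Rational structures are spaces of Laurent series with coefficients in a fixed subfield.\<close>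
definition fls_over :: "complex set \<Rightarrow> complex fls set" where
  "fls_over K = {F. \<forall>m. fls_nth F m \<in> K}"

lemma subfieldD:
  assumes "complex_subfield K"
  shows "0 \<in> K" "1 \<in> K" "\<And>x y. x \<in> K \<Longrightarrow> y \<in> K \<Longrightarrow> x + y \<in> K"
    "\<And>x y. x \<in> K \<Longrightarrow> y \<in> K \<Longrightarrow> x * y \<in> K" "\<And>x. x \<in> K \<Longrightarrow> - x \<in> K"
    "\<And>x. x \<in> K \<Longrightarrow> inverse x \<in> K"
    "\<And>x y. x \<in> K \<Longrightarrow> y \<in> K \<Longrightarrow> x - y \<in> K" "\<And>x y. x \<in> K \<Longrightarrow> y \<in> K \<Longrightarrow> x / y \<in> K"
  using assms unfolding complex_subfield_def diff_conv_add_uminus divide_inverse by blast+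

lemma subfield_sum:
  assumes "complex_subfield K" "\<And>x. x \<in> A \<Longrightarrow> f x \<in> K"
  shows "sum f A \<in> K"
  using assms(2) by (induction A rule: infinite_finite_induct) (auto intro: subfieldD[OF assms(1)])

lemma subfield_power: "complex_subfield K \<Longrightarrow> x \<in> K \<Longrightarrow> x ^ n \<in> K"
  by (induction n) (auto intro: subfieldD)

lemma subfield_of_nat: "complex_subfield K \<Longrightarrow> of_nat n \<in> K"
  by (induction n) (auto intro: subfieldD)

lemma subfield_of_int: "complex_subfield K \<Longrightarrow> of_int n \<in> K"
  by (cases n) (auto intro: subfieldD subfield_of_nat simp del: of_nat_Suc)

lemma subfield_rat: "complex_subfield K \<Longrightarrow> x \<in> \<rat> \<Longrightarrow> x \<in> K"
  by (auto elim!: Rats_cases' intro!: subfieldD subfield_of_int)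

lemma complex_subfield_Rats: "complex_subfield \<rat>"
  by (auto simp: complex_subfield_def)

lemma complex_subfield_UNIV: "complex_subfield UNIV"
  by (auto simp: complex_subfield_def)

lemma fls_over_mult:
  assumes "complex_subfield K" "F \<in> fls_over K" "G \<in> fls_over K"
  shows "F * G \<in> fls_over K"
  using assms unfolding fls_over_def
  by (auto simp: fls_times_nth(1) intro!: subfield_sum subfieldD)

lemma fls_over_add:
  "complex_subfield K \<Longrightarrow> F \<in> fls_over K \<Longrightarrow> G \<in> fls_over K \<Longrightarrow> F + G \<in> fls_over K"
  unfolding fls_over_def by (auto intro: subfieldD)

lemma fls_over_diff:
  "complex_subfield K \<Longrightarrow> F \<in> fls_over K \<Longrightarrow> G \<in> fls_over K \<Longrightarrow> F - G \<in> fls_over K"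
  unfolding fls_over_def by (auto intro: subfieldD)

lemma fls_over_const:
  "complex_subfield K \<Longrightarrow> c \<in> K \<Longrightarrow> fls_const c \<in> fls_over K"
  unfolding fls_over_def by (auto intro: subfieldD)

lemma fls_over_power:
  "complex_subfield K \<Longrightarrow> F \<in> fls_over K \<Longrightarrow> F ^ n \<in> fls_over K"
proof (induction n)
  case 0
  thus ?case by (auto simp: fls_over_def subfieldD)
next
  case (Suc n)
  thus ?case by (auto intro: fls_over_mult)
qed

text \<open>The coefficients of the inverse satisfy a recursion that divides only by the leading coefficient.\<close>
lemma fls_over_inverse:
  assumes K: "complex_subfield K" and F: "F \<in> fls_over K"
  shows "inverse F \<in> fls_over K"
proof (cases "F = 0")
  case False
  define G where "G = inverse F"
  have FG: "G * F = 1" using False by (simp add: G_def)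
  have G0: "G \<noteq> 0" using FG by auto
  define n where "n = fls_subdegree F"
  define m where "m = fls_subdegree G"
  have c0: "fls_nth F n \<noteq> 0" using False by (simp add: n_def)
  have mn: "m + n = 0"
    using fls_subdegree_mult[OF G0 False] FG by (simp add: m_def n_def)
  have "fls_nth G (m + int j) \<in> K" for j
  proof (induction j rule: less_induct)
    case (less j)
    have "fls_nth (G * F) (m + n + int j) = (\<Sum>i=m..m + int j. fls_nth G i * fls_nth F (m + n + int j - i))"
      unfolding fls_times_nth(2) m_def n_def by (simp add: algebra_simps)
    also have "\<dots> = fls_nth G (m + int j) * fls_nth F n + (\<Sum>i=m..<m + int j. fls_nth G i * fls_nth F (m + n + int j - i))"
    proof -
      have "{m..m + int j} = insert (m + int j) {m..<m + int j}" by auto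
      thus ?thesis by simp
    qed
    finally have "fls_nth G (m + int j) =
        (fls_nth (G * F) (m + n + int j) - (\<Sum>i=m..<m + int j. fls_nth G i * fls_nth F (m + n + int j - i))) / fls_nth F n"
      using c0 by (simp add: field_simps)
    also have "\<dots> \<in> K"
    proof (intro subfieldD(7,8)[OF K] subfield_sum[OF K] subfieldD(4)[OF K])
      show "fls_nth (G * F) (m + n + int j) \<in> K" using subfieldD(1,2)[OF K] by (simp add: FG)
      fix i assume i: "i \<in> {m..<m + int j}"
      hence "fls_nth G (m + int (nat (i - m))) \<in> K" by (intro less) auto
      thus "fls_nth G i \<in> K" using i by simp
    qed (use F in \<open>auto simp: fls_over_def\<close>)
    finally show ?case .
  qed note * = this
  have "fls_nth G i \<in> K" for i
  proof (cases "i \<ge> m")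
    case True
    thus ?thesis using *[of "nat (i - m)"] by simp
  next
    case False
    thus ?thesis using subfieldD(1)[OF K] by (simp add: m_def)
  qed
  thus ?thesis by (simp add: fls_over_def G_def)
qed (use F in auto)

section \<open>The modular group and its action\<close>

definition mat2 :: "int \<Rightarrow> int \<Rightarrow> int \<Rightarrow> int \<Rightarrow> int^2^2" where
  "mat2 a b c d = vector [vector [a, b], vector [c, d]]"

lemma mat2_nth [simp]:
  "mat2 a b c d $ 1 $ 1 = a" "mat2 a b c d $ 1 $ 2 = b"
  "mat2 a b c d $ 2 $ 1 = c" "mat2 a b c d $ 2 $ 2 = d"
  by (simp_all add: mat2_def)

lemma mat2_eq_iff:
  fixes A B :: "int^2^2"
  shows "A = B \<longleftrightarrow> A $ 1 $ 1 = B $ 1 $ 1 \<and> A $ 1 $ 2 = B $ 1 $ 2 \<and>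
   A $ 2 $ 1 = B $ 2 $ 1 \<and> A $ 2 $ 2 = B $ 2 $ 2"
  by (auto simp: vec_eq_iff forall_2)

lemma mat2_mult_nth [simp]:
  fixes A B :: "int^2^2"
  shows "(A ** B) $ i $ j = A $ i $ 1 * B $ 1 $ j + A $ i $ 2 * B $ 2 $ j"
  by (simp add: matrix_matrix_mult_def sum_2)

lemma mat1_nth [simp]: 
  "(mat 1 :: int^2^2) $ 1 $ 1 = 1" "(mat 1 :: int^2^2) $ 1 $ 2 = 0"
  "(mat 1 :: int^2^2) $ 2 $ 1 = 0" "(mat 1 :: int^2^2) $ 2 $ 2 = 1"
  by (simp_all add: mat_def)

lemma det_mat2 [simp]: "det (mat2 a b c d) = a * d - b * c"
  by (simp add: det_2)

text \<open>The adjugate inverts the Moebius transformation also for determinants other than 1, within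
  integer matrices.\<close>
definition adj :: "int^2^2 \<Rightarrow> int^2^2" where
  "adj A = mat2 (A $ 2 $ 2) (- A $ 1 $ 2) (- A $ 2 $ 1) (A $ 1 $ 1)"

lemma det_mult_int: "det ((A :: int^2^2) ** B) = det A * det B"
  by (simp add: det_2 algebra_simps)

lemma det_adj [simp]: "det (adj A) = det A"
  by (simp add: adj_def det_2 algebra_simps)

lemma adj_adj [simp]: "adj (adj A) = A"
  by (simp add: adj_def mat2_eq_iff)

lemma mult_adj_SL2: "A \<in> SL2Z \<Longrightarrow> A ** adj A = mat 1" "A \<in> SL2Z \<Longrightarrow> adj A ** A = mat 1"
  by (simp_all add: SL2Z_def det_2 adj_def mat2_eq_iff algebra_simps)

lemma SL2Z_mult: "A \<in> SL2Z \<Longrightarrow> B \<in> SL2Z \<Longrightarrow> A ** B \<in> SL2Z"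
  by (simp add: SL2Z_def det_mult_int)

lemma SL2Z_adj: "A \<in> SL2Z \<Longrightarrow> adj A \<in> SL2Z"
  by (simp add: SL2Z_def)

lemma SL2Z_one: "mat 1 \<in> SL2Z"
  by (simp add: SL2Z_def)

definition Smat :: "int^2^2" where "Smat = mat2 0 (-1) 1 0"
definition Tmat :: "int \<Rightarrow> int^2^2" where "Tmat n = mat2 1 n 0 1"

lemma Smat_in [simp]: "Smat \<in> SL2Z" and Tmat_in [simp]: "Tmat n \<in> SL2Z"
  by (simp_all add: SL2Z_def Smat_def Tmat_def)

text \<open>The automorphy factor.\<close>
definition autfac :: "int^2^2 \<Rightarrow> complex \<Rightarrow> complex" where
  "autfac g z = of_int (g $ 2 $ 1) * z + of_int (g $ 2 $ 2)"

lemma autfac_nonzero: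
  assumes "det g > 0" "Im z > 0"
  shows "autfac g z \<noteq> 0"
proof
  assume "autfac g z = 0"
  hence "Im (autfac g z) = 0" "Re (autfac g z) = 0" by simp_all
  hence "g $ 2 $ 1 = 0" "g $ 2 $ 2 = 0"
    using assms by (auto simp: autfac_def)
  thus False using assms by (simp add: det_2)
qed

lemma autfac_nonzero_SL2: "g \<in> SL2Z \<Longrightarrow> Im z > 0 \<Longrightarrow> autfac g z \<noteq> 0"
  by (rule autfac_nonzero) (auto simp: SL2Z_def)

lemma Im_moebius:
  assumes "det g > 0" "Im z > 0"
  shows "Im (moebius g z) = of_int (det g) * Im z / (norm (autfac g z))\<^sup>2"
proof -
  have "Im (moebius g z) = Im ((of_int (g $ 1 $ 1) * z + of_int (g $ 1 $ 2)) / autfac g z)"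
    by (simp add: moebius_def autfac_def)
  also have "\<dots> = Im ((of_int (g $ 1 $ 1) * z + of_int (g $ 1 $ 2)) * cnj (autfac g z)) / (norm (autfac g z))\<^sup>2"
    by (subst complex_div_cnj) (simp add: Im_divide_of_real flip: of_real_power)
  also have "Im ((of_int (g $ 1 $ 1) * z + of_int (g $ 1 $ 2)) * cnj (autfac g z)) = of_int (det g) * Im z"
    by (simp add: autfac_def det_2 algebra_simps)
  finally show ?thesis .
qed

lemma Im_moebius_pos:
  assumes "det g > 0" "Im z > 0"
  shows "Im (moebius g z) > 0"
  using assms autfac_nonzero[OF assms] by (simp add: Im_moebius)

lemma Im_moebius_SL2: "g \<in> SL2Z \<Longrightarrow> Im z > 0 \<Longrightarrow> Im (moebius g z) > 0"
  by (rule Im_moebius_pos) (auto simp: SL2Z_def)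

lemma autfac_mult:
  assumes "det B > 0" "Im z > 0"
  shows "autfac (A ** B) z = autfac A (moebius B z) * autfac B z"
proof -
  have "moebius B z * autfac B z = of_int (B $ 1 $ 1) * z + of_int (B $ 1 $ 2)"
    using autfac_nonzero[OF assms] by (simp add: moebius_def autfac_def)
  hence "autfac A (moebius B z) * autfac B z = of_int (A $ 2 $ 1) * (of_int (B $ 1 $ 1) * z + of_int (B $ 1 $ 2)) + of_int (A $ 2 $ 2) * autfac B z"
    by (simp add: autfac_def[of A] ring_distribs mult.assoc)
  thus ?thesis by (simp add: autfac_def algebra_simps)
qed

lemma moebius_mult:
  assumes "det A > 0" "det B > 0" "Im z > 0"
  shows "moebius (A ** B) z = moebius A (moebius B z)"
proof -
  let ?w = "moebius B z"
  have w: "?w * autfac B z = of_int (B $ 1 $ 1) * z + of_int (B $ 1 $ 2)"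
    using autfac_nonzero[OF assms(2,3)] by (simp add: moebius_def autfac_def)
  have nz: "autfac A ?w \<noteq> 0" "autfac B z \<noteq> 0"
    using autfac_nonzero[OF assms(1) Im_moebius_pos[OF assms(2,3)]] autfac_nonzero[OF assms(2,3)] by auto
  have "moebius (A ** B) z = (of_int (A $ 1 $ 1) * (of_int (B $ 1 $ 1) * z + of_int (B $ 1 $ 2)) + of_int (A $ 1 $ 2) * autfac B z) / autfac (A ** B) z"
    by (simp add: moebius_def autfac_def algebra_simps)
  also have "\<dots> = ((of_int (A $ 1 $ 1) * ?w + of_int (A $ 1 $ 2)) * autfac B z) / (autfac A ?w * autfac B z)"
    by (simp only: autfac_mult[OF assms(2,3)] w[symmetric] ring_distribs mult.assoc)
  also have "\<dots> = moebius A ?w"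
    using nz by (simp add: moebius_def autfac_def[of A])
  finally show ?thesis .
qed

lemma SL2Z_det: "A \<in> SL2Z \<Longrightarrow> det A > 0" by (simp add: SL2Z_def)

lemma moebius_one [simp]: "moebius (mat 1) z = z"
  by (simp add: moebius_def)

lemma moebius_T [simp]: "moebius (Tmat n) z = z + of_int n" and autfac_T [simp]: "autfac (Tmat n) z = 1"
  by (simp_all add: moebius_def autfac_def Tmat_def)

lemma moebius_S [simp]: "moebius Smat z = - 1 / z" and autfac_S [simp]: "autfac Smat z = z"
  by (simp_all add: moebius_def autfac_def Smat_def)

lemma moebius_adj:
  assumes "A \<in> SL2Z" "Im z > 0"
  shows "moebius (adj A) (moebius A z) = z" "moebius A (moebius (adj A) z) = z"
  using moebius_mult[of "adj A" A z] moebius_mult[of A "adj A" z] assms mult_adj_SL2[of A]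
  by (simp_all add: SL2Z_det)

lemma has_field_derivative_moebius:
  assumes "det \<delta> > 0" "Im z > 0"
  shows "(moebius \<delta> has_field_derivative of_int (det \<delta>) / (autfac \<delta> z)\<^sup>2) (at z)"
proof -
  define A B C D where "A = (of_int (\<delta> $ 1 $ 1) :: complex)" "B = (of_int (\<delta> $ 1 $ 2) :: complex)"
    "C = (of_int (\<delta> $ 2 $ 1) :: complex)" "D = (of_int (\<delta> $ 2 $ 2) :: complex)"
  have nz: "C * z + D \<noteq> 0" using autfac_nonzero[OF assms] by (simp add: A_B_C_D_def autfac_def)
  have "((\<lambda>w. (A * w + B) / (C * w + D)) has_field_derivative
          (A * (C * z + D) - (A * z + B) * C) / ((C * z + D) * (C * z + D))) (at z)"
    by (rule DERIV_divide) (use nz in \<open>auto intro!: derivative_eq_intros\<close>)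
  also have "A * (C * z + D) - (A * z + B) * C = of_int (det \<delta>)"
    by (simp add: A_B_C_D_def det_2 algebra_simps)
  finally show ?thesis
    unfolding moebius_def[abs_def] autfac_def by (simp only: A_B_C_D_def power2_eq_square)
qed

text \<open>Among all denominators \<open>\<bar>c z + d\<bar>\<close> of an orbit a least one exists; the corresponding point
  lies in the fundamental domain after a translation, since S would otherwise lower the denominator.\<close>
lemma reduction:
  assumes z: "Im z > 0"
  obtains \<gamma> where "\<gamma> \<in> SL2Z" "\<bar>Re (moebius \<gamma> z)\<bar> \<le> 1/2" "norm (moebius \<gamma> z) \<ge> 1"
proof -
  define V where "V = {norm (autfac \<gamma> z) |\<gamma>. \<gamma> \<in> SL2Z \<and> norm (autfac \<gamma> z) \<le> 1}"
  define C where "C = \<lceil>1 / Im z\<rceil>"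
  define D where "D = \<lceil>1 + of_int C * norm z\<rceil>"
  have "V \<subseteq> (\<lambda>(c, d). norm (of_int c * z + of_int d)) ` ({-C..C} \<times> {-D..D})"
  proof
    fix v assume "v \<in> V"
    then obtain \<gamma> where \<gamma>: "\<gamma> \<in> SL2Z" "norm (autfac \<gamma> z) \<le> 1" "v = norm (autfac \<gamma> z)"
      by (auto simp: V_def)
    define c d where "c = \<gamma> $ 2 $ 1" "d = \<gamma> $ 2 $ 2"
    have "\<bar>Im (autfac \<gamma> z)\<bar> \<le> 1" using \<gamma>(2) abs_Im_le_cmod order.trans by blast
    hence "\<bar>of_int c\<bar> * Im z \<le> 1" using z by (simp add: autfac_def c_d_def abs_mult)
    hence "of_int \<bar>c\<bar> \<le> 1 / Im z" using z by (simp add: field_simps)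
    hence c: "\<bar>c\<bar> \<le> C" unfolding C_def by linarith
    have "norm (of_int d :: complex) \<le> norm (autfac \<gamma> z) + norm (of_int c * z)"
      using norm_triangle_ineq4[of "autfac \<gamma> z" "of_int c * z"] by (simp add: autfac_def c_d_def)
    also have "norm (of_int c * z) = of_int \<bar>c\<bar> * norm z" by (simp add: norm_mult)
    also have "\<dots> \<le> of_int C * norm z" using c by (intro mult_right_mono) (simp_all only: of_int_le_iff norm_ge_zero)
    finally have "of_int \<bar>d\<bar> \<le> 1 + of_int C * norm z" using \<gamma>(2) by simp
    hence d: "\<bar>d\<bar> \<le> D" unfolding D_def by linarith
    show "v \<in> (\<lambda>(c, d). norm (of_int c * z + of_int d)) ` ({-C..C} \<times> {-D..D})"
      using c d \<gamma>(3) by (intro image_eqI[of _ _ "(c, d)"]) (auto simp: autfac_def c_d_def)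
  qed
  hence fin: "finite V" by (rule finite_subset) auto
  have "norm (autfac (mat 1) z) \<in> V"
    unfolding V_def using SL2Z_one by (intro CollectI exI[of _ "mat 1"]) (simp add: autfac_def)
  hence ne: "V \<noteq> {}" by auto
  have "Min V \<in> V" by (rule Min_in[OF fin ne])
  then obtain \<gamma> where \<gamma>: "\<gamma> \<in> SL2Z" "norm (autfac \<gamma> z) = Min V" "norm (autfac \<gamma> z) \<le> 1"
    unfolding V_def by (smt (verit) mem_Collect_eq)
  have least: "norm (autfac \<gamma> z) \<le> norm (autfac \<gamma>' z)" if "\<gamma>' \<in> SL2Z" for \<gamma>'
  proof (cases "norm (autfac \<gamma>' z) \<le> 1")
    case True
    hence "norm (autfac \<gamma>' z) \<in> V" using that by (auto simp: V_def)
    thus ?thesis using fin \<gamma>(2) by simp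
  qed (use \<gamma>(3) in auto)
  define n where "n = - round (Re (moebius \<gamma> z))"
  define \<delta> where "\<delta> = Tmat n ** \<gamma>"
  have \<delta>: "\<delta> \<in> SL2Z" using \<gamma> by (simp add: \<delta>_def SL2Z_mult)
  have m\<delta>: "moebius \<delta> z = moebius \<gamma> z + of_int n"
    using \<gamma> z by (simp add: \<delta>_def moebius_mult SL2Z_det)
  have a\<delta>: "autfac \<delta> z = autfac \<gamma> z"
    using \<gamma> z by (simp add: \<delta>_def autfac_mult SL2Z_det)
  have "\<bar>Re (moebius \<delta> z)\<bar> \<le> 1/2"
    using of_int_round_abs_le[of "Re (moebius \<gamma> z)"] by (simp add: m\<delta> n_def abs_minus_commute)
  moreover have "norm (moebius \<delta> z) \<ge> 1"
  proof (rule ccontr)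
    assume *: "\<not> ?thesis"
    have "autfac (Smat ** \<delta>) z = moebius \<delta> z * autfac \<gamma> z"
      using \<delta> z by (simp add: autfac_mult SL2Z_det a\<delta>)
    moreover have "norm (autfac \<gamma> z) > 0" using autfac_nonzero_SL2[OF \<gamma>(1) z] by simp
    ultimately have "norm (autfac (Smat ** \<delta>) z) < norm (autfac \<gamma> z)"
      using * by (simp add: norm_mult)
    thus False using least[of "Smat ** \<delta>"] \<delta> by (simp add: SL2Z_mult)
  qed
  ultimately show ?thesis using that \<delta> by blast
qed

lemma reduced_Im_ge:
  assumes "\<bar>Re z\<bar> \<le> 1/2" "norm z \<ge> 1" "Im z > 0"
  shows "Im z \<ge> 43/50"
proof (rule ccontr)
  assume "\<not> ?thesis"
  hence "(Im z)\<^sup>2 < (43/50)\<^sup>2" using assms by (intro power_strict_mono) auto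
  moreover have "(Re z)\<^sup>2 \<le> (1/2)\<^sup>2" using assms(1) by (intro abs_le_square_iff[THEN iffD1]) auto
  moreover have "1 \<le> (norm z)\<^sup>2" using assms(2) by (simp only: one_le_power)
  ultimately show False by (simp add: cmod_power2) (simp add: power2_eq_square)
qed

section \<open>Modular forms and a Sturm bound\<close>

text \<open>A weakly holomorphic modular form together with its expansion at the cusp; only the values
  on the upper half plane matter.\<close>
definition modform :: "int \<Rightarrow> (complex \<Rightarrow> complex) \<Rightarrow> complex fls \<Rightarrow> bool" where
  "modform k g F \<longleftrightarrow> qexp g F \<and> (\<forall>\<gamma>\<in>SL2Z. \<forall>z. Im z > 0 \<longrightarrow> g (moebius \<gamma> z) = autfac \<gamma> z powi k * g z)"

lemma modform_qexp: "modform k g F \<Longrightarrow> qexp g F"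
  by (simp add: modform_def)

lemma modformD: "modform k g F \<Longrightarrow> \<gamma> \<in> SL2Z \<Longrightarrow> Im z > 0 \<Longrightarrow> g (moebius \<gamma> z) = autfac \<gamma> z powi k * g z"
  by (simp add: modform_def)

lemma weak_forms_complex_iff:
  "g \<in> weak_forms_complex k \<longleftrightarrow> (\<forall>z. Im z \<le> 0 \<longrightarrow> g z = 0) \<and> (\<exists>F. modform k g F)"
proof
  assume g: "g \<in> weak_forms_complex k"
  then obtain a where a: "has_fourier g a" "finite {m. m < 0 \<and> a m \<noteq> 0}"
    by (auto simp: weak_forms_complex_def)
  obtain F where "qexp g F" by (rule has_fourier_qexp[OF a])
  hence "modform k g F" using g by (auto simp: weak_forms_complex_def modform_def autfac_def)
  thus "(\<forall>z. Im z \<le> 0 \<longrightarrow> g z = 0) \<and> (\<exists>F. modform k g F)"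
    using g by (auto simp: weak_forms_complex_def)
next
  assume g: "(\<forall>z. Im z \<le> 0 \<longrightarrow> g z = 0) \<and> (\<exists>F. modform k g F)"
  then obtain F where F: "modform k g F" by blast
  have "finite {m. m < 0 \<and> fls_nth F m \<noteq> 0}"
  proof (rule finite_subset)
    show "{m. m < 0 \<and> fls_nth F m \<noteq> 0} \<subseteq> {fls_subdegree F..0}"
      using fls_subdegree_leI by auto
  qed auto
  thus "g \<in> weak_forms_complex k"
    using g F qexp_has_fourier[OF modform_qexp[OF F]] qexp_holomorphic[OF modform_qexp[OF F]]
    unfolding weak_forms_complex_def modform_def autfac_def by blast
qed

lemma modform_cong: "modform k g F \<Longrightarrow> (\<And>z. Im z > 0 \<Longrightarrow> g z = h z) \<Longrightarrow> modform k h F"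
  unfolding modform_def using qexp_cong Im_moebius_SL2 by metis

lemma modform_mult: "modform k g F \<Longrightarrow> modform l h G \<Longrightarrow> modform (k + l) (\<lambda>z. g z * h z) (F * G)"
  unfolding modform_def by (auto simp: qexp_mult power_int_add autfac_nonzero_SL2)

lemma modform_cmult: "modform k g F \<Longrightarrow> modform k (\<lambda>z. c * g z) (fls_const c * F)"
  unfolding modform_def by (auto simp: qexp_cmult)

lemma modform_add: "modform k g F \<Longrightarrow> modform k h G \<Longrightarrow> modform k (\<lambda>z. g z + h z) (F + G)"
  unfolding modform_def by (auto simp: qexp_add algebra_simps)

lemma modform_diff: "modform k g F \<Longrightarrow> modform k h G \<Longrightarrow> modform k (\<lambda>z. g z - h z) (F - G)"
  unfolding modform_def by (auto simp: qexp_diff algebra_simps)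

lemma modform_const: "modform 0 (\<lambda>z. c) (fls_const c)"
  unfolding modform_def by (auto simp: qexp_const)

lemma modform_one: "modform 0 (\<lambda>z. 1) 1"
  using modform_const[of 1] by simp

lemma modform_power: "modform k g F \<Longrightarrow> modform (int n * k) (\<lambda>z. g z ^ n) (F ^ n)"
proof (induction n)
  case 0
  show ?case using modform_one by simp
next
  case (Suc n)
  have "modform (k + int n * k) (\<lambda>z. g z * g z ^ n) (F * F ^ n)"
    using Suc by (intro modform_mult) auto
  thus ?case by (simp add: algebra_simps)
qed

lemma modform_inverse: 
  assumes "modform k g F" "\<And>z. Im z > 0 \<Longrightarrow> g z \<noteq> 0"
  shows "modform (- k) (\<lambda>z. inverse (g z)) (inverse F)"
  using assms unfolding modform_def by (auto simp: qexp_inverse power_int_minus)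

lemma pi_ge_3: "pi \<ge> 3"
proof -
  have "sin (pi / 6) \<le> pi / 6" using pi_gt_zero by (intro sin_x_le_x) simp
  thus ?thesis by (simp add: sin_30)
qed

text \<open>Compare the maximum of \<open>g / q\<^sup>N\<close> on the line \<open>Im z = 17/20\<close>, which dominates all higher points
  by the maximum principle, with the invariant function \<open>y\<^sup>k |g|\<^sup>2\<close>: since every orbit meets the
  region \<open>Im z \<ge> 43/50\<close>, a nonzero maximum would be strictly smaller than itself. The numbers
  only have to satisfy \<open>10 / (17/20) < 4 \<pi>\<close> and \<open>17/20 < 43/50 < \<surd>3 / 2\<close>.\<close>
lemma sturm_bound:
  assumes g: "modform k g F" and N: "N \<ge> 1" "k \<le> 10 * int N"
    and F: "\<And>m. m < int N \<Longrightarrow> fls_nth F m = 0" and z: "Im z > 0"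
  shows "g z = 0"
proof -
  define G where "G = eval_fls (fls_shift (int N) F)"
  define y0 :: real where "y0 = 17/20"
  define r0 where "r0 = exp (- 2 * pi * y0)"
  have rad: "fls_conv_radius F \<ge> 1" using g by (simp add: modform_def qexp_def)
  have sub: "fls_subdegree (fls_shift (int N) F) \<ge> 0"
  proof (cases "fls_shift (int N) F = 0")
    case False
    thus ?thesis using F by (intro fls_subdegree_geI) auto
  qed simp
  have r0: "r0 < 1" "r0 > 0" by (simp_all add: r0_def y0_def)
  have holG: "G holomorphic_on cball 0 r0"
    unfolding G_def
  proof (rule holomorphic_on_eval_fls)
    have "ereal (dist 0 x) < fls_conv_radius F" if "dist 0 x \<le> r0" for x :: complex
      by (rule less_le_trans[OF _ rad]) (use that r0 in simp)
    thus "cball (0::complex) r0 \<subseteq> eball 0 (fls_conv_radius (fls_shift (int N) F)) -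
       (if 0 \<le> fls_subdegree (fls_shift (int N) F) then {} else {0})"
      using sub by auto
  qed
  have gG: "g z = nome z ^ N * G (nome z)" if "Im z > 0" for z
    unfolding G_def using qexp_eval[OF modform_qexp[OF g] that]
    by (simp add: eval_fls_shift power_int_minus field_simps)
  have contG: "continuous_on (cball 0 r0) G" by (rule holomorphic_on_imp_continuous_on[OF holG])
  obtain q0 where q0: "q0 \<in> sphere 0 r0" "\<And>x. x \<in> sphere 0 r0 \<Longrightarrow> norm (G x) \<le> norm (G q0)"
  proof -
    have "\<exists>x\<in>sphere 0 r0. \<forall>y\<in>sphere 0 r0. norm (G y) \<le> norm (G x)"
      using r0 by (intro continuous_attains_sup continuous_on_norm continuous_on_subset[OF contG]) auto
    thus ?thesis using that by blast
  qed
  have maxG: "norm (G x) \<le> norm (G q0)" if "x \<in> cball 0 r0" for x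
    by (rule maximum_modulus_frontier[of G "cball 0 r0"])
       (use that contG q0(2) r0 holG in \<open>auto intro: holomorphic_on_subset\<close>)
  have "q0 \<noteq> 0" "norm q0 < 1" using q0 r0 by auto
  then obtain z0 where z0: "Im z0 > 0" "nome z0 = q0" by (rule nome_surj)
  have Imz0: "Im z0 = y0" using q0(1) z0(2)[symmetric] by (simp add: norm_nome r0_def)
  \<comment> \<open>Unlike g, this function is invariant under the modular group.\<close>
  define \<phi> where "\<phi> z = Im z powi k * (norm (g z))\<^sup>2" for z
  have inv: "\<phi> (moebius \<gamma> z) = \<phi> z" if "\<gamma> \<in> SL2Z" "Im z > 0" for \<gamma> z
  proof -
    have "autfac \<gamma> z \<noteq> 0" using that autfac_nonzero_SL2 by blast
    moreover have "Im (moebius \<gamma> z) = Im z / (norm (autfac \<gamma> z))\<^sup>2"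
      using that by (subst Im_moebius) (auto simp: SL2Z_def)
    moreover have "((norm (autfac \<gamma> z))\<^sup>2) powi k = (norm (autfac \<gamma> z) powi k)\<^sup>2"
      by (metis power_int_mult power_int_numeral mult.commute)
    ultimately show ?thesis
      unfolding \<phi>_def modformD[OF g that]
      by (simp add: power_int_divide_distrib norm_mult norm_power_int power_mult_distrib)
  qed
  have \<phi>z0: "\<phi> z0 = y0 powi k * (exp (- 2 * pi * y0) ^ N)\<^sup>2 * (norm (G q0))\<^sup>2"
    using z0 q0 by (simp add: \<phi>_def gG Imz0 norm_mult norm_power norm_nome power_mult_distrib r0_def)
  obtain \<gamma> where \<gamma>: "\<gamma> \<in> SL2Z" "\<bar>Re (moebius \<gamma> z0)\<bar> \<le> 1/2" "norm (moebius \<gamma> z0) \<ge> 1"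
    using reduction[OF z0(1)] by blast
  define z1 where "z1 = moebius \<gamma> z0"
  have z1: "Im z1 > 0" using Im_moebius_SL2[OF \<gamma>(1) z0(1)] by (simp add: z1_def)
  define y where "y = Im z1"
  have y: "y \<ge> 43/50" using reduced_Im_ge[of z1] \<gamma> z1 by (simp add: y_def z1_def)
  have Gz1: "norm (G (nome z1)) \<le> norm (G q0)"
    by (rule maxG) (use y in \<open>simp add: norm_nome r0_def y0_def y_def\<close>)
  have "G q0 = 0"
  proof (rule ccontr)
    assume nz: "G q0 \<noteq> 0"
    have "\<phi> z0 = \<phi> z1" using inv[OF \<gamma>(1) z0(1)] by (simp add: z1_def)
    also have "\<phi> z1 = y powi k * (exp (- 2 * pi * y) ^ N)\<^sup>2 * (norm (G (nome z1)))\<^sup>2"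
      using z1 by (simp add: \<phi>_def gG y_def norm_mult norm_power norm_nome power_mult_distrib)
    also have "\<dots> \<le> y powi k * (exp (- 2 * pi * y) ^ N)\<^sup>2 * (norm (G q0))\<^sup>2"
      using Gz1 y by (intro mult_left_mono power_mono) auto
    finally have "y0 powi k * (exp (- 2 * pi * y0) ^ N)\<^sup>2 \<le> y powi k * (exp (- 2 * pi * y) ^ N)\<^sup>2"
      using nz by (simp add: \<phi>z0)
    moreover have "(exp (- 2 * pi * x) ^ N)\<^sup>2 = exp (- 4 * pi * real N * x)" for x
      by (simp add: mult_ac flip: exp_of_nat_mult)
    ultimately have "y0 powi k * exp (- 4 * pi * real N * y0) \<le> y powi k * exp (- 4 * pi * real N * y)"
      by metis
    moreover have "y0 powi k * exp (- 4 * pi * real N * y0) > 0" by (simp add: y0_def)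
    ultimately have "1 \<le> (y powi k * exp (- 4 * pi * real N * y)) / (y0 powi k * exp (- 4 * pi * real N * y0))"
      by (simp only: le_divide_eq_1_pos)
    also have "\<dots> = (y / y0) powi k * (exp (- 4 * pi * real N * y) / exp (- 4 * pi * real N * y0))"
      by (simp add: power_int_divide_distrib)
    also have "exp (- 4 * pi * real N * y) / exp (- 4 * pi * real N * y0) = exp (- 4 * pi * real N * (y - y0))"
      by (simp add: algebra_simps flip: exp_diff)
    finally have *: "1 \<le> (y / y0) powi k * exp (- 4 * pi * real N * (y - y0))" .
    have "(y / y0) powi k \<le> (y / y0) powi (10 * int N)"
      using N(2) y by (intro power_int_increasing) (auto simp: y0_def)
    also have "\<dots> = (y / y0) ^ (10 * N)" 
      by (metis of_nat_mult of_nat_numeral power_int_of_nat)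
    also have "\<dots> \<le> exp (y / y0 - 1) ^ (10 * N)"
      using y exp_ge_add_one_self[of "y / y0 - 1"] by (intro power_mono) (auto simp: y0_def)
    also have "\<dots> = exp (real (10 * N) * (y / y0 - 1))"
      by (rule exp_of_nat_mult[symmetric])
    finally have "(y / y0) powi k * exp (- 4 * pi * real N * (y - y0)) \<le>
        exp (real (10 * N) * (y / y0 - 1)) * exp (- 4 * pi * real N * (y - y0))"
      by simp
    with * have "1 \<le> exp (real (10 * N) * (y / y0 - 1)) * exp (- 4 * pi * real N * (y - y0))"
      by linarith
    also have "\<dots> = exp (real N * (y - y0) * (10 / y0 - 4 * pi))"
      by (simp add: y0_def algebra_simps flip: exp_add)
    also have "\<dots> < 1"
    proof -
      have "real N * (y - y0) > 0" using N y by (simp add: y0_def)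
      moreover have "10 / y0 - 4 * pi < 0" using pi_ge_3 by (simp add: y0_def)
      ultimately have "real N * (y - y0) * (10 / y0 - 4 * pi) < 0" by (rule mult_pos_neg)
      thus ?thesis by simp
    qed
    finally show False by simp
  qed
  hence G0: "G x = 0" if "x \<in> cball 0 r0" for x using maxG[OF that] by simp
  obtain \<gamma>' where \<gamma>': "\<gamma>' \<in> SL2Z" "\<bar>Re (moebius \<gamma>' z)\<bar> \<le> 1/2" "norm (moebius \<gamma>' z) \<ge> 1"
    using reduction[OF z] by blast
  have 1: "Im (moebius \<gamma>' z) > 0" by (rule Im_moebius_SL2[OF \<gamma>'(1) z])
  have "Im (moebius \<gamma>' z) \<ge> 43/50" using reduced_Im_ge \<gamma>' 1 by blast
  hence "nome (moebius \<gamma>' z) \<in> cball 0 r0" by (simp add: norm_nome r0_def y0_def)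
  hence "g (moebius \<gamma>' z) = 0" using gG[OF 1] G0 by simp
  thus "g z = 0" using modformD[OF g \<gamma>'(1) z] autfac_nonzero_SL2[OF \<gamma>'(1) z] by (simp add: power_int_eq_0_iff)
qed

lemma qexp_zero_imp:
  assumes "qexp g F" "\<And>z. Im z > 0 \<Longrightarrow> g z = 0"
  shows "F = 0"
  using qexp_unique[OF assms(1) qexp_cong[OF qexp_zero]] assms(2) by simp

section \<open>Eisenstein series\<close>

text \<open>The Lipschitz formula \<open>\<Sum>\<^sub>n (z + n)\<^sup>-\<^sup>k = (2 \<pi> i)\<^sup>k / (k - 1)! \<Sum>\<^sub>r r\<^sup>k\<^sup>-\<^sup>1 q\<^sup>r\<close> (k even) is the
  (k-1)-fold derivative of the reflection formula of the digamma function, whose right-hand side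
  \<open>\<pi> cot \<pi> z\<close> is a geometric series in q.\<close>
lemma upper_not_nonpos_Ints:
  assumes "Im z > 0"
  shows "z \<notin> \<int>\<^sub>\<le>\<^sub>0" "1 - z \<notin> \<int>\<^sub>\<le>\<^sub>0"
  using assms by (auto elim!: nonpos_Ints_cases simp: complex_eq_iff)

text \<open>The logarithmic derivative of the reflection formula of the Gamma function.\<close>
lemma digamma_reflection:
  fixes z :: complex
  assumes z: "Im z > 0"
  shows "Digamma (1 - z) - Digamma z = - of_real pi * \<i> - 2 * of_real pi * \<i> * (nome z / (1 - nome z))"
proof -
  note nz = upper_not_nonpos_Ints[OF z]
  have sn: "sin (of_real pi * w) \<noteq> 0" if "Im w > 0" for w :: complex
  proof
    assume "sin (of_real pi * w) = 0"
    hence "Gamma w * Gamma (1 - w) = 0" by (simp only: Gamma_reflection_complex) simp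
    thus False using upper_not_nonpos_Ints[OF that] by (simp add: Gamma_eq_zero_iff)
  qed
  have "((\<lambda>z. Gamma z * Gamma (1 - z)) has_field_derivative
          (Gamma z * Digamma z) * Gamma (1 - z) + (Gamma (1 - z) * Digamma (1 - z)) * (- 1) * Gamma z) (at z)"
    using nz by (auto intro!: derivative_eq_intros)
  moreover have "((\<lambda>z. Gamma z * Gamma (1 - z)) has_field_derivative
          - (of_real pi * (cos (of_real pi * z) * of_real pi)) / (sin (of_real pi * z))\<^sup>2) (at z)"
    unfolding Gamma_reflection_complex using sn[OF z]
    by (auto intro!: derivative_eq_intros simp: power2_eq_square)
  ultimately have "(Gamma z * Digamma z) * Gamma (1 - z) + (Gamma (1 - z) * Digamma (1 - z)) * (- 1) * Gamma z
      = - (of_real pi * (cos (of_real pi * z) * of_real pi)) / (sin (of_real pi * z))\<^sup>2"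
    by (rule DERIV_unique)
  hence "(Gamma z * Gamma (1 - z)) * (Digamma (1 - z) - Digamma z)
      = (of_real pi * (cos (of_real pi * z) * of_real pi)) / (sin (of_real pi * z))\<^sup>2"
    by (simp add: algebra_simps)
  hence "Digamma (1 - z) - Digamma z = of_real pi * (cos (of_real pi * z) / sin (of_real pi * z))"
  proof -
    have "(Gamma z * Gamma (1 - z)) * (Digamma (1 - z) - Digamma z) =
          (of_real pi / sin (of_real pi * z)) * (of_real pi * (cos (of_real pi * z) / sin (of_real pi * z)))"
      unfolding \<open>(Gamma z * Gamma (1 - z)) * (Digamma (1 - z) - Digamma z) = _\<close>
      by (simp add: power2_eq_square)
    moreover have "of_real pi / sin (of_real pi * z) \<noteq> 0" using sn[OF z] by simp
    ultimately show ?thesis unfolding Gamma_reflection_complex by (metis mult_left_cancel)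
  qed
  also have "cos (of_real pi * z) / sin (of_real pi * z) = - \<i> - 2 * \<i> * (nome z / (1 - nome z))"
  proof -
    define e where "e = exp (\<i> * (of_real pi * z))"
    have e: "e \<noteq> 0" "nome z = e\<^sup>2"
      by (simp_all add: e_def nome_def power2_eq_square mult_ac flip: exp_add)
    have "e\<^sup>2 \<noteq> 1" using norm_nome_less_1[OF z] e by auto
    have "cos (of_real pi * z) = (e + inverse e) / 2" "sin (of_real pi * z) = - \<i> / 2 * (e - inverse e)"
      by (simp_all add: cos_exp_eq sin_exp_eq e_def exp_minus)
    moreover have "(a / 2) / (- \<i> / 2 * b) = \<i> * (a / b)" for a b :: complex
      by (cases "b = 0") (auto simp: field_simps)
    ultimately have "cos (of_real pi * z) / sin (of_real pi * z) = \<i> * ((e + inverse e) / (e - inverse e))"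
      by (simp only:)
    also have "(e + inverse e) / (e - inverse e) = (e\<^sup>2 + 1) / (e\<^sup>2 - 1)"
      using e(1) \<open>e\<^sup>2 \<noteq> 1\<close> by (simp add: divide_simps power2_eq_square)
    also have "\<i> * \<dots> = - \<i> - 2 * \<i> * (e\<^sup>2 / (1 - e\<^sup>2))"
      using \<open>e\<^sup>2 \<noteq> 1\<close> by (simp add: divide_simps) (simp add: algebra_simps)
    finally show ?thesis by (simp add: e)
  qed
  finally show ?thesis by (simp add: algebra_simps)
qed

text \<open>This is \<open>\<pi> cot \<pi> z\<close> on the upper half plane.\<close>
definition cot_q :: "complex \<Rightarrow> complex" where
  "cot_q z = - of_real pi * \<i> - 2 * of_real pi * \<i> * (nome z / (1 - nome z))"

lemma cot_q_expansion:
  obtains F where "qexp cot_q F" "fls_nth F = (\<lambda>m. if m = 0 then - of_real pi * \<i> else if m < 0 then 0 else - 2 * of_real pi * \<i>)"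
proof -
  define a where "a m = (if m = 0 then - of_real pi * \<i> else if m < (0::int) then 0 else - 2 * of_real pi * \<i>)" for m
  have "has_fourier cot_q a"
    unfolding has_fourier_def nome_def[symmetric]
  proof (intro allI impI)
    fix z :: complex assume z: "Im z > 0"
    have "((\<lambda>n. nome z ^ n) has_sum (nome z / (1 - nome z))) {1..}"
      by (rule has_sum_geometric_from_1[OF norm_nome_less_1[OF z]])
    hence "((\<lambda>n. - 2 * of_real pi * \<i> * nome z ^ n) has_sum (- 2 * of_real pi * \<i> * (nome z / (1 - nome z)))) {1..}"
      by (rule has_sum_cmult_right)
    also have "?this \<longleftrightarrow> ((\<lambda>m. a m * nome z powi m) has_sum (- 2 * of_real pi * \<i> * (nome z / (1 - nome z)))) {1..}"
      by (rule has_sum_reindex_bij_witness[of _ nat int]) (auto simp: a_def power_int_def)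
    finally have "((\<lambda>m. a m * nome z powi m) has_sum (a 0 * nome z powi 0 + (- 2 * of_real pi * \<i> * (nome z / (1 - nome z))))) (insert 0 {1..})"
      by (intro has_sum_insert) auto
    also have "a 0 * nome z powi 0 + (- 2 * of_real pi * \<i> * (nome z / (1 - nome z))) = cot_q z"
      by (simp add: a_def cot_q_def)
    also have "((\<lambda>m. a m * nome z powi m) has_sum cot_q z) (insert 0 {1..}) \<longleftrightarrow> ((\<lambda>m. a m * nome z powi m) has_sum cot_q z) UNIV"
      by (intro has_sum_cong_neutral) (auto simp: a_def)
    finally show "((\<lambda>m. a m * nome z powi m) has_sum cot_q z) UNIV" .
  qed
  moreover have "{m. m < 0 \<and> a m \<noteq> 0} = {}" by (auto simp: a_def)
  ultimately obtain F where "qexp cot_q F" "fls_nth F = a"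
    using has_fourier_qexp[of cot_q a] by (metis finite.emptyI)
  thus ?thesis using that unfolding a_def[abs_def] by blast
qed

lemma polygamma_reflection:
  assumes "Im z > 0"
  shows "(-1) ^ j * Polygamma j (1 - z) - Polygamma j z = (2 * of_real pi * \<i>) ^ j * (qderiv ^^ j) cot_q z"
  using assms
proof (induction j arbitrary: z)
  case 0
  thus ?case using digamma_reflection by (simp add: cot_q_def)
next
  case (Suc j)
  obtain F where "qexp cot_q F" by (rule cot_q_expansion)
  hence "\<exists>G. qexp ((qderiv ^^ j) cot_q) G"
    by (induction j) (auto intro: qexp_deriv)
  then obtain G where G: "qexp ((qderiv ^^ j) cot_q) G" by blast
  note nz = upper_not_nonpos_Ints[OF Suc.prems]
  have "((\<lambda>z. (-1) ^ j * Polygamma j (1 - z) - Polygamma j z) has_field_derivative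
          (-1) ^ j * (Polygamma (Suc j) (1 - z) * (-1)) - Polygamma (Suc j) z) (at z)"
    using nz by (auto intro!: derivative_eq_intros)
  moreover have "((\<lambda>z. (2 * of_real pi * \<i>) ^ j * (qderiv ^^ j) cot_q z) has_field_derivative
          (2 * of_real pi * \<i>) ^ j * (2 * of_real pi * \<i> * qderiv ((qderiv ^^ j) cot_q) z)) (at z)"
    by (intro DERIV_cmult qexp_has_field_derivative_qderiv[OF G Suc.prems])
  hence "((\<lambda>z. (-1) ^ j * Polygamma j (1 - z) - Polygamma j z) has_field_derivative
          (2 * of_real pi * \<i>) ^ j * (2 * of_real pi * \<i> * qderiv ((qderiv ^^ j) cot_q) z)) (at z)"
    by (rule has_field_derivative_transform_within_open[OF _ open_upper]) (use Suc in auto)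
  ultimately have "(-1) ^ j * (Polygamma (Suc j) (1 - z) * (-1)) - Polygamma (Suc j) z =
          (2 * of_real pi * \<i>) ^ j * (2 * of_real pi * \<i> * qderiv ((qderiv ^^ j) cot_q) z)"
    by (rule DERIV_unique)
  thus ?case by (simp add: algebra_simps)
qed

lemma qexp_qderiv_funpow:
  assumes "qexp g F"
  obtains G where "qexp ((qderiv ^^ j) g) G" "\<And>m. fls_nth G m = of_int m ^ j * fls_nth F m"
proof -
  have "\<exists>G. qexp ((qderiv ^^ j) g) G \<and> (\<forall>m. fls_nth G m = of_int m ^ j * fls_nth F m)"
  proof (induction j)
    case 0
    thus ?case using assms by auto
  next
    case (Suc j)
    then obtain G where G: "qexp ((qderiv ^^ j) g) G" "\<And>m. fls_nth G m = of_int m ^ j * fls_nth F m" by blast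
    show ?case
      using qexp_deriv[OF G(1)] G(2) by (intro exI[of _ "fls_X * fls_deriv G"]) (auto simp: mult_ac)
  qed
  thus ?thesis using that by blast
qed

lemma summable_on_inverse_square_int: "(\<lambda>m::int. 1 / (1 + (of_int m)\<^sup>2) :: real) summable_on UNIV"
proof -
  have "summable (\<lambda>n. 1 / (1 + (real n)\<^sup>2))"
  proof (rule summable_comparison_test')
    show "summable (\<lambda>n. inverse (real n ^ 2))" by (rule inverse_power_summable) simp
    show "norm (1 / (1 + (real n)\<^sup>2)) \<le> inverse (real n ^ 2)" if "n \<ge> 1" for n
    proof -
      have "(real n)\<^sup>2 > 0" using that by simp
      hence "inverse (1 + (real n)\<^sup>2) \<le> inverse ((real n)\<^sup>2)" by (intro le_imp_inverse_le) auto
      thus ?thesis by (simp add: inverse_eq_divide)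
    qed
  qed
  hence *: "(\<lambda>n. 1 / (1 + (real n)\<^sup>2)) summable_on UNIV"
    by (subst summable_on_UNIV_nonneg_real_iff) auto
  have "(\<lambda>m::int. 1 / (1 + (of_int m)\<^sup>2) :: real) summable_on range int"
    using * by (subst summable_on_reindex) (auto simp: o_def)
  moreover have "(\<lambda>m::int. 1 / (1 + (of_int m)\<^sup>2) :: real) summable_on range (\<lambda>n. - int n)"
    using * by (subst summable_on_reindex) (auto simp: o_def inj_def)
  ultimately have "(\<lambda>m::int. 1 / (1 + (of_int m)\<^sup>2) :: real) summable_on (range int \<union> range (\<lambda>n. - int n))"
    by (rule summable_on_union)
  also have "range int \<union> range (\<lambda>n. - int n) = UNIV"
  proof -
    have "m \<in> range int \<union> range (\<lambda>n. - int n)" for m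
      by (cases m rule: int_cases2) auto
    thus ?thesis by blast
  qed
  finally show ?thesis .
qed

text \<open>Up to a constant, the norm of a lattice point dominates the Euclidean norm of its coordinates.\<close>
lemma lattice_bound:
  assumes "Im z > 0"
  obtains C where "C > 0" "\<And>m n. (of_int m)\<^sup>2 + (of_int n)\<^sup>2 \<le> C * (norm (of_int m * z + of_int n))\<^sup>2"
proof
  define C where "C = 2 + (2 * (Re z)\<^sup>2 + 1) / (Im z)\<^sup>2"
  show "C > 0" by (simp add: C_def add_pos_nonneg)
  fix m n :: int
  define u v where "u = (of_int m :: real)" "v = (of_int n :: real)"
  have "v\<^sup>2 \<le> 2 * (u * Re z + v)\<^sup>2 + 2 * (u * Re z)\<^sup>2"
    using zero_le_power2[of "v + 2 * (u * Re z)"] by (simp add: power2_eq_square algebra_simps)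
  hence "u\<^sup>2 + v\<^sup>2 \<le> 2 * (u * Re z + v)\<^sup>2 + (2 * (Re z)\<^sup>2 + 1) * u\<^sup>2"
    by (simp add: power_mult_distrib algebra_simps)
  also have "(2 * (Re z)\<^sup>2 + 1) * u\<^sup>2 = (2 * (Re z)\<^sup>2 + 1) / (Im z)\<^sup>2 * (u * Im z)\<^sup>2"
    using assms by (simp add: power_mult_distrib)
  also have "2 * (u * Re z + v)\<^sup>2 + \<dots> \<le> C * (u * Re z + v)\<^sup>2 + C * (u * Im z)\<^sup>2"
    by (intro add_mono mult_right_mono) (auto simp: C_def)
  also have "\<dots> = C * (norm (of_int m * z + of_int n))\<^sup>2"
    by (simp add: cmod_power2 u_v_def algebra_simps)
  finally show "(of_int m)\<^sup>2 + (of_int n)\<^sup>2 \<le> C * (norm (of_int m * z + of_int n))\<^sup>2"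
    by (simp add: u_v_def)
qed

lemma lattice_nonzero:
  assumes "Im z > 0" "(m, n) \<noteq> (0, 0)"
  shows "of_int m * z + of_int n \<noteq> 0"
  using assms by (auto simp: complex_eq_iff)

text \<open>The terms are bounded by a product of two one-dimensional convergent series.\<close>
lemma lattice_abs_summable:
  assumes z: "Im z > 0" and k: "even k" "k \<ge> 4"
  shows "(\<lambda>(m, n). norm (inverse ((of_int m * z + of_int n) ^ k))) summable_on (UNIV - {(0, 0)})"
proof -
  obtain C where C: "C > 0" "\<And>m n. (of_int m)\<^sup>2 + (of_int n)\<^sup>2 \<le> C * (norm (of_int m * z + of_int n))\<^sup>2"
    using lattice_bound[OF z] by metis
  obtain h where h: "k = 2 * (h + 2)"
  proof -
    from k(1) obtain l where "k = 2 * l" by auto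
    thus ?thesis using k(2) that[of "l - 2"] by simp
  qed
  define w where "w m = 1 / (1 + (of_int m)\<^sup>2 :: real)" for m :: int
  have "(\<lambda>(m, n). w m * w n) summable_on UNIV \<times> UNIV"
  proof (rule summable_on_SigmaI[where g = "\<lambda>m. w m * infsum w UNIV"])
    have "(w has_sum infsum w UNIV) UNIV"
      using summable_on_inverse_square_int unfolding w_def by simp
    thus "((\<lambda>n. case (m, n) of (m, n) \<Rightarrow> w m * w n) has_sum w m * infsum w UNIV) UNIV" for m
      by (simp add: has_sum_cmult_right)
    show "(\<lambda>m. w m * infsum w UNIV) summable_on UNIV"
      using summable_on_inverse_square_int unfolding w_def by (intro summable_on_cmult_left)
  qed (auto simp: w_def)
  hence "(\<lambda>x. (4 * C ^ (h + 2)) * (case x of (m, n) \<Rightarrow> w m * w n)) summable_on UNIV"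
    by (intro summable_on_cmult_right) simp
  hence sm: "(\<lambda>x. (4 * C ^ (h + 2)) * (case x of (m, n) \<Rightarrow> w m * w n)) summable_on (UNIV - {(0, 0)})"
    by (rule summable_on_subset_banach) auto
  show ?thesis
  proof (rule summable_on_comparison_test[OF sm])
    fix x :: "int \<times> int" assume x: "x \<in> UNIV - {(0, 0)}"
    obtain m n where mn: "x = (m, n)" by (cases x)
    define s where "s = ((of_int m)\<^sup>2 + (of_int n)\<^sup>2 :: real)"
    define d where "d = (norm (of_int m * z + of_int n))\<^sup>2"
    have d: "d > 0" using lattice_nonzero[OF z, of m n] x by (simp add: d_def mn)
    have sd: "s \<le> C * d" using C(2)[of m n] by (simp add: s_def d_def)
    have s1: "s \<ge> 1"
    proof -
      have "m\<^sup>2 + n\<^sup>2 > 0" using x mn by (auto simp: sum_power2_gt_zero_iff)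
      hence "m\<^sup>2 + n\<^sup>2 \<ge> 1" by simp
      hence "real_of_int (m\<^sup>2 + n\<^sup>2) \<ge> 1" by linarith
      thus ?thesis by (simp add: s_def)
    qed
    have "(1 + (of_int m)\<^sup>2) * (1 + (of_int n)\<^sup>2) \<le> (2 * s) * (2 * s)"
    proof (rule mult_mono)
      have aux: "1 + u \<le> 2 * (u + v)" if "1 \<le> u + v" "0 \<le> v" for u v :: real
        using that by simp
      show "1 + (of_int m)\<^sup>2 \<le> 2 * s" 
        using aux[of "(of_int m)\<^sup>2" "(of_int n)\<^sup>2"] s1 unfolding s_def by (simp add: add.commute)
      show "1 + (of_int n)\<^sup>2 \<le> 2 * s"
        using aux[of "(of_int n)\<^sup>2" "(of_int m)\<^sup>2"] s1 unfolding s_def by (simp add: add.commute)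
    qed (use s1 in auto)
    also have "\<dots> = 4 * s ^ 2" by (simp add: power2_eq_square)
    also have "\<dots> \<le> 4 * s ^ (h + 2)" using s1 by (intro mult_left_mono power_increasing) auto
    also have "\<dots> \<le> 4 * (C * d) ^ (h + 2)" using sd s1 by (intro mult_left_mono power_mono) auto
    finally have le: "(1 + (of_int m)\<^sup>2) * (1 + (of_int n)\<^sup>2) \<le> 4 * C ^ (h + 2) * d ^ (h + 2)"
      by (simp add: power_mult_distrib mult_ac)
    have "norm (inverse ((of_int m * z + of_int n) ^ k)) = 1 / d ^ (h + 2)"
      unfolding h d_def by (simp only: norm_inverse norm_power power_mult inverse_eq_divide norm_divide norm_one)
    also have "\<dots> \<le> 4 * C ^ (h + 2) * (w m * w n)"
    proof -
      have "1 + (real_of_int m)\<^sup>2 > 0" "1 + (real_of_int n)\<^sup>2 > 0" by (simp_all add: add_pos_nonneg)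
      thus ?thesis using le d by (simp add: w_def divide_simps)
    qed
    finally show "(case x of (m, n) \<Rightarrow> norm (inverse ((of_int m * z + of_int n) ^ k)))
            \<le> 4 * C ^ (h + 2) * (case x of (m, n) \<Rightarrow> w m * w n)"
      by (simp add: mn)
  qed auto
qed

lemma lattice_summable:
  assumes z: "Im z > 0" and k: "even k" "k \<ge> 4"
  shows "(\<lambda>(m, n). inverse ((of_int m * z + of_int n) ^ k)) summable_on (UNIV - {(0, 0)})"
  by (rule abs_summable_summable) (use lattice_abs_summable[OF assms] in \<open>simp add: case_prod_unfold\<close>)

lemma lattice_row_summable:
  assumes z: "Im z > 0" and k: "even k" "k \<ge> 4"
  shows "(\<lambda>n::int. inverse ((z + of_int n) ^ k)) summable_on UNIV"
proof -
  have "(\<lambda>(m, n). inverse ((of_int m * z + of_int n) ^ k)) summable_on (Pair 1 ` UNIV)"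
    by (rule summable_on_subset_banach[OF lattice_summable[OF assms]]) auto
  thus ?thesis by (subst (asm) summable_on_reindex) (auto simp: o_def inj_on_def)
qed

lemma lipschitz:
  assumes z: "Im z > 0" and k: "even k" "k \<ge> 4"
  shows "((\<lambda>r. (2 * of_real pi * \<i>) ^ k / fact (k - 1) * (of_nat r ^ (k - 1) * nome z ^ r)) has_sum
           infsum (\<lambda>n::int. inverse ((z + of_int n) ^ k)) UNIV) {1..}"
proof -
  define j where "j = k - 1"
  have kj: "k = Suc j" and j: "odd j" "j > 0" using k by (auto simp: j_def)
  note nz = upper_not_nonpos_Ints[OF z]
  define f where "f n = inverse ((z + of_int n) ^ k)" for n :: int
  have "f summable_on UNIV" using lattice_row_summable[OF assms] by (simp add: f_def[abs_def])
  hence sm: "f summable_on A" for A by (rule summable_on_subset_banach) auto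
  have pos: "infsum f {0..} = (\<Sum>n. inverse ((z + of_nat n) ^ k))"
  proof -
    have "(f has_sum infsum f {0..}) {0..}" using sm by simp
    also have "?this \<longleftrightarrow> ((\<lambda>n. inverse ((z + of_nat n) ^ k)) has_sum infsum f {0..}) UNIV"
      by (rule has_sum_reindex_bij_witness[of _ int nat]) (auto simp: f_def)
    finally show ?thesis using has_sum_imp_sums sums_unique by blast
  qed
  have neg: "infsum f {..-1} = (\<Sum>n. inverse ((1 - z + of_nat n) ^ k))"
  proof -
    have "(f has_sum infsum f {..-1}) {..-1}" using sm by simp
    also have "?this \<longleftrightarrow> ((\<lambda>n. inverse ((1 - z + of_nat n) ^ k)) has_sum infsum f {..-1}) UNIV"
    proof (rule has_sum_reindex_bij_witness[of _ "\<lambda>n. - 1 - int n" "\<lambda>m. nat (- 1 - m)"])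
      fix m :: int assume m: "m \<in> {..-1}"
      have "of_nat (nat (- 1 - m)) = (of_int (- 1 - m) :: complex)" using m by simp
      hence "1 - z + of_nat (nat (- 1 - m)) = - (z + of_int m)" by simp
      thus "inverse ((1 - z + of_nat (nat (- 1 - m))) ^ k) = f m" using k(1)
        by (simp only: f_def power_minus_even)
    qed auto
    finally show ?thesis using has_sum_imp_sums sums_unique by blast
  qed
  have "infsum f UNIV = infsum f ({0..} \<union> {..-1})"
    by (rule arg_cong[of _ _ "infsum f"]) auto
  also have "\<dots> = infsum f {0..} + infsum f {..-1}"
    by (intro infsum_Un_disjoint sm) auto
  also have "\<dots> = - (1 / fact j) * ((-1) ^ j * Polygamma j (1 - z) - Polygamma j z)"
    using j unfolding pos neg by (simp add: Polygamma_def kj field_simps)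
  also have "\<dots> = - (1 / fact j) * ((2 * of_real pi * \<i>) ^ j * (qderiv ^^ j) cot_q z)"
    by (simp only: polygamma_reflection[OF z])
  finally have tot: "infsum f UNIV = - (1 / fact j) * ((2 * of_real pi * \<i>) ^ j * (qderiv ^^ j) cot_q z)" .
  obtain F where F: "qexp cot_q F" "fls_nth F = (\<lambda>m. if m = 0 then - of_real pi * \<i> else if m < 0 then 0 else - 2 * of_real pi * \<i>)"
    by (rule cot_q_expansion)
  obtain G where G: "qexp ((qderiv ^^ j) cot_q) G" "\<And>m. fls_nth G m = of_int m ^ j * fls_nth F m"
    using qexp_qderiv_funpow[OF F(1)] by blast
  have "((\<lambda>m. fls_nth G m * nome z powi m) has_sum (qderiv ^^ j) cot_q z) UNIV"
    using qexp_has_fourier[OF G(1)] z by (simp add: has_fourier_def nome_def)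
  also have "?this \<longleftrightarrow> ((\<lambda>m. fls_nth G m * nome z powi m) has_sum (qderiv ^^ j) cot_q z) {1..}"
    using j by (intro has_sum_cong_neutral) (auto simp: G(2) F(2))
  also have "\<dots> \<longleftrightarrow> ((\<lambda>r. fls_nth G (int r) * nome z ^ r) has_sum (qderiv ^^ j) cot_q z) {1..}"
    by (rule has_sum_reindex_bij_witness[of _ int nat]) (auto simp: power_int_def)
  finally have "((\<lambda>r. - (1 / fact j) * (2 * of_real pi * \<i>) ^ j * (fls_nth G (int r) * nome z ^ r)) has_sum
                  (- (1 / fact j) * (2 * of_real pi * \<i>) ^ j * (qderiv ^^ j) cot_q z)) {1..}"
    by (rule has_sum_cmult_right)
  also have "- (1 / fact j) * (2 * of_real pi * \<i>) ^ j * (qderiv ^^ j) cot_q z = infsum f UNIV"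
    unfolding tot by simp
  also have "((\<lambda>r. - (1 / fact j) * (2 * of_real pi * \<i>) ^ j * (fls_nth G (int r) * nome z ^ r)) has_sum infsum f UNIV) {1..}
     \<longleftrightarrow> ((\<lambda>r. (2 * of_real pi * \<i>) ^ k / fact (k - 1) * (of_nat r ^ (k - 1) * nome z ^ r)) has_sum infsum f UNIV) {1..}"
    by (intro has_sum_cong) (auto simp: G(2) F(2) kj field_simps)
  finally show ?thesis by (simp add: f_def[abs_def])
qed

definition lattice_sum :: "nat \<Rightarrow> complex \<Rightarrow> complex" where
  "lattice_sum k z = infsum (\<lambda>(m, n). inverse ((of_int m * z + of_int n) ^ k)) (UNIV - {(0, 0)} :: (int \<times> int) set)"

text \<open>Integer matrices of determinant 1 permute the lattice points.\<close>
lemma lattice_sum_modular: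
  assumes z: "Im z > 0" and \<gamma>: "\<gamma> \<in> SL2Z"
  shows "lattice_sum k (moebius \<gamma> z) = autfac \<gamma> z ^ k * lattice_sum k z"
proof -
  define a b c d where "a = \<gamma> $ 1 $ 1" "b = \<gamma> $ 1 $ 2" "c = \<gamma> $ 2 $ 1" "d = \<gamma> $ 2 $ 2"
  have det: "a * d - b * c = 1" using \<gamma> by (simp add: SL2Z_def det_2 a_b_c_d_def)
  have nz: "autfac \<gamma> z \<noteq> 0" by (rule autfac_nonzero_SL2[OF \<gamma> z])
  let ?f = "\<lambda>(m, n). inverse ((of_int m * z + of_int n) ^ k)"
  have term_eq: "inverse ((of_int m * moebius \<gamma> z + of_int n) ^ k) =
        autfac \<gamma> z ^ k * inverse ((of_int (m * a + n * c) * z + of_int (m * b + n * d)) ^ k)" for m n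
  proof -
    have "moebius \<gamma> z = (of_int a * z + of_int b) / autfac \<gamma> z"
      by (simp add: moebius_def autfac_def a_b_c_d_def)
    hence "of_int m * moebius \<gamma> z + of_int n = (of_int m * (of_int a * z + of_int b) + of_int n * autfac \<gamma> z) / autfac \<gamma> z"
      using nz by (simp add: field_simps)
    also have "of_int m * (of_int a * z + of_int b) + of_int n * autfac \<gamma> z =
          of_int (m * a + n * c) * z + of_int (m * b + n * d)"
      by (simp add: autfac_def a_b_c_d_def algebra_simps)
    finally show ?thesis by (simp only: power_divide inverse_divide) (simp only: divide_inverse)
  qed
  have "lattice_sum k (moebius \<gamma> z) = (\<Sum>\<^sub>\<infinity>x\<in>UNIV - {(0, 0)}. autfac \<gamma> z ^ k * ?f x)"
    unfolding lattice_sum_def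
  proof (rule infsum_reindex_bij_witness[of _ "\<lambda>(m, n). (m * d - n * c, n * a - m * b)" "\<lambda>(m, n). (m * a + n * c, m * b + n * d)"])
    fix x :: "int \<times> int" assume "x \<in> UNIV - {(0, 0)}"
    obtain m n where x: "x = (m, n)" by (cases x)
    have 1: "(m * a + n * c) * d - (m * b + n * d) * c = m" "(m * b + n * d) * a - (m * a + n * c) * b = n"
      using det by algebra+
    have 2: "(m * d - n * c) * a + (n * a - m * b) * c = m" "(m * d - n * c) * b + (n * a - m * b) * d = n"
      using det by algebra+
    show "(case case x of (m, n) \<Rightarrow> (m * a + n * c, m * b + n * d) of (m, n) \<Rightarrow> (m * d - n * c, n * a - m * b)) = x"
         "(case case x of (m, n) \<Rightarrow> (m * d - n * c, n * a - m * b) of (m, n) \<Rightarrow> (m * a + n * c, m * b + n * d)) = x"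
      using 1 2 by (simp_all add: x)
    have "(m * a + n * c, m * b + n * d) \<noteq> (0, 0)" if "(m, n) \<noteq> (0, 0)"
      using 1 that by (metis diff_0_right mult_zero_left prod.inject)
    moreover have "(m * d - n * c, n * a - m * b) \<noteq> (0, 0)" if "(m, n) \<noteq> (0, 0)"
      using 2 that by (metis add_0 mult_zero_left prod.inject)
    ultimately show "(case x of (m, n) \<Rightarrow> (m * a + n * c, m * b + n * d)) \<in> UNIV - {(0, 0)}"
      "(case x of (m, n) \<Rightarrow> (m * d - n * c, n * a - m * b)) \<in> UNIV - {(0, 0)}"
      using \<open>x \<in> UNIV - {(0, 0)}\<close> by (simp_all add: x)
    show "autfac \<gamma> z ^ k * ?f (case x of (m, n) \<Rightarrow> (m * a + n * c, m * b + n * d)) =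
       (case x of (m, n) \<Rightarrow> inverse ((of_int m * moebius \<gamma> z + of_int n) ^ k))"
      by (simp add: x term_eq)
  qed
  also have "\<dots> = autfac \<gamma> z ^ k * lattice_sum k z"
    unfolding lattice_sum_def by (rule infsum_cmult_right')
  finally show ?thesis .
qed

definition divisor_sum :: "nat \<Rightarrow> nat \<Rightarrow> nat" where
  "divisor_sum k N = (\<Sum>d | d dvd N. d ^ k)"

text \<open>The series are the derivatives of the geometric series in q, which has a Fourier expansion.\<close>
lemma summable_power_times_geometric:
  fixes q :: complex
  assumes q: "norm q < 1" "q \<noteq> 0"
  shows "(\<lambda>r. real r ^ j * norm q ^ r) summable_on {1..}"
proof -
  obtain z where z: "Im z > 0" "nome z = q" using nome_surj q by blast
  obtain F where F: "qexp cot_q F" "fls_nth F = (\<lambda>m. if m = 0 then - of_real pi * \<i> else if m < 0 then 0 else - 2 * of_real pi * \<i>)"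
    by (rule cot_q_expansion)
  obtain G where G: "qexp ((qderiv ^^ j) cot_q) G" "\<And>m. fls_nth G m = of_int m ^ j * fls_nth F m"
    using qexp_qderiv_funpow[OF F(1)] by blast
  have "(\<lambda>m. fls_nth G m * q powi m) summable_on UNIV"
    using qexp_has_fourier[OF G(1)] z unfolding has_fourier_def nome_def[symmetric] summable_on_def by blast
  hence "(\<lambda>m. norm (fls_nth G m * q powi m)) summable_on UNIV"
    by (rule summable_on_iff_abs_summable_on_complex[THEN iffD1])
  hence "(\<lambda>m. norm (fls_nth G m * q powi m)) summable_on (int ` {1..})"
    by (rule summable_on_subset_banach) auto
  hence "(\<lambda>r. norm (fls_nth G (int r) * q ^ r)) summable_on {1..}"
    by (subst (asm) summable_on_reindex) (auto simp: o_def)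
  also have "?this \<longleftrightarrow> (\<lambda>r. (2 * pi) * (real r ^ j * norm q ^ r)) summable_on {1..}"
    by (intro summable_on_cong) (auto simp: G(2) F(2) norm_mult norm_power)
  finally have "(\<lambda>r. (1 / (2 * pi)) * ((2 * pi) * (real r ^ j * norm q ^ r))) summable_on {1..}"
    by (rule summable_on_cmult_right)
  thus ?thesis by simp
qed

text \<open>Both claims are ways to sum the family \<open>r\<^sup>j q\<^sup>m\<^sup>r\<close>: by the product \<open>m r\<close> and by rows.\<close>
lemma divisor_sum_series:
  fixes q :: complex
  assumes q: "norm q < 1" and q0: "q \<noteq> 0"
  obtains T where "((\<lambda>N. of_nat (divisor_sum j N) * q ^ N) has_sum T) {1..}"
    "\<And>A. (\<And>m. m \<ge> 1 \<Longrightarrow> ((\<lambda>r. of_nat r ^ j * (q ^ m) ^ r) has_sum A m) {1..}) \<Longrightarrow> (A has_sum T) {1..}"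
proof -
  define f where "f = (\<lambda>(m::nat, r::nat). of_nat r ^ j * (q ^ m) ^ r)"
  have s1: "(\<lambda>r. norm q ^ r) summable_on {1..}"
    using has_sum_geometric_from_1[of "norm q"] q by (auto simp: summable_on_def)
  have s2: "(\<lambda>r. real r ^ j * norm q ^ r) summable_on {1..}"
    by (rule summable_power_times_geometric[OF q q0])
  obtain B where B: "((\<lambda>r. real r ^ j * norm q ^ r) has_sum B) {1..}"
    using s2 by (auto simp: summable_on_def)
  have sm: "(\<lambda>(m, r). (norm q ^ m / norm q) * (real r ^ j * norm q ^ r)) summable_on {1..} \<times> {1..}"
    proof (rule summable_on_SigmaI[where g = "\<lambda>m. (norm q ^ m / norm q) * B"])
      show "((\<lambda>y. case (m, y) of (m, r) \<Rightarrow> (norm q ^ m / norm q) * (real r ^ j * norm q ^ r)) has_sum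
              (norm q ^ m / norm q) * B) {1..}" for m
        using has_sum_cmult_right[OF B, of "norm q ^ m / norm q"] by simp
      show "(\<lambda>m. (norm q ^ m / norm q) * B) summable_on {1..}"
        using s1 unfolding divide_inverse by (intro summable_on_cmult_left)
    qed auto
  have "(\<lambda>x. norm (f x)) summable_on {1..} \<times> {1..}"
  proof (rule summable_on_comparison_test[OF sm])
    fix x :: "nat \<times> nat" assume x: "x \<in> {1..} \<times> {1..}"
    obtain m r where mr: "x = (m, r)" by (cases x)
    have "m + r \<le> m * r + 1"
    proof -
      have "(m - 1) * (r - 1) \<ge> 0" by simp
      moreover obtain m' r' where "m = Suc m'" "r = Suc r'" using x mr by (cases m; cases r) auto
      ultimately show ?thesis by simp
    qed
    hence "norm q ^ (m * r + 1) \<le> norm q ^ (m + r)"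
      using q by (intro power_decreasing) auto
    hence "norm q ^ (m * r) \<le> norm q ^ m * norm q ^ r / norm q"
      using q0 by (simp add: field_simps power_add)
    hence "real r ^ j * norm q ^ (m * r) \<le> real r ^ j * (norm q ^ m * norm q ^ r / norm q)"
      by (rule mult_left_mono) simp
    moreover have "norm (f x) = real r ^ j * norm q ^ (m * r)"
      by (simp add: mr f_def norm_mult norm_power power_mult)
    ultimately show "norm (f x) \<le> (case x of (m, r) \<Rightarrow> (norm q ^ m / norm q) * (real r ^ j * norm q ^ r))"
      by (simp add: mr mult_ac)
  qed auto
  hence "f summable_on {1..} \<times> {1..}" by (rule abs_summable_summable)
  then obtain T where T: "(f has_sum T) ({1..} \<times> {1..})" by (auto simp: summable_on_def)
  have "(f has_sum T) ({1..} \<times> {1..}) \<longleftrightarrow>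
        ((\<lambda>(N, d). of_nat d ^ j * q ^ N) has_sum T) (SIGMA N:{1..}. {d. d dvd N})"
    by (rule has_sum_reindex_bij_witness[of _ "\<lambda>(N, d). (N div d, d)" "\<lambda>(m, r). (m * r, r)"])
       (auto simp: f_def power_mult Suc_le_eq intro: Nat.gr0I)
  with T have "((\<lambda>(N, d). of_nat d ^ j * q ^ N) has_sum T) (SIGMA N:{1..}. {d. d dvd N})" by simp
  hence "((\<lambda>N. of_nat (divisor_sum j N) * q ^ N) has_sum T) {1..}"
  proof (rule has_sum_SigmaD)
    fix N :: nat assume "N \<in> {1..}"
    hence "finite {d. d dvd N}" by (intro finite_divisors_nat) auto
    thus "((\<lambda>d. case (N, d) of (N, d) \<Rightarrow> of_nat d ^ j * q ^ N) has_sum of_nat (divisor_sum j N) * q ^ N) {d. d dvd N}"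
      by (intro has_sum_finiteI) (simp_all add: divisor_sum_def sum_distrib_right)
  qed
  moreover have "(A has_sum T) {1..}"
    if "\<And>m. m \<ge> 1 \<Longrightarrow> ((\<lambda>r. of_nat r ^ j * (q ^ m) ^ r) has_sum A m) {1..}" for A
    by (rule has_sum_SigmaD[OF T]) (use that in \<open>simp add: f_def\<close>)
  ultimately show ?thesis using that by blast
qed

text \<open>Row by row, the Lipschitz formula turns the lattice sum into a Fourier series. The constant term is
  a sum over nonzero integers of positive numbers, so it can be used for normalization.\<close>
lemma lattice_sum_expansion:
  assumes k: "even k" "k \<ge> 4"
  obtains c F where "qexp (lattice_sum k) F" "c \<noteq> 0" "fls_nth F 0 \<noteq> 0"
    "\<And>m. m < 0 \<Longrightarrow> fls_nth F m = 0" "\<And>N. N \<ge> 1 \<Longrightarrow> fls_nth F (int N) = c * of_nat (divisor_sum (k - 1) N)"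
proof -
  define A where "A = (2 * of_real pi * \<i>) ^ k / fact (k - 1)"
  define Z where "Z = infsum (\<lambda>n::int. inverse (of_int n ^ k) :: complex) (- {0})"
  define a where "a m = (if m < 0 then 0 else if m = 0 then Z else 2 * A * of_nat (divisor_sum (k - 1) (nat m)))" for m :: int
  have "has_fourier (lattice_sum k) a"
    unfolding has_fourier_def nome_def[symmetric]
  proof (intro allI impI)
    fix z :: complex assume z: "Im z > 0"
    let ?f = "\<lambda>(m, n). inverse ((of_int m * z + of_int n) ^ k)"
    define L where "L m = infsum (\<lambda>n::int. inverse ((of_int m * z + of_int n) ^ k)) UNIV" for m :: int
    have sm: "?f summable_on X" if "X \<subseteq> UNIV - {(0, 0)}" for X
      by (rule summable_on_subset_banach[OF lattice_summable[OF z k] that])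
    have "(?f has_sum infsum ?f ((- {0}) \<times> UNIV)) ((- {0}) \<times> UNIV)"
      by (intro has_sum_infsum sm) auto
    hence L: "(L has_sum infsum ?f ((- {0}) \<times> UNIV)) (- {0})"
    proof (rule has_sum_SigmaD)
      fix m :: int assume m: "m \<in> - {0}"
      have "?f summable_on (Pair m ` UNIV)" by (rule sm) (use m in auto)
      hence "(\<lambda>n. inverse ((of_int m * z + of_int n) ^ k)) summable_on UNIV"
        by (subst (asm) summable_on_reindex) (auto simp: o_def inj_on_def)
      thus "((\<lambda>n. case (m, n) of (m, n) \<Rightarrow> inverse ((of_int m * z + of_int n) ^ k)) has_sum L m) UNIV"
        unfolding L_def by simp
    qed
    have Lneg: "L (- m) = L m" for m
      unfolding L_def
    proof (rule infsum_reindex_bij_witness[of _ uminus uminus])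
      fix n :: int
      have "of_int m * z + of_int (- n) = - (of_int (- m) * z + of_int n)" by simp
      thus "inverse ((of_int m * z + of_int (- n)) ^ k) = inverse ((of_int (- m) * z + of_int n) ^ k)"
        by (simp only: power_minus_even[OF k(1)])
    qed auto
    have q: "norm (nome z) < 1" by (rule norm_nome_less_1[OF z])
    obtain T where T: "((\<lambda>N. of_nat (divisor_sum (k - 1) N) * nome z ^ N) has_sum T) {1..}"
      "\<And>B. (\<And>m. m \<ge> 1 \<Longrightarrow> ((\<lambda>r. of_nat r ^ (k - 1) * (nome z ^ m) ^ r) has_sum B m) {1..}) \<Longrightarrow> (B has_sum T) {1..}"
      using divisor_sum_series[OF q, of "k - 1"] by auto
    have A0: "A \<noteq> 0" by (simp add: A_def)
    have "((\<lambda>m. L (int m) / A) has_sum T) {1..}"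
    proof (rule T(2))
      fix m :: nat assume m: "m \<ge> 1"
      have "Im (of_nat m * z) > 0" using m z by simp
      from lipschitz[OF this k] have "((\<lambda>r. A * (of_nat r ^ (k - 1) * nome (of_nat m * z) ^ r)) has_sum L (int m)) {1..}"
        by (simp add: A_def L_def)
      hence "((\<lambda>r. 1 / A * (A * (of_nat r ^ (k - 1) * nome (of_nat m * z) ^ r))) has_sum 1 / A * L (int m)) {1..}"
        by (rule has_sum_cmult_right)
      thus "((\<lambda>r. of_nat r ^ (k - 1) * (nome z ^ m) ^ r) has_sum L (int m) / A) {1..}"
        using A0 by (simp add: nome_power)
    qed
    from has_sum_cmult_right[OF this, of A] have Lpos: "((\<lambda>m. L (int m)) has_sum A * T) {1..}"
      using A0 by simp
    have "((\<lambda>m. L (int m)) has_sum A * T) {1..} \<longleftrightarrow> (L has_sum A * T) {1..}"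
      by (rule has_sum_reindex_bij_witness[of _ nat int]) auto
    hence "(L has_sum A * T) {1..}" using Lpos by simp
    moreover have "((\<lambda>m. L (int m)) has_sum A * T) {1..} \<longleftrightarrow> (L has_sum A * T) {..-1}"
      by (rule has_sum_reindex_bij_witness[of _ "\<lambda>m. nat (- m)" "\<lambda>m. - int m"]) (auto simp: Lneg)
    hence "(L has_sum A * T) {..-1}" using Lpos by simp
    ultimately have "(L has_sum (A * T + A * T)) ({1..} \<union> {..-1})"
      by (intro has_sum_Un_disjoint) auto
    also have "{1..} \<union> {..-1} = - {0::int}" by auto
    finally have "infsum ?f ((- {0}) \<times> UNIV) = 2 * A * T"
      using L has_sum_unique by fastforce
    moreover have "infsum ?f ({0} \<times> (- {0})) = Z"
      unfolding Z_def by (rule infsum_reindex_bij_witness[of _ "\<lambda>n. (0, n)" snd]) auto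
    moreover have "lattice_sum k z = infsum ?f ({0} \<times> (- {0})) + infsum ?f ((- {0}) \<times> UNIV)"
    proof -
      have "lattice_sum k z = infsum ?f (({0} \<times> (- {0})) \<union> ((- {0}) \<times> UNIV))"
        unfolding lattice_sum_def by (rule arg_cong[of _ _ "infsum ?f"]) auto
      also have "\<dots> = infsum ?f ({0} \<times> (- {0})) + infsum ?f ((- {0}) \<times> UNIV)"
        by (intro infsum_Un_disjoint sm) auto
      finally show ?thesis .
    qed
    ultimately have G: "lattice_sum k z = Z + 2 * A * T" by simp
    have "((\<lambda>N. 2 * A * (of_nat (divisor_sum (k - 1) N) * nome z ^ N)) has_sum 2 * A * T) {1..}"
      by (rule has_sum_cmult_right[OF T(1)])
    also have "?this \<longleftrightarrow> ((\<lambda>m. a m * nome z powi m) has_sum 2 * A * T) {1..}"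
      by (rule has_sum_reindex_bij_witness[of _ nat int]) (auto simp: a_def power_int_def)
    finally have "((\<lambda>m. a m * nome z powi m) has_sum (a 0 * nome z powi 0 + 2 * A * T)) (insert 0 {1..})"
      by (intro has_sum_insert) auto
    also have "a 0 * nome z powi 0 + 2 * A * T = lattice_sum k z" by (simp add: G a_def)
    also have "((\<lambda>m. a m * nome z powi m) has_sum lattice_sum k z) (insert 0 {1..}) \<longleftrightarrow>
       ((\<lambda>m. a m * nome z powi m) has_sum lattice_sum k z) UNIV"
      by (intro has_sum_cong_neutral) (auto simp: a_def)
    finally show "((\<lambda>m. a m * nome z powi m) has_sum lattice_sum k z) UNIV" .
  qed
  moreover have "finite {m. m < 0 \<and> a m \<noteq> 0}" by (auto simp: a_def)
  ultimately obtain F where F: "qexp (lattice_sum k) F" "fls_nth F = a"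
    using has_fourier_qexp by metis
  have "Z \<noteq> 0"
  proof -
    define h where "h n = inverse (real_of_int n ^ k)" for n :: int
    have "(\<lambda>(m, n). inverse ((of_int m * \<i> + of_int n) ^ k)) summable_on (Pair 0 ` (- {0}))"
      by (rule summable_on_subset_banach[OF lattice_summable[of \<i>, OF _ k]]) auto
    hence "(\<lambda>n::int. inverse (of_int n ^ k) :: complex) summable_on (- {0})"
      by (subst (asm) summable_on_reindex) (auto simp: o_def inj_on_def)
    hence Zs: "((\<lambda>n::int. inverse (of_int n ^ k) :: complex) has_sum Z) (- {0})"
      by (simp add: Z_def)
    from has_sum_Re[OF this] have hs: "(h has_sum Re Z) (- {0})"
    proof (rule has_sum_cong[THEN iffD1, rotated])
      fix n :: int
      have "inverse (of_int n ^ k) = complex_of_real (h n)" by (simp add: h_def)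
      thus "Re (inverse (of_int n ^ k)) = h n" by (metis Re_complex_of_real)
    qed
    have "sum h {1} \<le> Re Z"
      by (rule finite_sum_le_has_sum[OF hs]) (use k in \<open>auto simp: h_def zero_le_even_power\<close>)
    hence "1 \<le> Re Z" by (simp add: h_def)
    thus ?thesis by auto
  qed
  thus ?thesis
    using that[OF F(1), of "2 * A"] by (simp add: F(2) a_def A_def)
qed

text \<open>The normalized Eisenstein series of even weight at least 4.\<close>
definition eisenstein :: "nat \<Rightarrow> complex \<Rightarrow> complex" where
  "eisenstein k z = lattice_sum k z / fourier_coeff (lattice_sum k) 0"

lemma eisenstein_expansion:
  assumes k: "even k" "k \<ge> 4"
  obtains c f where "modform (int k) (eisenstein k) (fps_to_fls f)" "c \<noteq> 0" "fps_nth f 0 = 1"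
    "\<And>N. N \<ge> 1 \<Longrightarrow> fps_nth f N = c * of_nat (divisor_sum (k - 1) N)"
proof -
  obtain c F where F: "qexp (lattice_sum k) F" "c \<noteq> 0" "fls_nth F 0 \<noteq> 0"
    "\<And>m. m < 0 \<Longrightarrow> fls_nth F m = 0" "\<And>N. N \<ge> 1 \<Longrightarrow> fls_nth F (int N) = c * of_nat (divisor_sum (k - 1) N)"
    by (rule lattice_sum_expansion[OF k], rule that)
  define r where "r = 1 / fls_nth F 0"
  define f where "f = fls_regpart (fls_const r * F)"
  have eisenstein: "eisenstein k z = r * lattice_sum k z" for z
    by (simp add: eisenstein_def r_def fourier_coeff_qexp[OF F(1)])
  have "modform (int k) (lattice_sum k) F"
    unfolding modform_def using F(1) lattice_sum_modular by simp
  hence "modform (int k) (eisenstein k) (fls_const r * F)"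
    unfolding eisenstein[abs_def] by (rule modform_cmult)
  moreover have "fls_const r * F = fps_to_fls f"
    unfolding f_def using F(4) by (intro fls_eqI) auto
  ultimately show ?thesis
    using that[of f "r * c"] F by (auto simp: f_def r_def mult_ac)
qed

text \<open>The same expansion for weights written as numerals.\<close>
lemma eisenstein_expansion':
  assumes k: "even k" "k \<ge> 4" and l: "l = int k" and j: "j = k - 1"
  shows "\<exists>c f. modform l (eisenstein k) (fps_to_fls f) \<and> c \<noteq> 0 \<and> fps_nth f 0 = 1 \<and>
    (\<forall>N\<ge>1. fps_nth f N = c * of_nat (divisor_sum j N))"
  using eisenstein_expansion[OF k] unfolding l j by metis

lemma divisor_sum_1 [simp]: "divisor_sum j (Suc 0) = 1"
  by (simp add: divisor_sum_def)

lemma divisor_sum_2: "divisor_sum j 2 = 1 + 2 ^ j"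
proof -
  have "{d::nat. d dvd 2} = {1, 2}"
    using two_is_prime_nat by (auto simp: prime_nat_iff)
  thus ?thesis by (simp add: divisor_sum_def)
qed

text \<open>The coefficients \<open>240\<close> and \<open>-504\<close> come out of the identities \<open>E\<^sub>4\<^sup>2 = E\<^sub>8\<close> and
  \<open>E\<^sub>4 E\<^sub>6 = E\<^sub>1\<^sub>0\<close>, compared at \<open>q\<close> and \<open>q\<^sup>2\<close>.\<close>
lemma eisenstein_4_6:
  obtains f g where "modform 4 (eisenstein 4) (fps_to_fls f)" "modform 6 (eisenstein 6) (fps_to_fls g)"
    "fps_nth f 0 = 1" "fps_nth g 0 = 1" "fps_nth f 1 = 240" "fps_nth g 1 = -504"
    "\<And>N. fps_nth f N \<in> \<rat>" "\<And>N. fps_nth g N \<in> \<rat>"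
proof -
  obtain c4 f4 where f4: "modform 4 (eisenstein 4) (fps_to_fls f4)" "c4 \<noteq> 0" "fps_nth f4 0 = 1"
    "\<forall>N\<ge>1. fps_nth f4 N = c4 * of_nat (divisor_sum 3 N)"
    using eisenstein_expansion'[of 4 4 3] by (auto simp del: One_nat_def)
  obtain c6 f6 where f6: "modform 6 (eisenstein 6) (fps_to_fls f6)" "c6 \<noteq> 0" "fps_nth f6 0 = 1"
    "\<forall>N\<ge>1. fps_nth f6 N = c6 * of_nat (divisor_sum 5 N)"
    using eisenstein_expansion'[of 6 6 5] by (auto simp del: One_nat_def)
  obtain c8 f8 where f8: "modform 8 (eisenstein 8) (fps_to_fls f8)" "c8 \<noteq> 0" "fps_nth f8 0 = 1"
    "\<forall>N\<ge>1. fps_nth f8 N = c8 * of_nat (divisor_sum 7 N)"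
    using eisenstein_expansion'[of 8 8 7] by (auto simp del: One_nat_def)
  obtain c10 f10 where f10: "modform 10 (eisenstein 10) (fps_to_fls f10)" "c10 \<noteq> 0" "fps_nth f10 0 = 1"
    "\<forall>N\<ge>1. fps_nth f10 N = c10 * of_nat (divisor_sum 9 N)"
    using eisenstein_expansion'[of 10 10 9] by (auto simp del: One_nat_def)
  have eq: "f * g = h" if "modform k u (fps_to_fls f)" "modform l v (fps_to_fls g)" "modform (k + l) w (fps_to_fls h)"
    "k + l \<le> 10" "fps_nth f 0 = 1" "fps_nth g 0 = 1" "fps_nth h 0 = 1" for k l u v w and f g h :: "complex fps"
  proof -
    have m: "modform (k + l) (\<lambda>z. u z * v z - w z) (fps_to_fls f * fps_to_fls g - fps_to_fls h)"
      by (intro modform_diff modform_mult that)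
    have "u z * v z - w z = 0" if "Im z > 0" for z
      using \<open>k + l \<le> 10\<close> that
      by (intro sturm_bound[OF m, of 1]) (auto simp: \<open>fps_nth f 0 = 1\<close> \<open>fps_nth g 0 = 1\<close> \<open>fps_nth h 0 = 1\<close>
           simp flip: fls_times_fps_to_fls)
    hence "fps_to_fls f * fps_to_fls g - fps_to_fls h = 0"
      by (rule qexp_zero_imp[OF modform_qexp[OF m]])
    hence "fps_to_fls (f * g) = fps_to_fls h" by (simp add: fls_times_fps_to_fls)
    thus ?thesis by (simp only: fps_to_fls_eq_iff)
  qed
  have e1: "f4 * f4 = f8" by (rule eq[OF f4(1) f4(1)]) (use f4 f8 in auto)
  have e2: "f4 * f6 = f10" by (rule eq[OF f4(1) f6(1)]) (use f4 f6 f10 in auto)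
  have c1: "fps_nth (u * v) 1 = fps_nth u 0 * fps_nth v 1 + fps_nth u 1 * fps_nth v 0" for u v :: "complex fps"
    by (simp add: fps_mult_nth)
  have c2: "fps_nth (u * v) 2 = fps_nth u 0 * fps_nth v 2 + fps_nth u 1 * fps_nth v 1 + fps_nth u 2 * fps_nth v 0" for u v :: "complex fps"
    by (simp add: fps_mult_nth numeral_2_eq_2)
  have a1: "2 * c4 = c8" using c1[of f4 f4] f4 f8 by (simp add: e1)
  have a2: "18 * c4 + c4 * c4 = c8 * 129" using c2[of f4 f4] f4 f8 by (simp add: e1 divisor_sum_2)
  have "c4 * (c4 - 240) = (18 * c4 + c4 * c4) - 129 * (2 * c4)" by (simp add: algebra_simps)
  also have "\<dots> = 0" unfolding a1 a2 by simp
  finally have "c4 * (c4 - 240) = 0" .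
  hence c4: "c4 = 240" using f4(2) by simp
  have b1: "c4 + c6 = c10" using c1[of f4 f6] f4 f6 f10 by (simp add: e2)
  have b2: "33 * c6 + c4 * c6 + 9 * c4 = c10 * 513" using c2[of f4 f6] f4 f6 f10 by (simp add: e2 divisor_sum_2 mult_ac add_ac)
  have "240 * (c6 + 504) = 513 * (c4 + c6) - (33 * c6 + c4 * c6 + 9 * c4)" by (simp add: c4)
  also have "\<dots> = 0" unfolding b1 b2 by simp
  finally have "240 * (c6 + 504) = 0" .
  hence "c6 + 504 = 0" unfolding mult_eq_0_iff by auto
  hence c6: "c6 = -504" by (simp only: eq_neg_iff_add_eq_0)
  have r: "fps_nth f4 N \<in> \<rat>" "fps_nth f6 N \<in> \<rat>" for N
    using f4(3,4) f6(3,4) c4 c6 by (cases "N = 0"; simp)+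
  show ?thesis
    by (rule that[OF f4(1) f6(1) f4(3) f6(3) _ _ r]) (use f4(4) f6(4) c4 c6 in auto)
qed

section \<open>The discriminant has no zeros\<close>

definition Delta :: "complex \<Rightarrow> complex" where
  "Delta z = (eisenstein 4 z ^ 3 - eisenstein 6 z ^ 2) / 1728"

lemma Delta_expansion:
  obtains f where "modform 12 Delta (fps_to_fls f)" "fps_nth f 0 = 0" "fps_nth f 1 = 1" "\<And>N. fps_nth f N \<in> \<rat>"
proof -
  obtain f g where fg: "modform 4 (eisenstein 4) (fps_to_fls f)" "modform 6 (eisenstein 6) (fps_to_fls g)"
    "fps_nth f 0 = 1" "fps_nth g 0 = 1" "fps_nth f 1 = 240" "fps_nth g 1 = -504"
    "\<And>N. fps_nth f N \<in> \<rat>" "\<And>N. fps_nth g N \<in> \<rat>"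
    by (rule eisenstein_4_6, rule that)
  define d where "d = fps_const (1 / 1728) * (f ^ 3 - g ^ 2)"
  have "modform 12 (\<lambda>z. eisenstein 4 z ^ 3) (fps_to_fls f ^ 3)" using modform_power[OF fg(1), of 3] by simp
  moreover have "modform 12 (\<lambda>z. eisenstein 6 z ^ 2) (fps_to_fls g ^ 2)" using modform_power[OF fg(2), of 2] by simp
  ultimately have "modform 12 (\<lambda>z. (1 / 1728) * (eisenstein 4 z ^ 3 - eisenstein 6 z ^ 2))
      (fls_const (1 / 1728) * (fps_to_fls f ^ 3 - fps_to_fls g ^ 2))"
    by (intro modform_cmult modform_diff)
  also have "fls_const (1 / 1728) * (fps_to_fls f ^ 3 - fps_to_fls g ^ 2) = fps_to_fls d"
    by (simp add: d_def fls_times_fps_to_fls fps_to_fls_power fps_const_to_fls)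
  also have "(\<lambda>z. (1 / 1728) * (eisenstein 4 z ^ 3 - eisenstein 6 z ^ 2)) = Delta" by (simp add: Delta_def fun_eq_iff)
  finally have "modform 12 Delta (fps_to_fls d)" .
  moreover have "fps_nth d 0 = 0" "fps_nth d 1 = 1"
    using fg by (simp_all add: d_def power2_eq_square power3_eq_cube fps_mult_nth algebra_simps)
  moreover have "fps_nth d N \<in> \<rat>" for N
  proof -
    have m: "fps_nth (u * v) N \<in> \<rat>" if "\<And>N. fps_nth u N \<in> \<rat>" "\<And>N. fps_nth v N \<in> \<rat>" for u v :: "complex fps" and N
      using that by (auto simp: fps_mult_nth intro!: Rats_sum)
    show ?thesis unfolding d_def power2_eq_square power3_eq_cube
      by (intro m) (auto intro!: m Rats_diff fg simp: fps_const_def)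
  qed
  ultimately show ?thesis using that by blast
qed

text \<open>The second Rankin--Cohen bracket: the factor \<open>13/12\<close> cancels the contributions of the lower left
  matrix entry in the transformation of the two derivatives.\<close>
lemma rankin_cohen_modular:
  assumes g: "modform 12 g G" and z: "Im z > 0" and \<gamma>: "\<gamma> \<in> SL2Z"
  defines "R \<equiv> \<lambda>z. g z * qderiv (qderiv g) z - 13 / 12 * (qderiv g z)\<^sup>2"
  shows "R (moebius \<gamma> z) = autfac \<gamma> z ^ 28 * R z"
proof -
  define p where "p = 2 * of_real pi * \<i>"
  have p0: "p \<noteq> 0" by (simp add: p_def)
  define c where "c = (of_int (\<gamma> $ 2 $ 1) :: complex)"
  define d0 where "d0 = qderiv g"
  define d1 where "d1 = qderiv d0"
  have qg: "qexp g G" using g by (simp add: modform_def)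
  have q0: "qexp d0 (fls_X * fls_deriv G)" unfolding d0_def by (rule qexp_deriv[OF qg])
  have Dg: "(g has_field_derivative p * d0 w) (at w)" if "Im w > 0" for w
    using qexp_has_field_derivative_qderiv[OF qg that] by (simp add: p_def d0_def)
  have Dd: "(d0 has_field_derivative p * d1 w) (at w)" if "Im w > 0" for w
    using qexp_has_field_derivative_qderiv[OF q0 that] by (simp add: p_def d1_def)
  have Da: "(autfac \<gamma> has_field_derivative c) (at w)" for w
    unfolding autfac_def c_def by (auto intro!: derivative_eq_intros)
  have Dm: "(moebius \<gamma> has_field_derivative 1 / (autfac \<gamma> w)\<^sup>2) (at w)" if w: "Im w > 0" for w
    using has_field_derivative_moebius[of \<gamma> w] \<gamma> w by (simp add: SL2Z_def)
  have e0: "g (moebius \<gamma> w) = autfac \<gamma> w ^ 12 * g w" if "Im w > 0" for w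
    using modformD[OF g \<gamma> that] by simp
  have e1: "p * d0 (moebius \<gamma> w) = autfac \<gamma> w ^ 14 * (p * d0 w) + 12 * c * autfac \<gamma> w ^ 13 * g w" if w: "Im w > 0" for w
  proof -
    have nz: "autfac \<gamma> w \<noteq> 0" by (rule autfac_nonzero_SL2[OF \<gamma> w])
    have "((\<lambda>w. g (moebius \<gamma> w)) has_field_derivative p * d0 (moebius \<gamma> w) * (1 / (autfac \<gamma> w)\<^sup>2)) (at w)"
      by (rule DERIV_chain2[OF Dg[OF Im_moebius_SL2[OF \<gamma> w]] Dm[OF w]])
    moreover have "((\<lambda>w. autfac \<gamma> w ^ 12 * g w) has_field_derivative
        (12 * c * autfac \<gamma> w ^ 11) * g w + autfac \<gamma> w ^ 12 * (p * d0 w)) (at w)"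
      by (rule derivative_eq_intros Da Dg[OF w] refl)+ (simp add: algebra_simps)
    hence "((\<lambda>w. g (moebius \<gamma> w)) has_field_derivative
        (12 * c * autfac \<gamma> w ^ 11) * g w + autfac \<gamma> w ^ 12 * (p * d0 w)) (at w)"
      by (rule has_field_derivative_transform_within_open[OF _ open_upper]) (use w e0 in auto)
    ultimately have "p * d0 (moebius \<gamma> w) * (1 / (autfac \<gamma> w)\<^sup>2) = (12 * c * autfac \<gamma> w ^ 11) * g w + autfac \<gamma> w ^ 12 * (p * d0 w)"
      by (rule DERIV_unique)
    hence "p * d0 (moebius \<gamma> w) = ((12 * c * autfac \<gamma> w ^ 11) * g w + autfac \<gamma> w ^ 12 * (p * d0 w)) * (autfac \<gamma> w)\<^sup>2"
      using nz by (simp add: field_simps)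
    thus ?thesis by (simp add: algebra_simps flip: power_add)
  qed
  have e2: "p * (p * d1 (moebius \<gamma> w)) = autfac \<gamma> w ^ 16 * (p * (p * d1 w)) + 26 * c * autfac \<gamma> w ^ 15 * (p * d0 w)
      + 156 * c\<^sup>2 * autfac \<gamma> w ^ 14 * g w" if w: "Im w > 0" for w
  proof -
    have nz: "autfac \<gamma> w \<noteq> 0" by (rule autfac_nonzero_SL2[OF \<gamma> w])
    have "((\<lambda>w. p * d0 (moebius \<gamma> w)) has_field_derivative p * (p * d1 (moebius \<gamma> w) * (1 / (autfac \<gamma> w)\<^sup>2))) (at w)"
      by (intro DERIV_cmult DERIV_chain2[OF Dd[OF Im_moebius_SL2[OF \<gamma> w]] Dm[OF w]])
    moreover have "((\<lambda>w. autfac \<gamma> w ^ 14 * (p * d0 w) + 12 * c * autfac \<gamma> w ^ 13 * g w) has_field_derivative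
        (14 * c * autfac \<gamma> w ^ 13) * (p * d0 w) + autfac \<gamma> w ^ 14 * (p * (p * d1 w)) +
        12 * c * (13 * c * autfac \<gamma> w ^ 12 * g w + autfac \<gamma> w ^ 13 * (p * d0 w))) (at w)"
      by (rule derivative_eq_intros Da Dg[OF w] Dd[OF w] refl)+ (simp add: algebra_simps)
    hence "((\<lambda>w. p * d0 (moebius \<gamma> w)) has_field_derivative
        (14 * c * autfac \<gamma> w ^ 13) * (p * d0 w) + autfac \<gamma> w ^ 14 * (p * (p * d1 w)) +
        12 * c * (13 * c * autfac \<gamma> w ^ 12 * g w + autfac \<gamma> w ^ 13 * (p * d0 w))) (at w)"
      by (rule has_field_derivative_transform_within_open[OF _ open_upper]) (use w e1 in auto)
    ultimately have "p * (p * d1 (moebius \<gamma> w) * (1 / (autfac \<gamma> w)\<^sup>2)) =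
        (14 * c * autfac \<gamma> w ^ 13) * (p * d0 w) + autfac \<gamma> w ^ 14 * (p * (p * d1 w)) +
        12 * c * (13 * c * autfac \<gamma> w ^ 12 * g w + autfac \<gamma> w ^ 13 * (p * d0 w))"
      by (rule DERIV_unique)
    hence "p * (p * d1 (moebius \<gamma> w)) =
        ((14 * c * autfac \<gamma> w ^ 13) * (p * d0 w) + autfac \<gamma> w ^ 14 * (p * (p * d1 w)) +
        12 * c * (13 * c * autfac \<gamma> w ^ 12 * g w + autfac \<gamma> w ^ 13 * (p * d0 w))) * (autfac \<gamma> w)\<^sup>2"
      using nz by (simp add: field_simps)
    thus ?thesis by (simp add: algebra_simps power2_eq_square[of c] flip: power_add)
  qed
  define a x y where "a = autfac \<gamma> z" "x = p * d0 z" "y = p * (p * d1 z)"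
  have "p\<^sup>2 * R (moebius \<gamma> z) = g (moebius \<gamma> z) * (p * (p * d1 (moebius \<gamma> z))) - 13 / 12 * (p * d0 (moebius \<gamma> z))\<^sup>2"
    by (simp add: R_def d0_def d1_def power2_eq_square algebra_simps)
  also have "\<dots> = a ^ 12 * g z * (a ^ 16 * y + 26 * c * a ^ 15 * x + 156 * c\<^sup>2 * a ^ 14 * g z)
       - 13 / 12 * (a ^ 14 * x + 12 * c * a ^ 13 * g z)\<^sup>2"
    by (simp only: e0[OF z] e1[OF z] e2[OF z] a_x_y_def)
  also have "\<dots> = a ^ 28 * (g z * y - 13 / 12 * x\<^sup>2)"
    by (simp add: power2_eq_square algebra_simps flip: power_add)
  also have "\<dots> = p\<^sup>2 * (a ^ 28 * R z)"
    by (simp add: R_def d0_def d1_def a_x_y_def power2_eq_square algebra_simps)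
  finally show ?thesis using p0 by (simp add: a_x_y_def)
qed

text \<open>The difference of both sides has weight 28 and vanishes to order 3 at the cusp, so the Sturm bound
  applies.\<close>
lemma Delta_ode:
  assumes z: "Im z > 0"
  shows "Delta z * qderiv (qderiv Delta) z - 13 / 12 * (qderiv Delta z)\<^sup>2 = - (1 / 12 * (eisenstein 4 z * (Delta z)\<^sup>2))"
proof -
  obtain f where f: "modform 12 Delta (fps_to_fls f)" "fps_nth f 0 = 0" "fps_nth f 1 = 1"
    by (rule Delta_expansion, rule that)
  obtain e where e: "modform 4 (eisenstein 4) (fps_to_fls e)" "fps_nth e 0 = 1"
    by (rule eisenstein_4_6, rule that)
  let ?D = "fps_X * fps_deriv f" and ?D2 = "fps_X * fps_deriv (fps_X * fps_deriv f)"
  have X: "fls_X * fls_deriv (fps_to_fls u) = fps_to_fls (fps_X * fps_deriv u)" for u :: "complex fps"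
    by (simp add: fls_times_fps_to_fls fls_deriv_fps_to_fls)
  have q: "qexp Delta (fps_to_fls f)" by (rule modform_qexp[OF f(1)])
  have q1: "qexp (qderiv Delta) (fps_to_fls ?D)" using qexp_deriv[OF q] by (simp only: X)
  have q2: "qexp (qderiv (qderiv Delta)) (fps_to_fls ?D2)" using qexp_deriv[OF q1] by (simp only: X)
  let ?R = "\<lambda>z. Delta z * qderiv (qderiv Delta) z - 13 / 12 * (qderiv Delta z)\<^sup>2"
  have "qexp ?R (fps_to_fls f * fps_to_fls ?D2 - fls_const (13 / 12) * fps_to_fls ?D ^ 2)"
    by (intro qexp_diff qexp_mult qexp_cmult qexp_power q q1 q2)
  hence "modform 28 ?R (fps_to_fls f * fps_to_fls ?D2 - fls_const (13 / 12) * fps_to_fls ?D ^ 2)"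
    unfolding modform_def using rankin_cohen_modular[OF f(1)] by simp
  moreover have "modform 28 (\<lambda>z. 1 / 12 * (eisenstein 4 z * (Delta z)\<^sup>2)) (fls_const (1 / 12) * (fps_to_fls e * fps_to_fls f ^ 2))"
    using modform_cmult[OF modform_mult[OF e(1) modform_power[OF f(1), of 2]], of "1/12"] by simp
  ultimately have m: "modform 28 (\<lambda>z. ?R z + 1 / 12 * (eisenstein 4 z * (Delta z)\<^sup>2))
      (fps_to_fls f * fps_to_fls ?D2 - fls_const (13 / 12) * fps_to_fls ?D ^ 2 + fls_const (1 / 12) * (fps_to_fls e * fps_to_fls f ^ 2))"
    by (rule modform_add)
  define u where "u = f * ?D2 - fps_const (13 / 12) * ?D ^ 2 + fps_const (1 / 12) * (e * f ^ 2)"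
  have u: "fps_to_fls f * fps_to_fls ?D2 - fls_const (13 / 12) * fps_to_fls ?D ^ 2 + fls_const (1 / 12) * (fps_to_fls e * fps_to_fls f ^ 2)
     = fps_to_fls u"
    by (simp add: u_def fls_times_fps_to_fls fps_to_fls_power fps_const_to_fls)
  have "fps_nth u 0 = 0" "fps_nth u 1 = 0" "fps_nth u 2 = 0"
    using f(2,3) e(2) by (simp_all add: u_def power2_eq_square fps_mult_nth numeral_2_eq_2 algebra_simps)
  hence "fls_nth (fps_to_fls u) m = 0" if "m < int 3" for m
  proof -
    have "m < 0 \<or> m = 0 \<or> m = 1 \<or> m = 2" using that by auto
    thus ?thesis using \<open>fps_nth u 0 = 0\<close> \<open>fps_nth u 1 = 0\<close> \<open>fps_nth u 2 = 0\<close> by auto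
  qed
  with sturm_bound[OF m, of 3 z] z have "?R z + 1 / 12 * (eisenstein 4 z * (Delta z)\<^sup>2) = 0"
    unfolding u by simp
  thus ?thesis by (simp only: eq_neg_iff_add_eq_0)
qed

text \<open>At a zero of order \<open>r \<ge> 1\<close> the left-hand side of the differential equation has order
  exactly \<open>2 r - 2\<close>, as \<open>r (r - 1) - 13/12 r\<^sup>2 \<noteq> 0\<close>, while the right-hand side has order at least
  \<open>2 r\<close>.\<close>
lemma Delta_nonzero:
  assumes z: "Im z > 0"
  shows "Delta z \<noteq> 0"
proof
  assume D0: "Delta z = 0"
  obtain f where f: "modform 12 Delta (fps_to_fls f)" "fps_nth f 1 = 1"
    by (rule Delta_expansion, rule that)
  obtain e where e: "modform 4 (eisenstein 4) (fps_to_fls e)"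
    by (rule eisenstein_4_6, rule that)
  have qD: "qexp Delta (fps_to_fls f)" by (rule modform_qexp[OF f(1)])
  have holD: "Delta holomorphic_on upper" by (rule qexp_holomorphic[OF qD])
  have nc: "\<not> Delta constant_on upper"
  proof
    assume "Delta constant_on upper"
    then obtain c where "\<And>z. Im z > 0 \<Longrightarrow> Delta z = c" by (auto simp: constant_on_def)
    hence "qexp Delta (fls_const c)" using qexp_cong[OF qexp_const[of c]] by metis
    hence "fps_to_fls f = fls_const c" by (rule qexp_unique[OF qD])
    hence "fls_nth (fps_to_fls f) 1 = 0" by simp
    thus False using f(2) by simp
  qed
  have zin: "z \<in> upper" using z by simp
  obtain g r n where gr: "0 < n" "0 < r" "ball z r \<subseteq> upper" "g holomorphic_on ball z r"
    "\<And>w. w \<in> ball z r \<Longrightarrow> Delta w = (w - z) ^ n * g w" "\<And>w. w \<in> ball z r \<Longrightarrow> g w \<noteq> 0"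
    by (rule holomorphic_factor_zero_nonconstant[OF holD open_upper convex_connected[OF convex_upper] zin D0 nc], rule that)
  define p where "p = 2 * of_real pi * \<i>"
  have p0: "p \<noteq> 0" by (simp add: p_def)
  define g1 g2 where "g1 = deriv g" "g2 = deriv (deriv g)"
  have hol1: "g1 holomorphic_on ball z r" unfolding g1_g2_def by (intro holomorphic_deriv gr(4) open_ball)
  have hol2: "g2 holomorphic_on ball z r" unfolding g1_g2_def by (intro holomorphic_deriv gr(4) open_ball)
  have Dg: "(g has_field_derivative g1 w) (at w)" if "w \<in> ball z r" for w
    unfolding g1_g2_def by (rule holomorphic_derivI[OF gr(4) open_ball that])
  have Dg1: "(g1 has_field_derivative g2 w) (at w)" if "w \<in> ball z r" for w
    using holomorphic_derivI[OF hol1 open_ball that] by (simp add: g1_g2_def)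
  have q1: "qexp (qderiv Delta) (fls_X * fls_deriv (fps_to_fls f))" by (rule qexp_deriv[OF qD])
  define m where "m = n - 1"
  have nm: "n = Suc m" using gr(1) by (simp add: m_def)
  have d1: "p * qderiv Delta w = (w - z) ^ m * (of_nat n * g w + (w - z) * g1 w)" if w: "w \<in> ball z r" for w
  proof -
    have "Im w > 0" using w gr(3) by auto
    from qexp_has_field_derivative_qderiv[OF qD this]
    have "(Delta has_field_derivative p * qderiv Delta w) (at w)" by (simp add: p_def)
    moreover have "((\<lambda>w. (w - z) ^ n * g w) has_field_derivative
        (w - z) ^ m * (of_nat n * g w + (w - z) * g1 w)) (at w)"
      by (rule derivative_eq_intros Dg[OF w] refl)+ (simp add: nm algebra_simps)
    hence "(Delta has_field_derivative (w - z) ^ m * (of_nat n * g w + (w - z) * g1 w)) (at w)"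
      by (rule has_field_derivative_transform_within_open[OF _ open_ball]) (use w gr(5) in auto)
    ultimately show ?thesis by (rule DERIV_unique)
  qed
  have d2: "(w - z) * (p * (p * qderiv (qderiv Delta) w)) =
      (w - z) ^ m * (of_nat m * (of_nat n * g w + (w - z) * g1 w) + (w - z) * (of_nat n * g1 w + g1 w + (w - z) * g2 w))"
    if w: "w \<in> ball z r" for w
  proof -
    have "Im w > 0" using w gr(3) by auto
    from qexp_has_field_derivative_qderiv[OF q1 this]
    have "((\<lambda>w. p * qderiv Delta w) has_field_derivative p * (p * qderiv (qderiv Delta) w)) (at w)"
      by (intro DERIV_cmult) (simp add: p_def)
    moreover have "((\<lambda>w. (w - z) ^ m * (of_nat n * g w + (w - z) * g1 w)) has_field_derivative
        of_nat m * (w - z) ^ (m - 1) * (of_nat n * g w + (w - z) * g1 w) +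
        (w - z) ^ m * (of_nat n * g1 w + g1 w + (w - z) * g2 w)) (at w)"
      by (rule derivative_eq_intros Dg[OF w] Dg1[OF w] refl)+ (simp add: algebra_simps)
    hence "((\<lambda>w. p * qderiv Delta w) has_field_derivative
        of_nat m * (w - z) ^ (m - 1) * (of_nat n * g w + (w - z) * g1 w) +
        (w - z) ^ m * (of_nat n * g1 w + g1 w + (w - z) * g2 w)) (at w)"
      by (rule has_field_derivative_transform_within_open[OF _ open_ball]) (use w d1 in auto)
    ultimately have "p * (p * qderiv (qderiv Delta) w) = of_nat m * (w - z) ^ (m - 1) * (of_nat n * g w + (w - z) * g1 w) +
        (w - z) ^ m * (of_nat n * g1 w + g1 w + (w - z) * g2 w)"
      by (rule DERIV_unique)
    moreover have "t * X = t ^ m * (of_nat m * U + t * V)" if "X = of_nat m * t ^ (m - 1) * U + t ^ m * V"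
      for t X U V :: complex
    proof -
      have "of_nat m * (t * t ^ (m - 1)) = of_nat m * t ^ m" by (cases m) auto
      moreover have "t * X = of_nat m * (t * t ^ (m - 1)) * U + t ^ m * (t * V)"
        unfolding that by (simp add: algebra_simps)
      ultimately show ?thesis by (simp add: algebra_simps)
    qed
    ultimately show ?thesis by blast
  qed
  define H where "H w = g w * (of_nat m * (of_nat n * g w + (w - z) * g1 w) + (w - z) * (of_nat n * g1 w + g1 w + (w - z) * g2 w))
      - 13 / 12 * (of_nat n * g w + (w - z) * g1 w)\<^sup>2 + 1 / 12 * p\<^sup>2 * (w - z)\<^sup>2 * (eisenstein 4 w * (g w)\<^sup>2)" for w
  have "H w = 0" if w: "w \<in> ball z r" "w \<noteq> z" for w
  proof -
    have Im: "Im w > 0" using w gr(3) by auto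
    define t where "t = w - z"
    have t0: "t \<noteq> 0" using w by (simp add: t_def)
    have "t\<^sup>2 * (p\<^sup>2 * (Delta w * qderiv (qderiv Delta) w - 13 / 12 * (qderiv Delta w)\<^sup>2)) =
          t\<^sup>2 * (p\<^sup>2 * - (1 / 12 * (eisenstein 4 w * (Delta w)\<^sup>2)))"
      by (simp only: Delta_ode[OF Im])
    hence "t * Delta w * (t * (p * (p * qderiv (qderiv Delta) w))) - 13 / 12 * (t * (p * qderiv Delta w))\<^sup>2
         + 1 / 12 * p\<^sup>2 * t\<^sup>2 * (eisenstein 4 w * (Delta w)\<^sup>2) = 0"
      by (simp add: power2_eq_square algebra_simps)
    hence "(t ^ n)\<^sup>2 * H w = 0"
      unfolding d1[OF w(1), folded t_def] d2[OF w(1), folded t_def] gr(5)[OF w(1), folded t_def] H_def t_def[symmetric] nm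
      by (simp add: power2_eq_square algebra_simps)
    thus ?thesis using t0 by simp
  qed
  hence ev: "eventually (\<lambda>w. H w = 0) (at z)"
    using gr(2) by (auto simp: eventually_at intro!: exI[of _ r] simp: dist_commute)
  have zb: "z \<in> ball z r" using gr(2) by simp
  have hole: "eisenstein 4 holomorphic_on upper" by (rule qexp_holomorphic[OF modform_qexp[OF e]])
  have "isCont g z" "isCont g1 z" "isCont g2 z" "isCont (eisenstein 4) z"
    using gr(4) hol1 hol2 hole zb z open_upper
    by (auto simp: continuous_on_eq_continuous_at dest!: holomorphic_on_imp_continuous_on)
  hence "isCont H z" unfolding H_def by (intro continuous_intros)
  hence "(H \<longlongrightarrow> H z) (at z)" by (simp add: isCont_def)
  moreover have "(H \<longlongrightarrow> 0) (at z)"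
    by (rule tendsto_eventually[OF ev])
  ultimately have "H z = 0" by (rule tendsto_unique[OF at_neq_bot])
  hence "(g z)\<^sup>2 * (of_nat m * of_nat n - 13 / 12 * (of_nat n)\<^sup>2) = 0"
    by (simp add: H_def power2_eq_square algebra_simps)
  hence "of_nat m * of_nat n - 13 / 12 * (of_nat n)\<^sup>2 = (0 :: complex)" using gr(6)[OF zb] by simp
  hence "of_nat (12 * m * n) = (of_nat (13 * n\<^sup>2) :: complex)" by (simp add: field_simps)
  hence "12 * m * n = 13 * n\<^sup>2" by (simp only: of_nat_eq_iff)
  thus False by (simp add: nm power2_eq_square)
qed

text \<open>Multiplied by the cusp form \<open>\<Delta>\<close>, which has no zeros, such a form violates the Sturm bound. In weight
  -1 the square is used, whose product with \<open>\<Delta>\<close> has weight 10.\<close>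
lemma negative_weight_zero:
  assumes h: "modform k h H" and k: "k < 0" and H: "\<And>m. m < 0 \<Longrightarrow> fls_nth H m = 0"
  shows "H = 0"
proof -
  obtain f where f: "modform 12 Delta (fps_to_fls f)" "fps_nth f 0 = 0"
    by (rule Delta_expansion, rule that)
  define u where "u = fls_regpart H"
  have Hu: "H = fps_to_fls u" unfolding u_def using H by (intro fls_eqI) auto
  show ?thesis
  \<comment> \<open>For k at most -2 the product with \<open>\<Delta>\<close> has weight at most 10.\<close>
  proof (cases "k \<le> -2")
    case True
    have m: "modform (k + 12) (\<lambda>z. h z * Delta z) (fps_to_fls (u * f))"
      using modform_mult[OF h f(1)] by (simp add: Hu fls_times_fps_to_fls)
    have "h z = 0" if "Im z > 0" for z
      using sturm_bound[OF m, of 1 z] that True Delta_nonzero[OF that] f(2) by (simp add: fps_mult_nth)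
    thus ?thesis by (rule qexp_zero_imp[OF modform_qexp[OF h]])
  next
    case False
    hence "k = -1" using k by simp
    have m: "modform (2 * k + 12) (\<lambda>z. h z * h z * Delta z) (fps_to_fls (u * u * f))"
      using modform_mult[OF modform_mult[OF h h] f(1)] by (simp add: Hu fls_times_fps_to_fls)
    have "h z = 0" if "Im z > 0" for z
      using sturm_bound[OF m, of 1 z] that \<open>k = -1\<close> Delta_nonzero[OF that] f(2) by (simp add: fps_mult_nth)
    thus ?thesis by (rule qexp_zero_imp[OF modform_qexp[OF h]])
  qed
qed

text \<open>Monomials in \<open>E\<^sub>4\<close> and \<open>E\<^sub>6\<close> have rational coefficients and the value 1 at the cusp, and exist in all
  these weights.\<close>
lemma eisenstein_product:
  assumes "even k" "k = 0 \<or> k \<ge> 4"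
  obtains g f where "modform (int k) g (fps_to_fls f)" "fps_nth f 0 = 1" "\<And>N. fps_nth f N \<in> \<rat>"
proof -
  obtain f4 f6 where f: "modform 4 (eisenstein 4) (fps_to_fls f4)" "modform 6 (eisenstein 6) (fps_to_fls f6)"
    "fps_nth f4 0 = 1" "fps_nth f6 0 = 1" "\<And>N. fps_nth f4 N \<in> \<rat>" "\<And>N. fps_nth f6 N \<in> \<rat>"
    by (rule eisenstein_4_6, rule that)
  obtain a b where ab: "k = 4 * a + 6 * b"
  proof (cases "4 dvd k")
    case True
    thus ?thesis using that[of "k div 4" 0] by auto
  next
    case False
    hence "k = 4 * ((k - 6) div 4) + 6 * 1" using assms by presburger
    thus ?thesis using that by blast
  qed
  have "modform (int k) (\<lambda>z. eisenstein 4 z ^ a * eisenstein 6 z ^ b) (fps_to_fls f4 ^ a * fps_to_fls f6 ^ b)"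
    using modform_mult[OF modform_power[OF f(1), of a] modform_power[OF f(2), of b]] by (simp add: ab mult.commute)
  hence "modform (int k) (\<lambda>z. eisenstein 4 z ^ a * eisenstein 6 z ^ b) (fps_to_fls (f4 ^ a * f6 ^ b))"
    by (simp add: fls_times_fps_to_fls fps_to_fls_power)
  moreover have "fps_nth (f4 ^ a * f6 ^ b) 0 = 1"
    using f by (simp add: fps_mult_nth fps_nth_power_0)
  moreover have "fps_nth (f4 ^ a * f6 ^ b) N \<in> \<rat>" for N
  proof -
    have m: "fps_nth (u * v) N \<in> \<rat>" if "\<And>N. fps_nth u N \<in> \<rat>" "\<And>N. fps_nth v N \<in> \<rat>" for u v :: "complex fps" and N
      using that by (auto simp: fps_mult_nth intro!: Rats_sum)
    have p: "fps_nth (u ^ j) N \<in> \<rat>" if "\<And>N. fps_nth u N \<in> \<rat>" for u :: "complex fps" and N j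
      by (induction j arbitrary: N) (auto intro!: m that)
    show ?thesis by (intro m p f)
  qed
  ultimately show ?thesis using that by blast
qed

section \<open>Integration of Fourier series and the residue theorem\<close>

text \<open>The j-fold inverse of \<open>q d/dq\<close>. Division by zero discards the constant coefficient when j > 0.\<close>
definition fls_int :: "nat \<Rightarrow> complex fls \<Rightarrow> complex fls" where
  "fls_int j F = Abs_fls (\<lambda>m. fls_nth F m / of_int m ^ j)"

lemma fls_nth_int [simp]: "fls_nth (fls_int j F) m = fls_nth F m / of_int m ^ j"
proof -
  have "\<forall>\<^sub>\<infinity>n. fls_nth F (- int n) = 0" by simp
  hence "\<forall>\<^sub>\<infinity>n. fls_nth F (- int n) / of_int (- int n) ^ j = 0"
    by (rule MOST_mono) simp
  thus ?thesis unfolding fls_int_def by (simp add: Abs_fls_inverse)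
qed

lemma fls_int_radius:
  assumes "1 \<le> fls_conv_radius F" "j > 0"
  shows "1 \<le> fls_conv_radius (fls_int j F)"
  unfolding fls_conv_radius_def fps_conv_radius_def
proof (rule conv_radius_geI_ex)
  fix r :: real assume r: "r > 0" "ereal r < 1"
  have "ereal (norm (of_real r :: complex)) < fls_conv_radius F"
    by (rule less_le_trans[OF _ assms(1)]) (use r in simp)
  hence s: "summable (\<lambda>n. norm (fls_nth F (int n) * of_real r ^ n))" by (rule norm_summable_fls)
  have "summable (\<lambda>n. fls_nth (fls_int j F) (int n) * of_real r ^ n)"
  proof (rule summable_comparison_test'[OF s, of 1])
    fix n :: nat assume n: "n \<ge> 1"
    have "norm (fls_nth F (int n)) / real n ^ j \<le> norm (fls_nth F (int n)) / 1"
      using n by (intro divide_left_mono) (auto intro: one_le_power)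
    note le = this
    show "norm (fls_nth (fls_int j F) (int n) * of_real r ^ n) \<le> norm (fls_nth F (int n) * of_real r ^ n)"
      using mult_right_mono[OF le, of "r ^ n"] r by (simp add: norm_mult norm_divide norm_power)
  qed
  thus "\<exists>z. norm z = r \<and> summable (\<lambda>n. fps_nth (fls_regpart (fls_int j F)) n * z ^ n)"
    using r by (intro exI[of _ "of_real r"]) simp
qed

lemma qexp_fls_int:
  assumes "qexp g F" "j > 0"
  shows "qexp (\<lambda>z. eval_fls (fls_int j F) (nome z)) (fls_int j F)"
  using assms fls_int_radius by (auto simp: qexp_def)

text \<open>The linear term that integrates the constant Fourier coefficient is the only obstruction to
  periodicity.\<close>
lemma qexp_primitive:
  assumes "qexp g F"
  obtains G where "\<And>z. Im z > 0 \<Longrightarrow> (G has_field_derivative g z) (at z)"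
    "\<And>z. G (z + 1) - G z = fls_nth F 0"
proof
  define e where "e z = eval_fls (fls_int 1 F) (nome z)" for z
  have e: "qexp e (fls_int 1 F)" unfolding e_def[abs_def] by (rule qexp_fls_int[OF assms]) simp
  define G where "G z = e z / (2 * of_real pi * \<i>) + fls_nth F 0 * z" for z
  have eq: "fls_X * fls_deriv (fls_int 1 F) = F - fls_const (fls_nth F 0)"
    by (rule fls_eqI) auto
  have d: "qderiv e z = g z - fls_nth F 0" if "Im z > 0" for z
    using qexp_eval[OF qexp_deriv[OF e] that] qexp_eval[OF qexp_diff[OF assms qexp_const[of "fls_nth F 0"]] that]
    unfolding eq by simp
  show "(G has_field_derivative g z) (at z)" if "Im z > 0" for z
  proof -
    note De = qexp_has_field_derivative_qderiv[OF e that]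
    have "(G has_field_derivative (2 * of_real pi * \<i> * qderiv e z) / (2 * of_real pi * \<i>) + fls_nth F 0) (at z)"
      unfolding G_def by (intro DERIV_add DERIV_cdivide De DERIV_cmult_Id)
    thus ?thesis by (simp add: d[OF that])
  qed
  show "G (z + 1) - G z = fls_nth F 0" for z
    unfolding G_def e_def nome_plus_1 by (simp add: algebra_simps)
qed

text \<open>The elliptic point of order three; S maps it to its translate by 1.\<close>
definition rho :: complex where "rho = Complex (-1/2) (sqrt 3 / 2)"

lemma rho_facts: "Im rho > 0" "rho * rho + rho + 1 = 0" "- 1 / rho = rho + 1"
proof -
  show "Im rho > 0" by (simp add: rho_def)
  show *: "rho * rho + rho + 1 = 0" by (simp add: rho_def complex_eq_iff)
  have "rho \<noteq> 0" by (simp add: rho_def complex_eq_iff)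
  moreover have "rho * (rho + 1) = - 1" using * by (simp add: algebra_simps add_eq_0_iff)
  ultimately show "- 1 / rho = rho + 1" by (simp add: field_simps)
qed

lemma zero_derivative_const:
  assumes "\<And>z. Im z > 0 \<Longrightarrow> (G has_field_derivative 0) (at z)"
  obtains c where "\<And>z. Im z > 0 \<Longrightarrow> G z = c"
proof -
  have "\<exists>c. \<forall>z\<in>upper. G z = c"
    by (intro has_field_derivative_zero_constant convex_upper)
       (use assms in \<open>auto intro: has_field_derivative_at_within\<close>)
  thus ?thesis using that by auto
qed

lemma derivative_S:
  assumes "z \<noteq> 0"
  shows "((\<lambda>z. - 1 / z) has_field_derivative 1 / z\<^sup>2) (at (z::complex))"
  using assms by (auto intro!: derivative_eq_intros simp: power2_eq_square)

lemma Im_S: "Im z > 0 \<Longrightarrow> Im (- 1 / z) > 0"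
  using Im_moebius_SL2[OF Smat_in, of z] by simp

text \<open>The residue theorem on the modular curve. A primitive \<open>G\<close> satisfies \<open>G(-1/z) = G(z) + c\<close>. The fixed
  point \<open>i\<close> shows \<open>c = 0\<close>, and at \<open>\<rho>\<close>, where \<open>-1/\<rho> = \<rho> + 1\<close>, the constant coefficient appears.\<close>
lemma weight_two_constant_coeff:
  assumes g: "modform 2 g F"
  shows "fls_nth F 0 = 0"
proof -
  obtain G where G: "\<And>z. Im z > 0 \<Longrightarrow> (G has_field_derivative g z) (at z)"
    "\<And>z. G (z + 1) - G z = fls_nth F 0"
    using qexp_primitive[OF modform_qexp[OF g]] by metis
  have "((\<lambda>z. G (- 1 / z) - G z) has_field_derivative 0) (at z)" if z: "Im z > 0" for z
  proof -
    have nz: "z \<noteq> 0" using z by auto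
    have "g (- 1 / z) = z\<^sup>2 * g z" using modformD[OF g Smat_in z] by (simp add: power2_eq_square power_int_def eval_nat_numeral)
    moreover have "((\<lambda>z. G (- 1 / z)) has_field_derivative g (- 1 / z) * (1 / z\<^sup>2)) (at z)"
      by (rule DERIV_chain2[OF G(1)[OF Im_S[OF z]] derivative_S[OF nz]])
    ultimately have "((\<lambda>z. G (- 1 / z)) has_field_derivative g z) (at z)" using nz by simp
    from DERIV_diff[OF this G(1)[OF z]] show ?thesis by simp
  qed
  note D = this
  obtain c where c: "\<And>z. Im z > 0 \<Longrightarrow> G (- 1 / z) - G z = c"
    by (rule zero_derivative_const[of "\<lambda>z. G (- 1 / z) - G z", OF D], assumption, rule that)
  \<comment> \<open>\<open>i\<close> is fixed by \<open>z \<mapsto> -1/z\<close>\<close>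
  have "c = 0" using c[of \<i>] by simp
  moreover have "G (rho + 1) - G rho = c" using c[of rho] rho_facts by simp
  ultimately show ?thesis using G(2) by simp
qed

section \<open>The pairing of Fourier expansions and Hecke operators\<close>

lemma fls_times_nth_finite:
  fixes F G :: "complex fls"
  assumes "finite M" "\<And>m. fls_nth F m \<noteq> 0 \<Longrightarrow> fls_nth G (n - m) \<noteq> 0 \<Longrightarrow> m \<in> M"
  shows "fls_nth (F * G) n = (\<Sum>m\<in>M. fls_nth F m * fls_nth G (n - m))"
proof -
  have "fls_nth (F * G) n = (\<Sum>i=fls_subdegree F..n - fls_subdegree G. fls_nth F i * fls_nth G (n - i))"
    by (rule fls_times_nth(2))
  also have "\<dots> = (\<Sum>m\<in>M. fls_nth F m * fls_nth G (n - m))"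
  proof (rule sum.mono_neutral_cong)
    fix m assume "m \<in> M - {fls_subdegree F..n - fls_subdegree G}"
    hence "m < fls_subdegree F \<or> n - m < fls_subdegree G" by auto
    thus "fls_nth F m * fls_nth G (n - m) = 0" by auto
  qed (use assms in auto)
  finally show ?thesis .
qed

text \<open>The residue at the cusp of F times the j-fold integral of G.\<close>
definition pair :: "nat \<Rightarrow> complex fls \<Rightarrow> complex fls \<Rightarrow> complex" where
  "pair j F G = fls_nth (F * fls_int j G) 0"

lemma pair_add_left: "pair j (F + F') G = pair j F G + pair j F' G"
  by (simp add: pair_def ring_distribs)

lemma pair_diff_left: "pair j (F - F') G = pair j F G - pair j F' G"
  by (simp add: pair_def ring_distribs)

lemma pair_cmult_left: "pair j (fls_const c * F) G = c * pair j F G"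
  by (simp add: pair_def mult.assoc)

lemma fls_int_add: "fls_int j (F + G) = fls_int j F + fls_int j G"
  by (rule fls_eqI) (simp add: add_divide_distrib)

lemma fls_int_cmult: "fls_int j (fls_const c * F) = fls_const c * fls_int j F"
  by (rule fls_eqI) simp

lemma pair_add_right: "pair j F (G + G') = pair j F G + pair j F G'"
  by (simp add: pair_def fls_int_add ring_distribs)

lemma pair_cmult_right: "pair j F (fls_const c * G) = c * pair j F G"
  unfolding pair_def fls_int_cmult by (subst mult.left_commute) simp

lemma pair_over: 
  assumes "complex_subfield K" "F \<in> fls_over K" "G \<in> fls_over K"
  shows "pair j F G \<in> K"
proof -
  have "fls_int j G \<in> fls_over K"
    using assms by (auto simp: fls_over_def intro!: subfieldD subfield_power subfield_of_int)
  thus ?thesis using fls_over_mult[OF assms(1,2)] by (auto simp: pair_def fls_over_def)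
qed

lemma pair_sum:
  assumes "finite M" "\<And>m. fls_nth F m \<noteq> 0 \<Longrightarrow> fls_nth G (- m) \<noteq> 0 \<Longrightarrow> m \<in> M"
  shows "pair j F G = (\<Sum>m\<in>M. fls_nth F m * fls_nth G (- m) / of_int (- m) ^ j)"
  unfolding pair_def by (subst fls_times_nth_finite[OF assms(1)]) (use assms(2) in auto)

lemma fls_bounded_support:
  obtains N :: int where "N > 0" "\<And>m. m < - N \<Longrightarrow> fls_nth F m = 0" "\<And>m. m < - N \<Longrightarrow> fls_nth G m = 0"
proof
  define N where "N = 1 + \<bar>fls_subdegree F\<bar> + \<bar>fls_subdegree G\<bar>"
  show "N > 0" by (simp add: N_def)
  show "fls_nth F m = 0" "fls_nth G m = 0" if "m < - N" for m
    using that by (auto simp: N_def intro!: fls_eq0_below_subdegree)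
qed

text \<open>The sign comes from the odd exponent \<open>j = k - 1\<close>.\<close>
lemma pair_swap:
  assumes "odd j"
  shows "pair j G F = - pair j F G"
proof -
  obtain N :: int where N: "\<And>m. m < - N \<Longrightarrow> fls_nth F m = 0" "\<And>m. m < - N \<Longrightarrow> fls_nth G m = 0"
    by (rule fls_bounded_support, rule that)
  have M: "m \<in> {-N..N}" if "fls_nth F m \<noteq> 0" "fls_nth G (- m) \<noteq> 0" for m
    using N(1)[of m] N(2)[of "-m"] that by force
  have "pair j G F = (\<Sum>m\<in>{-N..N}. fls_nth G m * fls_nth F (- m) / of_int (- m) ^ j)"
    by (rule pair_sum) (use M in force)+
  also have "\<dots> = (\<Sum>m\<in>{-N..N}. fls_nth G (- m) * fls_nth F m / of_int m ^ j)"
    by (rule sum.reindex_bij_witness[of _ uminus uminus]) auto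
  also have "\<dots> = - (\<Sum>m\<in>{-N..N}. fls_nth F m * fls_nth G (- m) / of_int (- m) ^ j)"
    using assms by (simp add: sum_negf[symmetric] mult.commute power_minus_odd)
  also have "\<dots> = - pair j F G"
    by (subst pair_sum[of "{-N..N}"]) (use M in auto)
  finally show ?thesis .
qed

text \<open>Integration by parts moves the derivatives onto H; then \<open>G H\<close> has weight 2, and its residue at the
  only cusp vanishes. G must have no constant term because the formal integral ignores it.\<close>
lemma pair_exact:
  assumes h: "modform (2 - k) h H" and g: "modform k g G" and G0: "fls_nth G 0 = 0"
    and j: "\<And>m. fls_nth E m = of_int m ^ j * fls_nth H m"
  shows "pair j G E = 0"
proof -
  obtain N :: int where N: "\<And>m. m < - N \<Longrightarrow> fls_nth G m = 0" "\<And>m. m < - N \<Longrightarrow> fls_nth H m = 0"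
    by (rule fls_bounded_support, rule that)
  have M: "m \<in> {-N..N}" if "fls_nth G m \<noteq> 0" "fls_nth H (- m) \<noteq> 0" for m
    using N(1)[of m] N(2)[of "-m"] that by force
  have "pair j G E = (\<Sum>m\<in>{-N..N}. fls_nth G m * fls_nth E (- m) / of_int (- m) ^ j)"
    by (rule pair_sum) (use M in \<open>auto simp: j\<close>)
  also have "\<dots> = (\<Sum>m\<in>{-N..N}. fls_nth G m * fls_nth H (0 - m))"
    by (rule sum.cong) (auto simp: j G0 field_simps)
  also have "\<dots> = fls_nth (G * H) 0"
    by (rule fls_times_nth_finite[symmetric]) (use M in auto)
  also have "\<dots> = 0"
    using weight_two_constant_coeff[of "\<lambda>z. g z * h z" "G * H"] modform_mult[OF g h] by simp
  finally show ?thesis .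
qed

definition fls_hecke :: "nat \<Rightarrow> nat \<Rightarrow> complex fls \<Rightarrow> complex fls" where
  "fls_hecke j p F = Abs_fls (\<lambda>m. fls_nth F (int p * m) +
     of_nat p ^ j * (if int p dvd m then fls_nth F (m div int p) else 0))"

lemma fls_nth_hecke:
  assumes "p > 0"
  shows "fls_nth (fls_hecke j p F) m = fls_nth F (int p * m) +
     of_nat p ^ j * (if int p dvd m then fls_nth F (m div int p) else 0)"
proof -
  obtain N :: int where N: "N > 0" "\<And>m. m < - N \<Longrightarrow> fls_nth F m = 0"
    by (rule fls_bounded_support, rule that)
  have "\<forall>\<^sub>\<infinity>n. fls_nth F (int p * - int n) +
     of_nat p ^ j * (if int p dvd - int n then fls_nth F (- int n div int p) else 0) = 0"
    unfolding MOST_nat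
  proof (intro exI[of _ "nat (N * int p)"] allI impI)
    fix n assume n: "nat (N * int p) < n"
    hence n': "N * int p < int n" by linarith
    have "N \<le> N * int p" using assms N by simp
    hence "N < int n" using n' by linarith
    also have "int n \<le> int p * int n" using mult_right_mono[of 1 "int p" "int n"] assms by simp
    finally have 1: "int p * - int n < - N" by simp
    have 2: "- int n div int p < - N" if "int p dvd - int n"
    proof -
      from that have "int p dvd int n" by (simp only: dvd_minus_iff)
      then obtain l where l: "int n = int p * l" by (rule dvdE)
      hence "N < l" using n' assms by (simp add: mult.commute)
      moreover have "- int n div int p = - l" using l assms by (metis mult_minus_right nonzero_mult_div_cancel_left of_nat_0_eq_iff less_numeral_extra(3))
      ultimately show ?thesis by simp
    qed
    show "fls_nth F (int p * - int n) +
     of_nat p ^ j * (if int p dvd - int n then fls_nth F (- int n div int p) else 0) = 0"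
      using N(2)[OF 1] N(2)[OF 2] by simp
  qed
  thus ?thesis unfolding fls_hecke_def by (simp add: Abs_fls_inverse)
qed

lemma sum_over_multiples:
  fixes g h :: "int \<Rightarrow> complex"
  assumes p: "p > 0" and g: "\<And>m. \<not> int p dvd m \<Longrightarrow> g m = 0"
    and h: "\<And>m. int p * m \<notin> {-L..L} \<Longrightarrow> h m = 0" and gh: "\<And>m. g (int p * m) = h m"
  shows "(\<Sum>m\<in>{-L..L}. g m) = (\<Sum>m\<in>{-L..L}. h m)"
proof -
  have pm: "\<bar>m\<bar> \<le> \<bar>int p * m\<bar>" for m
    using p mult_right_mono[of 1 "int p" "\<bar>m\<bar>"] by (simp add: abs_mult)
  have "(\<Sum>m\<in>{-L..L}. g m) = (\<Sum>m | m \<in> {-L..L} \<and> int p dvd m. g m)"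
    using g by (intro sum.mono_neutral_right) auto
  also have "\<dots> = (\<Sum>m | m \<in> {-L..L} \<and> int p * m \<in> {-L..L}. h m)"
  proof (rule sum.reindex_bij_witness[of _ "\<lambda>m. int p * m" "\<lambda>m. m div int p"])
    fix m assume m: "m \<in> {m. m \<in> {-L..L} \<and> int p dvd m}"
    then obtain l where l: "m = int p * l" by auto
    have dl: "m div int p = l" using p by (simp add: l)
    have "\<bar>l\<bar> \<le> L" using pm[of l] m l by auto
    thus "m div int p \<in> {m. m \<in> {-L..L} \<and> int p * m \<in> {-L..L}}" using m by (auto simp: dl l)
    show "int p * (m div int p) = m" "h (m div int p) = g m" using p by (simp_all add: dl l gh)
  next
    fix m assume "m \<in> {m. m \<in> {-L..L} \<and> int p * m \<in> {-L..L}}"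
    thus "int p * m div int p = m" "int p * m \<in> {m. m \<in> {-L..L} \<and> int p dvd m}" using p by auto
  qed
  also have "\<dots> = (\<Sum>m\<in>{-L..L}. h m)"
    using h by (intro sum.mono_neutral_left) auto
  finally show ?thesis .
qed

text \<open>Both sides are \<open>\<Sum> F\<^sub>p\<^sub>m G\<^sub>-\<^sub>m / (-m)\<^sup>j + \<Sum> F\<^sub>m G\<^sub>-\<^sub>p\<^sub>m / (-m)\<^sup>j\<close>.\<close>
lemma pair_hecke:
  assumes p: "p > 0"
  shows "pair j (fls_hecke j p F) G = pair j F (fls_hecke j p G)"
proof -
  obtain N :: int where N: "N > 0" "\<And>m. m < - N \<Longrightarrow> fls_nth F m = 0" "\<And>m. m < - N \<Longrightarrow> fls_nth G m = 0"
    by (rule fls_bounded_support[of F G], rule that)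
  define L where "L = int p * N"
  have NL: "N \<le> L" using p N(1) by (simp add: L_def)
  have "x \<le> int p * x" if "x \<ge> 0" for x using p that by (simp add: mult_le_cancel_right1)
  note ppos = this
  have pneg: "int p * x \<le> x" if "x < 0" for x using ppos[of "-x"] that by simp
  from ppos have pm: "\<bar>m\<bar> \<le> \<bar>int p * m\<bar>" for m by (simp add: abs_mult)
  have A: "pair j (fls_hecke j p F) G = (\<Sum>m\<in>{-L..L}. fls_nth F (int p * m) * fls_nth G (- m) / of_int (- m) ^ j)
     + (\<Sum>m\<in>{-L..L}. of_nat p ^ j * (if int p dvd m then fls_nth F (m div int p) else 0) * fls_nth G (- m) / of_int (- m) ^ j)"
    (is "_ = ?A1 + ?A2")
  proof -
    have "pair j (fls_hecke j p F) G = (\<Sum>m\<in>{-L..L}. fls_nth (fls_hecke j p F) m * fls_nth G (- m) / of_int (- m) ^ j)"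
    proof (rule pair_sum)
      fix m assume m: "fls_nth (fls_hecke j p F) m \<noteq> 0" "fls_nth G (- m) \<noteq> 0"
      have "m \<le> L" using N(3)[of "-m"] m NL by force
      moreover have "- L \<le> m"
      proof (rule ccontr)
        assume mL: "\<not> - L \<le> m"
        hence "int p * m < - N" using pneg[of m] NL N(1) by linarith
        moreover have "m div int p < - N" if "int p dvd m"
          using that mL p by (auto simp: L_def elim!: dvdE simp flip: mult_minus_right)
        ultimately show False using m(1) N(2) p by (auto simp: fls_nth_hecke split: if_splits)
      qed
      ultimately show "m \<in> {-L..L}" by simp
    qed auto
    thus ?thesis using p by (simp add: fls_nth_hecke sum.distrib[symmetric] add_divide_distrib ring_distribs)
  qed
  have B: "pair j F (fls_hecke j p G) = (\<Sum>m\<in>{-L..L}. fls_nth F m * fls_nth G (- (int p * m)) / of_int (- m) ^ j)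
     + (\<Sum>m\<in>{-L..L}. of_nat p ^ j * fls_nth F m * (if int p dvd m then fls_nth G (- m div int p) else 0) / of_int (- m) ^ j)"
    (is "_ = ?B1 + ?B2")
  proof -
    have "pair j F (fls_hecke j p G) = (\<Sum>m\<in>{-L..L}. fls_nth F m * fls_nth (fls_hecke j p G) (- m) / of_int (- m) ^ j)"
    proof (rule pair_sum)
      fix m assume m: "fls_nth F m \<noteq> 0" "fls_nth (fls_hecke j p G) (- m) \<noteq> 0"
      have "- L \<le> m" using N(2)[of m] m NL by force
      moreover have "m \<le> L"
      proof (rule ccontr)
        assume mL: "\<not> m \<le> L"
        hence "int p * - m < - N" using pneg[of "-m"] NL N(1) by linarith
        moreover have "- m div int p < - N" if "int p dvd - m"
        proof -
          from that obtain l where l: "- m = int p * l" by (rule dvdE)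
          hence "int p * N < int p * - l" using mL unfolding L_def mult_minus_right l[symmetric] by simp
          hence "N < - l" by (rule mult_left_less_imp_less) simp
          thus ?thesis using l p by simp
        qed
        ultimately show False using m(2) N(3) p by (auto simp: fls_nth_hecke split: if_splits)
      qed
      ultimately show "m \<in> {-L..L}" by simp
    qed auto
    thus ?thesis using p by (simp add: fls_nth_hecke sum.distrib[symmetric] add_divide_distrib ring_distribs mult_ac)
  qed
  have big: "\<not> m \<le> N \<or> \<not> - N \<le> m" if "int p * m \<notin> {-L..L}" for m
    using that p by (auto simp: L_def simp flip: mult_minus_right)
  have e: "of_int (- (int p * l)) ^ j = of_nat p ^ j * (of_int (- l) ^ j :: complex)" for l
    by (simp flip: power_mult_distrib)
  have d: "int p * l div int p = l" "- (int p * l) div int p = - l" for l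
    using p nonzero_mult_div_cancel_left[of "int p" "- l"] by simp_all
  have "?A2 = ?B1"
  proof (rule sum_over_multiples[OF p])
    fix m assume "int p * m \<notin> {-L..L}"
    from big[OF this] have "fls_nth F m = 0 \<or> fls_nth G (- (int p * m)) = 0"
    proof
      assume "\<not> m \<le> N"
      hence "int p * m > N" using ppos[of m] N(1) by linarith
      thus ?thesis using N(3)[of "- (int p * m)"] by simp
    qed (use N(2)[of m] in simp)
    thus "fls_nth F m * fls_nth G (- (int p * m)) / of_int (- m) ^ j = 0" by auto
  qed (unfold e d, use p in auto)
  moreover have "?B2 = ?A1"
  proof (rule sum_over_multiples[OF p])
    fix m assume "int p * m \<notin> {-L..L}"
    from big[OF this] have "fls_nth G (- m) = 0 \<or> fls_nth F (int p * m) = 0"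
    proof (elim disjE)
      assume "\<not> - N \<le> m"
      hence "int p * m < - N" using pneg[of m] N(1) by linarith
      thus ?thesis using N(2)[of "int p * m"] by simp
    qed (use N(3)[of "-m"] in simp)
    thus "fls_nth F (int p * m) * fls_nth G (- m) / of_int (- m) ^ j = 0" by auto
  qed (unfold e d, use p in auto)
  ultimately show ?thesis using A B by simp
qed

section \<open>Hecke operators on modular forms\<close>

text \<open>Upper triangular representatives of the left cosets of matrices of determinant p.\<close>
definition tri_reps :: "nat \<Rightarrow> (int^2^2) set" where
  "tri_reps p = insert (mat2 (int p) 0 0 1) ((\<lambda>j. mat2 1 (int j) 0 (int p)) ` {..<p})"

lemma finite_tri_reps: "finite (tri_reps p)"
  by (simp add: tri_reps_def)

lemma tri_reps_det: "r \<in> tri_reps p \<Longrightarrow> det r = int p"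
  by (auto simp: tri_reps_def)

text \<open>The gcd of the first column divides the prime p; it decides which representative occurs.\<close>
lemma tri_reps_exists:
  assumes p: "prime p" and m: "det m = int p"
  obtains \<gamma> r where "\<gamma> \<in> SL2Z" "r \<in> tri_reps p" "m = \<gamma> ** r"
proof -
  define a b c d where "a = m $ 1 $ 1" "b = m $ 1 $ 2" "c = m $ 2 $ 1" "d = m $ 2 $ 2"
  have det: "a * d - b * c = int p" using m by (simp add: det_2 a_b_c_d_def)
  have p0: "p > 0" using p prime_gt_0_nat by blast
  define g where "g = gcd a c"
  obtain a' c' where ac: "a = g * a'" "c = g * c'"
    unfolding g_def by (metis gcd_dvd1 gcd_dvd2 dvdE)
  have "g * (a' * d - b * c') = int p" using det by (simp add: ac algebra_simps)
  hence "g dvd int p" by (metis dvd_triv_left)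
  moreover have "g \<ge> 0" by (simp add: g_def)
  moreover have "prime (int p)" using p by simp
  ultimately have "g = 1 \<or> g = int p" by (auto simp: prime_int_iff)
  thus ?thesis
  proof
    assume g1: "g = 1"
    hence "gcd a c = 1" by (simp add: g_def)
    then obtain x y where xy: "x * a + y * c = 1" using bezout_int[of a c] by auto
    define u where "u = x * b + y * d"
    define t where "t = u div int p"
    define j where "j = nat (u mod int p)"
    have j: "int j = u - t * int p" "j < p"
      using p0 by (simp_all add: j_def t_def minus_div_mult_eq_mod nat_less_iff)
    define \<gamma> where "\<gamma> = mat2 a (a * t - y) c (c * t + x)"
    have "\<gamma> \<in> SL2Z" using xy by (simp add: \<gamma>_def SL2Z_def algebra_simps)
    moreover have "mat2 1 (int j) 0 (int p) \<in> tri_reps p" using j(2) by (auto simp: tri_reps_def)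
    moreover have "m = \<gamma> ** mat2 1 (int j) 0 (int p)"
    proof -
      have "b = a * u - y * int p"
      proof -
        have "a * u - y * int p = (x * a + y * c) * b" unfolding u_def det[symmetric] by (simp add: algebra_simps)
        thus ?thesis using xy by simp
      qed
      moreover have "d = c * u + x * int p"
      proof -
        have "c * u + x * int p = (x * a + y * c) * d" unfolding u_def det[symmetric] by (simp add: algebra_simps)
        thus ?thesis using xy by simp
      qed
      ultimately show ?thesis
        unfolding mat2_eq_iff by (simp add: \<gamma>_def j algebra_simps flip: a_b_c_d_def)
    qed
    ultimately show ?thesis using that by blast
  next
    assume gp: "g = int p"
    define \<gamma> where "\<gamma> = mat2 a' b c' d"
    have "int p * (a' * d - b * c') = int p * 1" using det by (simp add: ac gp algebra_simps)
    hence "a' * d - b * c' = 1" using p0 by (simp only: mult_cancel_left) simp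
    hence "\<gamma> \<in> SL2Z" by (simp add: \<gamma>_def SL2Z_def)
    moreover have "mat2 (int p) 0 0 1 \<in> tri_reps p" by (simp add: tri_reps_def)
    moreover have "m = \<gamma> ** mat2 (int p) 0 0 1"
      unfolding mat2_eq_iff using ac gp by (simp add: \<gamma>_def mult.commute flip: a_b_c_d_def)
    ultimately show ?thesis using that by blast
  qed
qed

lemma tri_reps_unique:
  assumes p: "prime p" and r: "r \<in> tri_reps p" "r' \<in> tri_reps p" and \<gamma>: "\<gamma> \<in> SL2Z" "r = \<gamma> ** r'"
  shows "r = r'"
proof -
  define a b c d where "a = \<gamma> $ 1 $ 1" "b = \<gamma> $ 1 $ 2" "c = \<gamma> $ 2 $ 1" "d = \<gamma> $ 2 $ 2"
  have det: "a * d - b * c = 1" using \<gamma>(1) by (simp add: SL2Z_def det_2 a_b_c_d_def)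
  have p1: "int p > 1" using prime_gt_1_nat[OF p] by simp
  have eqs: "r $ 1 $ 1 = a * r' $ 1 $ 1 + b * r' $ 2 $ 1" "r $ 1 $ 2 = a * r' $ 1 $ 2 + b * r' $ 2 $ 2"
       "r $ 2 $ 1 = c * r' $ 1 $ 1 + d * r' $ 2 $ 1" "r $ 2 $ 2 = c * r' $ 1 $ 2 + d * r' $ 2 $ 2"
    unfolding \<gamma>(2) by (simp_all add: a_b_c_d_def)
  have ndvd: False if "int p * x = 1" for x
  proof -
    have "int p dvd 1" using that by (metis dvd_triv_left)
    thus False using p1 by auto
  qed
  consider "r = mat2 (int p) 0 0 1" "r' = mat2 (int p) 0 0 1"
    | j where "r = mat2 (int p) 0 0 1" "r' = mat2 1 (int j) 0 (int p)"
    | j where "r' = mat2 (int p) 0 0 1" "r = mat2 1 (int j) 0 (int p)"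
    | i j where "r = mat2 1 (int i) 0 (int p)" "r' = mat2 1 (int j) 0 (int p)" "i < p" "j < p"
    using r by (auto simp: tri_reps_def)
  thus ?thesis
  proof cases
    case (2 j)
    hence "c = 0" "int p * d = 1" using eqs by (simp_all add: mult.commute)
    thus ?thesis using ndvd by blast
  next
    case (3 j)
    hence "int p * a = 1" using eqs by (simp add: mult.commute)
    thus ?thesis using ndvd by blast
  next
    case (4 i j)
    hence a: "a = 1" "c = 0" using eqs by simp_all
    hence "int i = int j + b * int p" using 4 eqs by simp
    moreover have "\<bar>int i - int j\<bar> < int p" using 4 by linarith
    ultimately have "\<bar>b\<bar> * int p < 1 * int p" using p1 by (simp add: abs_mult)
    hence "\<bar>b\<bar> < 1" using p1 mult_less_cancel_right_pos[of "int p" "\<bar>b\<bar>" 1] by simp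
    hence "b = 0" by simp
    thus ?thesis using \<open>int i = int j + b * int p\<close> 4 by simp
  qed auto
qed

definition hecke_term :: "int \<Rightarrow> (complex \<Rightarrow> complex) \<Rightarrow> int^2^2 \<Rightarrow> complex \<Rightarrow> complex" where
  "hecke_term k g \<delta> z = autfac \<delta> z powi (- k) * g (moebius \<delta> z)"

lemma hecke_term_left:
  assumes "modform k g F" "\<gamma> \<in> SL2Z" "det \<delta> > 0" "Im z > 0"
  shows "hecke_term k g (\<gamma> ** \<delta>) z = hecke_term k g \<delta> z"
proof -
  have I: "Im (moebius \<delta> z) > 0" by (rule Im_moebius_pos[OF assms(3,4)])
  have nz: "autfac \<gamma> (moebius \<delta> z) \<noteq> 0" by (rule autfac_nonzero_SL2[OF assms(2) I])
  show ?thesis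
    unfolding hecke_term_def autfac_mult[OF assms(3,4)] moebius_mult[OF SL2Z_det[OF assms(2)] assms(3,4)]
      modformD[OF assms(1,2) I]
    using nz by (simp add: power_int_mult_distrib power_int_minus)
qed

lemma hecke_term_right:
  assumes "\<gamma> \<in> SL2Z" "det \<delta> > 0" "Im z > 0"
  shows "hecke_term k g \<delta> (moebius \<gamma> z) = autfac \<gamma> z powi k * hecke_term k g (\<delta> ** \<gamma>) z"
  unfolding hecke_term_def autfac_mult[OF SL2Z_det[OF assms(1)] assms(3)] moebius_mult[OF assms(2) SL2Z_det[OF assms(1)] assms(3)]
  using autfac_nonzero_SL2[OF assms(1,3)] by (simp add: power_int_mult_distrib power_int_minus)

text \<open>Right multiplication by \<open>SL\<^sub>2(\<int>)\<close> permutes the left cosets of matrices of determinant p.\<close>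
lemma hecke_sum_modular:
  assumes p: "prime p" and g: "modform k g F" and \<gamma>: "\<gamma> \<in> SL2Z" and z: "Im z > 0"
  shows "(\<Sum>r\<in>tri_reps p. hecke_term k g r (moebius \<gamma> z)) =
         autfac \<gamma> z powi k * (\<Sum>r\<in>tri_reps p. hecke_term k g r z)"
proof -
  have p0: "int p > 0" using prime_gt_0_nat[OF p] by simp
  have "\<exists>s. s \<in> tri_reps p \<and> (\<exists>\<gamma>'\<in>SL2Z. r ** \<gamma> = \<gamma>' ** s)" if "r \<in> tri_reps p" for r
  proof -
    have "det (r ** \<gamma>) = int p" using tri_reps_det[OF that] \<gamma> by (simp add: det_mult_int SL2Z_def)
    from tri_reps_exists[OF p this] show ?thesis by metis
  qed
  then obtain s where s: "\<And>r. r \<in> tri_reps p \<Longrightarrow> s r \<in> tri_reps p"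
    "\<And>r. r \<in> tri_reps p \<Longrightarrow> \<exists>\<gamma>'\<in>SL2Z. r ** \<gamma> = \<gamma>' ** s r" by metis
  have "inj_on s (tri_reps p)"
  proof (rule inj_onI)
    fix r r' assume r: "r \<in> tri_reps p" "r' \<in> tri_reps p" "s r = s r'"
    obtain \<gamma>1 \<gamma>2 where g12: "\<gamma>1 \<in> SL2Z" "\<gamma>2 \<in> SL2Z" "r ** \<gamma> = \<gamma>1 ** s r" "r' ** \<gamma> = \<gamma>2 ** s r"
      using s(2)[OF r(1)] s(2)[OF r(2)] r(3) by auto
    have c: "X ** \<gamma> ** adj \<gamma> = X" for X :: "int^2^2"
      by (metis matrix_mul_assoc matrix_mul_rid mult_adj_SL2(1)[OF \<gamma>])
    have "r = (\<gamma>1 ** adj \<gamma>2) ** r'"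
    proof -
      have "s r = adj \<gamma>2 ** (r' ** \<gamma>)"
        by (metis g12(4) matrix_mul_assoc matrix_mul_lid mult_adj_SL2(2)[OF g12(2)])
      hence "r ** \<gamma> = ((\<gamma>1 ** adj \<gamma>2) ** r') ** \<gamma>" using g12(3) by (simp add: matrix_mul_assoc)
      thus ?thesis by (metis c)
    qed
    thus "r = r'" using tri_reps_unique[OF p r(1,2) SL2Z_mult[OF g12(1) SL2Z_adj[OF g12(2)]]] by simp
  qed
  hence bij: "bij_betw s (tri_reps p) (tri_reps p)"
    using s(1) finite_tri_reps by (simp add: bij_betw_def endo_inj_surj image_subsetI)
  have "hecke_term k g r (moebius \<gamma> z) = autfac \<gamma> z powi k * hecke_term k g (s r) z" if r: "r \<in> tri_reps p" for r
  proof -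
    obtain \<gamma>' where "\<gamma>' \<in> SL2Z" "r ** \<gamma> = \<gamma>' ** s r" using s(2)[OF r] by blast
    thus ?thesis
      using hecke_term_right[OF \<gamma>, of r z k g] hecke_term_left[OF g, of \<gamma>' "s r" z] tri_reps_det[OF r] tri_reps_det[OF s(1)[OF r]] p0 z
      by simp
  qed
  hence "(\<Sum>r\<in>tri_reps p. hecke_term k g r (moebius \<gamma> z)) = autfac \<gamma> z powi k * (\<Sum>r\<in>tri_reps p. hecke_term k g (s r) z)"
    by (simp add: sum_distrib_left)
  also have "(\<Sum>r\<in>tri_reps p. hecke_term k g (s r) z) = (\<Sum>r\<in>tri_reps p. hecke_term k g r z)"
    by (rule sum.reindex_bij_betw[OF bij])
  finally show ?thesis .
qed

lemma hecke_sum_explicit: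
  assumes p: "prime p"
  shows "(\<Sum>r\<in>tri_reps p. hecke_term k g r z) = g (of_nat p * z) + of_nat p powi (- k) * (\<Sum>j<p. g ((z + of_nat j) / of_nat p))"
proof -
  have p1: "int p \<noteq> 1" using prime_gt_1_nat[OF p] by simp
  have "mat2 (int p) 0 0 1 \<notin> (\<lambda>j. mat2 1 (int j) 0 (int p)) ` {..<p}"
    using p1 by (auto simp: mat2_eq_iff)
  moreover have "inj_on (\<lambda>j. mat2 1 (int j) 0 (int p)) {..<p}"
    by (auto simp: inj_on_def mat2_eq_iff)
  ultimately show ?thesis
    by (simp add: tri_reps_def sum.reindex hecke_term_def autfac_def moebius_def sum_distrib_left)
qed

text \<open>The translations by \<open>j/p\<close> average out all coefficients prime to p. The weight is an arbitrary
  integer, because exact forms require Hecke operators in weight \<open>2 - 2n\<close>.\<close>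
lemma hecke_sum_expansion:
  assumes p: "prime p" and g: "modform k g F"
  obtains H where "modform k (\<lambda>z. \<Sum>r\<in>tri_reps p. hecke_term k g r z) H"
    "\<And>m. fls_nth H m = of_nat p powi (1 - k) * fls_nth F (int p * m) +
       (if int p dvd m then fls_nth F (m div int p) else 0)"
proof -
  have p0: "p > 0" using prime_gt_0_nat[OF p] .
  define h where "h z = (\<Sum>r\<in>tri_reps p. hecke_term k g r z)" for z
  define c where "c m = of_nat p powi (1 - k) * fls_nth F (int p * m) +
       (if int p dvd m then fls_nth F (m div int p) else 0)" for m
  have hz: "h z = of_nat p powi (1 - k) * ((\<Sum>i<p. g (z / of_nat p + of_nat i / of_nat p)) / of_nat p) + g (of_nat p * z)" for z
  proof -
    have "of_nat p powi (1 - k) = (of_nat p powi (- k) * of_nat p :: complex)"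
      using p0 by (simp add: power_int_diff power_int_minus field_simps)
    thus ?thesis
      unfolding h_def hecke_sum_explicit[OF p] using p0 by (simp add: add_divide_distrib)
  qed
  have hf: "has_fourier g (fls_nth F)" by (rule qexp_has_fourier[OF modform_qexp[OF g]])
  have four: "((\<lambda>m. c m * nome z powi m) has_sum h z) UNIV" if z: "Im z > 0" for z
  proof -
    have z1: "Im (z / of_nat p) > 0" "Im (of_nat p * z) > 0" using z p0 by simp_all
    have "((\<lambda>m. if int p dvd m then fls_nth F m * nome (z / of_nat p) powi m else 0) has_sum
           (\<Sum>i<p. g (z / of_nat p + of_nat i / of_nat p)) / of_nat p) UNIV"
      using has_fourier_average[OF hf z1(1) p0, of 0] nome_of_int[of 0] by simp
    also have "?this \<longleftrightarrow> ((\<lambda>m. fls_nth F m * nome (z / of_nat p) powi m) has_sum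
           (\<Sum>i<p. g (z / of_nat p + of_nat i / of_nat p)) / of_nat p) {m. int p dvd m}"
      by (rule has_sum_cong_neutral) auto
    also have "\<dots> \<longleftrightarrow> ((\<lambda>m. fls_nth F (int p * m) * nome z powi m) has_sum
           (\<Sum>i<p. g (z / of_nat p + of_nat i / of_nat p)) / of_nat p) UNIV"
      by (rule has_sum_reindex_bij_witness[of _ "\<lambda>m. int p * m" "\<lambda>m. m div int p"])
         (use p0 in \<open>auto simp: nome_powi\<close>)
    finally have "((\<lambda>m. of_nat p powi (1 - k) * (fls_nth F (int p * m) * nome z powi m)) has_sum
           of_nat p powi (1 - k) * ((\<Sum>i<p. g (z / of_nat p + of_nat i / of_nat p)) / of_nat p)) UNIV"
      by (rule has_sum_cmult_right)
    moreover have "((\<lambda>m. fls_nth F m * nome (of_nat p * z) powi m) has_sum g (of_nat p * z)) UNIV"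
      using hf z1(2) unfolding has_fourier_def nome_def[symmetric] by blast
    hence "((\<lambda>m. fls_nth F (m div int p) * nome z powi m) has_sum g (of_nat p * z)) {m. int p dvd m}"
      by (rule has_sum_reindex_bij_witness[of _ "\<lambda>m. m div int p" "\<lambda>m. int p * m", THEN iffD1, rotated -1])
         (use p0 in \<open>auto simp: nome_powi mult_ac\<close>)
    hence "((\<lambda>m. (if int p dvd m then fls_nth F (m div int p) else 0) * nome z powi m) has_sum g (of_nat p * z)) UNIV"
      by (rule has_sum_cong_neutral[THEN iffD1, rotated -1]) auto
    ultimately have "((\<lambda>m. of_nat p powi (1 - k) * (fls_nth F (int p * m) * nome z powi m) +
          (if int p dvd m then fls_nth F (m div int p) else 0) * nome z powi m) has_sum h z) UNIV"
      unfolding hz by (rule has_sum_add)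
    thus ?thesis by (simp add: c_def ring_distribs mult.assoc)
  qed
  have fin: "finite {m. m < 0 \<and> c m \<noteq> 0}"
  proof (rule finite_subset)
    define N where "N = fls_subdegree F"
    have N: "m \<ge> N" if "fls_nth F m \<noteq> 0" for m using that unfolding N_def by (rule fls_subdegree_leI)
    show "{m. m < 0 \<and> c m \<noteq> 0} \<subseteq> {- \<bar>N\<bar> * int p..0}"
    proof safe
      fix m :: int assume m: "m < 0" "c m \<noteq> 0"
      have "fls_nth F (int p * m) \<noteq> 0 \<or> int p dvd m \<and> fls_nth F (m div int p) \<noteq> 0"
        using m(2) by (auto simp: c_def split: if_splits)
      then consider "int p * m \<ge> N" | l where "m = int p * l" "l \<ge> N"
        using N p0 by (fastforce elim!: dvdE)
      thus "m \<in> {- \<bar>N\<bar> * int p..0}"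
      proof cases
        case 1
        have "\<bar>N\<bar> * 1 \<le> \<bar>N\<bar> * int p" using p0 by (intro mult_left_mono) auto
        moreover have "int p * m \<le> 1 * m" using p0 m by (intro mult_right_mono_neg) auto
        ultimately have "- \<bar>N\<bar> * int p \<le> m" using 1 abs_ge_minus_self[of N] unfolding mult_minus_left by linarith
        thus ?thesis using m by simp
      next
        case (2 l)
        hence "- \<bar>N\<bar> * int p \<le> l * int p" by (intro mult_right_mono) auto
        thus ?thesis using 2 m by (simp add: mult.commute)
      qed
    qed
  qed simp
  have "has_fourier h c"
    unfolding has_fourier_def nome_def[symmetric] using four by blast
  then obtain H where H: "qexp h H" "fls_nth H = c"
    by (rule has_fourier_qexp[OF _ fin])
  have "modform k h H"
    using H(1) hecke_sum_modular[OF p g] by (simp add: modform_def h_def)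
  thus ?thesis using that[of H] H(2) by (simp add: h_def[abs_def] c_def)
qed

lemma hecke_dR_expansion:
  assumes p: "prime p" and n: "n \<ge> 1" and g: "modform (2 * int n) g F"
  shows "modform (2 * int n) (hecke_dR n p g) (fls_hecke (2 * n - 1) p F)"
    "\<And>z. Im z > 0 \<Longrightarrow> hecke_dR n p g z = of_nat p ^ (2 * n - 1) * (\<Sum>r\<in>tri_reps p. hecke_term (2 * int n) g r z)"
proof -
  have p0: "p > 0" using prime_gt_0_nat[OF p] .
  obtain H where H: "modform (2 * int n) (\<lambda>z. \<Sum>r\<in>tri_reps p. hecke_term (2 * int n) g r z) H"
    "\<And>m. fls_nth H m = of_nat p powi (1 - 2 * int n) * fls_nth F (int p * m) +
       (if int p dvd m then fls_nth F (m div int p) else 0)"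
    by (rule hecke_sum_expansion[OF p g], rule that)
  have c: "of_nat p ^ (2 * n - 1) * of_nat p powi (1 - 2 * int n) = (1 :: complex)"
  proof -
    have "1 - 2 * int n = - int (2 * n - 1)" using n by simp
    thus ?thesis using p0 by (simp only: power_int_minus power_int_of_nat) simp
  qed
  have FH: "fls_const (of_nat p ^ (2 * n - 1)) * H = fls_hecke (2 * n - 1) p F"
  proof (rule fls_eqI)
    fix m
    have "fls_nth (fls_const (of_nat p ^ (2 * n - 1)) * H) m = (of_nat p ^ (2 * n - 1) * of_nat p powi (1 - 2 * int n)) * fls_nth F (int p * m)
       + of_nat p ^ (2 * n - 1) * (if int p dvd m then fls_nth F (m div int p) else 0)"
      by (simp add: H(2) ring_distribs)
    thus "fls_nth (fls_const (of_nat p ^ (2 * n - 1)) * H) m = fls_nth (fls_hecke (2 * n - 1) p F) m"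
      unfolding c by (simp add: fls_nth_hecke[OF p0])
  qed
  have m: "modform (2 * int n) (\<lambda>z. of_nat p ^ (2 * n - 1) * (\<Sum>r\<in>tri_reps p. hecke_term (2 * int n) g r z)) (fls_hecke (2 * n - 1) p F)"
    using modform_cmult[OF H(1), of "of_nat p ^ (2 * n - 1)"] unfolding FH .
  have "((\<lambda>m. fls_nth (fls_hecke (2 * n - 1) p F) m * nome z powi m) has_sum
      of_nat p ^ (2 * n - 1) * (\<Sum>r\<in>tri_reps p. hecke_term (2 * int n) g r z)) UNIV" if "Im z > 0" for z
    using qexp_has_fourier[OF modform_qexp[OF m]] that unfolding has_fourier_def nome_def by blast
  from infsumI[OF this]
  have eq: "hecke_dR n p g z = of_nat p ^ (2 * n - 1) * (\<Sum>r\<in>tri_reps p. hecke_term (2 * int n) g r z)" if "Im z > 0" for z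
    using that unfolding hecke_dR_def fourier_coeff_qexp[OF modform_qexp[OF g]] fls_nth_hecke[OF p0] nome_def by simp
  show "modform (2 * int n) (hecke_dR n p g) (fls_hecke (2 * n - 1) p F)"
    by (rule modform_cong[OF m]) (use eq in auto)
  show "\<And>z. Im z > 0 \<Longrightarrow> hecke_dR n p g z = of_nat p ^ (2 * n - 1) * (\<Sum>r\<in>tri_reps p. hecke_term (2 * int n) g r z)"
    using eq by simp
qed

section \<open>The Petersson inner product\<close>

subsection \<open>Invariant integration\<close>

definition complex_of_vec :: "real^2 \<Rightarrow> complex" where "complex_of_vec v = Complex (v $ 1) (v $ 2)"
definition vec_of_complex :: "complex \<Rightarrow> real^2" where "vec_of_complex z = vector [Re z, Im z]"
text \<open>Lebesgue integration and its change of variables are carried out in \<open>\<real>\<^sup>2\<close>.\<close>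
definition upper_vec :: "(real^2) set" where "upper_vec = {v. v $ 2 > 0}"

lemma complex_of_vec_vec_of_complex [simp]: "complex_of_vec (vec_of_complex z) = z" and vec_of_complex_complex_of_vec [simp]: "vec_of_complex (complex_of_vec v) = v"
  by (simp_all add: complex_of_vec_def vec_of_complex_def vec_eq_iff forall_2)

lemma complex_of_vec_simps [simp]: "Re (complex_of_vec v) = v $ 1" "Im (complex_of_vec v) = v $ 2"
  by (simp_all add: complex_of_vec_def)

lemma vec_of_complex_nth [simp]: "vec_of_complex z $ 1 = Re z" "vec_of_complex z $ 2 = Im z"
  by (simp_all add: vec_of_complex_def)

lemma bounded_linear_complex_of_vec: "bounded_linear complex_of_vec"
  unfolding linear_conv_bounded_linear[symmetric]
  by (rule linearI) (auto simp: complex_eq_iff)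

lemma bounded_linear_vec_of_complex: "bounded_linear vec_of_complex"
  unfolding linear_conv_bounded_linear[symmetric]
  by (rule linearI) (auto simp: vec_eq_iff forall_2)

lemma open_upper_vec: "open upper_vec"
proof -
  have "upper_vec = complex_of_vec -` upper" by (auto simp: upper_vec_def)
  thus ?thesis
    using open_vimage[OF open_upper] bounded_linear_complex_of_vec by (metis linear_continuous_on)
qed

lemma upper_vec_lebesgue [simp]: "upper_vec \<in> sets lebesgue"
  by (rule sets_completionI_sets) (simp add: open_upper_vec borel_open)

lemma det_complex_mult:
  "det (matrix (\<lambda>h. vec_of_complex (c * complex_of_vec h))) = (norm c)\<^sup>2"
  by (simp add: det_2 matrix_def axis_def cmod_power2) (simp add: power2_eq_square)

text \<open>The Jacobian determinant of a holomorphic map is \<open>\<bar>\<phi>'\<bar>\<^sup>2\<close>.\<close>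
lemma conformal_change_of_variables:
  fixes f :: "real^2 \<Rightarrow> real^2"
  assumes der: "\<And>z. Im z > 0 \<Longrightarrow> (\<phi> has_field_derivative \<phi>' z) (at z)"
    and bij: "bij_betw \<phi> upper upper"
  shows "(\<lambda>v. (norm (\<phi>' (complex_of_vec v)))\<^sup>2 *\<^sub>R f (vec_of_complex (\<phi> (complex_of_vec v)))) absolutely_integrable_on upper_vec \<and>
           integral upper_vec (\<lambda>v. (norm (\<phi>' (complex_of_vec v)))\<^sup>2 *\<^sub>R f (vec_of_complex (\<phi> (complex_of_vec v)))) = b
     \<longleftrightarrow> f absolutely_integrable_on upper_vec \<and> integral upper_vec f = b"
proof -
  let ?g = "\<lambda>v. vec_of_complex (\<phi> (complex_of_vec v))"
  let ?g' = "\<lambda>v h. vec_of_complex (\<phi>' (complex_of_vec v) * complex_of_vec h)"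
  have img: "?g ` upper_vec = upper_vec"
  proof -
    have "complex_of_vec ` upper_vec = upper"
      by (auto simp: upper_vec_def intro!: image_eqI[of _ complex_of_vec "vec_of_complex _"])
    hence "?g ` upper_vec = vec_of_complex ` (\<phi> ` upper)" by (metis image_image)
    also have "\<phi> ` upper = upper" using bij by (simp add: bij_betw_def)
    also have "vec_of_complex ` upper = upper_vec"
      by (auto simp: upper_vec_def intro!: image_eqI[of _ vec_of_complex "complex_of_vec _"])
    finally show ?thesis .
  qed
  have inj: "inj_on ?g upper_vec"
  proof (rule inj_onI)
    fix v w assume vw: "v \<in> upper_vec" "w \<in> upper_vec" "?g v = ?g w"
    hence "\<phi> (complex_of_vec v) = \<phi> (complex_of_vec w)" by (metis complex_of_vec_vec_of_complex)
    hence "complex_of_vec v = complex_of_vec w" using bij vw unfolding bij_betw_def inj_on_def by (auto simp: upper_vec_def)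
    thus "v = w" by (metis vec_of_complex_complex_of_vec)
  qed
  have d: "(?g has_derivative ?g' v) (at v within upper_vec)" if "v \<in> upper_vec" for v
  proof -
    have "(\<phi> has_derivative (\<lambda>h. \<phi>' (complex_of_vec v) * h)) (at (complex_of_vec v))"
      using der[of "complex_of_vec v"] that by (simp add: has_field_derivative_def upper_vec_def)
    moreover have "(complex_of_vec has_derivative complex_of_vec) (at v)"
      by (rule bounded_linear_imp_has_derivative[OF bounded_linear_complex_of_vec])
    ultimately have "((\<lambda>v. \<phi> (complex_of_vec v)) has_derivative (\<lambda>h. \<phi>' (complex_of_vec v) * complex_of_vec h)) (at v)"
      using has_derivative_compose[of complex_of_vec complex_of_vec v UNIV \<phi>] by simp
    from bounded_linear.has_derivative[OF bounded_linear_vec_of_complex this] show ?thesis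
      by (rule has_derivative_at_withinI)
  qed
  show ?thesis
    using has_absolute_integral_change_of_variables[OF upper_vec_lebesgue d inj, of f b]
    unfolding img det_complex_mult by simp
qed

text \<open>The integral with respect to the invariant measure \<open>dx dy / y\<^sup>2\<close>.\<close>
definition hyp_integral :: "(complex \<Rightarrow> complex) \<Rightarrow> complex" where
  "hyp_integral u = integral upper_vec (\<lambda>v. u (complex_of_vec v) / of_real ((v $ 2)\<^sup>2))"

definition hyp_integrable :: "(complex \<Rightarrow> complex) \<Rightarrow> bool" where
  "hyp_integrable u \<longleftrightarrow> (\<lambda>v. u (complex_of_vec v) / of_real ((v $ 2)\<^sup>2)) absolutely_integrable_on upper_vec"

lemma moebius_scalar: "det \<delta> > 0 \<Longrightarrow> Im z > 0 \<Longrightarrow> moebius (adj \<delta>) (moebius \<delta> z) = z"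
  "det \<delta> > 0 \<Longrightarrow> Im z > 0 \<Longrightarrow> autfac (adj \<delta>) (moebius \<delta> z) * autfac \<delta> z = of_int (det \<delta>)"
proof -
  assume d: "det \<delta> > 0" and z: "Im z > 0"
  have e: "(adj \<delta> ** \<delta>) $ 1 $ 1 = det \<delta>" "(adj \<delta> ** \<delta>) $ 1 $ 2 = 0"
    "(adj \<delta> ** \<delta>) $ 2 $ 1 = 0" "(adj \<delta> ** \<delta>) $ 2 $ 2 = det \<delta>"
    by (simp_all add: adj_def det_2 algebra_simps del: mat2_mult_nth add: mat2_mult_nth)
  have "moebius (adj \<delta> ** \<delta>) z = z" unfolding moebius_def e using d by simp
  thus "moebius (adj \<delta>) (moebius \<delta> z) = z"
    using moebius_mult[of "adj \<delta>" \<delta> z] d z by simp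
  have "autfac (adj \<delta> ** \<delta>) z = of_int (det \<delta>)" unfolding autfac_def e by simp
  thus "autfac (adj \<delta>) (moebius \<delta> z) * autfac \<delta> z = of_int (det \<delta>)"
    using autfac_mult[OF d z, of "adj \<delta>"] by simp
qed

lemma bij_moebius:
  assumes "det \<delta> > 0"
  shows "bij_betw (moebius \<delta>) upper upper"
proof (rule bij_betw_byWitness[of _ "moebius (adj \<delta>)"])
  show "\<forall>z\<in>upper. moebius (adj \<delta>) (moebius \<delta> z) = z"
    using moebius_scalar[OF assms] by auto
  show "\<forall>z\<in>upper. moebius \<delta> (moebius (adj \<delta>) z) = z"
    using moebius_scalar(1)[of "adj \<delta>"] assms by auto
qed (use assms Im_moebius_pos[of \<delta>] Im_moebius_pos[of "adj \<delta>"] in auto)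

text \<open>The factor \<open>y\<^sup>-\<^sup>2\<close> compensates the Jacobian also for determinants different from 1.\<close>
lemma hyp_integral_moebius:
  assumes \<delta>: "det \<delta> > 0" and u: "hyp_integrable u"
  shows "hyp_integrable (\<lambda>z. u (moebius \<delta> z))" "hyp_integral (\<lambda>z. u (moebius \<delta> z)) = hyp_integral u"
proof -
  define U where "U v = u (complex_of_vec v) / of_real ((v $ 2)\<^sup>2)" for v
  define \<phi>' where "\<phi>' z = of_int (det \<delta>) / (autfac \<delta> z)\<^sup>2" for z
  have "(\<lambda>v. vec_of_complex (U v)) absolutely_integrable_on upper_vec"
    using absolutely_integrable_linear[OF u[unfolded hyp_integrable_def] bounded_linear_vec_of_complex] by (simp add: o_def U_def)
  hence *: "(\<lambda>v. (norm (\<phi>' (complex_of_vec v)))\<^sup>2 *\<^sub>R vec_of_complex (U (vec_of_complex (moebius \<delta> (complex_of_vec v))))) absolutely_integrable_on upper_vec \<and>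
     integral upper_vec (\<lambda>v. (norm (\<phi>' (complex_of_vec v)))\<^sup>2 *\<^sub>R vec_of_complex (U (vec_of_complex (moebius \<delta> (complex_of_vec v))))) = integral upper_vec (\<lambda>v. vec_of_complex (U v))"
    using conformal_change_of_variables[OF has_field_derivative_moebius[OF \<delta>] bij_moebius[OF \<delta>], of "\<lambda>v. vec_of_complex (U v)" "integral upper_vec (\<lambda>v. vec_of_complex (U v))"]
    by (simp add: \<phi>'_def)
  have eq: "(norm (\<phi>' (complex_of_vec v)))\<^sup>2 *\<^sub>R vec_of_complex (U (vec_of_complex (moebius \<delta> (complex_of_vec v)))) = vec_of_complex (u (moebius \<delta> (complex_of_vec v)) / of_real ((v $ 2)\<^sup>2))"
    if v: "v \<in> upper_vec" for v
  proof -
    have I: "Im (complex_of_vec v) > 0" using v by (simp add: upper_vec_def)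
    define N where "N = norm (autfac \<delta> (complex_of_vec v))"
    have N: "N > 0" using autfac_nonzero[OF \<delta> I] by (simp add: N_def)
    have "(norm (\<phi>' (complex_of_vec v)))\<^sup>2 *\<^sub>R U (vec_of_complex (moebius \<delta> (complex_of_vec v))) =
       of_real ((of_int (det \<delta>) / N\<^sup>2)\<^sup>2 / (of_int (det \<delta>) * v $ 2 / N\<^sup>2)\<^sup>2) * u (moebius \<delta> (complex_of_vec v))"
      using \<delta> by (simp add: U_def \<phi>'_def Im_moebius[OF \<delta> I] norm_divide norm_power scaleR_conv_of_real N_def)
    also have "(of_int (det \<delta>) / N\<^sup>2)\<^sup>2 / (of_int (det \<delta>) * v $ 2 / N\<^sup>2)\<^sup>2 = 1 / (v $ 2)\<^sup>2"
      using N \<delta> I by (simp add: power_divide power_mult_distrib)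
    finally have "(norm (\<phi>' (complex_of_vec v)))\<^sup>2 *\<^sub>R U (vec_of_complex (moebius \<delta> (complex_of_vec v))) = u (moebius \<delta> (complex_of_vec v)) / of_real ((v $ 2)\<^sup>2)"
      by simp
    thus ?thesis using linear_cmul[OF bounded_linear.linear[OF bounded_linear_vec_of_complex]] by metis
  qed
  have A: "(\<lambda>v. vec_of_complex (u (moebius \<delta> (complex_of_vec v)) / of_real ((v $ 2)\<^sup>2))) absolutely_integrable_on upper_vec"
  proof -
    have "set_integrable lebesgue upper_vec (\<lambda>v. (norm (\<phi>' (complex_of_vec v)))\<^sup>2 *\<^sub>R vec_of_complex (U (vec_of_complex (moebius \<delta> (complex_of_vec v))))) =
      set_integrable lebesgue upper_vec (\<lambda>v. vec_of_complex (u (moebius \<delta> (complex_of_vec v)) / of_real ((v $ 2)\<^sup>2)))"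
      by (rule set_integrable_cong[OF refl refl eq])
    thus ?thesis using * by blast
  qed
  have B: "integral upper_vec (\<lambda>v. vec_of_complex (u (moebius \<delta> (complex_of_vec v)) / of_real ((v $ 2)\<^sup>2))) = integral upper_vec (\<lambda>v. vec_of_complex (U v))"
    using * integral_cong[of upper_vec] eq by (metis (no_types, lifting))
  show C: "hyp_integrable (\<lambda>z. u (moebius \<delta> z))"
    using absolutely_integrable_linear[OF A bounded_linear_complex_of_vec] by (simp add: o_def hyp_integrable_def)
  have "vec_of_complex (hyp_integral (\<lambda>z. u (moebius \<delta> z))) = vec_of_complex (hyp_integral u)"
    using integral_linear[OF set_lebesgue_integral_eq_integral(1)[OF C[unfolded hyp_integrable_def]] bounded_linear_vec_of_complex]
      integral_linear[OF set_lebesgue_integral_eq_integral(1)[OF u[unfolded hyp_integrable_def]] bounded_linear_vec_of_complex] B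
    by (simp add: o_def hyp_integral_def U_def)
  thus "hyp_integral (\<lambda>z. u (moebius \<delta> z)) = hyp_integral u" by (metis complex_of_vec_vec_of_complex)
qed

lemma hyp_integral_add: "hyp_integrable u \<Longrightarrow> hyp_integrable w \<Longrightarrow> hyp_integral (\<lambda>z. u z + w z) = hyp_integral u + hyp_integral w"
  unfolding hyp_integral_def hyp_integrable_def add_divide_distrib
  by (intro integral_add set_lebesgue_integral_eq_integral(1))

lemma hyp_integral_sum:
  assumes "finite A" "\<And>a. a \<in> A \<Longrightarrow> hyp_integrable (u a)"
  shows "hyp_integral (\<lambda>z. \<Sum>a\<in>A. u a z) = (\<Sum>a\<in>A. hyp_integral (u a))"
  using assms unfolding hyp_integral_def hyp_integrable_def sum_divide_distrib
  by (intro integral_sum set_lebesgue_integral_eq_integral(1)) auto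

lemma hyp_integral_cmult: "hyp_integral (\<lambda>z. c * u z) = c * hyp_integral u"
proof (cases "c = 0")
  case False
  have "hyp_integral (\<lambda>z. c * u z) = integral upper_vec (\<lambda>v. c * (u (complex_of_vec v) / of_real ((v $ 2)\<^sup>2)))"
    by (simp add: hyp_integral_def)
  also have "\<dots> = c * hyp_integral u" unfolding hyp_integral_def by (rule integral_mult_right)
  finally show ?thesis .
qed (simp add: hyp_integral_def)

lemma hyp_integral_cnj:
  assumes "hyp_integrable u"
  shows "hyp_integral (\<lambda>z. cnj (u z)) = cnj (hyp_integral u)"
proof -
  have "integral upper_vec (cnj \<circ> (\<lambda>v. u (complex_of_vec v) / of_real ((v $ 2)\<^sup>2))) = cnj (hyp_integral u)"
    unfolding hyp_integral_def
    by (intro integral_linear bounded_linear_cnj set_lebesgue_integral_eq_integral(1)) (use assms in \<open>simp add: hyp_integrable_def\<close>)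
  thus ?thesis by (simp add: hyp_integral_def o_def)
qed

lemma hyp_integral_cong: "(\<And>z. Im z > 0 \<Longrightarrow> u z = w z) \<Longrightarrow> hyp_integral u = hyp_integral w"
  unfolding hyp_integral_def by (rule integral_cong) (simp add: upper_vec_def)

subsection \<open>A weight function summing to one over each orbit\<close>

text \<open>Unlike the fundamental domain, the strip is easily described, and it still meets every orbit in
  finitely many points; multiplicities are corrected by a weight function.\<close>
definition strip :: "complex set" where "strip = {z. \<bar>Re z\<bar> \<le> 1/2 \<and> Im z \<ge> 1/2}"

definition strip_overlap :: "int \<Rightarrow> (int^2^2) set" where
  "strip_overlap p = {\<delta>. det \<delta> = p \<and> (\<exists>z\<in>strip. moebius \<delta> z \<in> strip)}"

lemma strip_upper: "z \<in> strip \<Longrightarrow> Im z > 0"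
  by (simp add: strip_def)

lemma strip_overlap_adj:
  assumes "p > 0" "\<delta> \<in> strip_overlap p"
  shows "adj \<delta> \<in> strip_overlap p"
proof -
  obtain z where z: "z \<in> strip" "moebius \<delta> z \<in> strip" "det \<delta> = p" using assms by (auto simp: strip_overlap_def)
  have "moebius (adj \<delta>) (moebius \<delta> z) = z" using moebius_scalar(1) z assms strip_upper by blast
  thus ?thesis using z unfolding strip_overlap_def by force
qed

lemma strip_overlap_bottom_row:
  assumes p: "p > 0" and \<delta>: "\<delta> \<in> strip_overlap p"
  shows "\<bar>\<delta> $ 2 $ 1\<bar> \<le> 4 * p" "\<delta> $ 2 $ 1 \<noteq> 0 \<Longrightarrow> \<bar>\<delta> $ 2 $ 2\<bar> \<le> 2 * p + 4 * p * (1 + 2 * p)"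
proof -
  obtain z where z: "z \<in> strip" "moebius \<delta> z \<in> strip" "det \<delta> = p" using \<delta> by (auto simp: strip_overlap_def)
  define c d where "c = \<delta> $ 2 $ 1" "d = \<delta> $ 2 $ 2"
  define y where "y = Im z"
  have y: "y \<ge> 1/2" using z by (simp add: strip_def y_def)
  define N where "N = norm (autfac \<delta> z)"
  have N: "N > 0" using autfac_nonzero[of \<delta> z] p z strip_upper by (simp add: N_def)
  have "1/2 \<le> of_int p * y / N\<^sup>2"
    using z Im_moebius[of \<delta> z] p strip_upper by (simp add: strip_def y_def N_def)
  hence 1: "N\<^sup>2 \<le> 2 * of_int p * y" using N by (simp add: field_simps)
  have "\<bar>of_int c * y\<bar> \<le> N"
    using abs_Im_le_cmod[of "autfac \<delta> z"] by (simp add: autfac_def c_d_def y_def N_def)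
  hence "(of_int c * y)\<^sup>2 \<le> N\<^sup>2" by (rule power2_le_iff_abs_le[THEN iffD2, rotated]) (use N in simp)
  hence "(of_int c)\<^sup>2 * y * y \<le> 2 * of_int p * y" using 1 by (simp add: power2_eq_square mult_ac)
  hence cy: "(of_int c)\<^sup>2 * y \<le> 2 * of_int p" using y by simp
  have "(of_int c)\<^sup>2 * (1/2) \<le> (of_int c)\<^sup>2 * y" using y by (intro mult_left_mono) auto
  hence "(of_int c)\<^sup>2 \<le> (4 * of_int p :: real)" using cy by linarith
  hence c2: "c\<^sup>2 \<le> 4 * p" by (metis of_int_le_iff of_int_mult of_int_numeral of_int_power)
  have "\<bar>c\<bar> \<le> \<bar>c\<bar> * \<bar>c\<bar>" 
  proof (cases "c = 0")
    case False
    hence "1 \<le> \<bar>c\<bar>" by linarith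
    from mult_left_mono[OF this abs_ge_zero[of c]] show ?thesis by (simp only: mult_1_right)
  qed simp
  also have "\<bar>c\<bar> * \<bar>c\<bar> = c\<^sup>2" by (simp only: abs_mult_self_eq power2_eq_square)
  finally have cp: "\<bar>c\<bar> \<le> 4 * p" using c2 by linarith
  thus "\<bar>\<delta> $ 2 $ 1\<bar> \<le> 4 * p" by (simp add: c_d_def)
  show "\<bar>\<delta> $ 2 $ 2\<bar> \<le> 2 * p + 4 * p * (1 + 2 * p)" if "\<delta> $ 2 $ 1 \<noteq> 0"
  proof -
    have "c \<noteq> 0" using that by (simp add: c_d_def)
    hence "1 \<le> c\<^sup>2" using zero_less_power2[of c] by linarith
    hence "(1::real) \<le> (of_int c)\<^sup>2" by (metis of_int_1_le_iff of_int_power)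
    hence "1 * y \<le> (of_int c)\<^sup>2 * y" using y by (intro mult_right_mono) auto
    hence yp: "y \<le> 2 * of_int p" using cy by linarith
    have "2 * of_int p * y \<le> 2 * of_int p * (2 * of_int p)" using yp p by (intro mult_left_mono) auto
    with 1 have "N\<^sup>2 \<le> 2 * of_int p * (2 * of_int p)" by linarith
    hence "N\<^sup>2 \<le> (2 * of_int p)\<^sup>2" by (simp only: power2_eq_square)
    hence Np: "N \<le> 2 * of_int p" by (rule power2_le_imp_le) (use p in auto)
    have "norm z \<le> \<bar>Re z\<bar> + \<bar>Im z\<bar>" by (rule cmod_le)
    hence zp: "norm z \<le> 1 + 2 * of_int p" using yp y z by (simp add: strip_def y_def)
    have "norm (of_int d :: complex) \<le> N + norm (of_int c * z)"
      using norm_triangle_ineq4[of "autfac \<delta> z" "of_int c * z"] by (simp add: autfac_def c_d_def N_def)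
    also have "norm (of_int c * z) \<le> of_int (4 * p) * (1 + 2 * of_int p)"
    proof -
      have "of_int \<bar>c\<bar> \<le> (of_int (4 * p) :: real)" using cp by (rule of_int_le_iff[THEN iffD2])
      hence cr: "norm (of_int c :: complex) \<le> of_int (4 * p)" by (simp only: of_int_abs norm_of_int)
      show ?thesis unfolding norm_mult by (rule mult_mono[OF cr zp]) (use p in simp_all)
    qed
    finally have "norm (of_int d :: complex) \<le> N + of_int (4 * p) * (1 + 2 * of_int p)" by simp
    moreover have "norm (of_int d :: complex) = of_int \<bar>d\<bar>" by simp
    moreover have "(of_int (2 * p + 4 * p * (1 + 2 * p)) :: real) = 2 * of_int p + of_int (4 * p) * (1 + 2 * of_int p)" by simp
    ultimately have "of_int \<bar>d\<bar> \<le> (of_int (2 * p + 4 * p * (1 + 2 * p)) :: real)" using Np by linarith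
    thus ?thesis by (simp only: of_int_le_iff c_d_def)
  qed
qed

text \<open>The heights of the point and of its image bound the bottom row; those for the adjugate
  bound the diagonal.\<close>
lemma finite_strip_overlap:
  assumes p: "p > 0"
  shows "finite (strip_overlap p)"
proof -
  define B where "B = 2 * p + 4 * p * (1 + 2 * p)"
  have "4 * p * 1 \<le> 4 * p * (1 + 2 * p)" using p by (intro mult_left_mono) auto
  hence B: "p \<le> B" "4 * p \<le> B" "B \<ge> 1" using p unfolding B_def by linarith+
  have "strip_overlap p \<subseteq> (\<lambda>(a, b, c, d). mat2 a b c d) ` ({-B..B} \<times> {-(B * B + B)..B * B + B} \<times> {-B..B} \<times> {-B..B})"
  proof
    fix \<delta> assume \<delta>: "\<delta> \<in> strip_overlap p"
    define a b c d where "a = \<delta> $ 1 $ 1" "b = \<delta> $ 1 $ 2" "c = \<delta> $ 2 $ 1" "d = \<delta> $ 2 $ 2"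
    have det: "a * d - b * c = p" using \<delta> by (simp add: strip_overlap_def det_2 a_b_c_d_def)
    have c: "\<bar>c\<bar> \<le> B" using strip_overlap_bottom_row(1)[OF p \<delta>] B by (simp add: a_b_c_d_def)
    have "\<bar>a\<bar> \<le> B \<and> \<bar>d\<bar> \<le> B \<and> \<bar>b\<bar> \<le> B * B + B"
    proof (cases "c = 0")
      case False
      have d: "\<bar>d\<bar> \<le> B" using strip_overlap_bottom_row(2)[OF p \<delta>] False by (simp add: a_b_c_d_def B_def)
      have a: "\<bar>a\<bar> \<le> B" using strip_overlap_bottom_row(2)[OF p strip_overlap_adj[OF p \<delta>]] False
        by (simp add: adj_def a_b_c_d_def B_def)
      have "\<bar>b\<bar> * 1 \<le> \<bar>b\<bar> * \<bar>c\<bar>" using False by (intro mult_left_mono) auto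
      also have "\<dots> = \<bar>a * d - p\<bar>" using det by (simp add: abs_mult[symmetric])
      also have "\<dots> \<le> \<bar>a\<bar> * \<bar>d\<bar> + p" using p by (simp add: abs_mult[symmetric])
      also have "\<dots> \<le> B * B + B" using a d B by (intro add_mono mult_mono) auto
      finally show ?thesis using a d by simp
    next
      case True
      hence ad: "a * d = p" using det by simp
      hence "a dvd p" "d dvd p" by (metis dvd_triv_left, metis dvd_triv_right)
      hence ap: "\<bar>a\<bar> \<le> p" "\<bar>d\<bar> \<le> p" using p zdvd_imp_le[of "\<bar>a\<bar>" p] zdvd_imp_le[of "\<bar>d\<bar>" p] by auto
      obtain z where z: "z \<in> strip" "moebius \<delta> z \<in> strip" using \<delta> by (auto simp: strip_overlap_def)
      have d0: "d \<noteq> 0" using ad p by auto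
      have "moebius \<delta> z = (of_int a * z + of_int b) / of_int d"
        using True by (simp add: moebius_def a_b_c_d_def)
      hence "of_int b = moebius \<delta> z * of_int d - of_int a * z" using d0 by simp
      hence "Re (of_int b) = Re (moebius \<delta> z * of_int d - of_int a * z)" by simp
      hence "of_int b = Re (moebius \<delta> z) * of_int d - of_int a * Re z" by simp
      hence "\<bar>of_int b\<bar> \<le> \<bar>Re (moebius \<delta> z)\<bar> * \<bar>of_int d\<bar> + \<bar>of_int a\<bar> * \<bar>Re z\<bar>"
        by (metis abs_mult abs_triangle_ineq4)
      also have "\<dots> \<le> 1/2 * of_int p + of_int p * (1/2)"
        using z ap p by (intro add_mono mult_mono) (auto simp: strip_def simp flip: of_int_abs)
      finally have "of_int \<bar>b\<bar> \<le> (of_int p :: real)" by simp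
      hence "\<bar>b\<bar> \<le> p" by (simp only: of_int_le_iff)
      moreover have "B \<le> B * B + B" using B by simp
      ultimately show ?thesis using ap B by linarith
    qed
    moreover have "\<delta> = mat2 a b c d" by (simp add: mat2_eq_iff a_b_c_d_def)
    ultimately show "\<delta> \<in> (\<lambda>(a, b, c, d). mat2 a b c d) ` ({-B..B} \<times> {-(B * B + B)..B * B + B} \<times> {-B..B} \<times> {-B..B})"
      using c by (intro image_eqI[of _ _ "(a, b, c, d)"]) auto
  qed
  thus ?thesis by (rule finite_subset) auto
qed

definition visits :: "complex \<Rightarrow> (int^2^2) set" where
  "visits z = {\<gamma>\<in>SL2Z. moebius \<gamma> z \<in> strip}"

text \<open>Integrating against this weight over the strip amounts to integrating over the quotient by
  \<open>SL\<^sub>2(\<int>)\<close>.\<close>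
definition orbit_weight :: "complex \<Rightarrow> real" where
  "orbit_weight z = (if z \<in> strip then 1 / real (card (visits z)) else 0)"

lemma visits_nonempty:
  assumes "Im z > 0"
  shows "visits z \<noteq> {}"
proof -
  obtain \<gamma> where \<gamma>: "\<gamma> \<in> SL2Z" "\<bar>Re (moebius \<gamma> z)\<bar> \<le> 1/2" "norm (moebius \<gamma> z) \<ge> 1"
    using reduction[OF assms] by blast
  hence "Im (moebius \<gamma> z) \<ge> 43/50" using reduced_Im_ge Im_moebius_SL2 assms by blast
  thus ?thesis using \<gamma> by (auto simp: visits_def strip_def)
qed

text \<open>The number of visits is constant along orbits, which is why the weights add up to 1.\<close>
lemma visits_translate:
  assumes "\<gamma> \<in> SL2Z" "Im z > 0"
  shows "bij_betw (\<lambda>\<gamma>'. \<gamma>' ** \<gamma>) (visits (moebius \<gamma> z)) (visits z)"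
proof (rule bij_betw_byWitness[of _ "\<lambda>\<gamma>'. \<gamma>' ** adj \<gamma>"])
  have m: "moebius (\<gamma>' ** \<gamma>) z = moebius \<gamma>' (moebius \<gamma> z)" if "\<gamma>' \<in> SL2Z" for \<gamma>'
    using that assms by (intro moebius_mult) (auto simp: SL2Z_det)
  have m': "moebius (\<gamma>' ** adj \<gamma>) (moebius \<gamma> z) = moebius \<gamma>' z" if "\<gamma>' \<in> SL2Z" for \<gamma>'
    using that assms moebius_mult[of \<gamma>' "adj \<gamma>" "moebius \<gamma> z"]
    by (simp add: SL2Z_det SL2Z_adj Im_moebius_SL2 moebius_adj)
  show "(\<lambda>\<gamma>'. \<gamma>' ** \<gamma>) ` visits (moebius \<gamma> z) \<subseteq> visits z"
    using assms m by (auto simp: visits_def SL2Z_mult)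
  show "(\<lambda>\<gamma>'. \<gamma>' ** adj \<gamma>) ` visits z \<subseteq> visits (moebius \<gamma> z)"
    using assms m' by (auto simp: visits_def SL2Z_mult SL2Z_adj)
qed (use mult_adj_SL2[OF assms(1)] in \<open>auto simp: matrix_mul_assoc[symmetric] matrix_mul_rid\<close>)

lemma visits_strip_overlap: "z \<in> strip \<Longrightarrow> visits z = {\<gamma>\<in>strip_overlap 1. moebius \<gamma> z \<in> strip}"
  by (auto simp: visits_def strip_overlap_def SL2Z_def)

lemma finite_visits:
  assumes "Im z > 0"
  shows "finite (visits z)"
proof -
  obtain \<gamma> where \<gamma>: "\<gamma> \<in> SL2Z" "moebius \<gamma> z \<in> strip" using visits_nonempty[OF assms] by (auto simp: visits_def)
  have "finite (visits (moebius \<gamma> z))"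
    unfolding visits_strip_overlap[OF \<gamma>(2)] using finite_strip_overlap[of 1] by simp
  thus ?thesis using bij_betw_finite[OF visits_translate[OF \<gamma>(1) assms]] by simp
qed

lemma orbit_weight_sum:
  assumes z: "Im z > 0"
  shows "(\<Sum>\<gamma>\<in>visits z. orbit_weight (moebius \<gamma> z)) = 1"
proof -
  have "orbit_weight (moebius \<gamma> z) = 1 / real (card (visits z))" if "\<gamma> \<in> visits z" for \<gamma>
  proof -
    have "card (visits (moebius \<gamma> z)) = card (visits z)"
      using that z by (intro bij_betw_same_card[OF visits_translate]) (auto simp: visits_def)
    thus ?thesis using that by (simp add: orbit_weight_def visits_def)
  qed
  hence "(\<Sum>\<gamma>\<in>visits z. orbit_weight (moebius \<gamma> z)) = (\<Sum>\<gamma>\<in>visits z. 1 / real (card (visits z)))" by simp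
  also have "\<dots> = 1" using finite_visits[OF z] visits_nonempty[OF z] by (simp add: card_eq_0_iff)
  finally show ?thesis .
qed

lemma orbit_weight_bounds: "0 \<le> orbit_weight z" "orbit_weight z \<le> 1" "z \<notin> strip \<Longrightarrow> orbit_weight z = 0"
proof -
  show "orbit_weight z \<le> 1"
  proof (cases "z \<in> strip")
    case True
    hence "card (visits z) \<ge> 1"
      using finite_visits visits_nonempty strip_upper by (metis Suc_leI One_nat_def card_gt_0_iff)
    thus ?thesis by (simp add: orbit_weight_def)
  qed (simp add: orbit_weight_def)
qed (auto simp: orbit_weight_def)

lemma orbit_weight_lower:
  assumes "z \<in> strip"
  shows "orbit_weight z \<ge> 1 / real (Suc (card (strip_overlap 1)))"
proof -
  have "card (visits z) > 0"
    using finite_visits visits_nonempty strip_upper assms by (metis card_gt_0_iff)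
  moreover have "card (visits z) \<le> card (strip_overlap 1)"
    unfolding visits_strip_overlap[OF assms] using finite_strip_overlap[of 1] by (intro card_mono) auto
  ultimately show ?thesis using assms by (simp add: orbit_weight_def frac_le)
qed

lemma measurable_comp_moebius:
  assumes "det \<delta> > 0" "continuous_on upper u"
  shows "(\<lambda>v. u (moebius \<delta> (complex_of_vec v))) \<in> borel_measurable (lebesgue_on upper_vec)"
proof (rule continuous_imp_measurable_on_sets_lebesgue)
  have "continuous_on upper (moebius \<delta>)"
    using has_field_derivative_moebius[OF assms(1)] by (intro continuous_at_imp_continuous_on) (auto intro: DERIV_isCont)
  hence "continuous_on upper (\<lambda>z. u (moebius \<delta> z))"
    by (rule continuous_on_compose2[OF assms(2)]) (use assms Im_moebius_pos in auto)
  moreover have "continuous_on upper_vec complex_of_vec" by (rule linear_continuous_on[OF bounded_linear_complex_of_vec])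
  ultimately show "continuous_on upper_vec (\<lambda>v. u (moebius \<delta> (complex_of_vec v)))"
    by (rule continuous_on_compose2) (auto simp: upper_vec_def)
qed simp

lemma measurable_continuous_upper:
  assumes "continuous_on upper u"
  shows "(\<lambda>v. u (complex_of_vec v)) \<in> borel_measurable (lebesgue_on upper_vec)"
  using measurable_comp_moebius[of "mat 1" u] assms by simp

lemma measurable_strip:
  assumes "det \<delta> > 0"
  shows "{v\<in>upper_vec. moebius \<delta> (complex_of_vec v) \<in> strip} \<in> sets (lebesgue_on upper_vec)"
proof -
  have "(\<lambda>v. Re (moebius \<delta> (complex_of_vec v))) \<in> borel_measurable (lebesgue_on upper_vec)"
    "(\<lambda>v. Im (moebius \<delta> (complex_of_vec v))) \<in> borel_measurable (lebesgue_on upper_vec)"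
    using assms by (intro measurable_comp_moebius continuous_intros; simp)+
  hence "{v\<in>space (lebesgue_on upper_vec). \<bar>Re (moebius \<delta> (complex_of_vec v))\<bar> \<le> 1/2 \<and> Im (moebius \<delta> (complex_of_vec v)) \<ge> 1/2} \<in> sets (lebesgue_on upper_vec)"
    by measurable
  thus ?thesis by (simp add: strip_def)
qed

lemma measurable_orbit_weight:
  assumes "det \<delta> > 0"
  shows "(\<lambda>v. orbit_weight (moebius \<delta> (complex_of_vec v))) \<in> borel_measurable (lebesgue_on upper_vec)"
proof -
  define A where "A \<gamma> = {v\<in>upper_vec. moebius (\<gamma> ** \<delta>) (complex_of_vec v) \<in> strip}" for \<gamma> :: "int^2^2"
  have A: "A \<gamma> \<in> sets (lebesgue_on upper_vec)" if "\<gamma> \<in> strip_overlap 1 \<union> {mat 1}" for \<gamma>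
    unfolding A_def using that assms by (intro measurable_strip) (auto simp: strip_overlap_def det_mult_int)
  have "(\<lambda>v. indicat_real (A (mat 1)) v / (\<Sum>\<gamma>\<in>strip_overlap 1. indicat_real (A \<gamma>) v)) \<in> borel_measurable (lebesgue_on upper_vec)"
    using A by (intro borel_measurable_divide borel_measurable_sum borel_measurable_indicator) auto
  also have "?this \<longleftrightarrow> ?thesis"
  proof (rule measurable_cong)
    fix v assume "v \<in> space (lebesgue_on upper_vec)"
    hence v: "v \<in> upper_vec" by simp
    let ?z = "moebius \<delta> (complex_of_vec v)"
    have "(\<Sum>\<gamma>\<in>strip_overlap 1. indicat_real (A \<gamma>) v) = real (card (visits ?z))" if "?z \<in> strip"
    proof -
      have "indicat_real (A \<gamma>) v = (if moebius \<gamma> ?z \<in> strip then 1 else 0)" if "\<gamma> \<in> strip_overlap 1" for \<gamma>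
        using that v assms by (simp add: A_def indicator_def moebius_mult strip_overlap_def upper_vec_def)
      hence "(\<Sum>\<gamma>\<in>strip_overlap 1. indicat_real (A \<gamma>) v) = (\<Sum>\<gamma>\<in>strip_overlap 1. if moebius \<gamma> ?z \<in> strip then 1 else 0)"
        by (rule sum.cong[OF refl])
      also have "\<dots> = real (card (visits ?z))"
        unfolding visits_strip_overlap[OF that]
        using sum.inter_filter[of "strip_overlap 1" "\<lambda>_. 1 :: real" "\<lambda>\<gamma>. moebius \<gamma> ?z \<in> strip"] finite_strip_overlap[of 1] by simp
      finally show ?thesis .
    qed
    thus "indicat_real (A (mat 1)) v / (\<Sum>\<gamma>\<in>strip_overlap 1. indicat_real (A \<gamma>) v) = orbit_weight ?z"
      using v by (simp add: A_def indicator_def orbit_weight_def)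
  qed
  finally show ?thesis .
qed

text \<open>The boxes \<open>m/2 \<le> y \<le> (m+1)/2\<close> contribute at most a constant times \<open>m\<^sup>-\<^sup>2\<close>.\<close>
lemma strip_area_integrable:
  "(\<lambda>v. if complex_of_vec v \<in> strip then 1 / (v $ 2)\<^sup>2 else 0 :: real) integrable_on upper_vec"
proof -
  define w where "w v = (if complex_of_vec v \<in> strip then 1 / (v $ 2)\<^sup>2 else 0 :: real)" for v :: "real^2"
  define Bx where "Bx m = cbox (vector [-1/2, real (Suc m) / 2]) (vector [1/2, real (Suc (Suc m)) / 2] :: real^2)" for m
  have em: "emeasure lborel (Bx m) = ennreal (1/2)" for m
  proof -
    have "Bx m \<noteq> {}"
      unfolding Bx_def interval_ne_empty_cart by (simp add: forall_2)
    hence "measure lborel (Bx m) = 1/2"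
      unfolding Bx_def by (subst content_cbox_cart) (auto simp: prod_2 UNIV_2 field_simps)
    moreover have "emeasure lborel (Bx m) \<noteq> \<infinity>"
      using emeasure_lborel_cbox_finite unfolding Bx_def by (metis infinity_ennreal_def less_irrefl)
    ultimately show ?thesis by (metis emeasure_eq_ennreal_measure infinity_ennreal_def)
  qed
  have mw: "w \<in> borel_measurable lborel"
  proof -
    have "closed {v. complex_of_vec v \<in> strip}"
      unfolding strip_def by (simp add: Collect_conj_eq) (intro closed_Int closed_Collect_le continuous_intros)
    hence "{v. complex_of_vec v \<in> strip} \<in> sets borel" by (rule borel_closed)
    moreover have "(\<lambda>v::real^2. 1 / (v $ 2)\<^sup>2) \<in> borel_measurable borel"
      by (intro borel_measurable_divide borel_measurable_power borel_measurable_const borel_measurable_continuous_onI continuous_intros)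
    ultimately show ?thesis unfolding w_def by (intro measurable_If) auto
  qed
  have bound: "ennreal (norm (w v)) \<le> (\<Sum>m. ennreal (4 / real (Suc m) ^ 2) * indicator (Bx m) v)" for v
  proof (cases "complex_of_vec v \<in> strip")
    case True
    define m where "m = nat \<lfloor>2 * v $ 2\<rfloor> - 1"
    have y: "v $ 2 \<ge> 1/2" "\<bar>v $ 1\<bar> \<le> 1/2" using True by (auto simp: strip_def)
    have "\<lfloor>2 * v $ 2\<rfloor> \<ge> 1" using y by linarith
    hence "real (Suc m) = of_int \<lfloor>2 * v $ 2\<rfloor>" by (simp add: m_def)
    hence m: "real (Suc m) \<le> 2 * v $ 2" "2 * v $ 2 \<le> real (Suc (Suc m))" by linarith+
    have vB: "v \<in> Bx m" using m y by (auto simp: Bx_def mem_box_cart forall_2)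
    have "(real (Suc m) / 2) ^ 2 \<le> (v $ 2)\<^sup>2" using m by (intro power_mono) auto
    hence "1 / (v $ 2)\<^sup>2 \<le> 1 / (real (Suc m) / 2) ^ 2" by (intro divide_left_mono mult_pos_pos) (use y in auto)
    also have "\<dots> = 4 / real (Suc m) ^ 2" by (simp add: power_divide)
    finally have "ennreal (norm (w v)) \<le> ennreal (4 / real (Suc m) ^ 2) * indicator (Bx m) v"
      using True vB by (simp add: w_def ennreal_leI)
    also have "\<dots> \<le> (\<Sum>m. ennreal (4 / real (Suc m) ^ 2) * indicator (Bx m) v)"
    proof -
      define f where "f m = ennreal (4 / real (Suc m) ^ 2) * indicator (Bx m) v" for m
      have "sum f {m} \<le> suminf f" by (rule sum_le_suminf) auto
      hence "f m \<le> suminf f" by simp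
      thus ?thesis unfolding f_def[abs_def] .
    qed
    finally show ?thesis .
  qed (simp add: w_def)
  have "(\<integral>\<^sup>+v. ennreal (norm (w v)) \<partial>lborel) \<le> (\<integral>\<^sup>+v. (\<Sum>m. ennreal (4 / real (Suc m) ^ 2) * indicator (Bx m) v) \<partial>lborel)"
    by (rule nn_integral_mono) (rule bound)
  also have "\<dots> = (\<Sum>m. \<integral>\<^sup>+v. ennreal (4 / real (Suc m) ^ 2) * indicator (Bx m) v \<partial>lborel)"
    by (rule nn_integral_suminf) (auto simp: Bx_def)
  also have "\<dots> = (\<Sum>m. ennreal (2 / real (Suc m) ^ 2))"
  proof (rule arg_cong[of _ _ suminf], rule ext)
    fix m
    have "(\<integral>\<^sup>+v. ennreal (4 / real (Suc m) ^ 2) * indicator (Bx m) v \<partial>lborel) = ennreal (4 / real (Suc m) ^ 2) * emeasure lborel (Bx m)"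
      by (rule nn_integral_cmult_indicator) (simp add: Bx_def)
    also have "\<dots> = ennreal (2 / real (Suc m) ^ 2)"
      unfolding em by (subst ennreal_mult[symmetric]) auto
    finally show "(\<integral>\<^sup>+v. ennreal (4 / real (Suc m) ^ 2) * indicator (Bx m) v \<partial>lborel) = ennreal (2 / real (Suc m) ^ 2)" .
  qed
  also have "\<dots> < \<infinity>"
  proof -
    have "summable (\<lambda>m. 2 * inverse (real (Suc m) ^ 2))"
      by (intro summable_mult) (subst summable_Suc_iff, rule inverse_power_summable, simp)
    hence "summable (\<lambda>m. 2 / real (Suc m) ^ 2)" by (simp add: divide_inverse)
    hence "(\<Sum>m. ennreal (2 / real (Suc m) ^ 2)) \<noteq> top"
      by (intro ennreal_suminf_neq_top) auto
    thus ?thesis by (simp add: less_top)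
  qed
  finally have "integrable lborel w" using mw by (intro integrableI_bounded) (auto simp: top.not_eq_extremum)
  hence "integrable lebesgue w" using mw by (simp add: integrable_completion)
  hence "w absolutely_integrable_on UNIV" by (simp add: set_integrable_def)
  hence "w absolutely_integrable_on upper_vec" by (rule set_integrable_subset) auto
  thus ?thesis unfolding w_def[abs_def] by (rule set_lebesgue_integral_eq_integral(1))
qed

lemma hyp_integrable_bounded:
  assumes meas: "(\<lambda>v. u (complex_of_vec v)) \<in> borel_measurable (lebesgue_on upper_vec)"
    and B: "\<And>z. z \<in> strip \<Longrightarrow> norm (u z) \<le> B" "\<And>z. Im z > 0 \<Longrightarrow> z \<notin> strip \<Longrightarrow> u z = 0"
  shows "hyp_integrable u"
  unfolding hyp_integrable_def
proof (rule measurable_bounded_by_integrable_imp_absolutely_integrable)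
  have "(\<lambda>v. of_real ((Im (complex_of_vec v))\<^sup>2) :: complex) \<in> borel_measurable (lebesgue_on upper_vec)"
    by (rule measurable_continuous_upper) (intro continuous_intros)
  with meas show "(\<lambda>v. u (complex_of_vec v) / of_real ((v $ 2)\<^sup>2)) \<in> borel_measurable (lebesgue_on upper_vec)"
    by (intro borel_measurable_divide) auto
  show "(\<lambda>v. B * (if complex_of_vec v \<in> strip then 1 / (v $ 2)\<^sup>2 else 0)) integrable_on upper_vec"
    by (intro integrable_on_mult_right strip_area_integrable)
  show "norm (u (complex_of_vec v) / of_real ((v $ 2)\<^sup>2)) \<le> B * (if complex_of_vec v \<in> strip then 1 / (v $ 2)\<^sup>2 else 0)" if "v \<in> upper_vec" for v
    using that B(1)[of "complex_of_vec v"] B(2)[of "complex_of_vec v"]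
    by (auto simp: norm_divide norm_power upper_vec_def divide_right_mono)
qed simp

subsection \<open>The inner product of cusp forms\<close>

definition cusp :: "nat \<Rightarrow> (complex \<Rightarrow> complex) \<Rightarrow> complex fls \<Rightarrow> bool" where
  "cusp k g G \<longleftrightarrow> modform (int k) g G \<and> (\<forall>m\<le>0. fls_nth G m = 0)"

lemma cusp_modform: "cusp k g G \<Longrightarrow> modform (int k) g G"
  by (simp add: cusp_def)

lemma cusp_nth: "cusp k g G \<Longrightarrow> m \<le> 0 \<Longrightarrow> fls_nth G m = 0"
  by (simp add: cusp_def)

lemma cusp_add_cmult:
  "cusp k g G \<Longrightarrow> cusp k h H \<Longrightarrow> cusp k (\<lambda>z. g z + c * h z) (G + fls_const c * H)"
  unfolding cusp_def by (auto intro!: modform_add modform_cmult)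

lemma cusp_continuous: "cusp k g G \<Longrightarrow> continuous_on upper g"
  unfolding cusp_def by (intro holomorphic_on_imp_continuous_on qexp_holomorphic modform_qexp) auto

text \<open>The invariant function \<open>y\<^sup>k \<bar>g\<bar>\<^sup>2\<close> only has to be bounded for large y, where the exponential decay of q
  beats every power of y.\<close>
lemma cusp_bounded:
  assumes g: "cusp k g G"
  obtains M where "M \<ge> 0" "\<And>z. Im z > 0 \<Longrightarrow> (Im z) ^ k * (norm (g z))\<^sup>2 \<le> M"
proof -
  define r0 where "r0 = exp (- pi)"
  have r0: "r0 < 1" "r0 > 0" by (simp_all add: r0_def)
  define G' where "G' = eval_fls (fls_shift 1 G)"
  have rad: "fls_conv_radius G \<ge> 1" using g by (simp add: cusp_def modform_def qexp_def)
  have sub: "fls_subdegree (fls_shift 1 G) \<ge> 0"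
  proof (cases "fls_shift 1 G = 0")
    case False
    thus ?thesis using g by (intro fls_subdegree_geI) (auto simp: cusp_def)
  qed simp
  have "continuous_on (cball 0 r0) G'"
    unfolding G'_def
  proof (rule continuous_on_eval_fls)
    have "ereal (dist 0 x) < fls_conv_radius G" if "dist 0 x \<le> r0" for x :: complex
      by (rule less_le_trans[OF _ rad]) (use that r0 in simp)
    thus "cball (0::complex) r0 \<subseteq> eball 0 (fls_conv_radius (fls_shift 1 G)) -
       (if 0 \<le> fls_subdegree (fls_shift 1 G) then {} else {0})"
      using sub by auto
  qed
  hence "bounded (G' ` cball 0 r0)"
    by (intro compact_imp_bounded compact_continuous_image) auto
  then obtain B where B: "B > 0" "\<And>x. x \<in> cball 0 r0 \<Longrightarrow> norm (G' x) \<le> B"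
    unfolding bounded_pos by auto
  define M where "M = real k ^ k * B\<^sup>2"
  have high: "(Im z) ^ k * (norm (g z))\<^sup>2 \<le> M" if z: "Im z \<ge> 1/2" for z
  proof -
    define y where "y = Im z"
    have y: "y \<ge> 1/2" using z by (simp add: y_def)
    have z0: "Im z > 0" using z by linarith
    have "g z = nome z * G' (nome z)"
      unfolding G'_def using qexp_eval[OF modform_qexp[OF cusp_modform[OF g]] z0] by (simp add: eval_fls_shift)
    moreover have "nome z \<in> cball 0 r0" using y by (simp add: norm_nome r0_def y_def)
    ultimately have "norm (g z) \<le> exp (- 2 * pi * y) * B"
      using B(2) by (simp add: norm_mult norm_nome y_def)
    hence "(norm (g z))\<^sup>2 \<le> (exp (- 2 * pi * y) * B)\<^sup>2" by (intro power_mono) auto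
    also have "\<dots> = exp (- 4 * pi * y) * B\<^sup>2"
      by (simp add: power_mult_distrib power2_eq_square[of "exp _"] flip: exp_add)
    finally have "y ^ k * (norm (g z))\<^sup>2 \<le> y ^ k * (exp (- 4 * pi * y) * B\<^sup>2)"
      using y by (intro mult_left_mono) auto
    also have "\<dots> = y ^ k * exp (- 4 * pi * y) * B\<^sup>2" by simp
    also have "y ^ k \<le> real k ^ k * exp y"
    proof (cases "k = 0")
      case False
      have "y ^ k = real k ^ k * (y / real k) ^ k" using False by (simp add: power_divide)
      also have "\<dots> \<le> real k ^ k * (1 + y / real k) ^ k"
        using y by (intro mult_left_mono power_mono) auto
      also have "\<dots> \<le> real k ^ k * exp y"
        using y False by (intro mult_left_mono exp_ge_one_plus_x_over_n_power_n) auto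
      finally show ?thesis .
    qed (use y in simp)
    hence "y ^ k * exp (- 4 * pi * y) * B\<^sup>2 \<le> real k ^ k * exp y * exp (- 4 * pi * y) * B\<^sup>2"
      by (intro mult_right_mono) auto
    also have "real k ^ k * exp y * exp (- 4 * pi * y) \<le> real k ^ k * 1"
    proof -
      have "4 * pi * y \<ge> 1 * y" using pi_ge_3 y by (intro mult_right_mono) auto
      hence "exp (y + - 4 * pi * y) \<le> 1" by simp
      hence "exp y * exp (- 4 * pi * y) \<le> 1" by (simp only: exp_add)
      thus ?thesis unfolding mult.assoc by (intro mult_left_mono) auto
    qed
    finally show ?thesis by (simp add: M_def y_def mult_right_mono)
  qed
  have "(Im z) ^ k * (norm (g z))\<^sup>2 \<le> M" if z: "Im z > 0" for z
  proof -
    obtain \<gamma> where \<gamma>: "\<gamma> \<in> SL2Z" "moebius \<gamma> z \<in> strip" using visits_nonempty[OF z] by (auto simp: visits_def)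
    have N: "norm (autfac \<gamma> z) > 0" using autfac_nonzero_SL2[OF \<gamma>(1) z] by simp
    have "(Im (moebius \<gamma> z)) ^ k * (norm (g (moebius \<gamma> z)))\<^sup>2 = (Im z) ^ k * (norm (g z))\<^sup>2"
      using N \<gamma>(1) unfolding modformD[OF cusp_modform[OF g] \<gamma>(1) z] Im_moebius[OF SL2Z_det[OF \<gamma>(1)] z]
      by (simp add: SL2Z_def norm_mult norm_power power_mult_distrib power_divide power_even_eq[symmetric] power_mult[symmetric] mult.commute)
    thus ?thesis using high[of "moebius \<gamma> z"] \<gamma>(2) by (simp add: strip_def)
  qed
  moreover have "M \<ge> 0" by (simp add: M_def)
  ultimately show ?thesis using that by blast
qed

definition petersson :: "nat \<Rightarrow> (complex \<Rightarrow> complex) \<Rightarrow> (complex \<Rightarrow> complex) \<Rightarrow> complex" where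
  "petersson k g h = hyp_integral (\<lambda>z. of_real (orbit_weight z * (Im z) ^ k) * (g z * cnj (h z)))"

lemma petersson_integrable:
  assumes u: "continuous_on upper u" "\<And>z. Im z > 0 \<Longrightarrow> (Im z) ^ k * (norm (u z))\<^sup>2 \<le> M"
    and w: "continuous_on upper w" "\<And>z. Im z > 0 \<Longrightarrow> (Im z) ^ k * (norm (w z))\<^sup>2 \<le> M"
    and c: "(\<lambda>v. c (complex_of_vec v)) \<in> borel_measurable (lebesgue_on upper_vec)" "\<And>z. 0 \<le> c z" "\<And>z. c z \<le> 1"
  shows "hyp_integrable (\<lambda>z. of_real (orbit_weight z * c z * (Im z) ^ k) * (u z * cnj (w z)))"
proof (rule hyp_integrable_bounded)
  have "(\<lambda>v. orbit_weight (complex_of_vec v)) \<in> borel_measurable (lebesgue_on upper_vec)"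
    using measurable_orbit_weight[of "mat 1"] by simp
  moreover have "(\<lambda>v. (of_real ((Im (complex_of_vec v)) ^ k) * (u (complex_of_vec v) * cnj (w (complex_of_vec v))))) \<in> borel_measurable (lebesgue_on upper_vec)"
    by (rule measurable_continuous_upper) (intro continuous_intros u w)
  ultimately have "(\<lambda>v. of_real (orbit_weight (complex_of_vec v) * c (complex_of_vec v)) * (of_real ((Im (complex_of_vec v)) ^ k) * (u (complex_of_vec v) * cnj (w (complex_of_vec v))))) \<in> borel_measurable (lebesgue_on upper_vec)"
    using c(1) by measurable
  thus "(\<lambda>v. of_real (orbit_weight (complex_of_vec v) * c (complex_of_vec v) * (Im (complex_of_vec v)) ^ k) * (u (complex_of_vec v) * cnj (w (complex_of_vec v)))) \<in> borel_measurable (lebesgue_on upper_vec)"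
    by (simp add: mult_ac)
  show "norm (of_real (orbit_weight z * c z * (Im z) ^ k) * (u z * cnj (w z))) \<le> M" if "z \<in> strip" for z
  proof -
    have I: "Im z > 0" by (rule strip_upper[OF that])
    have "norm (u z) * norm (w z) \<le> ((norm (u z))\<^sup>2 + (norm (w z))\<^sup>2) / 2"
      using zero_le_power2[of "norm (u z) - norm (w z)"] by (simp add: power2_eq_square algebra_simps)
    hence "(Im z) ^ k * (norm (u z) * norm (w z)) \<le> (Im z) ^ k * (((norm (u z))\<^sup>2 + (norm (w z))\<^sup>2) / 2)"
      using I by (intro mult_left_mono) auto
    also have "\<dots> \<le> M" using u(2)[OF I] w(2)[OF I] by (simp add: algebra_simps)
    finally have 1: "(Im z) ^ k * (norm (u z) * norm (w z)) \<le> M" .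
    have "orbit_weight z * c z * ((Im z) ^ k * (norm (u z) * norm (w z))) \<le> 1 * ((Im z) ^ k * (norm (u z) * norm (w z)))"
      using orbit_weight_bounds(1,2)[of z] c(2,3)[of z] I by (intro mult_right_mono) (auto intro: mult_le_one)
    with 1 show ?thesis using orbit_weight_bounds(1)[of z] c(2)[of z] I by (simp add: norm_mult norm_power mult_ac)
  qed
  show "of_real (orbit_weight z * c z * (Im z) ^ k) * (u z * cnj (w z)) = 0" if "z \<notin> strip" for z
    using orbit_weight_bounds(3)[OF that] by simp
qed

lemma petersson_integrable_cusp:
  assumes "cusp k g G" "cusp k h H"
  shows "hyp_integrable (\<lambda>z. of_real (orbit_weight z * (Im z) ^ k) * (g z * cnj (h z)))"
proof -
  obtain M1 where M1: "M1 \<ge> 0" "\<And>z. Im z > 0 \<Longrightarrow> (Im z) ^ k * (norm (g z))\<^sup>2 \<le> M1"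
    by (rule cusp_bounded[OF assms(1)], rule that)
  obtain M2 where M2: "M2 \<ge> 0" "\<And>z. Im z > 0 \<Longrightarrow> (Im z) ^ k * (norm (h z))\<^sup>2 \<le> M2"
    by (rule cusp_bounded[OF assms(2)], rule that)
  have "hyp_integrable (\<lambda>z. of_real (orbit_weight z * (\<lambda>_. 1) z * (Im z) ^ k) * (g z * cnj (h z)))"
    by (rule petersson_integrable[where M = "M1 + M2"])
       (use M1 M2 cusp_continuous assms in \<open>auto intro: add_increasing2 add_increasing\<close>)
  thus ?thesis by simp
qed

lemma petersson_cnj:
  assumes "cusp k g G" "cusp k h H"
  shows "petersson k h g = cnj (petersson k g h)"
  using hyp_integral_cnj[OF petersson_integrable_cusp[OF assms]] by (simp add: petersson_def mult.commute)

lemma petersson_add_cmult: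
  assumes "cusp k g G" "cusp k h H" "cusp k w W"
  shows "petersson k (\<lambda>z. g z + c * h z) w = petersson k g w + c * petersson k h w"
proof -
  have "petersson k (\<lambda>z. g z + c * h z) w = hyp_integral (\<lambda>z. of_real (orbit_weight z * (Im z) ^ k) * (g z * cnj (w z)) + of_real (orbit_weight z * (Im z) ^ k) * ((c * h z) * cnj (w z)))"
    unfolding petersson_def by (rule hyp_integral_cong) (simp add: algebra_simps)
  also have "\<dots> = petersson k g w + hyp_integral (\<lambda>z. of_real (orbit_weight z * (Im z) ^ k) * ((c * h z) * cnj (w z)))"
    unfolding petersson_def
  proof (rule hyp_integral_add)
    have "cusp k (\<lambda>z. c * h z) (fls_const c * H)" using assms(2) by (auto simp: cusp_def intro!: modform_cmult)
    from petersson_integrable_cusp[OF this assms(3)]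
    show "hyp_integrable (\<lambda>z. of_real (orbit_weight z * (Im z) ^ k) * ((c * h z) * cnj (w z)))" .
  qed (rule petersson_integrable_cusp[OF assms(1,3)])
  also have "hyp_integral (\<lambda>z. of_real (orbit_weight z * (Im z) ^ k) * ((c * h z) * cnj (w z))) = hyp_integral (\<lambda>z. c * (of_real (orbit_weight z * (Im z) ^ k) * (h z * cnj (w z))))"
    by (rule hyp_integral_cong) (simp add: mult_ac)
  also have "\<dots> = c * petersson k h w" unfolding petersson_def by (rule hyp_integral_cmult)
  finally show ?thesis .
qed

text \<open>The weight is bounded below on the strip, so the continuous function g vanishes on a box, hence
  everywhere.\<close>
lemma petersson_definite:
  assumes g: "cusp k g G" and zero: "petersson k g g = 0"
  shows "G = 0"
proof -
  define c where "c = 1 / real (Suc (card (strip_overlap 1)))"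
  have c0: "c > 0" by (simp add: c_def)
  define a b where "a = (vector [-1/4, 1] :: real^2)" "b = (vector [1/4, 2] :: real^2)"
  have ab: "v \<in> cbox a b \<longleftrightarrow> v $ 1 \<in> {-1/4..1/4} \<and> v $ 2 \<in> {1..2}" for v
    by (auto simp: a_b_def mem_box_cart forall_2)
  define q where "q v = orbit_weight (complex_of_vec v) * (v $ 2) ^ k * (norm (g (complex_of_vec v)))\<^sup>2 / (v $ 2)\<^sup>2" for v
  define r where "r v = c * (v $ 2) ^ k * (norm (g (complex_of_vec v)))\<^sup>2 / (v $ 2)\<^sup>2" for v
  have cont: "continuous_on upper_vec (\<lambda>v. g (complex_of_vec v))"
    by (rule continuous_on_compose2[OF cusp_continuous[OF g] linear_continuous_on[OF bounded_linear_complex_of_vec]]) (auto simp: upper_vec_def)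
  have sub: "cbox a b \<subseteq> upper_vec" by (auto simp: ab upper_vec_def)
  have contr: "continuous_on (cbox a b) r"
    unfolding r_def by (intro continuous_intros continuous_on_subset[OF cont sub]) (auto simp: ab)
  have I: "hyp_integrable (\<lambda>z. of_real (orbit_weight z * (Im z) ^ k) * (g z * cnj (g z)))"
    by (rule petersson_integrable_cusp[OF g g])
  have qeq: "q v = Re (of_real (orbit_weight (complex_of_vec v) * (Im (complex_of_vec v)) ^ k) * (g (complex_of_vec v) * cnj (g (complex_of_vec v))) / of_real ((v $ 2)\<^sup>2))" for v
  proof -
    have "of_real (orbit_weight (complex_of_vec v) * (Im (complex_of_vec v)) ^ k) * (g (complex_of_vec v) * cnj (g (complex_of_vec v))) / of_real ((v $ 2)\<^sup>2) = complex_of_real (q v)"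
      by (simp add: q_def complex_norm_square[symmetric])
    thus ?thesis by (metis Re_complex_of_real)
  qed
  have qi: "q integrable_on upper_vec" 
    unfolding qeq[abs_def] using integrable_linear[OF set_lebesgue_integral_eq_integral(1)[OF I[unfolded hyp_integrable_def]] bounded_linear_Re] by (simp add: o_def)
  have "integral upper_vec q = Re (petersson k g g)"
    unfolding qeq[abs_def] petersson_def hyp_integral_def
    using integral_linear[OF set_lebesgue_integral_eq_integral(1)[OF I[unfolded hyp_integrable_def]] bounded_linear_Re] by (simp add: o_def)
  hence q0: "integral upper_vec q = 0" by (simp add: zero)
  have q_nonneg: "0 \<le> q v" if "v \<in> upper_vec" for v
    using that orbit_weight_bounds(1)[of "complex_of_vec v"] by (simp add: q_def upper_vec_def)
  have ri: "r integrable_on cbox a b" by (rule integrable_continuous[OF contr])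
  have qib: "q integrable_on cbox a b"
  proof -
    have "q absolutely_integrable_on upper_vec" using qi q_nonneg by (subst absolutely_integrable_on_iff_nonneg) auto
    hence "q absolutely_integrable_on cbox a b" by (rule set_integrable_subset) (use sub in auto)
    thus ?thesis by (rule set_lebesgue_integral_eq_integral(1))
  qed
  have "integral (cbox a b) r \<le> integral (cbox a b) q"
  proof (rule integral_le[OF ri qib])
    fix v assume v: "v \<in> cbox a b"
    hence "complex_of_vec v \<in> strip" by (auto simp: ab strip_def)
    hence "c \<le> orbit_weight (complex_of_vec v)" using orbit_weight_lower by (simp add: c_def)
    hence "c * ((v $ 2) ^ k * (norm (g (complex_of_vec v)))\<^sup>2 / (v $ 2)\<^sup>2) \<le> orbit_weight (complex_of_vec v) * ((v $ 2) ^ k * (norm (g (complex_of_vec v)))\<^sup>2 / (v $ 2)\<^sup>2)"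
      using v by (intro mult_right_mono) (auto simp: ab)
    thus "r v \<le> q v" by (simp add: r_def q_def mult.assoc)
  qed
  also have "\<dots> \<le> integral upper_vec q"
    by (rule integral_subset_le[OF sub qib qi]) (use q_nonneg in auto)
  finally have "integral (cbox a b) r \<le> integral upper_vec q" .
  moreover have r_nonneg: "0 \<le> r v" if "v \<in> cbox a b" for v
    using that c0 by (auto simp: r_def ab)
  hence "0 \<le> integral (cbox a b) r" by (intro integral_nonneg ri) auto
  ultimately have hi: "(r has_integral 0) (cbox a b)"
    using ri q0 by (metis integrable_integral order_antisym)
  have r0: "r v = 0" if "v \<in> cbox a b" for v
    by (rule has_integral_0_cbox_imp_0[OF contr _ hi _ that])
       (use r_nonneg box_subset_cbox in \<open>auto simp: a_b_def interval_ne_empty_cart forall_2\<close>)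
  have gz: "g z = 0" if "z \<in> ball (3/2 * \<i>) (1/8)" for z
  proof -
    have "\<bar>Re (3/2 * \<i> - z)\<bar> < 1/8" "\<bar>Im (3/2 * \<i> - z)\<bar> < 1/8"
      using that abs_Re_le_cmod[of "3/2 * \<i> - z"] abs_Im_le_cmod[of "3/2 * \<i> - z"] by (auto simp: dist_norm)
    hence "vec_of_complex z \<in> cbox a b" by (auto simp: ab abs_if split: if_splits)
    from r0[OF this] this show ?thesis using c0 by (auto simp: r_def ab)
  qed
  have "g z = 0" if "Im z > 0" for z
  proof (rule analytic_continuation_open[of "ball (3/2 * \<i>) (1/8)" upper g "\<lambda>_. 0"])
    show "g holomorphic_on upper" by (rule qexp_holomorphic[OF modform_qexp[OF cusp_modform[OF g]]])
    show "connected upper" by (rule convex_connected[OF convex_upper])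
    show "ball (3/2 * \<i>) (1/8) \<subseteq> upper"
    proof
      fix z assume "z \<in> ball (3/2 * \<i>) (1/8)"
      hence "\<bar>Im (3/2 * \<i> - z)\<bar> < 1/8" using abs_Im_le_cmod[of "3/2 * \<i> - z"] by (auto simp: dist_norm)
      thus "z \<in> upper" by (simp add: abs_if split: if_splits)
    qed
  qed (use that gz open_upper in auto)
  thus ?thesis by (rule qexp_zero_imp[OF modform_qexp[OF cusp_modform[OF g]]])
qed

text \<open>Inserting the weight at the image point turns the sum over left cosets into a finite sum over
  all integer matrices of determinant p that move the strip to itself.\<close>
lemma hecke_unfold:
  assumes p: "prime p" and g: "modform k g F" and z: "z \<in> strip"
  shows "(\<Sum>r\<in>tri_reps p. hecke_term k g r z) =
    (\<Sum>\<delta>\<in>strip_overlap (int p). of_real (orbit_weight (moebius \<delta> z)) * hecke_term k g \<delta> z)"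
proof -
  have I: "Im z > 0" by (rule strip_upper[OF z])
  have p0: "int p > 0" using prime_gt_0_nat[OF p] by simp
  have Ir: "Im (moebius r z) > 0" "det r > 0" if "r \<in> tri_reps p" for r
    using tri_reps_det[OF that] p0 by (auto intro: Im_moebius_pos I)
  define A where "A r = visits (moebius r z)" for r
  have "(\<Sum>r\<in>tri_reps p. hecke_term k g r z) = (\<Sum>r\<in>tri_reps p. \<Sum>\<gamma>\<in>A r. of_real (orbit_weight (moebius (\<gamma> ** r) z)) * hecke_term k g (\<gamma> ** r) z)"
  proof (rule sum.cong[OF refl])
    fix r assume r: "r \<in> tri_reps p"
    have "(\<Sum>\<gamma>\<in>A r. of_real (orbit_weight (moebius (\<gamma> ** r) z)) * hecke_term k g (\<gamma> ** r) z) =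
       (\<Sum>\<gamma>\<in>A r. of_real (orbit_weight (moebius \<gamma> (moebius r z))) * hecke_term k g r z)"
    proof (rule sum.cong[OF refl])
      fix \<gamma> assume "\<gamma> \<in> A r"
      hence \<gamma>: "\<gamma> \<in> SL2Z" by (simp add: A_def visits_def)
      show "of_real (orbit_weight (moebius (\<gamma> ** r) z)) * hecke_term k g (\<gamma> ** r) z = of_real (orbit_weight (moebius \<gamma> (moebius r z))) * hecke_term k g r z"
        by (simp add: hecke_term_left[OF g \<gamma> Ir(2)[OF r] I] moebius_mult[OF SL2Z_det[OF \<gamma>] Ir(2)[OF r] I])
    qed
    also have "\<dots> = of_real (\<Sum>\<gamma>\<in>A r. orbit_weight (moebius \<gamma> (moebius r z))) * hecke_term k g r z"
      by (simp add: sum_distrib_right)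
    also have "(\<Sum>\<gamma>\<in>A r. orbit_weight (moebius \<gamma> (moebius r z))) = 1"
      unfolding A_def by (rule orbit_weight_sum[OF Ir(1)[OF r]])
    finally show "hecke_term k g r z = (\<Sum>\<gamma>\<in>A r. of_real (orbit_weight (moebius (\<gamma> ** r) z)) * hecke_term k g (\<gamma> ** r) z)" by simp
  qed
  also have "\<dots> = (\<Sum>(r, \<gamma>)\<in>Sigma (tri_reps p) A. of_real (orbit_weight (moebius (\<gamma> ** r) z)) * hecke_term k g (\<gamma> ** r) z)"
    by (rule sum.Sigma) (auto simp: finite_tri_reps A_def intro!: finite_visits Ir)
  also have "\<dots> = (\<Sum>\<delta>\<in>{\<delta>. det \<delta> = int p \<and> moebius \<delta> z \<in> strip}. of_real (orbit_weight (moebius \<delta> z)) * hecke_term k g \<delta> z)"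
  proof -
    have bij: "bij_betw (\<lambda>(r, \<gamma>). \<gamma> ** r) (Sigma (tri_reps p) A) {\<delta>. det \<delta> = int p \<and> moebius \<delta> z \<in> strip}"
      unfolding bij_betw_def
    proof
      show "inj_on (\<lambda>(r, \<gamma>). \<gamma> ** r) (Sigma (tri_reps p) A)"
      proof (rule inj_onI, clarify)
        fix r \<gamma> r' \<gamma>' assume h: "r \<in> tri_reps p" "\<gamma> \<in> A r" "r' \<in> tri_reps p" "\<gamma>' \<in> A r'" "\<gamma> ** r = \<gamma>' ** r'"
        have \<gamma>: "\<gamma> \<in> SL2Z" "\<gamma>' \<in> SL2Z" using h by (auto simp: A_def visits_def)
        have "r = (adj \<gamma> ** \<gamma>') ** r'"
          using h(5) mult_adj_SL2(2)[OF \<gamma>(1)] by (metis matrix_mul_assoc matrix_mul_lid)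
        hence rr: "r = r'" using tri_reps_unique[OF p h(1,3)] SL2Z_mult SL2Z_adj \<gamma> by blast
        have "(\<gamma> ** r) ** adj r = (\<gamma>' ** r) ** adj r" using h(5) rr by simp
        moreover have "((X ** r) ** adj r) $ i $ l = int p * X $ i $ l" for X :: "int^2^2" and i l
        proof -
          have d: "r $ 1 $ 1 * r $ 2 $ 2 - r $ 1 $ 2 * r $ 2 $ 1 = int p" using tri_reps_det[OF h(1)] by (simp add: det_2)
          have "l = 1 \<or> l = 2" using exhaust_2 by blast
          thus ?thesis unfolding d[symmetric] by (auto simp: adj_def algebra_simps)
        qed
        ultimately have "int p * \<gamma> $ i $ l = int p * \<gamma>' $ i $ l" for i l by metis
        hence "\<gamma> = \<gamma>'" using p0 by (simp add: mat2_eq_iff)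
        thus "r = r' \<and> \<gamma> = \<gamma>'" using rr by simp
      qed
      show "(\<lambda>(r, \<gamma>). \<gamma> ** r) ` Sigma (tri_reps p) A = {\<delta>. det \<delta> = int p \<and> moebius \<delta> z \<in> strip}"
      proof (intro equalityI subsetI)
        fix \<delta> assume "\<delta> \<in> (\<lambda>(r, \<gamma>). \<gamma> ** r) ` Sigma (tri_reps p) A"
        then obtain r \<gamma> where h: "r \<in> tri_reps p" "\<gamma> \<in> A r" "\<delta> = \<gamma> ** r" by auto
        have \<gamma>: "\<gamma> \<in> SL2Z" "moebius \<gamma> (moebius r z) \<in> strip" using h by (auto simp: A_def visits_def)
        show "\<delta> \<in> {\<delta>. det \<delta> = int p \<and> moebius \<delta> z \<in> strip}"
          using \<gamma> h tri_reps_det[OF h(1)] by (simp add: det_mult_int SL2Z_def moebius_mult[OF SL2Z_det[OF \<gamma>(1)] Ir(2)[OF h(1)] I])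
      next
        fix \<delta> assume \<delta>: "\<delta> \<in> {\<delta>. det \<delta> = int p \<and> moebius \<delta> z \<in> strip}"
        then obtain \<gamma> r where h: "\<gamma> \<in> SL2Z" "r \<in> tri_reps p" "\<delta> = \<gamma> ** r"
          using tri_reps_exists[OF p] by blast
        hence "\<gamma> \<in> A r" using \<delta> by (simp add: A_def visits_def moebius_mult[OF SL2Z_det[OF h(1)] Ir(2)[OF h(2)] I])
        thus "\<delta> \<in> (\<lambda>(r, \<gamma>). \<gamma> ** r) ` Sigma (tri_reps p) A" using h by (intro image_eqI[of _ _ "(r, \<gamma>)"]) auto
      qed
    qed
    show ?thesis
      using sum.reindex_bij_betw[OF bij, of "\<lambda>\<delta>. of_real (orbit_weight (moebius \<delta> z)) * hecke_term k g \<delta> z"]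
      by (simp add: case_prod_unfold)
  qed
  also have "\<dots> = (\<Sum>\<delta>\<in>strip_overlap (int p). of_real (orbit_weight (moebius \<delta> z)) * hecke_term k g \<delta> z)"
    by (rule sum.mono_neutral_left[OF finite_strip_overlap[OF p0]])
       (use z orbit_weight_bounds(3) in \<open>auto simp: strip_overlap_def\<close>)
  finally show ?thesis .
qed

lemma hecke_term_continuous:
  assumes "cusp k g G" "det \<delta> > 0"
  shows "continuous_on upper (hecke_term (int k) g \<delta>)"
proof -
  have "continuous_on upper (moebius \<delta>)"
    using has_field_derivative_moebius[OF assms(2)] by (intro continuous_at_imp_continuous_on) (auto intro: DERIV_isCont)
  hence "continuous_on upper (\<lambda>z. g (moebius \<delta> z))"
    by (rule continuous_on_compose2[OF cusp_continuous[OF assms(1)]]) (use assms Im_moebius_pos in auto)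
  moreover have "continuous_on upper (\<lambda>z. autfac \<delta> z powi (- int k))"
    unfolding autfac_def using autfac_nonzero[OF assms(2)] by (intro continuous_intros) (auto simp: autfac_def)
  ultimately show ?thesis unfolding hecke_term_def by (intro continuous_on_mult)
qed

lemma hecke_term_bound:
  assumes M: "\<And>z. Im z > 0 \<Longrightarrow> (Im z) ^ k * (norm (g z))\<^sup>2 \<le> M" and \<delta>: "det \<delta> > 0" and z: "Im z > 0"
  shows "(Im z) ^ k * (norm (hecke_term (int k) g \<delta> z))\<^sup>2 \<le> M"
proof -
  define N where "N = norm (autfac \<delta> z)"
  have N: "N > 0" using autfac_nonzero[OF \<delta> z] by (simp add: N_def)
  have d: "(1::real) \<le> of_int (det \<delta>)" using \<delta> by simp
  have "(norm (hecke_term (int k) g \<delta> z))\<^sup>2 = (norm (g (moebius \<delta> z)))\<^sup>2 / (N\<^sup>2) ^ k"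
    by (simp add: hecke_term_def norm_mult norm_power power_mult_distrib N_def power_int_minus norm_inverse power_inverse divide_inverse mult.commute flip: power_mult)
  hence "(Im z) ^ k * (norm (hecke_term (int k) g \<delta> z))\<^sup>2 = (1 * Im z / N\<^sup>2) ^ k * (norm (g (moebius \<delta> z)))\<^sup>2"
    by (simp add: power_divide)
  also have "\<dots> \<le> (of_int (det \<delta>) * Im z / N\<^sup>2) ^ k * (norm (g (moebius \<delta> z)))\<^sup>2"
    using d z N by (intro mult_right_mono power_mono divide_right_mono) auto
  also have "of_int (det \<delta>) * Im z / N\<^sup>2 = Im (moebius \<delta> z)" by (simp add: Im_moebius[OF \<delta> z] N_def)
  also have "\<dots> ^ k * (norm (g (moebius \<delta> z)))\<^sup>2 \<le> M" by (rule M[OF Im_moebius_pos[OF \<delta> z]])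
  finally show ?thesis .
qed

text \<open>Substituting \<open>z = \<delta>\<^sup>* w\<close> with the adjugate exchanges the roles of the two cusp forms and of
  the two weight factors.\<close>
lemma hecke_summand_adjoint:
  assumes g: "cusp k g G" and h: "cusp k h H" and \<delta>: "det \<delta> > 0"
  defines "A \<equiv> \<lambda>\<delta> g h z. of_real (orbit_weight z * orbit_weight (moebius \<delta> z) * (Im z) ^ k) * (hecke_term (int k) g \<delta> z * cnj (h z))"
  shows "hyp_integrable (A \<delta> g h)" "hyp_integral (A \<delta> g h) = cnj (hyp_integral (A (adj \<delta>) h g))"
proof -
  have int: "hyp_integrable (A \<delta> g h)" if g: "cusp k g G" and h: "cusp k h H" and \<delta>: "det \<delta> > 0" for g h G H \<delta>
  proof -
    obtain M1 where M1: "M1 \<ge> 0" "\<And>z. Im z > 0 \<Longrightarrow> (Im z) ^ k * (norm (g z))\<^sup>2 \<le> M1"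
      by (rule cusp_bounded[OF g], rule that)
    obtain M2 where M2: "M2 \<ge> 0" "\<And>z. Im z > 0 \<Longrightarrow> (Im z) ^ k * (norm (h z))\<^sup>2 \<le> M2"
      by (rule cusp_bounded[OF h], rule that)
    have b1: "(Im z) ^ k * (norm (hecke_term (int k) g \<delta> z))\<^sup>2 \<le> M1 + M2" if "Im z > 0" for z
      using hecke_term_bound[OF M1(2) \<delta> that] M2(1) by simp
    have b2: "(Im z) ^ k * (norm (h z))\<^sup>2 \<le> M1 + M2" if "Im z > 0" for z
      using M2(2)[OF that] M1(1) by simp
    show ?thesis
      unfolding A_def
      by (rule petersson_integrable[OF hecke_term_continuous[OF g \<delta>] b1 cusp_continuous[OF h] b2 measurable_orbit_weight[OF \<delta>] orbit_weight_bounds(1,2)])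
  qed
  show "hyp_integrable (A \<delta> g h)" by (rule int[OF g h \<delta>])
  have \<delta>': "det (adj \<delta>) > 0" using \<delta> by simp
  have eq: "A \<delta> g h (moebius (adj \<delta>) w) = cnj (A (adj \<delta>) h g w)" if w: "Im w > 0" for w
  proof -
    define z where "z = moebius (adj \<delta>) w"
    have z: "Im z > 0" unfolding z_def by (rule Im_moebius_pos[OF \<delta>' w])
    have mz: "moebius \<delta> z = w" using moebius_scalar(1)[OF \<delta>' w] by (simp add: z_def)
    define a b where "a = autfac (adj \<delta>) w" "b = autfac \<delta> z"
    have ab: "b * a = of_int (det \<delta>)" using moebius_scalar(2)[OF \<delta>' w] by (simp add: a_b_def z_def)
    have d0: "of_int (det \<delta>) \<noteq> (0 :: complex)" using \<delta> by simp
    have a0: "a \<noteq> 0" using ab d0 by auto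
    have "b = of_int (det \<delta>) / a" using ab a0 by (simp add: field_simps)
    hence binv: "b powi (- int k) = a ^ k / of_int (det \<delta>) ^ k"
      by (simp add: power_int_minus power_divide)
    have "Im z = of_int (det \<delta>) * Im w / (norm a)\<^sup>2"
      unfolding z_def using Im_moebius[OF \<delta>' w] by (simp add: a_b_def)
    hence "of_real (Im z) = of_int (det \<delta>) * of_real (Im w) / (a * cnj a)"
      by (simp add: complex_norm_square[symmetric] flip: of_real_power)
    hence Imz: "of_real ((Im z) ^ k) = of_int (det \<delta>) ^ k * of_real ((Im w) ^ k) / (a ^ k * cnj a ^ k)"
      by (simp add: power_divide power_mult_distrib)
    have hh: "h z = cnj (cnj a ^ k * cnj (hecke_term (int k) h (adj \<delta>) w))"
      using a0 by (simp add: hecke_term_def z_def a_b_def power_int_minus)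
    have "A \<delta> g h z = of_real (orbit_weight z * orbit_weight w) * (of_real ((Im z) ^ k) * (b powi (- int k) * g w * cnj (h z)))"
      by (simp add: A_def mz hecke_term_def a_b_def mult_ac)
    also have "of_real ((Im z) ^ k) * (b powi (- int k) * g w * cnj (h z)) =
        of_real ((Im w) ^ k) * (cnj (hecke_term (int k) h (adj \<delta>) w) * g w)"
      unfolding Imz binv hh using a0 d0 by (simp add: field_simps)
    finally show ?thesis by (simp add: A_def z_def mult_ac)
  qed
  have "hyp_integral (A \<delta> g h) = hyp_integral (\<lambda>w. A \<delta> g h (moebius (adj \<delta>) w))"
    by (rule hyp_integral_moebius(2)[OF \<delta>' int[OF g h \<delta>], symmetric])
  also have "\<dots> = hyp_integral (\<lambda>w. cnj (A (adj \<delta>) h g w))" by (rule hyp_integral_cong) (rule eq)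
  also have "\<dots> = cnj (hyp_integral (A (adj \<delta>) h g))" by (rule hyp_integral_cnj[OF int[OF h g \<delta>']])
  finally show "hyp_integral (A \<delta> g h) = cnj (hyp_integral (A (adj \<delta>) h g))" .
qed

text \<open>Taking adjugates is an involution of the matrices of determinant p that occur in the unfolded sum.\<close>
lemma hecke_self_adjoint:
  assumes p: "prime p" and g: "cusp k g G" and h: "cusp k h H"
  defines "T \<equiv> \<lambda>g z. \<Sum>r\<in>tri_reps p. hecke_term (int k) g r z"
  shows "petersson k (T g) h = cnj (petersson k (T h) g)"
proof -
  have p0: "int p > 0" using prime_gt_0_nat[OF p] by simp
  define A where "A \<delta> g h z = of_real (orbit_weight z * orbit_weight (moebius \<delta> z) * (Im z) ^ k) * (hecke_term (int k) g \<delta> z * cnj (h z))" for \<delta> g h z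
  have unf: "petersson k (T g) h = (\<Sum>\<delta>\<in>strip_overlap (int p). hyp_integral (A \<delta> g h))" if g: "cusp k g G" and h: "cusp k h H" for g h G H
  proof -
    have "petersson k (T g) h = hyp_integral (\<lambda>z. \<Sum>\<delta>\<in>strip_overlap (int p). A \<delta> g h z)"
      unfolding petersson_def
    proof (rule hyp_integral_cong)
      fix z :: complex assume "Im z > 0"
      show "of_real (orbit_weight z * (Im z) ^ k) * (T g z * cnj (h z)) = (\<Sum>\<delta>\<in>strip_overlap (int p). A \<delta> g h z)"
      proof (cases "z \<in> strip")
        case True
        show ?thesis unfolding T_def hecke_unfold[OF p cusp_modform[OF g] True] A_def
          by (simp add: sum_distrib_left sum_distrib_right mult_ac)
      next
        case False
        thus ?thesis using orbit_weight_bounds(3) by (simp add: A_def)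
      qed
    qed
    also have "\<dots> = (\<Sum>\<delta>\<in>strip_overlap (int p). hyp_integral (A \<delta> g h))"
      by (rule hyp_integral_sum[OF finite_strip_overlap[OF p0]])
         (use hecke_summand_adjoint(1)[OF g h] p0 in \<open>auto simp: strip_overlap_def A_def\<close>)
    finally show ?thesis .
  qed
  have "petersson k (T g) h = (\<Sum>\<delta>\<in>strip_overlap (int p). cnj (hyp_integral (A (adj \<delta>) h g)))"
    unfolding unf[OF g h]
    by (rule sum.cong[OF refl]) (use hecke_summand_adjoint(2)[OF g h] p0 in \<open>auto simp: strip_overlap_def A_def[abs_def]\<close>)
  also have "\<dots> = (\<Sum>\<delta>\<in>strip_overlap (int p). cnj (hyp_integral (A \<delta> h g)))"
    by (rule sum.reindex_bij_witness[of _ adj adj]) (use strip_overlap_adj[OF p0] in auto)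
  also have "\<dots> = cnj (petersson k (T h) g)" unfolding unf[OF h g] by simp
  finally show ?thesis .
qed

subsection \<open>Eigenfunctionals\<close>

lemma cusp_zero: "cusp k (\<lambda>z. 0) 0"
  by (simp add: cusp_def modform_def qexp_zero)

text \<open>Cusp forms are determined by finitely many coefficients, so orthogonal projections onto
  subspaces exist: the induction is on the number of coefficients that separate the subspace, as in
  the Gram--Schmidt process.\<close>
lemma orthogonal_projection:
  assumes W: "\<And>g G. (g, G) \<in> W \<Longrightarrow> cusp k g G" "(\<lambda>z. 0, 0) \<in> W"
    "\<And>g G h H c. (g, G) \<in> W \<Longrightarrow> (h, H) \<in> W \<Longrightarrow> (\<lambda>z. g z + c * h z, G + fls_const c * H) \<in> W"
    and sep: "\<And>g G. (g, G) \<in> W \<Longrightarrow> (\<forall>i\<le>d. fls_nth G (int i) = 0) \<Longrightarrow> G = 0"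
    and g: "cusp k g G"
  obtains u U where "(u, U) \<in> W" "\<And>w V. (w, V) \<in> W \<Longrightarrow> petersson k (\<lambda>z. g z + (-1) * u z) w = 0"
proof -
  have zero: "petersson k v w = 0" if "cusp k v V" "cusp k w V'" "V' = 0" for v w V V'
  proof -
    have "w z = 0" if "Im z > 0" for z
      using qexp_eval[OF modform_qexp[OF cusp_modform[OF \<open>cusp k w V'\<close>]] that] \<open>V' = 0\<close> by simp
    hence "petersson k v w = hyp_integral (\<lambda>z. 0)" unfolding petersson_def by (intro hyp_integral_cong) simp
    thus ?thesis by (simp add: hyp_integral_def)
  qed
  have addr: "petersson k v (\<lambda>z. x z + c * y z) = petersson k v x + cnj c * petersson k v y"
    if "cusp k v V" "cusp k x X" "cusp k y Y" for v x y V X Y c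
  proof -
    have "petersson k v (\<lambda>z. x z + c * y z) = cnj (petersson k (\<lambda>z. x z + c * y z) v)"
      by (rule petersson_cnj[OF cusp_add_cmult[OF that(2,3)] that(1)])
    also have "\<dots> = cnj (petersson k x v) + cnj c * cnj (petersson k y v)"
      by (simp add: petersson_add_cmult[OF that(2,3,1)])
    also have "\<dots> = petersson k v x + cnj c * petersson k v y"
      using petersson_cnj[OF that(2) that(1)] petersson_cnj[OF that(3) that(1)] by simp
    finally show ?thesis .
  qed
  have "\<exists>u U. (u, U) \<in> W \<and> (\<forall>w V. (w, V) \<in> W \<longrightarrow> petersson k (\<lambda>z. g z + (-1) * u z) w = 0)"
    if "\<And>g G. (g, G) \<in> W \<Longrightarrow> cusp k g G" "(\<lambda>z. 0, 0) \<in> W"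
    "\<And>g G h H c. (g, G) \<in> W \<Longrightarrow> (h, H) \<in> W \<Longrightarrow> (\<lambda>z. g z + c * h z, G + fls_const c * H) \<in> W"
    "\<And>g G. (g, G) \<in> W \<Longrightarrow> (\<forall>i<d. fls_nth G (int i) = 0) \<Longrightarrow> G = 0"
    "cusp k g G" for W d g G
    using that
  proof (induction d arbitrary: W g G)
    case 0
    have "petersson k (\<lambda>z. g z + (-1) * 0) w = 0" if "(w, V) \<in> W" for w V
      using zero[OF 0(5) 0(1)[OF that]] 0(4)[OF that] by simp
    thus ?case using 0(2) by (intro exI[of _ "\<lambda>z. 0"] exI[of _ 0]) auto
  next
    case (Suc d)
    \<comment> \<open>The subspace of codimension at most one on which the last separating coefficient vanishes.\<close>
    define W' where "W' = {(h, H) \<in> W. fls_nth H (int d) = 0}"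
    have ih: "\<exists>u U. (u, U) \<in> W' \<and> (\<forall>w V. (w, V) \<in> W' \<longrightarrow> petersson k (\<lambda>z. g z + (-1) * u z) w = 0)"
      if "cusp k g G" for g G
      by (rule Suc.IH[OF _ _ _ _ that]) (use Suc.prems in \<open>auto simp: W'_def less_Suc_eq\<close>)
    show ?case
    proof (cases "W' = W")
      case True
      thus ?thesis using ih[OF Suc.prems(5)] by simp
    next
      case False
      then obtain a A where a: "(a, A) \<in> W" "fls_nth A (int d) \<noteq> 0" by (auto simp: W'_def)
      obtain b B where b: "(b, B) \<in> W'" "\<And>w V. (w, V) \<in> W' \<Longrightarrow> petersson k (\<lambda>z. a z + (-1) * b z) w = 0"
        using ih[OF Suc.prems(1)[OF a(1)]] by blast
      \<comment> \<open>The component of a orthogonal to W' spans a complement of W' in W.\<close>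
      define e E where "e = (\<lambda>z. a z + (-1) * b z)" "E = A + fls_const (-1) * B"
      have eW: "(e, E) \<in> W" unfolding e_E_def using a b by (intro Suc.prems(3)) (auto simp: W'_def)
      have e_d: "fls_nth E (int d) \<noteq> 0" using a b by (auto simp: e_E_def W'_def)
      have ce: "cusp k e E" by (rule Suc.prems(1)[OF eW])
      have ee: "petersson k e e \<noteq> 0" using petersson_definite[OF ce] e_d by auto
      have eW': "petersson k e w = 0" if "(w, V) \<in> W'" for w V using b(2)[OF that] by (simp add: e_E_def)
      obtain u U where u: "(u, U) \<in> W'" "\<And>w V. (w, V) \<in> W' \<Longrightarrow> petersson k (\<lambda>z. g z + (-1) * u z) w = 0"
        using ih[OF Suc.prems(5)] by blast
      have uW: "(u, U) \<in> W" using u(1) by (simp add: W'_def)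
      define x X where "x = (\<lambda>z. g z + (-1) * u z)" "X = G + fls_const (-1) * U"
      have cx: "cusp k x X" unfolding x_X_def by (rule cusp_add_cmult[OF Suc.prems(5) Suc.prems(1)[OF uW]])
      define c where "c = petersson k x e / petersson k e e"
      have "petersson k (\<lambda>z. g z + (-1) * (u z + c * e z)) w = 0" if w: "(w, V) \<in> W" for w V
      proof -
        define t where "t = fls_nth V (int d) / fls_nth E (int d)"
        define y Y where "y = (\<lambda>z. w z + (- t) * e z)" "Y = V + fls_const (- t) * E"
        have cw: "cusp k w V" by (rule Suc.prems(1)[OF w])
        have yW': "(y, Y) \<in> W'"
          using Suc.prems(3)[OF w eW, of "-t"] e_d by (simp add: W'_def y_Y_def t_def)
        have cy: "cusp k y Y" using yW' Suc.prems(1) by (auto simp: W'_def)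
        have weq: "w = (\<lambda>z. y z + t * e z)" by (simp add: y_Y_def)
        have "petersson k (\<lambda>z. g z + (-1) * (u z + c * e z)) w = petersson k (\<lambda>z. x z + (- c) * e z) w"
          by (simp add: x_X_def algebra_simps)
        also have "\<dots> = petersson k x w + (- c) * petersson k e w"
          by (rule petersson_add_cmult[OF cx ce cw])
        also have "petersson k x w = petersson k x y + cnj t * petersson k x e"
          unfolding weq by (rule addr[OF cx cy ce])
        also have "petersson k x y = 0" using u(2)[OF yW'] by (simp add: x_X_def)
        also have "petersson k e w = petersson k e y + cnj t * petersson k e e"
          unfolding weq by (rule addr[OF ce cy ce])
        also have "petersson k e y = 0" by (rule eW'[OF yW'])
        finally show ?thesis using ee by (simp add: c_def)
      qed
      moreover have "(\<lambda>z. u z + c * e z, U + fls_const c * E) \<in> W" by (rule Suc.prems(3)[OF uW eW])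
      ultimately show ?thesis by blast
    qed
  qed
  from this[of W "Suc d" g G]
  have "\<exists>u U. (u, U) \<in> W \<and> (\<forall>w V. (w, V) \<in> W \<longrightarrow> petersson k (\<lambda>z. g z + (-1) * u z) w = 0)"
    using W sep g unfolding less_Suc_eq_le by force
  thus ?thesis using that by force
qed

text \<open>Multiplicity one: the eigenvalue of \<open>T\<^sub>p\<close> determines the coefficient at \<open>p r\<close> from those at r and
  \<open>r / p\<close>.\<close>
lemma hecke_eigen_coeffs:
  assumes F: "\<And>m. m \<le> 0 \<Longrightarrow> fls_nth F m = 0" "\<And>p. prime p \<Longrightarrow> fls_hecke j p F = fls_const (l p) * F" "fls_nth F 1 = 1"
    and G: "\<And>m. m \<le> 0 \<Longrightarrow> fls_nth G m = 0" "\<And>p. prime p \<Longrightarrow> fls_hecke j p G = fls_const (l p) * G"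
  shows "G = fls_const (fls_nth G 1) * F"
proof (rule fls_eqI)
  fix m :: int
  have "fls_nth G (int i) = fls_nth G 1 * fls_nth F (int i)" for i
  proof (induction i rule: less_induct)
    case (less i)
    consider "i = 0" | "i = 1" | "i > 1" by linarith
    thus ?case
    proof cases
      case 3
      then obtain p where p: "prime p" "p dvd i" using prime_factor_nat[of i] by auto
      then obtain r where r: "i = p * r" by auto
      have p1: "p > 1" using prime_gt_1_nat[OF p(1)] .
      have r0: "r > 0" using 3 r by (cases r) auto
      have ri: "r < i" using p1 r0 r by simp
      have rec: "fls_nth H (int i) = l p * fls_nth H (int r) -
          of_nat p ^ j * (if int p dvd int r then fls_nth H (int (r div p)) else 0)"
        if "fls_hecke j p H = fls_const (l p) * H" for H
      proof -
        have "fls_nth (fls_hecke j p H) (int r) = l p * fls_nth H (int r)" unfolding that by simp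
        moreover have "int r div int p = int (r div p)" by (simp add: zdiv_int)
        ultimately show ?thesis using p1 by (auto simp: fls_nth_hecke r algebra_simps split: if_splits)
      qed
      have "r div p < i" using ri p1 by (meson div_le_dividend order_le_less_trans)
      thus ?thesis
        unfolding rec[OF F(2)[OF p(1)]] rec[OF G(2)[OF p(1)]] using less[OF ri] less[of "r div p"]
        by (simp add: algebra_simps)
    qed (use F G in auto)
  qed
  from this[of "nat m"] show "fls_nth G m = fls_nth (fls_const (fls_nth G 1) * F) m"
    using F(1) G(1) by (cases "m \<le> 0") auto
qed

lemma hecke_cusp:
  assumes "prime p" "n \<ge> 1" "cusp (2 * n) g G"
  shows "cusp (2 * n) (hecke_dR n p g) (fls_hecke (2 * n - 1) p G)"
proof -
  have "modform (int (2 * n)) (hecke_dR n p g) (fls_hecke (2 * n - 1) p G)"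
    using hecke_dR_expansion(1)[OF assms(1,2), of g G] assms(3) by (simp add: cusp_def)
  moreover have "fls_nth (fls_hecke (2 * n - 1) p G) m = 0" if "m \<le> 0" for m
  proof -
    have "int p * m \<le> 0" using that by (simp add: mult_nonneg_nonpos)
    moreover have "m div int p \<le> 0" using that prime_gt_0_nat[OF assms(1)] by (simp add: div_nonpos_pos_le0)
    ultimately show ?thesis using assms(3) prime_gt_0_nat[OF assms(1)] by (simp add: fls_nth_hecke cusp_def)
  qed
  ultimately show ?thesis by (simp add: cusp_def)
qed

lemma petersson_hecke:
  assumes p: "prime p" and n: "n \<ge> 1" and g: "cusp (2 * n) g G" and h: "cusp (2 * n) h H"
  shows "petersson (2 * n) (hecke_dR n p g) h = cnj (petersson (2 * n) (hecke_dR n p h) g)"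
proof -
  have eq: "petersson (2 * n) (hecke_dR n p g) h = of_nat p ^ (2 * n - 1) * petersson (2 * n) (\<lambda>z. \<Sum>r\<in>tri_reps p. hecke_term (int (2 * n)) g r z) h"
    if g: "cusp (2 * n) g G" for g h G
  proof -
    have "petersson (2 * n) (hecke_dR n p g) h = hyp_integral (\<lambda>z. of_nat p ^ (2 * n - 1) * (of_real (orbit_weight z * (Im z) ^ (2 * n)) * ((\<Sum>r\<in>tri_reps p. hecke_term (int (2 * n)) g r z) * cnj (h z))))"
      unfolding petersson_def
      by (rule hyp_integral_cong) (use hecke_dR_expansion(2)[OF p n, of g G] cusp_modform[OF g] in \<open>simp add: mult_ac\<close>)
    thus ?thesis unfolding petersson_def by (simp only: hyp_integral_cmult)
  qed
  show ?thesis unfolding eq[OF g] eq[OF h] using hecke_self_adjoint[OF p g h] by simp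
qed

text \<open>Hecke operators are self-adjoint, so on cusp forms a linear functional with the eigenvalues of f
  is determined by its value at f: an element orthogonal to its kernel is an eigenform with these
  eigenvalues, hence a multiple of f by multiplicity one.\<close>
lemma eigenfunctional_zero:
  assumes n: "n \<ge> 1" and f: "cusp (2 * n) f F" "fls_nth F 1 = 1"
    and eig: "\<And>p. prime p \<Longrightarrow> fls_hecke (2 * n - 1) p F = fls_const (l p) * F"
    and E: "\<And>p g G. prime p \<Longrightarrow> cusp (2 * n) g G \<Longrightarrow>
              pair j E (fls_hecke (2 * n - 1) p G) = l p * pair j E G"
    and zero: "pair j E F = 0" and g: "cusp (2 * n) g G"
  shows "pair j E G = 0"
proof -
  define k where "k = 2 * n"
  define W where "W = {(h, H). cusp k h H \<and> pair j E H = 0}"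
  have WI: "(\<lambda>z. g z + c * h z, G + fls_const c * H) \<in> W" if "(g, G) \<in> W" "(h, H) \<in> W" for g G h H c
    using that unfolding W_def by (auto intro: cusp_add_cmult simp: pair_add_right pair_cmult_right)
  have sep: "H = 0" if "(h, H) \<in> W" "\<forall>i\<le>k. fls_nth H (int i) = 0" for h H
  proof -
    have h: "cusp k h H" using that by (simp add: W_def)
    have "fls_nth H m = 0" if "m < int (Suc k)" for m
      using \<open>\<forall>i\<le>k. fls_nth H (int i) = 0\<close>[rule_format, of "nat m"] cusp_nth[OF h, of m] that by (cases "m \<le> 0") auto
    hence "h z = 0" if "Im z > 0" for z
      by (intro sturm_bound[OF cusp_modform[OF h], of "Suc k"]) (use that in auto)
    thus ?thesis by (rule qexp_zero_imp[OF modform_qexp[OF cusp_modform[OF h]]])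
  qed
  have "fls_int j 0 = 0" for j by (rule fls_eqI) (simp add: fls_nth_int)
  hence W0: "(\<lambda>z. 0, 0) \<in> W" using cusp_zero by (simp add: W_def pair_def)
  obtain u U where u: "(u, U) \<in> W" "\<And>w V. (w, V) \<in> W \<Longrightarrow> petersson k (\<lambda>z. g z + (-1) * u z) w = 0"
    by (rule orthogonal_projection[of W k k g G, OF _ W0 WI sep])
       (use g in \<open>auto simp: W_def k_def\<close>)
  define x X where "x = (\<lambda>z. g z + (-1) * u z)" "X = G + fls_const (-1) * U"
  have cx: "cusp k x X" unfolding x_X_def using g u(1) by (intro cusp_add_cmult) (auto simp: W_def k_def)
  have EX: "pair j E X = pair j E G"
    using u(1) unfolding x_X_def pair_add_right pair_cmult_right by (simp add: W_def)
  have "fls_hecke (2 * n - 1) p X = fls_const (l p) * X" if p: "prime p" for p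
  proof -
    define T where "T = hecke_dR n p x"
    define h H where "h = (\<lambda>z. T z + (- l p) * x z)" "H = fls_hecke (2 * n - 1) p X + fls_const (- l p) * X"
    have cT: "cusp k T (fls_hecke (2 * n - 1) p X)"
      unfolding T_def k_def by (rule hecke_cusp[OF p n cx[unfolded k_def]])
    have ch: "cusp k h H" unfolding h_H_def by (rule cusp_add_cmult[OF cT cx])
    have hW: "(h, H) \<in> W"
    proof -
      have "pair j E H = 0"
        unfolding h_H_def(2) pair_add_right pair_cmult_right E[OF p cx[unfolded k_def]] by simp
      thus ?thesis using ch by (simp add: W_def)
    qed
    have cTh: "cusp k (hecke_dR n p h) (fls_hecke (2 * n - 1) p H)"
      unfolding k_def by (rule hecke_cusp[OF p n ch[unfolded k_def]])
    have ThW: "(hecke_dR n p h, fls_hecke (2 * n - 1) p H) \<in> W"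
      using cTh hW E[OF p ch[unfolded k_def]] by (simp add: W_def)
    have "petersson k h h = petersson k T h + (- l p) * petersson k x h"
      unfolding h_H_def(1)[of ] by (rule petersson_add_cmult[OF cT cx ch[unfolded h_H_def]])
    also have "petersson k T h = cnj (petersson k (hecke_dR n p h) x)"
      unfolding T_def k_def by (rule petersson_hecke[OF p n cx[unfolded k_def] ch[unfolded k_def]])
    also have "petersson k (hecke_dR n p h) x = cnj (petersson k x (hecke_dR n p h))" by (rule petersson_cnj[OF cx cTh])
    also have "petersson k x (hecke_dR n p h) = 0" using u(2)[OF ThW] by (simp add: x_X_def)
    also have "petersson k x h = 0" using u(2)[OF hW] by (simp add: x_X_def)
    finally have "petersson k h h = 0" by simp
    hence "H = 0" by (rule petersson_definite[OF ch])
    hence "fls_hecke (2 * n - 1) p X + fls_const (- l p) * X = 0" by (simp only: h_H_def)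
    moreover have "fls_const (- l p) * X = - (fls_const (l p) * X)"
      by (rule fls_eqI) simp
    ultimately show ?thesis by (simp add: algebra_simps)
  qed
  hence "X = fls_const (fls_nth X 1) * F"
    by (intro hecke_eigen_coeffs[of F "2 * n - 1" l X]) (use f eig cx cusp_nth in auto)
  hence "pair j E X = fls_nth X 1 * pair j E F" by (metis pair_cmult_right)
  thus ?thesis using EX zero by simp
qed

section \<open>Bol's identity\<close>

text \<open>Sequences of successive derivatives are used instead of iterated derivatives, so that
  explicit formulas can be given for them.\<close>
lemma derivative_chain_unique:
  fixes U V :: "nat \<Rightarrow> complex \<Rightarrow> complex"
  assumes U: "\<And>i z. Im z > 0 \<Longrightarrow> (U i has_field_derivative U (Suc i) z) (at z)"
    and V: "\<And>i z. Im z > 0 \<Longrightarrow> (V i has_field_derivative V (Suc i) z) (at z)"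
    and 0: "\<And>z. Im z > 0 \<Longrightarrow> U 0 z = V 0 z" and z: "Im z > 0"
  shows "U i z = V i z"
  using z
proof (induction i arbitrary: z)
  case (Suc i)
  have "(V i has_field_derivative U (Suc i) z) (at z)"
    by (rule has_field_derivative_transform_within_open[OF U[OF Suc.prems] open_upper])
       (use Suc in auto)
  thus ?case using V[OF Suc.prems] DERIV_unique by blast
qed (rule 0)

text \<open>Iterated derivatives of \<open>(c z + d)\<^sup>m h(\<gamma> z)\<close>. Raising m by one multiplies the function by a linear
  factor, so only two terms of the Leibniz rule survive, and the contributions of c cancel.\<close>
lemma bol_chain:
  fixes H :: "nat \<Rightarrow> complex \<Rightarrow> complex"
  assumes \<gamma>: "\<gamma> \<in> SL2Z" and H: "\<And>i z. Im z > 0 \<Longrightarrow> (H i has_field_derivative H (Suc i) z) (at z)"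
  obtains U where "\<And>i z. Im z > 0 \<Longrightarrow> (U i has_field_derivative U (Suc i) z) (at z)"
    "\<And>z. Im z > 0 \<Longrightarrow> U 0 z = autfac \<gamma> z ^ m * H 0 (moebius \<gamma> z)"
    "\<And>z. Im z > 0 \<Longrightarrow> U (Suc m) z = H (Suc m) (moebius \<gamma> z) / autfac \<gamma> z ^ (m + 2)"
proof -
  define c where "c = (of_int (\<gamma> $ 2 $ 1) :: complex)"
  have aut': "(autfac \<gamma> has_field_derivative c) (at z)" for z
    unfolding autfac_def[abs_def] c_def by (auto intro!: derivative_eq_intros)
  have det: "det \<gamma> > 0" using \<gamma> by (simp add: SL2Z_def)
  have nz: "autfac \<gamma> z \<noteq> 0" if "Im z > 0" for z by (rule autfac_nonzero_SL2[OF \<gamma> that])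
  have comp: "((\<lambda>z. H i (moebius \<gamma> z)) has_field_derivative H (Suc i) (moebius \<gamma> z) * (1 / (autfac \<gamma> z)\<^sup>2)) (at z)"
    if z: "Im z > 0" for i z
  proof -
    have "(moebius \<gamma> has_field_derivative 1 / (autfac \<gamma> z)\<^sup>2) (at z)"
      using has_field_derivative_moebius[OF det z] \<gamma> by (simp add: SL2Z_def)
    from DERIV_chain2[OF H[OF Im_moebius_SL2[OF \<gamma> z]] this] show ?thesis .
  qed
  have "\<exists>U. (\<forall>i z. Im z > 0 \<longrightarrow> (U i has_field_derivative U (Suc i) z) (at z)) \<and>
    (\<forall>z. Im z > 0 \<longrightarrow> U 0 z = autfac \<gamma> z ^ m * H 0 (moebius \<gamma> z)) \<and>
    (\<forall>z. Im z > 0 \<longrightarrow> U (Suc m) z = H (Suc m) (moebius \<gamma> z) / autfac \<gamma> z ^ (m + 2))"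
  proof (induction m)
    case 0
    define U where "U i = (deriv ^^ i) (\<lambda>z. H 0 (moebius \<gamma> z))" for i
    have "(\<lambda>z. H 0 (moebius \<gamma> z)) holomorphic_on upper"
      unfolding holomorphic_on_open[OF open_upper] using comp[of _ 0] by blast
    hence hol: "U i holomorphic_on upper" for i
      unfolding U_def by (intro holomorphic_higher_deriv open_upper)
    have U: "(U i has_field_derivative U (Suc i) z) (at z)" if "Im z > 0" for i z
      using holomorphic_derivI[OF hol[of i] open_upper, of z] that by (simp add: U_def)
    have "U (Suc 0) z = H (Suc 0) (moebius \<gamma> z) / autfac \<gamma> z ^ 2" if "Im z > 0" for z
      using DERIV_imp_deriv[OF comp[OF that, of 0]] by (simp add: U_def)
    moreover have "U 0 z = H 0 (moebius \<gamma> z)" for z by (simp add: U_def)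
    ultimately show ?case using U by (intro exI[of _ U]) (auto simp: numeral_2_eq_2)
  next
    case (Suc m)
    then obtain U where U: "\<And>i z. Im z > 0 \<Longrightarrow> (U i has_field_derivative U (Suc i) z) (at z)"
      "\<And>z. Im z > 0 \<Longrightarrow> U 0 z = autfac \<gamma> z ^ m * H 0 (moebius \<gamma> z)"
      "\<And>z. Im z > 0 \<Longrightarrow> U (Suc m) z = H (Suc m) (moebius \<gamma> z) / autfac \<gamma> z ^ (m + 2)"
      by blast
    define V where "V i z = autfac \<gamma> z * U i z + of_nat i * c * U (i - 1) z" for i z
    have V: "(V i has_field_derivative V (Suc i) z) (at z)" if z: "Im z > 0" for i z
    proof -
      have D: "((\<lambda>z. autfac \<gamma> z * U i z + of_nat i * c * U (i - 1) z) has_field_derivative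
          (c * U i z + autfac \<gamma> z * U (Suc i) z) + of_nat i * c * U (Suc (i - 1)) z) (at z)"
        using DERIV_add[OF DERIV_mult[OF aut' U(1)[OF z]] DERIV_cmult[OF U(1)[OF z]], of i "of_nat i * c" "i - 1"]
        by (simp add: mult_ac)
      have Q: "(c * U i z + autfac \<gamma> z * U (Suc i) z) + of_nat i * c * U (Suc (i - 1)) z = V (Suc i) z"
        by (cases i) (simp_all add: V_def algebra_simps)
      have "V i = (\<lambda>z. autfac \<gamma> z * U i z + of_nat i * c * U (i - 1) z)" by (simp add: V_def fun_eq_iff)
      thus ?thesis using D unfolding Q by (simp only:)
    qed
    have "V (Suc (Suc m)) z = H (Suc (Suc m)) (moebius \<gamma> z) / autfac \<gamma> z ^ (Suc m + 2)" if z: "Im z > 0" for z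
    proof -
      define a b where "a = autfac \<gamma> z" "b = H (Suc m) (moebius \<gamma> z)"
      have a: "a \<noteq> 0" using nz[OF z] by (simp add: a_b_def)
      have D1: "((\<lambda>z. H (Suc m) (moebius \<gamma> z) / autfac \<gamma> z ^ (m + 2)) has_field_derivative U (Suc (Suc m)) z) (at z)"
        by (rule has_field_derivative_transform_within_open[OF U(1)[OF z] open_upper]) (use z U(3) in auto)
      have D2: "((\<lambda>z. H (Suc m) (moebius \<gamma> z) / autfac \<gamma> z ^ (m + 2)) has_field_derivative
          (H (Suc (Suc m)) (moebius \<gamma> z) * (1 / (autfac \<gamma> z)\<^sup>2) * autfac \<gamma> z ^ (m + 2) -
           H (Suc m) (moebius \<gamma> z) * (of_nat (m + 2) * (c * autfac \<gamma> z ^ (m + 2 - Suc 0)))) /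
          (autfac \<gamma> z ^ (m + 2) * autfac \<gamma> z ^ (m + 2))) (at z)"
        by (rule DERIV_divide[OF comp[OF z] DERIV_power[OF aut']]) (use nz[OF z] in simp)
      have "U (Suc (Suc m)) z = (H (Suc (Suc m)) (moebius \<gamma> z) * (1 / a\<^sup>2) * a ^ (m + 2) -
           b * (of_nat (m + 2) * (c * a ^ (m + 1)))) / (a ^ (m + 2) * a ^ (m + 2))"
        using DERIV_unique[OF D1 D2] unfolding a_b_def by simp
      also have "\<dots> = H (Suc (Suc m)) (moebius \<gamma> z) / a ^ (m + 4) - of_nat (m + 2) * c * b / a ^ (m + 3)"
      proof -
        have e: "a ^ (m + 2) = a\<^sup>2 * a ^ m" "a ^ (m + 1) = a * a ^ m" "a ^ (m + 4) = a\<^sup>2 * a\<^sup>2 * a ^ m" "a ^ (m + 3) = a * a\<^sup>2 * a ^ m"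
          by (simp_all add: power_add power2_eq_square power3_eq_cube power4_eq_xxxx mult_ac)
        have "a ^ m \<noteq> 0" using a by simp
        thus ?thesis using a unfolding e by (simp add: divide_simps power2_eq_square) (simp add: algebra_simps)
      qed
      finally have u: "U (Suc (Suc m)) z = \<dots>" .
      have "U (Suc m) z = b / a ^ (m + 2)" using U(3)[OF z] by (simp add: a_b_def)
      hence "V (Suc (Suc m)) z = a * (H (Suc (Suc m)) (moebius \<gamma> z) / a ^ (m + 4) - of_nat (m + 2) * c * b / a ^ (m + 3))
          + of_nat (m + 2) * c * (b / a ^ (m + 2))"
        unfolding V_def u by (simp add: a_b_def)
      also have "\<dots> = H (Suc (Suc m)) (moebius \<gamma> z) / a ^ (m + 3)"
      proof -
        have "a ^ (m + 4) = a * a ^ (m + 3)" "a ^ (m + 3) = a * a ^ (m + 2)" by (simp_all add: eval_nat_numeral)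
        thus ?thesis using a by (simp add: right_diff_distrib)
      qed
      finally show ?thesis by (simp add: a_b_def add.commute eval_nat_numeral)
    qed
    moreover have "V 0 z = autfac \<gamma> z ^ Suc m * H 0 (moebius \<gamma> z)" if "Im z > 0" for z
      using U(2)[OF that] by (simp add: V_def)
    ultimately show ?case using V by (intro exI[of _ V]) auto
  qed
  thus ?thesis using that by force
qed

lemma qderiv_chain:
  assumes h: "qexp h H" and z: "Im z > 0"
  shows "((\<lambda>z. (2 * of_real pi * \<i>) ^ i * (qderiv ^^ i) h z) has_field_derivative
    (2 * of_real pi * \<i>) ^ Suc i * (qderiv ^^ Suc i) h z) (at z)"
proof -
  obtain E where E: "qexp ((qderiv ^^ i) h) E" by (rule qexp_qderiv_funpow[OF h, of i], rule that)
  show ?thesis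
    using DERIV_cmult[OF qexp_has_field_derivative_qderiv[OF E z], of "(2 * of_real pi * \<i>) ^ i"] by (simp add: mult_ac)
qed

text \<open>In weight \<open>-w\<close> the factor \<open>(c z + d)\<^sup>w\<close> makes h invariant, so by uniqueness the (w+1)-st derivatives
  agree.\<close>
lemma bol_identity:
  assumes n: "n \<ge> 1" and h: "modform (2 - 2 * int n) h H"
  obtains E where "modform (2 * int n) ((qderiv ^^ (2 * n - 1)) h) E"
    "\<And>m. fls_nth E m = of_int m ^ (2 * n - 1) * fls_nth H m"
proof -
  define w where "w = 2 * n - 2"
  have w: "2 * n - 1 = Suc w" "2 * int n = int (w + 2)" "2 - 2 * int n = - int w" using n by (simp_all add: w_def)
  obtain E where E: "qexp ((qderiv ^^ Suc w) h) E" "\<And>m. fls_nth E m = of_int m ^ Suc w * fls_nth H m"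
    by (rule qexp_qderiv_funpow[OF modform_qexp[OF h], of "Suc w"], rule that)
  define C where "C i z = (2 * of_real pi * \<i>) ^ i * (qderiv ^^ i) h z" for i z
  have C: "(C i has_field_derivative C (Suc i) z) (at z)" if z: "Im z > 0" for i z
    unfolding C_def[abs_def] by (rule qderiv_chain[OF modform_qexp[OF h] z])
  have "(qderiv ^^ Suc w) h (moebius \<gamma> z) = autfac \<gamma> z powi (2 * int n) * (qderiv ^^ Suc w) h z"
    if \<gamma>: "\<gamma> \<in> SL2Z" and z: "Im z > 0" for \<gamma> z
  proof -
    obtain U where U: "\<And>i z. Im z > 0 \<Longrightarrow> (U i has_field_derivative U (Suc i) z) (at z)"
      "\<And>z. Im z > 0 \<Longrightarrow> U 0 z = autfac \<gamma> z ^ w * C 0 (moebius \<gamma> z)"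
      "\<And>z. Im z > 0 \<Longrightarrow> U (Suc w) z = C (Suc w) (moebius \<gamma> z) / autfac \<gamma> z ^ (w + 2)"
      by (rule bol_chain[OF \<gamma>, of C w], rule C, assumption, rule that)
    have "U 0 z = C 0 z" if z: "Im z > 0" for z
      using modformD[OF h \<gamma> z] autfac_nonzero_SL2[OF \<gamma> z] unfolding U(2)[OF z] w(3)
      by (simp add: C_def power_int_minus)
    from derivative_chain_unique[OF U(1) C this z] have "U (Suc w) z = C (Suc w) z" by blast
    hence "C (Suc w) (moebius \<gamma> z) = autfac \<gamma> z ^ (w + 2) * C (Suc w) z"
      using U(3)[OF z] autfac_nonzero_SL2[OF \<gamma> z] by (simp add: field_simps)
    hence "(2 * of_real pi * \<i>) ^ Suc w * (qderiv ^^ Suc w) h (moebius \<gamma> z) =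
        (2 * of_real pi * \<i>) ^ Suc w * (autfac \<gamma> z ^ (w + 2) * (qderiv ^^ Suc w) h z)"
      unfolding C_def by (simp only: mult.left_commute)
    hence "(qderiv ^^ Suc w) h (moebius \<gamma> z) = autfac \<gamma> z ^ (w + 2) * (qderiv ^^ Suc w) h z"
      by (subst (asm) mult_cancel_left) simp
    thus ?thesis unfolding w(2) power_int_of_nat .
  qed
  hence "modform (2 * int n) ((qderiv ^^ (2 * n - 1)) h) E" using E(1) unfolding modform_def w(1) by blast
  thus ?thesis using that E(2) unfolding w(1) by blast
qed

section \<open>Extension of scalars\<close>

lemma span_over_induct [consumes 1, case_names zero add]:
  assumes "v \<in> span_over K s U" "P 0" "\<And>v c u. P v \<Longrightarrow> c \<in> K \<Longrightarrow> u \<in> U \<Longrightarrow> P (s c u + v)"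
  shows "P v"
proof -
  obtain c T where T: "finite T" "T \<subseteq> U" "c ` T \<subseteq> K" "v = (\<Sum>u\<in>T. s (c u) u)"
    using assms(1) by (auto simp: span_over_def)
  have "P (\<Sum>u\<in>T. s (c u) u)" using T(1-3)
    by (induction T rule: finite_induct) (auto intro: assms(2,3))
  thus ?thesis by (simp add: T(4))
qed

lemma span_over_zero: "0 \<in> span_over K s U"
  by (auto simp: span_over_def intro!: exI[of _ "{}"])

lemma span_over_base:
  assumes "c \<in> K" "u \<in> U" shows "s c u \<in> span_over K s U"
  using assms by (auto simp: span_over_def intro!: exI[of _ "\<lambda>_. c"] exI[of _ "{u}"])

lemma span_over_add:
  assumes s: "vector_space s" and K: "complex_subfield K"
    and v: "v \<in> span_over K s U" and w: "w \<in> span_over K s U"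
  shows "v + w \<in> span_over K s U"
proof -
  interpret vector_space s by (rule s)
  obtain c T where T: "finite T" "T \<subseteq> U" "c ` T \<subseteq> K" "v = (\<Sum>u\<in>T. s (c u) u)"
    using v by (auto simp: span_over_def)
  obtain d R where R: "finite R" "R \<subseteq> U" "d ` R \<subseteq> K" "w = (\<Sum>u\<in>R. s (d u) u)"
    using w by (auto simp: span_over_def)
  define e where "e u = (if u \<in> T then c u else 0) + (if u \<in> R then d u else 0)" for u
  have "v = (\<Sum>u\<in>T \<union> R. s (if u \<in> T then c u else 0) u)"
    unfolding T(4) using T(1) R(1) by (intro sum.mono_neutral_cong_left) auto
  moreover have "w = (\<Sum>u\<in>T \<union> R. s (if u \<in> R then d u else 0) u)"
    unfolding R(4) using T(1) R(1) by (intro sum.mono_neutral_cong_left) auto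
  ultimately have "v + w = (\<Sum>u\<in>T \<union> R. s (e u) u)"
    by (simp only: e_def scale_left_distrib sum.distrib)
  moreover have "e u \<in> K" if "u \<in> T \<union> R" for u
    using T(3) R(3) unfolding e_def by (intro subfieldD(3)[OF K]) (auto intro: subfieldD(1)[OF K])
  hence "e ` (T \<union> R) \<subseteq> K" by blast
  ultimately show ?thesis using T(1,2) R(1,2) unfolding span_over_def
    by (auto intro!: exI[of _ e] exI[of _ "T \<union> R"])
qed

lemma span_over_scale:
  assumes s: "vector_space s" and K: "complex_subfield K" and a: "a \<in> K"
    and v: "v \<in> span_over K s U"
  shows "s a v \<in> span_over K s U"
proof -
  interpret vector_space s by (rule s)
  obtain c T where T: "finite T" "T \<subseteq> U" "c ` T \<subseteq> K" "v = (\<Sum>u\<in>T. s (c u) u)"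
    using v by (auto simp: span_over_def)
  have "s a v = (\<Sum>u\<in>T. s (a * c u) u)" by (simp add: T(4) scale_sum_right)
  moreover have "(\<lambda>u. a * c u) ` T \<subseteq> K" using T(3) a subfieldD[OF K] by auto
  ultimately show ?thesis using T(1,2) unfolding span_over_def
    by (auto intro!: exI[of _ "\<lambda>u. a * c u"] exI[of _ T])
qed

lemma vector_space_fscale: "vector_space fscale"
  by unfold_locales (auto simp: fscale_def algebra_simps fun_eq_iff)

lemma field_generated_subfield: "complex_subfield (field_generated S)" and field_generated_superset: "S \<subseteq> field_generated S"
  unfolding field_generated_def complex_subfield_def by auto

lemma weak_forms_iff:
  "g \<in> weak_forms k \<longleftrightarrow> (\<forall>z. Im z \<le> 0 \<longrightarrow> g z = 0) \<and> (\<exists>F\<in>fls_over \<rat>. modform k g F)"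
proof -
  have "(\<forall>m. fourier_coeff g m \<in> \<rat>) \<longleftrightarrow> F \<in> fls_over \<rat>" if "modform k g F" for F
    by (simp add: fourier_coeff_qexp[OF modform_qexp[OF that]] fls_over_def)
  thus ?thesis unfolding weak_forms_def weak_forms_complex_iff by auto
qed

lemma fls_over_mono: "complex_subfield K \<Longrightarrow> F \<in> fls_over \<rat> \<Longrightarrow> F \<in> fls_over K"
  by (auto simp: fls_over_def intro: subfield_rat)

lemma zero_over: "complex_subfield K \<Longrightarrow> 0 \<in> fls_over K"
  by (auto simp: fls_over_def intro: subfieldD)

lemma modform_zero: "modform k (\<lambda>z. 0) 0"
  by (simp add: modform_def qexp_zero)

lemma dR_forms_expansion:
  assumes K: "complex_subfield K" and g: "g \<in> dR_forms n K"
  obtains G where "modform (2 * int n) g G" "G \<in> fls_over K" "\<And>z. Im z \<le> 0 \<Longrightarrow> g z = 0"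
proof -
  have "(\<exists>G\<in>fls_over K. modform (2 * int n) g G) \<and> (\<forall>z. Im z \<le> 0 \<longrightarrow> g z = 0)"
    using g unfolding dR_forms_def
  proof (induction rule: span_over_induct)
    case zero
    show ?case using modform_zero zero_over[OF K] by (auto simp: zero_fun_def)
  next
    case (add v c u)
    then obtain V U where "V \<in> fls_over K" "modform (2 * int n) v V" "U \<in> fls_over \<rat>" "modform (2 * int n) u U"
      by (auto simp: weak_forms_iff)
    note VU = this
    have "modform (2 * int n) (fscale c u + v) (fls_const c * U + V)"
      unfolding fscale_def plus_fun_def using VU by (intro modform_add modform_cmult)
    moreover have "fls_const c * U + V \<in> fls_over K"
      by (rule fls_over_add[OF K fls_over_mult[OF K fls_over_const[OF K add(2)] fls_over_mono[OF K VU(3)]] VU(1)])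
    moreover have "u z = 0" if "Im z \<le> 0" for z
      using add(3) that unfolding weak_forms_iff by blast
    hence "\<forall>z. Im z \<le> 0 \<longrightarrow> (fscale c u + v) z = 0" using add(1) by (simp add: fscale_def)
    ultimately show ?case by blast
  qed
  thus ?thesis using that by auto
qed

text \<open>Besides its own expansion an exact form comes with that of a form of weight \<open>2 - 2n\<close> of which it is
  the derivative; the latter is what \<open>pair_exact\<close> and the reduction of poles use.\<close>
lemma dR_exact_expansion:
  assumes K: "complex_subfield K" and n: "n \<ge> 1" and x: "x \<in> dR_exact n K"
  obtains X h H where "modform (2 * int n) x X" "modform (2 - 2 * int n) h H" "H \<in> fls_over K"
    "\<And>m. fls_nth X m = of_int m ^ (2 * n - 1) * fls_nth H m" "\<And>z. Im z \<le> 0 \<Longrightarrow> x z = 0"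
proof -
  have "(\<exists>X h H. modform (2 * int n) x X \<and> modform (2 - 2 * int n) h H \<and> H \<in> fls_over K \<and>
    (\<forall>m. fls_nth X m = of_int m ^ (2 * n - 1) * fls_nth H m)) \<and> (\<forall>z. Im z \<le> 0 \<longrightarrow> x z = 0)"
    using x unfolding dR_exact_def
  proof (induction rule: span_over_induct)
    case zero
    show ?case using modform_zero zero_over[OF K] by (auto simp: zero_fun_def intro!: exI[of _ 0] exI[of _ "\<lambda>_. 0"])
  next
    case (add v c u)
    then obtain V h H where V: "modform (2 * int n) v V" "modform (2 - 2 * int n) h H" "H \<in> fls_over K"
      "\<And>m. fls_nth V m = of_int m ^ (2 * n - 1) * fls_nth H m" by blast
    obtain t where t: "t \<in> weak_forms (2 - 2 * int n)" "u = (qderiv ^^ (2 * n - 1)) t" using add by blast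
    then obtain T where T: "T \<in> fls_over \<rat>" "modform (2 - 2 * int n) t T" by (auto simp: weak_forms_iff)
    obtain U where U: "modform (2 * int n) u U" "\<And>m. fls_nth U m = of_int m ^ (2 * n - 1) * fls_nth T m"
      by (rule bol_identity[OF n T(2), folded t(2)], rule that)
    have "modform (2 * int n) (fscale c u + v) (fls_const c * U + V)"
      using U V unfolding fscale_def plus_fun_def by (intro modform_add modform_cmult)
    moreover have "modform (2 - 2 * int n) (\<lambda>z. c * t z + h z) (fls_const c * T + H)"
      using T V by (intro modform_add modform_cmult)
    moreover have "fls_const c * T + H \<in> fls_over K"
      by (rule fls_over_add[OF K fls_over_mult[OF K fls_over_const[OF K add(2)] fls_over_mono[OF K T(1)]] V(3)])
    moreover have "fls_nth (fls_const c * U + V) m = of_int m ^ (2 * n - 1) * fls_nth (fls_const c * T + H) m" for m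
      by (simp add: U V algebra_simps)
    moreover have "u z = 0" if "Im z \<le> 0" for z
      using that n unfolding t(2) by (cases "2 * n - 1") (auto simp: qderiv_def)
    hence "\<forall>z. Im z \<le> 0 \<longrightarrow> (fscale c u + v) z = 0" using add(1) by (simp add: fscale_def)
    ultimately show ?case by blast
  qed
  thus ?thesis using that by auto
qed

lemma dR_exactI:
  assumes n: "n \<ge> 1" and c: "c \<in> K" and h: "modform (2 - 2 * int n) h H" "H \<in> fls_over \<rat>"
  obtains x X where "x \<in> dR_exact n K" "modform (2 * int n) x X"
    "\<And>m. fls_nth X m = c * (of_int m ^ (2 * n - 1) * fls_nth H m)"
proof -
  define t where "t z = (if Im z > 0 then h z else 0)" for z
  have t: "modform (2 - 2 * int n) t H" by (rule modform_cong[OF h(1)]) (simp add: t_def)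
  hence "t \<in> weak_forms (2 - 2 * int n)" using h(2) by (auto simp: weak_forms_iff t_def)
  hence x: "fscale c ((qderiv ^^ (2 * n - 1)) t) \<in> dR_exact n K"
    unfolding dR_exact_def by (intro span_over_base c imageI)
  obtain U where U: "modform (2 * int n) ((qderiv ^^ (2 * n - 1)) t) U"
      "\<And>m. fls_nth U m = of_int m ^ (2 * n - 1) * fls_nth H m"
    by (rule bol_identity[OF n t], rule that)
  show ?thesis
    by (rule that[OF x, of "fls_const c * U"]) (use modform_cmult[OF U(1)] U(2) in \<open>auto simp: fscale_def[abs_def]\<close>)
qed

section \<open>The pairing between the eigenclasses\<close>

text \<open>The eigenvalue is the p-th coefficient, as the first one is 1; in particular it is unique.\<close>
lemma eigenform_expansion:
  assumes n: "n \<ge> 1" and f: "normalized_cuspidal_eigenform n f"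
  obtains F where "cusp (2 * n) f F" "fls_nth F 1 = 1" "F \<in> fls_over (coeff_field f)"
    "\<And>p. prime p \<Longrightarrow> fls_hecke (2 * n - 1) p F = fls_const (hecke_eigenvalue n f p) * F"
    "\<And>z. Im z \<le> 0 \<Longrightarrow> f z = 0"
proof -
  obtain F where F: "modform (2 * int n) f F" and z: "\<And>z. Im z \<le> 0 \<Longrightarrow> f z = 0"
    using f unfolding normalized_cuspidal_eigenform_def cusp_forms_def weak_forms_complex_iff by blast
  note four = fourier_coeff_qexp[OF modform_qexp[OF F]]
  have c: "cusp (2 * n) f F" and 1: "fls_nth F 1 = 1"
    using f F unfolding normalized_cuspidal_eigenform_def cusp_forms_def cusp_def by (auto simp: four)
  have K: "F \<in> fls_over (coeff_field f)"
    using field_generated_superset[of "range (fls_nth F)"] by (auto simp: fls_over_def coeff_field_def four)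
  have "fls_hecke (2 * n - 1) p F = fls_const (hecke_eigenvalue n f p) * F" if p: "prime p" for p
  proof -
    have eig: "fls_hecke (2 * n - 1) p F = fls_const l * F" if "hecke_dR n p f = fscale l f" for l
      using hecke_dR_expansion(1)[OF p n F] modform_cmult[OF F, of l] qexp_unique modform_qexp
      unfolding that fscale_def by blast
    have uniq: "l = fls_nth (fls_hecke (2 * n - 1) p F) 1" if "hecke_dR n p f = fscale l f" for l
      using eig[OF that] 1 by simp
    obtain l where l: "hecke_dR n p f = fscale l f"
      using f p unfolding normalized_cuspidal_eigenform_def by blast
    have "hecke_eigenvalue n f p = l"
      unfolding hecke_eigenvalue_def by (rule the_equality, rule l) (use uniq l in metis)
    thus ?thesis using eig[OF l] by simp
  qed
  thus ?thesis using that[OF c 1 K] z by blast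
qed

lemma cusp_weight_ge_4:
  assumes "cusp (2 * n) f F" "fls_nth F 1 = 1"
  shows "n \<ge> 2"
proof (rule ccontr)
  assume "\<not> n \<ge> 2"
  hence "f z = 0" if "Im z > 0" for z
    by (intro sturm_bound[OF cusp_modform[OF assms(1)], of 1]) (use that cusp_nth[OF assms(1)] in auto)
  from qexp_zero_imp[OF modform_qexp[OF cusp_modform[OF assms(1)]] this] assms(2) show False by simp
qed

text \<open>The divisors of \<open>p r\<close> are those of r and their multiples by p; the overlap comes from \<open>r / p\<close>.\<close>
lemma divisor_sum_prime_mult:
  assumes p: "prime p" and r: "r > 0"
  shows "divisor_sum j (p * r) + p ^ j * (if p dvd r then divisor_sum j (r div p) else 0) = (1 + p ^ j) * divisor_sum j r"
proof -
  define A B where "A = {d. d dvd r}" "B = (*) p ` {d. d dvd r}"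
  have p0: "p > 0" using prime_gt_0_nat[OF p] .
  have fin: "finite A" "finite B" using r by (simp_all add: A_B_def)
  have inj: "inj_on ((*) p) X" for X using p0 by (auto simp: inj_on_def)
  have "{d. d dvd p * r} = A \<union> B"
  proof (intro equalityI subsetI)
    fix d assume "d \<in> {d. d dvd p * r}"
    hence d: "d dvd p * r" by simp
    show "d \<in> A \<union> B"
    proof (cases "p dvd d")
      case True
      then obtain e where "d = p * e" by (rule dvdE)
      thus ?thesis using d p0 by (auto simp: A_B_def)
    next
      case False
      hence "coprime d p" using p by (metis coprime_commute prime_imp_coprime)
      thus ?thesis using d by (simp add: A_B_def coprime_dvd_mult_right_iff)
    qed
  qed (auto simp: A_B_def)
  hence "divisor_sum j (p * r) + (\<Sum>d\<in>A \<inter> B. d ^ j) = (\<Sum>d\<in>A. d ^ j) + (\<Sum>d\<in>B. d ^ j)"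
    using sum.union_inter[OF fin, of "\<lambda>d. d ^ j"] by (simp add: divisor_sum_def)
  moreover have "(\<Sum>d\<in>B. d ^ j) = p ^ j * divisor_sum j r"
    by (simp add: A_B_def sum.reindex[OF inj] divisor_sum_def power_mult_distrib sum_distrib_left)
  moreover have "(\<Sum>d\<in>A \<inter> B. d ^ j) = p ^ j * (if p dvd r then divisor_sum j (r div p) else 0)"
  proof (cases "p dvd r")
    case True
    then obtain q where q: "r = p * q" by (rule dvdE)
    have "A \<inter> B = (*) p ` {d. d dvd q}" using p0 by (auto simp: A_B_def q)
    thus ?thesis using p0 by (simp add: q sum.reindex[OF inj] divisor_sum_def power_mult_distrib sum_distrib_left)
  next
    case False
    have "A \<inter> B = {}" using False dvd_trans[of p] by (auto simp: A_B_def)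
    thus ?thesis using False by simp
  qed
  ultimately show ?thesis by (simp add: A_B_def divisor_sum_def ring_distribs)
qed

text \<open>Otherwise f would have the same coefficients as the Eisenstein series up to a factor, except for the
  constant one, and the difference would be a nonzero constant of positive weight.\<close>
lemma not_eisenstein_eigenvalues:
  assumes n: "n \<ge> 2" and f: "cusp (2 * n) f F" "fls_nth F 1 = 1"
    and eig: "\<And>p. prime p \<Longrightarrow> fls_hecke (2 * n - 1) p F = fls_const (l p) * F"
  shows "\<exists>p. prime p \<and> l p \<noteq> 1 + of_nat p ^ (2 * n - 1)"
proof (rule ccontr)
  define j where "j = 2 * n - 1"
  assume nt: "\<not> ?thesis"
  have l: "l p = 1 + of_nat p ^ j" if p: "prime p" for p
    using nt p by (auto simp: j_def)
  obtain c e where e: "modform (int (2 * n)) (eisenstein (2 * n)) (fps_to_fls e)" "c \<noteq> 0" "fps_nth e 0 = 1"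
    "\<And>N. N \<ge> 1 \<Longrightarrow> fps_nth e N = c * of_nat (divisor_sum (2 * n - 1) N)"
  proof -
    have k: "even (2 * n)" "2 * n \<ge> 4" using n by auto
    show ?thesis by (rule eisenstein_expansion[OF k], rule that)
  qed
  define G where "G = fps_to_fls e - 1"
  have Gneg: "fls_nth G m = 0" if "m \<le> 0" for m
    using that e(3) by (cases "m = 0") (auto simp: G_def)
  have Gpos: "fls_nth G (int N) = c * of_nat (divisor_sum j N)" if "N \<ge> 1" for N
    using that e(4) by (auto simp: G_def j_def)
  have "fls_hecke j p G = fls_const (l p) * G" if p: "prime p" for p
  proof (rule fls_eqI)
    fix m
    have p0: "p > 0" using prime_gt_0_nat[OF p] .
    show "fls_nth (fls_hecke j p G) m = fls_nth (fls_const (l p) * G) m"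
    proof (cases "m \<le> 0")
      case True
      hence "int p * m \<le> 0" "m div int p \<le> 0" using p0 by (simp_all add: mult_nonneg_nonpos div_nonpos_pos_le0)
      thus ?thesis using Gneg True by (simp add: fls_nth_hecke[OF p0])
    next
      case False
      then obtain N where N: "m = int N" "N > 0" by (metis not_le_imp_less zero_less_imp_eq_int)
      have 1: "fls_nth G (int p * m) = c * of_nat (divisor_sum j (p * N))"
        using Gpos[of "p * N"] N p0 by (simp add: Suc_le_eq)
      have 2: "(if int p dvd m then fls_nth G (m div int p) else 0) = c * of_nat (if p dvd N then divisor_sum j (N div p) else 0)"
      proof (cases "p dvd N")
        case True
        then obtain q where "N = p * q" by (rule dvdE)
        thus ?thesis using Gpos[of q] N p0 by (simp add: Suc_le_eq)
      qed (simp add: N)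
      have "fls_nth (fls_hecke j p G) m = c * of_nat (divisor_sum j (p * N) + p ^ j * (if p dvd N then divisor_sum j (N div p) else 0))"
        unfolding fls_nth_hecke[OF p0] 1 2 by (simp add: algebra_simps)
      also have "\<dots> = fls_nth (fls_const (l p) * G) m"
        unfolding divisor_sum_prime_mult[OF p N(2)] using N Gpos[of N] l[OF p] by (simp add: algebra_simps)
      finally show ?thesis .
    qed
  qed
  hence GF: "G = fls_const (fls_nth G 1) * F"
    by (intro hecke_eigen_coeffs[of F j l G]) (use f eig Gneg cusp_nth in \<open>auto simp: j_def\<close>)
  define u where "u z = eisenstein (2 * n) z - fls_nth G 1 * f z" for z
  have "modform (int (2 * n)) u (fps_to_fls e - fls_const (fls_nth G 1) * F)"
    unfolding u_def by (intro modform_diff modform_cmult e cusp_modform f)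
  moreover have "fps_to_fls e - fls_const (fls_nth G 1) * F = 1"
    by (simp only: GF[symmetric]) (simp add: G_def)
  ultimately have u: "modform (int (2 * n)) u 1" by simp
  have u1: "u z = 1" if "Im z > 0" for z using qexp_eval[OF modform_qexp[OF u] that] by simp
  have "u (moebius Smat (2 * \<i>)) = (2 * \<i>) powi (int (2 * n)) * u (2 * \<i>)"
    using modformD[OF u Smat_in, of "2 * \<i>"] by simp
  hence "(2 * \<i>) ^ (2 * n) = 1"
    using u1[of "moebius Smat (2 * \<i>)"] u1[of "2 * \<i>"] Im_moebius_SL2[OF Smat_in, of "2 * \<i>"]
    by (simp only: power_int_of_nat) simp
  hence "norm ((2 * \<i>) ^ (2 * n)) = 1" by simp
  hence "(2::real) ^ (2 * n) = 1" by (simp add: norm_power norm_mult)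
  thus False using n one_less_power[of "2::real" "2 * n"] by simp
qed

definition leading :: "int \<Rightarrow> complex fls \<Rightarrow> bool" where
  "leading a F \<longleftrightarrow> fls_subdegree F = a \<and> fls_nth F a = 1"

lemma leading_mult:
  assumes "leading a F" "leading b G" shows "leading (a + b) (F * G)"
proof -
  have "F \<noteq> 0" "G \<noteq> 0" using assms by (auto simp: leading_def)
  thus ?thesis using assms fls_times_base[of F G] by (auto simp: leading_def)
qed

lemma leading_power: "leading a F \<Longrightarrow> leading (int i * a) (F ^ i)"
proof (induction i)
  case 0
  show ?case by (simp add: leading_def)
next
  case (Suc i)
  thus ?case using leading_mult[of a F "int i * a" "F ^ i"] by (simp add: algebra_simps)
qed

lemma leading_inverse:
  assumes "leading a F" shows "leading (- a) (inverse F)"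
proof -
  have F: "F \<noteq> 0" using assms by (auto simp: leading_def)
  hence i: "inverse F \<noteq> 0" "F * inverse F = 1" by auto
  have "fls_subdegree (F * inverse F) = fls_subdegree F + fls_subdegree (inverse F)"
    using F i(1) by simp
  hence s: "fls_subdegree (inverse F) = - a" using assms by (simp add: i(2) leading_def)
  moreover have "fls_nth (inverse F) (- a) = 1"
    using fls_times_base[of F "inverse F"] assms s by (simp add: i(2) leading_def)
  ultimately show ?thesis by (simp add: leading_def)
qed

lemma leading_below: "leading a F \<Longrightarrow> m < a \<Longrightarrow> fls_nth F m = 0"
  by (auto simp: leading_def)

lemma leading_fps: "fps_nth f 0 = 1 \<Longrightarrow> leading 0 (fps_to_fls f)"
  by (auto simp: leading_def fls_subdegree_eqI)

text \<open>A pole of order i can be removed by an exact form with leading coefficient \<open>q\<^sup>-\<^sup>i\<close>, built from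
  \<open>\<Delta>\<^sup>-\<^sup>i\<close> and an Eisenstein series, unless the weight \<open>2 n - 12 i\<close> is 0 or at least 4; then there is a
  cusp form with leading term \<open>q\<^sup>i\<close>, and orthogonality to it forces the coefficient to vanish.\<close>
lemma reduce_poles:
  assumes K: "complex_subfield K" and n: "n \<ge> 1"
    and e: "modform (2 * int n) e E" "E \<in> fls_over K" "\<And>m. m < - int N \<Longrightarrow> fls_nth E m = 0"
    and orth: "\<And>g G. cusp (2 * n) g G \<Longrightarrow> pair (2 * n - 1) E G = 0"
  shows "\<exists>x\<in>dR_exact n K. \<exists>G. modform (2 * int n) (e - x) G \<and> (\<forall>m<0. fls_nth G m = 0)"
  using e orth
proof (induction N arbitrary: e E)
  case 0
  show ?case
    by (rule bexI[of _ 0]) (use 0 in \<open>auto simp: dR_exact_def span_over_zero\<close>)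
next
  case (Suc N)
  define i where "i = Suc N"
  define j where "j = 2 * n - 1"
  obtain d where d: "modform 12 Delta (fps_to_fls d)" "fps_nth d 0 = 0" "fps_nth d 1 = 1" "\<And>N. fps_nth d N \<in> \<rat>"
    by (rule Delta_expansion, rule that)
  define D where "D = fps_to_fls d"
  have D: "modform 12 Delta D" "D \<in> fls_over \<rat>" using d by (auto simp: D_def fls_over_def)
  have lD: "leading 1 D"
  proof -
    have "fls_nth D 1 = 1" "\<And>m. m < 1 \<Longrightarrow> fls_nth D m = 0"
      using d(2,3) by (auto simp: D_def)
    thus ?thesis by (auto simp: leading_def fls_subdegree_eqI)
  qed
  have Di: "modform (int i * 12) (\<lambda>z. Delta z ^ i) (D ^ i)" by (rule modform_power[OF D(1)])
  have lDi: "leading (int i) (D ^ i)" using leading_power[OF lD, of i] by simp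
  show ?case
  proof (cases "2 * int n - 12 * int i = 0 \<or> 2 * int n - 12 * int i \<ge> 4")
    case True
    define k where "k = nat (2 * int n - 12 * int i)"
    have k: "int k = 2 * int n - 12 * int i" using True by (auto simp: k_def)
    have "even k" using k by presburger
    moreover have "k = 0 \<or> k \<ge> 4" using True k by linarith
    ultimately obtain g b where g: "modform (int k) g (fps_to_fls b)" "fps_nth b 0 = 1"
      using eisenstein_product by metis
    define G where "G = D ^ i * fps_to_fls b"
    have lG: "leading (int i) G" using leading_mult[OF lDi leading_fps[OF g(2)]] by (simp add: G_def)
    have "modform (2 * int n) (\<lambda>z. Delta z ^ i * g z) G" using modform_mult[OF Di g(1)] k by (simp add: G_def algebra_simps)
    hence "cusp (2 * n) (\<lambda>z. Delta z ^ i * g z) G"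
      using leading_below[OF lG] by (auto simp: cusp_def i_def)
    hence "pair j E G = 0" using Suc.prems(4) by (simp add: j_def)
    moreover have "pair j E G = (\<Sum>m\<in>{- int i}. fls_nth E m * fls_nth G (- m) / of_int (- m) ^ j)"
    proof (rule pair_sum)
      fix m assume "fls_nth E m \<noteq> 0" "fls_nth G (- m) \<noteq> 0"
      hence "\<not> m < - int i" "\<not> - m < int i" using Suc.prems(3)[of m] leading_below[OF lG, of "- m"] by (auto simp: i_def)
      thus "m \<in> {- int i}" by simp
    qed simp
    moreover have "fls_nth G (int i) = 1" using lG by (simp add: leading_def)
    moreover have "i \<noteq> 0" by (simp add: i_def)
    ultimately have "fls_nth E (- int i) = 0" by simp
    hence "fls_nth E m = 0" if "m < - int N" for m
      using that Suc.prems(3)[of m] by (cases "m = - int i") (auto simp: i_def)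
    thus ?thesis using Suc.IH[OF Suc.prems(1,2)] Suc.prems(4) by blast
  next
    case False
    define k where "k = nat (12 * int i + 2 - 2 * int n)"
    have k: "int k = 12 * int i + 2 - 2 * int n" using False by (simp add: k_def) presburger
    have "even k" using k by presburger
    moreover have "k = 0 \<or> k \<ge> 4" using False k by presburger
    ultimately obtain g b where g: "modform (int k) g (fps_to_fls b)" "fps_nth b 0 = 1" "\<And>N. fps_nth b N \<in> \<rat>"
      using eisenstein_product by metis
    define h H where "h = (\<lambda>z. inverse (Delta z ^ i) * g z)" "H = inverse (D ^ i) * fps_to_fls b"
    have "modform (- (int i * 12)) (\<lambda>z. inverse (Delta z ^ i)) (inverse (D ^ i))"
      by (rule modform_inverse[OF Di]) (use Delta_nonzero in auto)
    from modform_mult[OF this g(1)] have h: "modform (2 - 2 * int n) h H" using k by (simp add: h_H_def algebra_simps)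
    have "fps_to_fls b \<in> fls_over \<rat>" using g(3) by (auto simp: fls_over_def)
    hence HQ: "H \<in> fls_over \<rat>" unfolding h_H_def
      by (intro fls_over_mult fls_over_inverse fls_over_power D complex_subfield_Rats)
    have lH: "leading (- int i) H" 
      using leading_mult[OF leading_inverse[OF lDi] leading_fps[OF g(2)]] by (simp add: h_H_def)
    define c where "c = fls_nth E (- int i) / of_int (- int i) ^ j"
    have cK: "c \<in> K" using Suc.prems(2) K unfolding c_def
      by (intro subfieldD subfield_power subfield_of_int) (auto simp: fls_over_def)
    obtain x X where x: "x \<in> dR_exact n K" "modform (2 * int n) x X"
      "\<And>m. fls_nth X m = c * (of_int m ^ (2 * n - 1) * fls_nth H m)"
      by (rule dR_exactI[OF n cK h HQ], rule that)
    have XK: "X \<in> fls_over K"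
      using fls_over_mono[OF K HQ] cK by (auto simp: fls_over_def x(3) intro!: subfieldD[OF K] subfield_power[OF K] subfield_of_int[OF K])
    have i0: "of_int (- int i) ^ j \<noteq> (0 :: complex)" using of_nat_neq_0[of N, where ?'a = complex] by (simp add: i_def del: of_nat_Suc)
    have van: "fls_nth (E - X) m = 0" if "m < - int N" for m
    proof (cases "m = - int i")
      case True
      thus ?thesis using lH i0 by (simp add: x(3) c_def leading_def j_def)
    next
      case False
      hence "m < - int i" using that by (simp add: i_def)
      thus ?thesis using Suc.prems(3)[of m] leading_below[OF lH] by (simp add: x(3) i_def)
    qed
    have "modform (2 * int n) (e - x) (E - X)" unfolding fun_diff_def by (intro modform_diff Suc.prems(1) x)
    moreover have "pair (2 * n - 1) (E - X) G = 0" if G: "cusp (2 * n) g G" for g G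
    proof -
      have "pair (2 * n - 1) G X = 0"
      proof (rule pair_exact[where k = "2 * int n"])
        show "modform (2 - 2 * int n) (\<lambda>z. c * h z) (fls_const c * H)" by (rule modform_cmult[OF h])
        show "modform (2 * int n) g G" "fls_nth G 0 = 0" using G by (auto simp: cusp_def)
      qed (simp add: x(3))
      hence "pair (2 * n - 1) X G = 0" using pair_swap[of "2 * n - 1" X G] n by simp
      thus ?thesis using Suc.prems(4)[OF G] by (simp add: pair_diff_left)
    qed
    ultimately obtain y G where y: "y \<in> dR_exact n K" "modform (2 * int n) (e - x - y) G" "\<forall>m<0. fls_nth G m = 0"
      using Suc.IH[of "e - x" "E - X"] van fls_over_diff[OF K Suc.prems(2) XK] by blast
    have "x + y \<in> dR_exact n K"
      using x(1) y(1) unfolding dR_exact_def by (intro span_over_add vector_space_fscale K)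
    moreover have "e - x - y = e - (x + y)" by (rule diff_diff_eq)
    ultimately show ?thesis using y(2,3) by (intro bexI[of _ "x + y"] exI[of _ G]) (simp_all only: simp_thms)
  qed
qed

text \<open>Up to a power of p the operators in weight 2n and \<open>2 - 2n\<close> correspond to each other.\<close>
lemma hecke_exact:
  assumes p: "prime p" and n: "n \<ge> 1" and h: "modform (2 - 2 * int n) h H"
    and X: "\<And>m. fls_nth X m = of_int m ^ (2 * n - 1) * fls_nth H m"
  obtains h' H' where "modform (2 - 2 * int n) h' H'"
    "\<And>m. fls_nth (fls_hecke (2 * n - 1) p X) m = of_int m ^ (2 * n - 1) * fls_nth H' m"
proof -
  have p0: "p > 0" using prime_gt_0_nat[OF p] .
  obtain H' where H': "modform (2 - 2 * int n) (\<lambda>z. \<Sum>r\<in>tri_reps p. hecke_term (2 - 2 * int n) h r z) H'"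
    "\<And>m. fls_nth H' m = of_nat p powi (1 - (2 - 2 * int n)) * fls_nth H (int p * m) +
       (if int p dvd m then fls_nth H (m div int p) else 0)"
    by (rule hecke_sum_expansion[OF p h], rule that)
  have "1 - (2 - 2 * int n) = int (2 * n - 1)" using n by simp
  hence c: "of_nat p powi (1 - (2 - 2 * int n)) = (of_nat p ^ (2 * n - 1) :: complex)"
    by (simp only: power_int_of_nat)
  have "fls_nth (fls_hecke (2 * n - 1) p X) m = of_int m ^ (2 * n - 1) * fls_nth H' m" for m
    unfolding H'(2) c fls_nth_hecke[OF p0] X
    by (auto simp: power_mult_distrib ring_distribs elim!: dvdE)
  thus ?thesis using that[OF H'(1)] by blast
qed

text \<open>If the pairing of the first eigenclass with f vanished, it would vanish on all cusp forms; removing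
  the poles, the class would be represented by a cusp form. Its Hecke relations then hold exactly and
  not only modulo exact forms, because an exact cusp form comes from a form of negative weight that is
  holomorphic at the cusp. So it would be a multiple of f.\<close>
lemma eigenclass_pairing:
  assumes n: "n \<ge> 1" and f: "normalized_cuspidal_eigenform n f"
    and basis: "basis2_mod (coeff_field f) fscale (eigenspace_dR n f) (dR_exact n (coeff_field f)) e1 e2"
    and e2: "l \<in> coeff_field f" "l \<noteq> 0" "e2 - fscale l f \<in> dR_exact n (coeff_field f)"
  obtains E1 E2 where "n \<ge> 2" "modform (2 * int n) e1 E1" "modform (2 * int n) e2 E2" "fls_nth E1 0 = 0" "fls_nth E2 0 = 0"
    "pair (2 * n - 1) E2 E1 \<in> coeff_field f" "pair (2 * n - 1) E2 E1 \<noteq> 0"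
proof -
  define K where "K = coeff_field f"
  have K: "complex_subfield K" unfolding K_def coeff_field_def by (rule field_generated_subfield)
  define j where "j = 2 * n - 1"
  have oj: "odd j" using n by (simp add: j_def)
  define a where "a p = hecke_eigenvalue n f p" for p
  obtain F where F: "cusp (2 * n) f F" "fls_nth F 1 = 1" "F \<in> fls_over K"
    "\<And>p. prime p \<Longrightarrow> fls_hecke j p F = fls_const (a p) * F" "\<And>z. Im z \<le> 0 \<Longrightarrow> f z = 0"
    by (rule eigenform_expansion[OF n f, folded K_def a_def j_def], rule that)
  have n2: "n \<ge> 2" by (rule cusp_weight_ge_4[OF F(1,2)])
  have e: "e1 \<in> dR_forms n K" "\<And>p. prime p \<Longrightarrow> hecke_dR n p e1 - fscale (a p) e1 \<in> dR_exact n K"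
    using basis unfolding basis2_mod_def eigenspace_dR_def K_def a_def by auto
  have ind: "x = 0 \<and> y = 0" if "x \<in> K" "y \<in> K" "fscale x e1 + fscale y e2 \<in> dR_exact n K" for x y
    using basis that unfolding basis2_mod_def K_def by blast
  obtain E1 where E1: "modform (2 * int n) e1 E1" "E1 \<in> fls_over K" "\<And>z. Im z \<le> 0 \<Longrightarrow> e1 z = 0"
    by (rule dR_forms_expansion[OF K e(1)], rule that)
  have eig: "\<exists>h H. modform (2 - 2 * int n) h H \<and> (\<forall>m. fls_nth (fls_hecke j p E1 - fls_const (a p) * E1) m = of_int m ^ j * fls_nth H m)"
    if p: "prime p" for p
  proof -
    obtain X h H where X: "modform (2 * int n) (hecke_dR n p e1 - fscale (a p) e1) X" "modform (2 - 2 * int n) h H"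
      "\<And>m. fls_nth X m = of_int m ^ (2 * n - 1) * fls_nth H m"
      by (rule dR_exact_expansion[OF K n e(2)[OF p]], rule that)
    have "modform (2 * int n) (hecke_dR n p e1 - fscale (a p) e1) (fls_hecke j p E1 - fls_const (a p) * E1)"
      unfolding fun_diff_def fscale_def j_def by (intro modform_diff modform_cmult E1 hecke_dR_expansion p n)
    hence "X = fls_hecke j p E1 - fls_const (a p) * E1" using X(1) modform_qexp qexp_unique by blast
    thus ?thesis using X by (auto simp: j_def)
  qed
  have exact0: "pair j X G = 0"
    if "modform (2 - 2 * int n) h H" "\<And>m. fls_nth X m = of_int m ^ j * fls_nth H m" "modform (2 * int n) g G" "fls_nth G 0 = 0" for X h H g G
    using pair_exact[OF that(1,3,4,2)] pair_swap[OF oj, of X G] by simp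
  have E10: "fls_nth E1 0 = 0"
  proof -
    obtain p where p: "prime p" "a p \<noteq> 1 + of_nat p ^ j"
      using not_eisenstein_eigenvalues[OF n2 F(1,2) F(4)[unfolded j_def]] unfolding j_def by blast
    obtain H where "\<And>m. fls_nth (fls_hecke j p E1 - fls_const (a p) * E1) m = of_int m ^ j * fls_nth H m"
      using eig[OF p(1)] by blast
    from this[of 0] have "(1 + of_nat p ^ j - a p) * fls_nth E1 0 = 0"
      using n prime_gt_0_nat[OF p(1)] by (simp add: fls_nth_hecke j_def algebra_simps)
    thus ?thesis using p(2) by auto
  qed
  obtain X h H where X: "modform (2 * int n) (e2 - fscale l f) X" "modform (2 - 2 * int n) h H" "H \<in> fls_over K"
      "\<And>m. fls_nth X m = of_int m ^ (2 * n - 1) * fls_nth H m"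
    by (rule dR_exact_expansion[OF K n e2(3)[folded K_def]], rule that)
  define E2 where "E2 = fls_const l * F + X"
  have E2: "modform (2 * int n) e2 E2"
  proof -
    have "modform (2 * int n) (\<lambda>z. l * f z + (e2 - fscale l f) z) E2"
      unfolding E2_def using cusp_modform[OF F(1)] by (intro modform_add modform_cmult X(1)) simp
    thus ?thesis by (rule modform_cong) (simp add: fscale_def)
  qed
  have E20: "fls_nth E2 0 = 0" using cusp_nth[OF F(1), of 0] n by (simp add: E2_def X(4))
  have E21: "pair j E2 E1 = l * pair j F E1"
    using exact0[OF X(2) _ E1(1) E10, of X] X(4) by (simp add: E2_def pair_add_left pair_cmult_left j_def)
  have FE: "pair j F E1 \<noteq> 0"
  proof
    assume "pair j F E1 = 0"
    hence zero: "pair j E1 F = 0" using pair_swap[OF oj, of E1 F] by simp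
    have Epair: "pair j E1 (fls_hecke j p G) = a p * pair j E1 G" if p: "prime p" and G: "cusp (2 * n) g G" for p g G
    proof -
      obtain h H where "modform (2 - 2 * int n) h H" "\<And>m. fls_nth (fls_hecke j p E1 - fls_const (a p) * E1) m = of_int m ^ j * fls_nth H m"
        using eig[OF p] by blast
      from exact0[OF this, of g G] G have "pair j (fls_hecke j p E1) G = a p * pair j E1 G"
        by (simp add: pair_diff_left pair_cmult_left cusp_def)
      thus ?thesis using pair_hecke[OF prime_gt_0_nat[OF p]] by simp
    qed
    have orth: "pair j E1 G = 0" if "cusp (2 * n) g G" for g G
      by (rule eigenfunctional_zero[OF n F(1,2) F(4)[unfolded j_def] Epair[unfolded j_def] zero[unfolded j_def] that, folded j_def])
    obtain N :: int where N: "N > 0" "\<And>m. m < - N \<Longrightarrow> fls_nth E1 m = 0"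
      by (rule fls_bounded_support[of E1 E1], rule that)
    obtain x G where x: "x \<in> dR_exact n K" and G: "modform (2 * int n) (e1 - x) G" "\<forall>m<0. fls_nth G m = 0"
      using reduce_poles[OF K n E1(1,2), of "nat N"] N orth by (auto simp: j_def)
    obtain X h H where X: "modform (2 * int n) x X" "modform (2 - 2 * int n) h H"
      "\<And>m. fls_nth X m = of_int m ^ (2 * n - 1) * fls_nth H m" "\<And>z. Im z \<le> 0 \<Longrightarrow> x z = 0" "H \<in> fls_over K"
      by (rule dR_exact_expansion[OF K n x], rule that)
    have XH: "fls_nth X m = of_int m ^ j * fls_nth H m" for m using X(3) by (simp add: j_def)
    have "modform (2 * int n) (e1 - x) (E1 - X)" unfolding fun_diff_def by (intro modform_diff E1 X)
    hence GE: "G = E1 - X" using G(1) modform_qexp qexp_unique by blast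
    have "X \<in> fls_over K"
      using X(5) by (auto simp: fls_over_def XH intro!: subfieldD[OF K] subfield_power[OF K] subfield_of_int[OF K])
    hence GK: "G \<in> fls_over K" unfolding GE by (intro fls_over_diff K E1)
    have "fls_nth G 0 = 0" using E10 oj by (auto simp: GE XH intro: Suc_pred' elim: oddE)
    hence cG: "cusp (2 * n) (e1 - x) G" using G by (auto simp: cusp_def order_le_less)
    have "fls_hecke j p G = fls_const (a p) * G" if p: "prime p" for p
    proof -
      have p0: "p > 0" using prime_gt_0_nat[OF p] .
      obtain b B where b: "modform (2 - 2 * int n) b B" "\<And>m. fls_nth (fls_hecke j p E1 - fls_const (a p) * E1) m = of_int m ^ j * fls_nth B m"
        using eig[OF p] by blast
      obtain h' H' where h': "modform (2 - 2 * int n) h' H'" "\<And>m. fls_nth (fls_hecke j p X) m = of_int m ^ j * fls_nth H' m"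
        by (rule hecke_exact[OF p n X(2,3), folded j_def], rule that)
      \<comment> \<open>R expands a form of weight \<open>2 - 2n\<close> whose derivative is \<open>T\<^sub>p G - a\<^sub>p G\<close>.\<close>
      define R where "R = B - H' + fls_const (a p) * H"
      have R: "modform (2 - 2 * int n) (\<lambda>z. b z - h' z + a p * h z) R"
        unfolding R_def by (intro modform_add modform_diff modform_cmult b h' X)
      have Q: "fls_nth (fls_hecke j p G - fls_const (a p) * G) m = of_int m ^ j * fls_nth R m" for m
      proof -
        have "fls_nth (fls_hecke j p G - fls_const (a p) * G) m =
          fls_nth (fls_hecke j p E1 - fls_const (a p) * E1) m - fls_nth (fls_hecke j p X) m + a p * fls_nth X m"
          by (simp add: GE fls_nth_hecke[OF p0] algebra_simps)
        also have "\<dots> = of_int m ^ j * fls_nth R m"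
          unfolding b(2) h'(2) XH by (simp add: R_def algebra_simps)
        finally show ?thesis .
      qed
      have "cusp (2 * n) (hecke_dR n p (e1 - x)) (fls_hecke j p G)"
        unfolding j_def by (rule hecke_cusp[OF p n cG])
      hence "fls_nth R m = 0" if "m < 0" for m
        using Q[of m] that cusp_nth[of "2 * n" _ _ m] cG by simp
      hence "R = 0" using n2 by (intro negative_weight_zero[OF R]) auto
      thus ?thesis using Q by (auto intro!: fls_eqI)
    qed
    hence GF: "G = fls_const (fls_nth G 1) * F"
      by (intro hecke_eigen_coeffs[of F j a G]) (use F cusp_nth[OF F(1)] cusp_nth[OF cG] in auto)
    define c where "c = fls_nth G 1"
    have cK: "c \<in> K" using GK by (simp add: c_def fls_over_def)
    have ex: "e1 - fscale c f = x"
    proof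
      fix z
      show "(e1 - fscale c f) z = x z"
      proof (cases "Im z > 0")
        case True
        have "(e1 - x) z = c * f z"
          using qexp_unique[OF modform_qexp[OF G(1)]] qexp_eval[OF modform_qexp[OF G(1)] True] qexp_eval[OF modform_qexp[OF modform_cmult[OF cusp_modform[OF F(1)], of c]] True] GF
          by (simp add: c_def)
        thus ?thesis by (simp add: fscale_def algebra_simps)
      next
        case False
        thus ?thesis using E1(3) F(5) X(4) by (simp add: fscale_def)
      qed
    qed
    have lK: "l \<in> K" using e2(1) by (simp add: K_def)
    have "fscale (- (c / l)) (e2 - fscale l f) \<in> dR_exact n K"
      using e2(3) unfolding K_def[symmetric] dR_exact_def
      by (intro span_over_scale vector_space_fscale K subfieldD cK lK)
    hence "x + fscale (- (c / l)) (e2 - fscale l f) \<in> dR_exact n K"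
      using x unfolding dR_exact_def by (intro span_over_add vector_space_fscale K)
    moreover have "x + fscale (- (c / l)) (e2 - fscale l f) = fscale 1 e1 + fscale (- (c / l)) e2"
      unfolding ex[symmetric] using e2(2) by (simp add: fscale_def fun_eq_iff field_simps)
    ultimately have "fscale 1 e1 + fscale (- (c / l)) e2 \<in> dR_exact n K" by simp
    from ind[OF _ _ this] show False using subfieldD[OF K] cK lK by auto
  qed
  have "pair j F E1 \<in> K" by (rule pair_over[OF K F(3) E1(2)])
  hence "pair j E2 E1 \<in> K" unfolding E21 using e2(1) subfieldD[OF K] by (simp add: K_def)
  thus ?thesis using that[OF n2 E1(1) E2 E10 E20] E21 FE e2(2) by (simp add: K_def j_def)
qed

section \<open>Polynomials of degree at most w as a representation\<close>

text \<open>Setting \<open>a = 1\<close> and \<open>b = X\<close> identifies homogeneous polynomials of degree w with polynomials of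
  degree at most w. The right action of S, which is \<open>a \<mapsto> b\<close>, \<open>b \<mapsto> -a\<close>, becomes
  \<open>p(X) \<mapsto> X\<^sup>w p(-1/X)\<close>, and that of T becomes \<open>p(X) \<mapsto> p(X + 1)\<close>.\<close>
definition act_S :: "nat \<Rightarrow> complex poly \<Rightarrow> complex poly" where
  "act_S w p = (\<Sum>i\<le>w. monom ((-1) ^ i * coeff p i) (w - i))"

definition act_T :: "complex poly \<Rightarrow> complex poly" where
  "act_T p = pcompose p [:1, 1:]"

definition act_Tinv :: "complex poly \<Rightarrow> complex poly" where
  "act_Tinv p = pcompose p [:-1, 1:]"

text \<open>The action of \<open>T\<^sup>-\<^sup>1 S\<close>, which has order three in \<open>PSL\<^sub>2(\<int>)\<close> and fixes \<open>\<rho>\<close>.\<close>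
definition act_U :: "nat \<Rightarrow> complex poly \<Rightarrow> complex poly" where
  "act_U w p = act_S w (act_Tinv p)"

lemma poly_act_T [simp]: "poly (act_T p) x = poly p (x + 1)"
  by (simp add: act_T_def poly_pcompose add.commute)

lemma poly_act_Tinv [simp]: "poly (act_Tinv p) x = poly p (x - 1)"
  by (simp add: act_Tinv_def poly_pcompose)

lemma degree_act_T [simp]: "degree (act_T p) = degree p" and degree_act_Tinv [simp]: "degree (act_Tinv p) = degree p"
  by (simp_all add: act_T_def act_Tinv_def degree_pcompose)

lemma poly_ext: "(\<And>x. poly p x = poly q x) \<Longrightarrow> p = (q :: complex poly)"
  by (simp add: poly_eq_poly_eq_iff[symmetric] fun_eq_iff)

text \<open>The two exceptional points are those where S or a product of S and T has a pole.\<close>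
lemma poly_ext_nonzero:
  assumes "\<And>x. x \<noteq> 0 \<Longrightarrow> x \<noteq> -1 \<Longrightarrow> poly p x = poly q x"
  shows "p = (q :: complex poly)"
proof -
  have "p * ([:0, 1:] * [:1, 1:]) = q * ([:0, 1:] * [:1, 1:])"
  proof (rule poly_ext)
    fix x :: complex
    consider "x = 0" | "x = -1" | "x \<noteq> 0" "x \<noteq> -1" by blast
    thus "poly (p * ([:0, 1:] * [:1, 1:])) x = poly (q * ([:0, 1:] * [:1, 1:])) x"
      by cases (simp_all add: assms)
  qed
  thus ?thesis by (subst (asm) mult_cancel_right) simp
qed

lemma act_Tinv_act_T [simp]: "act_Tinv (act_T p) = p" "act_T (act_Tinv p) = p"
  by (rule poly_ext, simp)+

lemma act_T_add: "act_T (p + q) = act_T p + act_T q"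
  and act_T_smult: "act_T (smult c p) = smult c (act_T p)"
  by (rule poly_ext, simp)+

lemma act_Tinv_add: "act_Tinv (p + q) = act_Tinv p + act_Tinv q" and act_Tinv_smult: "act_Tinv (smult c p) = smult c (act_Tinv p)"
  by (rule poly_ext, simp)+

lemma coeff_act_S: "coeff (act_S w p) k = (if k \<le> w then (-1) ^ (w - k) * coeff p (w - k) else 0)"
proof -
  have "coeff (act_S w p) k = (\<Sum>i\<le>w. if i = w - k \<and> k \<le> w then (-1) ^ i * coeff p i else 0)"
    unfolding act_S_def coeff_sum coeff_monom by (intro sum.cong) auto
  thus ?thesis by (auto simp: sum.delta)
qed

lemma degree_act_S: "degree (act_S w p) \<le> w"
  by (rule degree_le) (simp add: coeff_act_S)

lemma act_S_add: "act_S w (p + q) = act_S w p + act_S w q"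
  and act_S_smult: "act_S w (smult c p) = smult c (act_S w p)"
  by (rule poly_eqI, simp add: coeff_act_S algebra_simps)+

lemma degree_act_U: "degree (act_U w p) \<le> w"
  by (simp add: act_U_def degree_act_S)

lemma act_U_add: "act_U w (p + q) = act_U w p + act_U w q"
  and act_U_smult: "act_U w (smult c p) = smult c (act_U w p)"
  by (simp_all add: act_U_def act_Tinv_add act_Tinv_smult act_S_add act_S_smult)

lemma poly_act_S:
  assumes "degree p \<le> w" "x \<noteq> 0"
  shows "poly (act_S w p) x = x ^ w * poly p (- 1 / x)"
proof -
  have "poly p y = (\<Sum>i\<le>w. coeff p i * y ^ i)" for y
    using arg_cong[OF poly_as_sum_of_monoms'[OF assms(1)], of "\<lambda>p. poly p y"]
    by (simp add: poly_sum poly_monom)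
  hence e: "x ^ w * poly p (- 1 / x) = (\<Sum>i\<le>w. x ^ w * (coeff p i * (- 1 / x) ^ i))"
    by (simp only: sum_distrib_left)
  have "(-1) ^ i * coeff p i * x ^ (w - i) = x ^ w * (coeff p i * (- 1 / x) ^ i)" if "i \<le> w" for i
  proof -
    have "x ^ w = x ^ i * x ^ (w - i)" using that by (simp flip: power_add)
    moreover have "(- 1 / x) ^ i = (- 1) ^ i / x ^ i" by (rule power_divide)
    ultimately show ?thesis using assms(2) by simp
  qed
  hence "(\<Sum>i\<le>w. (-1) ^ i * coeff p i * x ^ (w - i)) = (\<Sum>i\<le>w. x ^ w * (coeff p i * (- 1 / x) ^ i))"
    by (intro sum.cong) simp_all
  thus ?thesis unfolding e by (simp add: act_S_def poly_sum poly_monom)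
qed

lemma act_S_act_S:
  assumes "even w" "degree p \<le> w" shows "act_S w (act_S w p) = p"
proof (rule poly_eqI)
  fix k
  have "(-1) ^ (w - k) * (-1) ^ k = (1 :: complex)" if "k \<le> w"
    using that assms(1) by (simp flip: power_add)
  thus "coeff (act_S w (act_S w p)) k = coeff p k"
    using assms(2) by (cases "k \<le> w") (auto simp: coeff_act_S coeff_eq_0 simp flip: mult.assoc)
qed

lemma act_U_cube:
  assumes w: "even w" and p: "degree p \<le> w"
  shows "act_U w (act_U w (act_U w p)) = p"
proof (rule poly_ext_nonzero)
  fix x :: complex assume x: "x \<noteq> 0" "x \<noteq> -1"
  have v: "poly (act_U w q) y = y ^ w * poly q (- 1 / y - 1)" if "degree q \<le> w" "y \<noteq> 0" for q y
    using that by (simp add: act_U_def poly_act_S)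
  have x1: "x + 1 \<noteq> 0" using x(2) by (metis add_eq_0_iff2)
  have a: "- 1 / x - 1 = - ((x + 1) / x)" using x(1) by (simp add: field_simps)
  have b: "- 1 / (- ((x + 1) / x)) - 1 = - 1 / (x + 1)" using x x1 by (simp add: field_simps)
  have c: "- 1 / (- 1 / (x + 1)) - 1 = x" using x1 by (simp add: field_simps)
  have "poly (act_U w (act_U w (act_U w p))) x = x ^ w * ((- ((x + 1) / x)) ^ w * ((- 1 / (x + 1)) ^ w * poly p x))"
  proof -
    have nz: "- ((x + 1) / x) \<noteq> 0" "- 1 / (x + 1) \<noteq> 0" using x x1 by simp_all
    show ?thesis
      unfolding v[OF degree_act_U x(1)] a v[OF degree_act_U nz(1)] b v[OF p nz(2)] c ..
  qed
  also have "\<dots> = (x * - ((x + 1) / x) * (- 1 / (x + 1))) ^ w * poly p x"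
    by (simp only: power_mult_distrib mult.assoc)
  also have "x * - (y / x) * (- 1 / y) = 1" if "y \<noteq> 0" for y using that x(1) by simp
  note this[OF x1]
  finally show "poly (act_U w (act_U w (act_U w p))) x = poly p x" by simp
qed

subsection \<open>The invariant form\<close>

text \<open>The \<open>SL\<^sub>2(\<int>)\<close>-invariant form on the symmetric power.\<close>
definition inv_form :: "nat \<Rightarrow> complex poly \<Rightarrow> complex poly \<Rightarrow> complex" where
  "inv_form w p q = (\<Sum>i\<le>w. (-1) ^ i * (fact i * fact (w - i) / fact w) * coeff p i * coeff q (w - i))"

lemma inv_form_add_left: "inv_form w (p + p') q = inv_form w p q + inv_form w p' q"
  and inv_form_smult_left: "inv_form w (smult c p) q = c * inv_form w p q"
  by (simp_all only: inv_form_def coeff_add coeff_smult ring_distribs sum.distrib sum_distrib_left)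
     (simp add: mult_ac)

lemma inv_form_add_right: "inv_form w p (q + q') = inv_form w p q + inv_form w p q'"
  and inv_form_diff_right: "inv_form w p (q - q') = inv_form w p q - inv_form w p q'"
  and inv_form_smult_right: "inv_form w p (smult c q) = c * inv_form w p q"
  by (simp_all only: inv_form_def coeff_add coeff_diff coeff_smult ring_distribs sum.distrib sum_subtractf sum_distrib_left)
     (simp add: mult_ac)

lemma inv_form_minus_left: "inv_form w (- p) q = - inv_form w p q"
  using inv_form_smult_left[of w "-1" p q] by simp

lemma inv_form_diff_left: "inv_form w (p - p') q = inv_form w p q - inv_form w p' q"
  using inv_form_add_left[of w p "- p'" q] by (simp add: inv_form_minus_left)

lemma inv_form_zero_left: "inv_form w 0 q = 0"
  by (simp add: inv_form_def)

lemma inv_form_sym: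
  assumes "even w" shows "inv_form w p q = inv_form w q p"
proof -
  have "inv_form w p q = (\<Sum>i\<le>w. (-1) ^ (w - i) * (fact (w - i) * fact i / fact w) * coeff p (w - i) * coeff q i)"
    unfolding inv_form_def by (rule sum.reindex_bij_witness[of _ "\<lambda>i. w - i" "\<lambda>i. w - i"]) auto
  also have "\<dots> = inv_form w q p"
    unfolding inv_form_def
  proof (rule sum.cong[OF refl])
    fix i assume "i \<in> {..w}"
    hence "even (w - i) \<longleftrightarrow> even i" using assms by auto
    hence "(-1) ^ (w - i) = ((-1) ^ i :: complex)" by (simp add: minus_one_power_iff)
    thus "(-1) ^ (w - i) * (fact (w - i) * fact i / fact w) * coeff p (w - i) * coeff q i =
       (-1) ^ i * (fact i * fact (w - i) / fact w) * coeff q i * coeff p (w - i)" by simp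
  qed
  finally show ?thesis .
qed

lemma inv_form_act_S:
  assumes "even w" shows "inv_form w (act_S w p) (act_S w q) = inv_form w p q"
proof -
  have "inv_form w (act_S w p) (act_S w q) = (\<Sum>i\<le>w. (-1) ^ i * (fact i * fact (w - i) / fact w) *
      coeff p (w - i) * coeff q i)"
    unfolding inv_form_def
  proof (rule sum.cong[OF refl])
    fix i assume i: "i \<in> {..w}"
    hence "(-1) ^ (w - i) * (-1) ^ i = (1 :: complex)" using assms by (simp flip: power_add)
    thus "(-1) ^ i * (fact i * fact (w - i) / fact w) * coeff (act_S w p) i * coeff (act_S w q) (w - i) =
      (-1) ^ i * (fact i * fact (w - i) / fact w) * coeff p (w - i) * coeff q i"
      using i by (simp add: coeff_act_S)
  qed
  also have "\<dots> = inv_form w q p" unfolding inv_form_def by (intro sum.cong) auto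
  finally show ?thesis using inv_form_sym[OF assms] by simp
qed

text \<open>The form is normalized so that the powers \<open>(X - z)\<^sup>w\<close> represent evaluation at z.\<close>
lemma inv_form_linear_power:
  assumes w: "even w" and p: "degree p \<le> w"
  shows "inv_form w p ([:- z, 1:] ^ w) = poly p z"
proof -
  have "(-1) ^ i * (fact i * fact (w - i) / fact w) * coeff p i * coeff ([:- z, 1:] ^ w) (w - i) = coeff p i * z ^ i"
    if i: "i \<le> w" for i
  proof -
    have "coeff ([:- z, 1:] ^ w) (w - i) = of_nat (w choose i) * (- z) ^ i"
      using i coeff_linear_poly_power[of "w - i" w "- z" 1] by (simp add: binomial_symmetric[symmetric])
    moreover have "of_nat (w choose i) = (fact w / (fact i * fact (w - i)) :: complex)"
      using i by (rule binomial_fact)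
    ultimately have "(-1) ^ i * (fact i * fact (w - i) / fact w) * coeff p i * coeff ([:- z, 1:] ^ w) (w - i)
       = (fact i * fact (w - i) / fact w * (fact w / (fact i * fact (w - i)))) * coeff p i * ((-1) ^ i * (- z) ^ i)"
      by (simp only: mult_ac)
    also have "fact i * fact (w - i) / fact w * (fact w / (fact i * fact (w - i))) = (1 :: complex)" by simp
    finally show ?thesis by (simp flip: power_mult_distrib)
  qed
  moreover have "poly p z = (\<Sum>i\<le>w. coeff p i * z ^ i)"
    using arg_cong[OF poly_as_sum_of_monoms'[OF p], of "\<lambda>p. poly p z"]
    by (simp add: poly_sum poly_monom)
  ultimately show ?thesis unfolding inv_form_def by simp
qed

text \<open>The powers \<open>(X - z)\<^sup>w\<close> span the polynomials of degree at most w: as a function of z, the value of a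
  functional on them is a polynomial whose coefficients are its values on monomials, up to nonzero
  factors.\<close>
lemma functional_zero:
  fixes L :: "complex poly \<Rightarrow> complex"
  assumes add: "\<And>p q. L (p + q) = L p + L q" and smult: "\<And>c p. L (smult c p) = c * L p"
    and power: "\<And>z. L ([:- z, 1:] ^ w) = 0" and q: "degree q \<le> w"
  shows "L q = 0"
proof -
  have L0: "L 0 = 0" using smult[of 0 0] by simp
  have Lsum: "L (\<Sum>i\<in>A. h i) = (\<Sum>i\<in>A. L (h i))" if "finite A" for A :: "nat set" and h
    using that by (induction A rule: finite_induct) (simp_all add: L0 add)
  have expand: "L p = (\<Sum>i\<le>w. coeff p i * L (monom 1 i))" if "degree p \<le> w" for p
  proof -
    have "L p = L (\<Sum>i\<le>w. smult (coeff p i) (monom 1 i))"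
      using poly_as_sum_of_monoms'[OF that] by (simp add: smult_monom)
    thus ?thesis by (simp add: Lsum smult)
  qed
  define Q where "Q = (\<Sum>i\<le>w. monom (of_nat (w choose i) * (-1) ^ (w - i) * L (monom 1 i)) (w - i))"
  have "poly Q z = 0" for z
  proof -
    have "degree ([:- z, 1:] ^ w) \<le> w" by (simp add: degree_power_eq)
    from expand[OF this] have "0 = (\<Sum>i\<le>w. coeff ([:- z, 1:] ^ w) i * L (monom 1 i))" by (simp add: power)
    also have "\<dots> = poly Q z"
      unfolding Q_def poly_sum poly_monom
    proof (rule sum.cong[OF refl])
      fix i assume "i \<in> {..w}"
      hence "coeff ([:- z, 1:] ^ w) i = of_nat (w choose i) * (- z) ^ (w - i)"
        using coeff_linear_poly_power[of i w "- z" 1] by simp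
      moreover have "(- z) ^ (w - i) = (-1) ^ (w - i) * z ^ (w - i)" by (rule power_minus)
      ultimately show "coeff ([:- z, 1:] ^ w) i * L (monom 1 i) =
         of_nat (w choose i) * (-1) ^ (w - i) * L (monom 1 i) * z ^ (w - i)" by simp
    qed
    finally show ?thesis by simp
  qed
  hence Q0: "Q = 0" by (intro poly_ext) simp
  have "L (monom 1 k) = 0" if k: "k \<le> w" for k
  proof -
    have "coeff Q (w - k) = (\<Sum>i\<le>w. if i = k then of_nat (w choose i) * (-1) ^ (w - i) * L (monom 1 i) else 0)"
      unfolding Q_def coeff_sum coeff_monom by (rule sum.cong) (use k in auto)
    hence "of_nat (w choose k) * (-1) ^ (w - k) * L (monom 1 k) = 0" using k by (simp add: Q0 sum.delta)
    thus ?thesis using k by simp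
  qed
  thus ?thesis using expand[OF q] by simp
qed

text \<open>Translation by T maps the powers \<open>(X - z)\<^sup>w\<close> to each other and is compatible with evaluation.\<close>
lemma inv_form_act_Tinv:
  assumes w: "even w" and p: "degree p \<le> w" and q: "degree q \<le> w"
  shows "inv_form w (act_Tinv p) (act_Tinv q) = inv_form w p q"
proof -
  have "inv_form w (act_Tinv p) (act_Tinv q) - inv_form w p q = 0"
  proof (rule functional_zero[OF _ _ _ q, where L = "\<lambda>q. inv_form w (act_Tinv p) (act_Tinv q) - inv_form w p q"])
    fix z
    have "act_Tinv ([:- z, 1:] ^ w) = [:- (z + 1), 1:] ^ w" by (rule poly_ext) (simp add: poly_power algebra_simps)
    thus "inv_form w (act_Tinv p) (act_Tinv ([:- z, 1:] ^ w)) - inv_form w p ([:- z, 1:] ^ w) = 0"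
      using w p by (simp only: inv_form_linear_power degree_act_Tinv) simp
  qed (simp_all add: act_Tinv_add act_Tinv_smult inv_form_add_right inv_form_smult_right algebra_simps)
  thus ?thesis by simp
qed

lemma inv_form_act_U:
  assumes "even w" "degree p \<le> w" "degree q \<le> w"
  shows "inv_form w (act_U w p) (act_U w q) = inv_form w p q"
  using assms by (simp add: act_U_def inv_form_act_S inv_form_act_Tinv)

subsection \<open>Period polynomials\<close>

text \<open>The value at S of a cocycle that vanishes at T; the two equations are the cocycle relations for
  \<open>S\<^sup>2\<close> and for the cube of \<open>T\<^sup>-\<^sup>1 S\<close>.\<close>
definition period_poly :: "nat \<Rightarrow> complex poly \<Rightarrow> bool" where
  "period_poly w k \<longleftrightarrow> degree k \<le> w \<and> act_S w k = - k \<and> k + act_U w k + act_U w (act_U w k) = 0"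

text \<open>The cup product of two parabolic cocycles in terms of their values at S, up to normalization.\<close>
definition period_pairing :: "nat \<Rightarrow> complex poly \<Rightarrow> complex poly \<Rightarrow> complex" where
  "period_pairing w k l = inv_form w k (l + smult 2 (act_U w l))"

text \<open>A cocycle is determined by S and \<open>T\<^sup>-\<^sup>1 S\<close>, and on the finite subgroups generated by them it is a
  coboundary. The values of an Eichler integral at the elliptic points give u and x.\<close>
lemma period_polyI:
  assumes w: "even w" and u: "degree u \<le> w" "act_S w u = u + k" and x: "degree x \<le> w" "act_U w x = x + k"
  shows "period_poly w k"
proof -
  have "k = act_S w u - u" using u(2) by simp
  hence deg: "degree k \<le> w" using u(1) degree_act_S by (simp add: degree_diff_le)
  have "u = act_S w (act_S w u)" by (rule act_S_act_S[OF w u(1), symmetric])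
  also have "\<dots> = u + k + act_S w k" unfolding u(2) by (simp add: act_S_add u(2))
  finally have "u + 0 = u + (k + act_S w k)" by (simp add: add.assoc)
  hence "k + act_S w k = 0" by (simp only: add_left_cancel)
  hence "act_S w k = - k" by (rule add_eq_0_iff[THEN iffD1])
  moreover have "x = act_U w (act_U w (act_U w x))" by (rule act_U_cube[OF w x(1), symmetric])
  hence "x = x + (k + act_U w k + act_U w (act_U w k))" by (simp add: x(2) act_U_add add_ac)
  hence "x + 0 = x + (k + act_U w k + act_U w (act_U w k))" by simp
  hence "k + act_U w k + act_U w (act_U w k) = 0" by (simp only: add_left_cancel)
  ultimately show ?thesis using deg by (simp add: period_poly_def)
qed

lemma period_poly_combine:
  assumes "period_poly w k" "period_poly w l"
  shows "period_poly w (smult a k + smult b l)"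
proof -
  have "smult a (k + act_U w k + act_U w (act_U w k)) + smult b (l + act_U w l + act_U w (act_U w l)) = 0"
    using assms by (simp add: period_poly_def)
  moreover have "degree (smult a k + smult b l) \<le> w"
    using assms by (intro degree_add_le) (auto simp: period_poly_def intro: order_trans[OF degree_smult_le])
  ultimately show ?thesis using assms
    by (simp add: period_poly_def act_S_add act_S_smult act_U_add act_U_smult smult_add_right algebra_simps)
qed

text \<open>Invariance of the form determines the products of k with u and with x: averaging over the groups
  generated by S and by \<open>T\<^sup>-\<^sup>1 S\<close> amounts to \<open>u = - l/2\<close> and \<open>x = - 2/3 l - 1/3 (l | T\<^sup>-\<^sup>1 S)\<close>.\<close>
lemma inv_form_fixed_points:
  assumes w: "even w" and k: "period_poly w k"
    and u: "degree u \<le> w" "act_S w u = u + l" and x: "degree x \<le> w" "act_U w x = x + l"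
  shows "inv_form w k (x - u) = - period_pairing w k l / 6"
proof -
  have dk: "degree k \<le> w" and ks: "act_S w k = - k" and sum: "k + act_U w k + act_U w (act_U w k) = 0"
    using k by (simp_all add: period_poly_def)
  have "act_U w (act_U w k) = - (k + act_U w k)" by (rule add_eq_0_iff[THEN iffD1, OF sum])
  hence kv: "act_U w (act_U w k) = - k - act_U w k" by simp
  have dl: "degree l \<le> w"
  proof -
    have "l = act_S w u - u" using u(2) by simp
    thus ?thesis using u(1) degree_act_S by (simp add: degree_diff_le)
  qed
  note dv = degree_act_U[of w]
  have "inv_form w k u = inv_form w (act_S w k) (act_S w u)" using inv_form_act_S[OF w] by simp
  hence 1: "2 * inv_form w k u = - inv_form w k l" by (simp add: ks u(2) inv_form_minus_left inv_form_add_right)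
  have "inv_form w k x = inv_form w (act_U w k) (act_U w x)" using inv_form_act_U[OF w dk x(1)] by simp
  hence 2: "inv_form w k x = inv_form w (act_U w k) x + inv_form w (act_U w k) l" by (simp add: x(2) inv_form_add_right)
  have "inv_form w (act_U w k) x = inv_form w (act_U w (act_U w k)) (act_U w x)" using inv_form_act_U[OF w dv x(1)] by simp
  also have "\<dots> = - inv_form w k x - inv_form w (act_U w k) x - inv_form w k l - inv_form w (act_U w k) l"
    unfolding kv x(2) inv_form_add_right inv_form_diff_left inv_form_minus_left by simp
  finally have 3: "inv_form w (act_U w k) x = \<dots>" .
  have "inv_form w (act_U w k) l = inv_form w (act_U w (act_U w k)) (act_U w l)" using inv_form_act_U[OF w dv dl] by simp
  also have "\<dots> = - inv_form w k (act_U w l) - inv_form w (act_U w k) (act_U w l)"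
    unfolding kv inv_form_diff_left inv_form_minus_left by simp
  also have "inv_form w (act_U w k) (act_U w l) = inv_form w k l" by (rule inv_form_act_U[OF w dk dl])
  finally have 4: "inv_form w (act_U w k) l = - inv_form w k (act_U w l) - inv_form w k l" .
  have "period_pairing w k l = inv_form w k l + 2 * inv_form w k (act_U w l)"
    by (simp add: period_pairing_def inv_form_add_right inv_form_smult_right)
  moreover have "6 * inv_form w k x - 6 * inv_form w k u = - (inv_form w k l + 2 * inv_form w k (act_U w l))"
    using 1 2 3 4 by algebra
  ultimately show ?thesis by (simp add: inv_form_diff_right field_simps)
qed

lemma period_pairing_alternating:
  assumes w: "even w" and k: "period_poly w k"
  shows "period_pairing w k k = 0"
proof -
  have dk: "degree k \<le> w" and kv: "k + act_U w k + act_U w (act_U w k) = 0"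
    using k by (auto simp: period_poly_def)
  have "inv_form w (act_U w (act_U w k)) k = inv_form w (act_U w (act_U w (act_U w k))) (act_U w k)"
    using inv_form_act_U[OF w degree_act_U dk] by simp
  also have "\<dots> = inv_form w k (act_U w k)" by (simp add: act_U_cube[OF w dk])
  finally have 1: "inv_form w (act_U w (act_U w k)) k = inv_form w k (act_U w k)" .
  have "0 = inv_form w (k + act_U w k + act_U w (act_U w k)) k" by (simp add: kv inv_form_zero_left)
  also have "\<dots> = inv_form w k k + 2 * inv_form w k (act_U w k)"
    using 1 inv_form_sym[OF w, of "act_U w k" k] by (simp add: inv_form_add_left)
  finally show ?thesis by (simp add: period_pairing_def inv_form_add_right inv_form_smult_right)
qed

lemma period_pairing_add_left: "period_pairing w (k + k') l = period_pairing w k l + period_pairing w k' l"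
  and period_pairing_smult_left: "period_pairing w (smult c k) l = c * period_pairing w k l"
  and period_pairing_add_right: "period_pairing w l (k + k') = period_pairing w l k + period_pairing w l k'"
  and period_pairing_smult_right: "period_pairing w l (smult c k) = c * period_pairing w l k"
  by (simp_all add: period_pairing_def inv_form_add_left inv_form_smult_left inv_form_add_right inv_form_smult_right
      act_U_add act_U_smult smult_add_right algebra_simps)

lemma period_pairing_swap:
  assumes w: "even w" and k: "period_poly w k" "period_poly w l"
  shows "period_pairing w l k = - period_pairing w k l"
proof -
  have "period_poly w (k + l)" using period_poly_combine[OF k, of 1 1] by simp
  from period_pairing_alternating[OF w this] show ?thesis
    using period_pairing_alternating[OF w k(1)] period_pairing_alternating[OF w k(2)]
    by (simp add: period_pairing_add_left period_pairing_add_right add_eq_0_iff)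
qed

text \<open>For a T-invariant u one may take \<open>x = u\<close> in the formula for the pairing.\<close>
lemma coboundary_period:
  assumes w: "even w" and u: "degree u \<le> w" "act_T u = u"
  shows "period_poly w (act_S w u - u)" "period_poly w k \<Longrightarrow> period_pairing w k (act_S w u - u) = 0"
proof -
  have "act_Tinv u = u" using act_Tinv_act_T(1)[of u] u(2) by simp
  hence v: "act_U w u = u + (act_S w u - u)" by (simp add: act_U_def)
  have s: "act_S w u = u + (act_S w u - u)" by simp
  show "period_poly w (act_S w u - u)" by (rule period_polyI[OF w u(1) s u(1) v])
  show "period_pairing w k (act_S w u - u) = 0" if "period_poly w k"
    using inv_form_fixed_points[OF w that u(1) s u(1) v] by (simp add: inv_form_def)
qed

section \<open>Eichler integrals\<close>

text \<open>A polynomial-valued primitive of \<open>E\<^sub>w\<^sub>+\<^sub>1(z) (X - z)\<^sup>w / w!\<close>, where E is a sequence of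
  successive derivatives: the Taylor polynomial of \<open>E\<^sub>0\<close> at z.\<close>
definition eichler :: "nat \<Rightarrow> (nat \<Rightarrow> complex \<Rightarrow> complex) \<Rightarrow> complex \<Rightarrow> complex poly" where
  "eichler w E z = (\<Sum>i\<le>w. smult (E i z / fact i) ([:- z, 1:] ^ i))"

lemma linear_power_coeff_deriv:
  "((\<lambda>z. coeff ([:- z, 1:] ^ i) k) has_field_derivative - (of_nat i * coeff ([:- z, 1:] ^ (i - 1)) k)) (at (z :: complex))"
proof (induction i arbitrary: k)
  case 0
  show ?case by simp
next
  case (Suc i)
  have rec: "coeff ([:- z, 1:] ^ Suc j) k = - z * coeff ([:- z, 1:] ^ j) k + (if k = 0 then 0 else coeff ([:- z, 1:] ^ j) (k - 1))"
    for z :: complex and j k by (simp add: coeff_pCons')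
  have "((\<lambda>z. - z * coeff ([:- z, 1:] ^ i) k + (if k = 0 then 0 else coeff ([:- z, 1:] ^ i) (k - 1))) has_field_derivative
     (- 1 * coeff ([:- z, 1:] ^ i) k + - (of_nat i * coeff ([:- z, 1:] ^ (i - 1)) k) * - z) +
      (if k = 0 then 0 else - (of_nat i * coeff ([:- z, 1:] ^ (i - 1)) (k - 1)))) (at z)"
  proof (rule DERIV_add)
    show "((\<lambda>z. - z * coeff ([:- z, 1:] ^ i) k) has_field_derivative
      - 1 * coeff ([:- z, 1:] ^ i) k + - (of_nat i * coeff ([:- z, 1:] ^ (i - 1)) k) * - z) (at z)"
      by (rule DERIV_mult[OF _ Suc.IH]) (auto intro!: derivative_eq_intros)
    show "((\<lambda>z. if k = 0 then 0 else coeff ([:- z, 1:] ^ i) (k - 1)) has_field_derivative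
      (if k = 0 then 0 else - (of_nat i * coeff ([:- z, 1:] ^ (i - 1)) (k - 1)))) (at z)"
      using Suc.IH[of "k - 1"] by (cases "k = 0") simp_all
  qed
  moreover have "(- 1 * coeff ([:- z, 1:] ^ i) k + - (of_nat i * coeff ([:- z, 1:] ^ (i - 1)) k) * - z) +
      (if k = 0 then 0 else - (of_nat i * coeff ([:- z, 1:] ^ (i - 1)) (k - 1))) =
      - (of_nat (Suc i) * coeff ([:- z, 1:] ^ (Suc i - 1)) k)"
  proof (cases i)
    case (Suc j)
    show ?thesis using rec[of z j k] unfolding Suc by (simp add: algebra_simps)
  qed simp
  ultimately show ?case unfolding rec by (simp only:)
qed

text \<open>All terms of the derivative of the Taylor polynomial cancel except for the last one.\<close>
lemma eichler_coeff_deriv: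
  assumes E: "\<And>i. (E i has_field_derivative E (Suc i) z) (at z)"
  shows "((\<lambda>z. coeff (eichler w E z) k) has_field_derivative coeff (smult (E (Suc w) z / fact w) ([:- z, 1:] ^ w)) k) (at z)"
proof (induction w)
  case 0
  show ?case by (cases k) (use E[of 0] in \<open>simp_all add: eichler_def\<close>)
next
  case (Suc w)
  have "((\<lambda>z. coeff (eichler w E z) k + (E (Suc w) z / fact (Suc w)) * coeff ([:- z, 1:] ^ Suc w) k) has_field_derivative
    coeff (smult (E (Suc w) z / fact w) ([:- z, 1:] ^ w)) k +
    ((E (Suc (Suc w)) z / fact (Suc w)) * coeff ([:- z, 1:] ^ Suc w) k +
     - (of_nat (Suc w) * coeff ([:- z, 1:] ^ (Suc w - 1)) k) * (E (Suc w) z / fact (Suc w)))) (at z)"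
    by (rule DERIV_add[OF Suc.IH DERIV_mult[OF DERIV_cdivide[OF E] linear_power_coeff_deriv]])
  moreover have "coeff (smult (E (Suc w) z / fact w) ([:- z, 1:] ^ w)) k +
    ((E (Suc (Suc w)) z / fact (Suc w)) * coeff ([:- z, 1:] ^ Suc w) k +
     - (of_nat (Suc w) * coeff ([:- z, 1:] ^ (Suc w - 1)) k) * (E (Suc w) z / fact (Suc w))) =
    coeff (smult (E (Suc (Suc w)) z / fact (Suc w)) ([:- z, 1:] ^ Suc w)) k"
  proof -
    have "of_nat (Suc w) / fact (Suc w) = (1 / fact w :: complex)"
      by (simp add: fact_Suc del: of_nat_Suc)
    hence "of_nat (Suc w) * c * (e / fact (Suc w)) = e / fact w * c" for c e :: complex
      by (metis (no_types, opaque_lifting) mult.commute mult.left_commute mult.right_neutral times_divide_eq_right)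
    thus ?thesis by simp
  qed
  moreover have "coeff (eichler (Suc w) E z) k = coeff (eichler w E z) k + (E (Suc w) z / fact (Suc w)) * coeff ([:- z, 1:] ^ Suc w) k" for z
    by (simp add: eichler_def)
  ultimately show ?case by (simp only:)
qed

lemma degree_eichler: "degree (eichler w E z) \<le> w"
  unfolding eichler_def
  by (intro degree_sum_le) (auto intro!: order_trans[OF degree_smult_le] simp: degree_power_eq)

lemma poly_eichler: "poly (eichler w E z) x = (\<Sum>i\<le>w. E i z / fact i * (x - z) ^ i)"
  by (simp add: eichler_def poly_sum poly_power)

lemma poly_eichler_diag: "poly (eichler w E z) z = E 0 z"
proof -
  have "poly (eichler w E z) z = (\<Sum>i\<le>w. if i = 0 then E 0 z else 0)"
    unfolding poly_eichler by (intro sum.cong) (auto simp: power_0_left)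
  thus ?thesis by (simp add: sum.delta)
qed

lemma poly_coeff_sum: "degree p \<le> w \<Longrightarrow> poly p x = (\<Sum>i\<le>w. x ^ i * coeff p i)" for p :: "complex poly"
  using arg_cong[OF poly_as_sum_of_monoms'[of p w], of "\<lambda>p. poly p x"] by (simp add: poly_sum poly_monom mult.commute)

lemma eichler_poly_deriv:
  assumes E: "\<And>i. (E i has_field_derivative E (Suc i) z) (at z)"
  shows "((\<lambda>z. poly (eichler w E z) x) has_field_derivative E (Suc w) z / fact w * (x - z) ^ w) (at z)"
proof -
  define Q where "Q = smult (E (Suc w) z / fact w) ([:- z, 1:] ^ w)"
  have dQ: "degree Q \<le> w" by (auto simp: Q_def degree_power_eq intro!: order_trans[OF degree_smult_le])
  have "((\<lambda>z. \<Sum>i\<le>w. x ^ i * coeff (eichler w E z) i) has_field_derivative (\<Sum>i\<le>w. x ^ i * coeff Q i)) (at z)"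
    unfolding Q_def by (intro DERIV_sum DERIV_cmult eichler_coeff_deriv E)
  moreover have "(\<Sum>i\<le>w. x ^ i * coeff Q i) = E (Suc w) z / fact w * (x - z) ^ w"
    using poly_coeff_sum[OF dQ, of x] by (simp add: Q_def poly_power)
  ultimately show ?thesis by (simp add: poly_coeff_sum[OF degree_eichler])
qed

lemma eichler_inv_form_deriv:
  assumes E: "\<And>i. (E i has_field_derivative E (Suc i) z) (at z)" and w: "even w" and p: "degree p \<le> w"
  shows "((\<lambda>z. inv_form w p (eichler w E z)) has_field_derivative E (Suc w) z / fact w * poly p z) (at z)"
proof -
  have "((\<lambda>z. inv_form w p (eichler w E z)) has_field_derivative inv_form w p (smult (E (Suc w) z / fact w) ([:- z, 1:] ^ w))) (at z)"
    unfolding inv_form_def by (intro DERIV_sum DERIV_cmult eichler_coeff_deriv E)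
  thus ?thesis by (simp add: inv_form_smult_right inv_form_linear_power[OF w p])
qed

lemma eichler_act_T:
  assumes "\<And>i. E i (z + 1) = E i z"
  shows "act_T (eichler w E (z + 1)) = eichler w E z"
  by (rule poly_ext) (simp add: poly_eichler assms)

text \<open>Both sides are primitives of the same polynomial-valued form, by the modularity of \<open>E\<^sub>w\<^sub>+\<^sub>1\<close>; their
  difference is the period polynomial.\<close>
lemma eichler_act_S:
  assumes w: "even w" and E: "\<And>i z. Im z > 0 \<Longrightarrow> (E i has_field_derivative E (Suc i) z) (at z)"
    and mod: "\<And>z. Im z > 0 \<Longrightarrow> E (Suc w) (- 1 / z) = z ^ (w + 2) * E (Suc w) z"
  obtains k where "\<And>z. Im z > 0 \<Longrightarrow> act_S w (eichler w E (- 1 / z)) = eichler w E z + k"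
proof -
  define k where "k = act_S w (eichler w E (- 1 / \<i>)) - eichler w E \<i>"
  have "act_S w (eichler w E (- 1 / z)) = eichler w E z + k" if z: "Im z > 0" for z
  proof (rule poly_ext_nonzero)
    fix x :: complex assume x: "x \<noteq> 0"
    define r where "r z = poly (act_S w (eichler w E (- 1 / z))) x - poly (eichler w E z) x" for z
    have req: "r z = x ^ w * poly (eichler w E (- 1 / z)) (- 1 / x) - poly (eichler w E z) x" for z
      by (simp add: r_def poly_act_S[OF degree_eichler x])
    have "(r has_field_derivative 0) (at z)" if z: "Im z > 0" for z
    proof -
      have z0: "z \<noteq> 0" using z by auto
      have "((\<lambda>z. poly (eichler w E (- 1 / z)) (- 1 / x)) has_field_derivative
          E (Suc w) (- 1 / z) / fact w * (- 1 / x - - 1 / z) ^ w * (1 / z\<^sup>2)) (at z)"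
        by (rule DERIV_chain2[OF eichler_poly_deriv derivative_S[OF z0]]) (rule E[OF Im_S[OF z]])
      hence "(r has_field_derivative
          x ^ w * (E (Suc w) (- 1 / z) / fact w * (- 1 / x - - 1 / z) ^ w * (1 / z\<^sup>2)) - E (Suc w) z / fact w * (x - z) ^ w) (at z)"
        unfolding req[abs_def] by (intro DERIV_diff DERIV_cmult eichler_poly_deriv E[OF z])
      moreover have "x ^ w * (E (Suc w) (- 1 / z) / fact w * (- 1 / x - - 1 / z) ^ w * (1 / z\<^sup>2)) = E (Suc w) z / fact w * (x - z) ^ w"
      proof -
        have "x ^ w * (- 1 / x - - 1 / z) ^ w * z ^ w = (x * (- 1 / x - - 1 / z) * z) ^ w" by (simp only: power_mult_distrib)
        also have "x * (- 1 / x - - 1 / z) * z = x - z" using x z0 by (simp add: field_simps)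
        finally have "x ^ w * (- 1 / x - - 1 / z) ^ w * z ^ w = (x - z) ^ w" .
        moreover have "x ^ w * (E (Suc w) (- 1 / z) / fact w * (- 1 / x - - 1 / z) ^ w * (1 / z\<^sup>2)) =
            E (Suc w) z / fact w * (x ^ w * (- 1 / x - - 1 / z) ^ w * z ^ w)"
          unfolding mod[OF z] power_add using z0 by (simp add: power2_eq_square)
        ultimately show ?thesis by simp
      qed
      ultimately show ?thesis by simp
    qed
    then obtain c where "\<And>z. Im z > 0 \<Longrightarrow> r z = c" using zero_derivative_const[of r] by blast
    hence "r z = r \<i>" using z by simp
    thus "poly (act_S w (eichler w E (- 1 / z))) x = poly (eichler w E z + k) x"
      unfolding r_def k_def by (simp add: algebra_simps)
  qed
  thus ?thesis by (rule that)
qed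

text \<open>The constant coefficient c of a product of weight 2 is the period of its primitive G. The
  transformation of G under \<open>z \<mapsto> -1/z\<close> is governed by the period polynomials; comparing its values
  at the fixed points i and \<open>\<rho>\<close> gives the formula.\<close>
lemma haberland:
  assumes w: "even w"
    and E: "\<And>i z. Im z > 0 \<Longrightarrow> (E i has_field_derivative E (Suc i) z) (at z)"
      "\<And>i z. Im z > 0 \<Longrightarrow> E i (z + 1) = E i z"
      "\<And>z. Im z > 0 \<Longrightarrow> E (Suc w) (- 1 / z) = z ^ (w + 2) * E (Suc w) z"
    and D: "\<And>i z. Im z > 0 \<Longrightarrow> (D i has_field_derivative D (Suc i) z) (at z)"
      "\<And>i z. Im z > 0 \<Longrightarrow> D i (z + 1) = D i z"
      "\<And>z. Im z > 0 \<Longrightarrow> D (Suc w) (- 1 / z) = z ^ (w + 2) * D (Suc w) z"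
    and G: "\<And>z. Im z > 0 \<Longrightarrow> (G has_field_derivative D (Suc w) z / fact w * E 0 z) (at z)"
      "\<And>z. Im z > 0 \<Longrightarrow> G (z + 1) - G z = c"
    and k: "\<And>z. Im z > 0 \<Longrightarrow> act_S w (eichler w E (- 1 / z)) = eichler w E z + k"
    and l: "\<And>z. Im z > 0 \<Longrightarrow> act_S w (eichler w D (- 1 / z)) = eichler w D z + l"
  shows "period_poly w k" "period_poly w l" "c = - period_pairing w k l / 6"
proof -
  have inv: "act_S w (eichler w H \<i>) = eichler w H \<i> + h" "act_U w (eichler w H rho) = eichler w H rho + h"
    if "\<And>i z. Im z > 0 \<Longrightarrow> H i (z + 1) = H i z"
      "\<And>z. Im z > 0 \<Longrightarrow> act_S w (eichler w H (- 1 / z)) = eichler w H z + h" for H h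
  proof -
    show "act_S w (eichler w H \<i>) = eichler w H \<i> + h" using that(2)[of \<i>] by simp
    have "act_T (eichler w H (rho + 1)) = eichler w H rho" by (rule eichler_act_T) (rule that(1)[OF rho_facts(1)])
    hence "act_Tinv (eichler w H rho) = eichler w H (rho + 1)" using act_Tinv_act_T(1) by metis
    thus "act_U w (eichler w H rho) = eichler w H rho + h"
      using that(2)[OF rho_facts(1)] unfolding rho_facts(3) by (simp add: act_U_def)
  qed
  note kE = inv[of E k, OF E(2) k] and lD = inv[of D l, OF D(2) l]
  show pk: "period_poly w k" by (rule period_polyI[OF w degree_eichler kE(1) degree_eichler kE(2)])
  show "period_poly w l" by (rule period_polyI[OF w degree_eichler lD(1) degree_eichler lD(2)])
  have dk: "degree k \<le> w" using pk by (simp add: period_poly_def)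
  \<comment> \<open>G(-1/z) - G(z) and the product of k with the Eichler integral have the same derivative.\<close>
  define r where "r z = G (- 1 / z) - G z - inv_form w k (eichler w D z)" for z
  have "(r has_field_derivative 0) (at z)" if z: "Im z > 0" for z
  proof -
    have z0: "z \<noteq> 0" using z by auto
    have "((\<lambda>z. G (- 1 / z)) has_field_derivative D (Suc w) (- 1 / z) / fact w * E 0 (- 1 / z) * (1 / z\<^sup>2)) (at z)"
      by (rule DERIV_chain2[OF G(1)[OF Im_S[OF z]] derivative_S[OF z0]])
    hence "(r has_field_derivative D (Suc w) (- 1 / z) / fact w * E 0 (- 1 / z) * (1 / z\<^sup>2) -
        D (Suc w) z / fact w * E 0 z - D (Suc w) z / fact w * poly k z) (at z)"
      unfolding r_def[abs_def] by (intro DERIV_diff G(1) z eichler_inv_form_deriv w dk D(1))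
    moreover have "D (Suc w) (- 1 / z) / fact w * E 0 (- 1 / z) * (1 / z\<^sup>2) = D (Suc w) z / fact w * (E 0 z + poly k z)"
    proof -
      have "poly (act_S w (eichler w E (- 1 / z))) z = E 0 z + poly k z"
        unfolding k[OF z] by (simp add: poly_eichler_diag)
      hence "z ^ w * E 0 (- 1 / z) = E 0 z + poly k z"
        unfolding poly_act_S[OF degree_eichler z0] poly_eichler_diag .
      moreover have "D (Suc w) (- 1 / z) / fact w * E 0 (- 1 / z) * (1 / z\<^sup>2) = D (Suc w) z / fact w * (z ^ w * E 0 (- 1 / z))"
        unfolding D(3)[OF z] power_add using z0 by (simp add: power2_eq_square)
      ultimately show ?thesis by simp
    qed
    ultimately show ?thesis by (simp add: ring_distribs)
  qed
  then obtain b where b: "\<And>z. Im z > 0 \<Longrightarrow> r z = b" using zero_derivative_const[of r] by blast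
  have "r \<i> = r rho" using b rho_facts(1) by simp
  hence "c = inv_form w k (eichler w D rho - eichler w D \<i>)"
    using G(2)[OF rho_facts(1)] unfolding r_def rho_facts(3) by (simp add: inv_form_diff_right algebra_simps)
  also have "\<dots> = - period_pairing w k l / 6"
    by (rule inv_form_fixed_points[OF w pk degree_eichler lD(1) degree_eichler lD(2)])
  finally show "c = - period_pairing w k l / 6" .
qed

section \<open>Rational structure on period polynomials\<close>

definition poly_over :: "complex set \<Rightarrow> complex poly set" where
  "poly_over K = {p. \<forall>i. coeff p i \<in> K}"

lemma poly_over_add: "complex_subfield K \<Longrightarrow> p \<in> poly_over K \<Longrightarrow> q \<in> poly_over K \<Longrightarrow> p + q \<in> poly_over K"
  and poly_over_diff: "complex_subfield K \<Longrightarrow> p \<in> poly_over K \<Longrightarrow> q \<in> poly_over K \<Longrightarrow> p - q \<in> poly_over K"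
  and poly_over_smult: "complex_subfield K \<Longrightarrow> c \<in> K \<Longrightarrow> p \<in> poly_over K \<Longrightarrow> smult c p \<in> poly_over K"
  by (auto simp: poly_over_def intro: subfieldD)

lemma poly_over_mult:
  assumes "complex_subfield K" "p \<in> poly_over K" "q \<in> poly_over K" shows "p * q \<in> poly_over K"
  using assms unfolding poly_over_def by (auto simp: coeff_mult intro!: subfield_sum subfieldD)

lemma poly_over_pCons:
  "complex_subfield K \<Longrightarrow> pCons a p \<in> poly_over K \<longleftrightarrow> a \<in> K \<and> p \<in> poly_over K"
  unfolding poly_over_def by (auto simp: coeff_pCons split: nat.splits)

lemma poly_over_pcompose:
  assumes K: "complex_subfield K" and q: "q \<in> poly_over K" and p: "p \<in> poly_over K"
  shows "pcompose p q \<in> poly_over K"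
  using p
proof (induction p)
  case 0
  thus ?case by simp
next
  case (pCons a p)
  hence a: "a \<in> K" "p \<in> poly_over K" using poly_over_pCons[OF K] by auto
  have "0 \<in> poly_over K" using subfieldD(1)[OF K] by (simp add: poly_over_def)
  hence "[:a:] \<in> poly_over K" using poly_over_pCons[OF K] a by simp
  thus ?case
    using pCons.IH[OF a(2)] by (simp add: pcompose_pCons poly_over_add[OF K] poly_over_mult[OF K] q)
qed

lemma linear_over: "complex_subfield K \<Longrightarrow> a \<in> K \<Longrightarrow> [:a, 1:] \<in> poly_over K"
  using subfieldD[of K] by (simp add: poly_over_pCons) (simp add: poly_over_def)

lemma poly_over_act_Tinv: "complex_subfield K \<Longrightarrow> p \<in> poly_over K \<Longrightarrow> act_Tinv p \<in> poly_over K"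
  unfolding act_Tinv_def by (intro poly_over_pcompose linear_over) (auto intro: subfieldD)

lemma poly_over_act_T: "complex_subfield K \<Longrightarrow> p \<in> poly_over K \<Longrightarrow> act_T p \<in> poly_over K"
  unfolding act_T_def by (intro poly_over_pcompose linear_over) (auto intro: subfieldD)

lemma poly_over_act_S: "complex_subfield K \<Longrightarrow> p \<in> poly_over K \<Longrightarrow> act_S w p \<in> poly_over K"
  unfolding poly_over_def by (auto simp: coeff_act_S intro!: subfieldD(4) subfield_power intro: subfieldD)

lemma subfield_fact: "complex_subfield K \<Longrightarrow> fact n \<in> K"
  using subfield_of_nat[of K "fact n"] by simp

lemma subfield_numeral: "complex_subfield K \<Longrightarrow> numeral n \<in> K"
  using subfield_of_nat[of K "numeral n"] by simp

lemma period_pairing_over: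
  assumes K: "complex_subfield K" and p: "p \<in> poly_over K" and q: "q \<in> poly_over K"
  shows "period_pairing w p q \<in> K"
proof -
  have pf: "inv_form w p q \<in> K" if "p \<in> poly_over K" "q \<in> poly_over K" for p q
    using that unfolding inv_form_def poly_over_def
    by (intro subfield_sum[OF K] subfieldD(4)[OF K] subfieldD(8)[OF K] subfield_power[OF K] subfield_fact[OF K])
       (auto intro: subfieldD(2,5)[OF K])
  have "act_U w q \<in> poly_over K" unfolding act_U_def by (intro poly_over_act_S poly_over_act_Tinv K q)
  thus ?thesis unfolding period_pairing_def by (intro pf poly_over_add poly_over_smult K p q subfield_numeral)
qed

text \<open>So the top coefficient is the obstruction to being a difference \<open>v(X + 1) - v(X)\<close>.\<close>
lemma coeff_act_T_top:
  assumes "degree p \<le> w" shows "coeff (act_T p) w = coeff p w"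
proof (cases "degree p = w")
  case True
  have "lead_coeff (act_T p) = lead_coeff p" unfolding act_T_def by (subst lead_coeff_comp) auto
  thus ?thesis using True by simp
next
  case False
  thus ?thesis using assms by (simp add: coeff_eq_0)
qed

text \<open>Over K the difference operator is solvable below the top degree, by induction on the degree.\<close>
lemma difference_equation:
  assumes K: "complex_subfield K" and t: "t \<in> poly_over K" "\<And>i. i \<ge> m \<Longrightarrow> coeff t i = 0"
  shows "\<exists>v\<in>poly_over K. degree v \<le> m \<and> act_T v - v = t"
  using t
proof (induction m arbitrary: t)
  case 0
  hence "t = 0" by (intro poly_eqI) simp
  thus ?case using 0 by (intro bexI[of _ 0]) (auto simp: act_T_def)
next
  case (Suc m)
  define a where "a = coeff t m / of_nat (Suc m)"
  have aK: "a \<in> K" using Suc.prems(1) unfolding a_def poly_over_def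
    by (intro subfieldD(8)[OF K] subfield_of_nat[OF K]) auto
  define v where "v = monom a (Suc m)"
  have v: "v \<in> poly_over K" "degree v \<le> Suc m"
    using aK subfieldD(1)[OF K] by (auto simp: v_def poly_over_def degree_monom_le)
  have tv: "act_T v = smult a ([:1, 1:] ^ Suc m)"
    by (rule poly_ext) (simp add: v_def poly_monom poly_power add.commute del: power_Suc)
  define d where "d = t - (act_T v - v)"
  have "coeff d i = 0" if i: "i \<ge> m" for i
  proof -
    consider "i = m" | "i = Suc m" | "i > Suc m" using i by linarith
    thus ?thesis
    proof cases
      case 1
      have "coeff ([:1, 1:] ^ Suc m) m = (of_nat (Suc m) :: complex)"
        using coeff_linear_poly_power[of m "Suc m" "1 :: complex" 1] by (simp del: power_Suc of_nat_Suc)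
      thus ?thesis using 1 unfolding d_def tv by (simp add: v_def a_def del: power_Suc of_nat_Suc)
    next
      case 2
      thus ?thesis using Suc.prems(2)[of i] coeff_act_T_top[OF v(2)] by (simp add: d_def)
    next
      case 3
      thus ?thesis using Suc.prems(2)[of i] v(2) by (simp add: d_def coeff_eq_0)
    qed
  qed
  moreover have "d \<in> poly_over K" unfolding d_def
    by (intro poly_over_diff poly_over_act_T K Suc.prems v)
  ultimately obtain u where u: "u \<in> poly_over K" "degree u \<le> m" "act_T u - u = d" using Suc.IH by blast
  have "act_T (u + v) - (u + v) = t" using u(3) by (simp add: d_def act_T_add algebra_simps)
  moreover have "degree (u + v) \<le> Suc m" using u(2) v(2) by (intro degree_add_le) auto
  ultimately show ?case using poly_over_add[OF K u(1) v(1)] by blast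
qed

text \<open>The pairs \<open>(s\<^sub>i, t\<^sub>i)\<close> are the values of two cocycles over K at S and T, and \<open>(k, 0)\<close>, \<open>(l, 0)\<close>
  are combinations of them modulo coboundaries. A relation between the columns of the matrix makes
  a combination of k and l a coboundary, so the matrix is invertible. Then the top
  coefficients of \<open>t\<^sub>i\<close> vanish, and subtracting coboundaries over K makes \<open>t\<^sub>i = 0\<close>. The pairing of the
  modified \<open>s\<^sub>i\<close> lies in K, and the alternating pairing of k and l differs from it by the determinant.\<close>
lemma period_determinant:
  assumes w: "even w" and K: "complex_subfield K"
    and s: "s1 \<in> poly_over K" "degree s1 \<le> w" "s2 \<in> poly_over K" "degree s2 \<le> w"
    and t: "t1 \<in> poly_over K" "degree t1 \<le> w" "t2 \<in> poly_over K" "degree t2 \<le> w"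
    and k: "period_poly w k" "k = smult p s1 + smult r s2 + (act_S w u - u)"
       "smult p t1 + smult r t2 + (act_T u - u) = 0" "degree u \<le> w"
    and l: "period_poly w l" "l = smult q s1 + smult x s2 + (act_S w v - v)"
       "smult q t1 + smult x t2 + (act_T v - v) = 0" "degree v \<le> w"
    and kl: "period_pairing w k l \<noteq> 0"
  shows "\<exists>c\<in>K. c \<noteq> 0 \<and> period_pairing w k l = (p * x - q * r) * c"
proof -
  have inj: "a = 0 \<and> b = 0" if ab: "a * p + b * q = 0" "a * r + b * x = 0" for a b
  proof -
    define y where "y = smult a u + smult b v"
    have dy: "degree y \<le> w" unfolding y_def using k(4) l(4)
      by (intro degree_add_le) (auto intro: order_trans[OF degree_smult_le])
    have "smult a (smult p t1 + smult r t2 + (act_T u - u)) + smult b (smult q t1 + smult x t2 + (act_T v - v)) =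
      smult (a * p + b * q) t1 + smult (a * r + b * x) t2 + (act_T y - y)"
      by (rule poly_ext) (simp add: y_def algebra_simps)
    hence ty: "act_T y = y" using ab k(3) l(3) by simp
    have kly: "smult a k + smult b l = act_S w y - y"
    proof -
      have "smult a k + smult b l = smult (a * p + b * q) s1 + smult (a * r + b * x) s2 + (act_S w y - y)"
        unfolding k(2) l(2) y_def by (rule poly_ext) (simp add: act_S_add act_S_smult algebra_simps)
      thus ?thesis using ab by simp
    qed
    have "period_pairing w k (smult a k + smult b l) = 0" "period_pairing w l (smult a k + smult b l) = 0"
      unfolding kly using coboundary_period(2)[OF w dy ty] k(1) l(1) by blast+
    thus ?thesis using kl period_pairing_alternating[OF w k(1)] period_pairing_alternating[OF w l(1)] period_pairing_swap[OF w k(1) l(1)]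
      by (simp add: period_pairing_add_right period_pairing_smult_right)
  qed
  define d where "d = p * x - q * r"
  have d0: "d \<noteq> 0"
  proof
    assume "d = 0"
    hence "q = 0 \<and> - p = 0" by (intro inj) (simp_all add: d_def algebra_simps)
    moreover from this have "x = 0 \<and> - r = 0" by (intro inj) (simp_all add: algebra_simps)
    ultimately show False using inj[of 1 0] by simp
  qed
  have top: "a * coeff t1 w + b * coeff t2 w = 0" if "smult a t1 + smult b t2 + (act_T y - y) = 0" "degree y \<le> w" for a b y
    using arg_cong[OF that(1), of "\<lambda>p. coeff p w"] coeff_act_T_top[OF that(2)] by simp
  have e1: "p * coeff t1 w + r * coeff t2 w = 0" by (rule top[OF k(3,4)])
  have e2: "q * coeff t1 w + x * coeff t2 w = 0" by (rule top[OF l(3,4)])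
  have "d * coeff t1 w = x * (p * coeff t1 w + r * coeff t2 w) - r * (q * coeff t1 w + x * coeff t2 w)"
       "d * coeff t2 w = p * (q * coeff t1 w + x * coeff t2 w) - q * (p * coeff t1 w + r * coeff t2 w)"
    by (simp_all add: d_def algebra_simps)
  hence "d * coeff t1 w = 0" "d * coeff t2 w = 0" unfolding e1 e2 by simp_all
  hence t0: "coeff t1 w = 0" "coeff t2 w = 0" using d0 by simp_all
  have solve: "\<exists>v\<in>poly_over K. degree v \<le> w \<and> act_T v - v = t" if "t \<in> poly_over K" "degree t \<le> w" "coeff t w = 0" for t
  proof (rule difference_equation[OF K that(1)])
    fix i assume "i \<ge> w"
    thus "coeff t i = 0" using that by (cases "i = w") (auto intro: coeff_eq_0)
  qed
  obtain v1 where v1: "v1 \<in> poly_over K" "degree v1 \<le> w" "act_T v1 - v1 = t1" using solve[OF t(1,2) t0(1)] by blast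
  obtain v2 where v2: "v2 \<in> poly_over K" "degree v2 \<le> w" "act_T v2 - v2 = t2" using solve[OF t(3,4) t0(2)] by blast
  \<comment> \<open>The modified cocycles vanish at T.\<close>
  define m1 m2 where "m1 = s1 - (act_S w v1 - v1)" "m2 = s2 - (act_S w v2 - v2)"
  have mK: "m1 \<in> poly_over K" "m2 \<in> poly_over K"
    unfolding m1_m2_def by (intro poly_over_diff poly_over_act_S K s v1 v2)+
  have red: "\<exists>y. degree y \<le> w \<and> act_T y = y \<and> k = smult a m1 + smult b m2 + (act_S w y - y)"
    if "k = smult a s1 + smult b s2 + (act_S w u - u)" "smult a t1 + smult b t2 + (act_T u - u) = 0" "degree u \<le> w" for a b k u
  proof (intro exI conjI)
    define y where "y = u + smult a v1 + smult b v2"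
    show "degree y \<le> w" unfolding y_def using that(3) v1(2) v2(2)
      by (intro degree_add_le) (auto intro: order_trans[OF degree_smult_le])
    have "act_T y - y = smult a (act_T v1 - v1) + smult b (act_T v2 - v2) + (act_T u - u)"
      by (rule poly_ext) (simp add: y_def algebra_simps)
    thus "act_T y = y" using that(2) by (simp add: v1 v2)
    show "k = smult a m1 + smult b m2 + (act_S w y - y)"
      unfolding that(1) m1_m2_def y_def by (rule poly_ext) (simp add: act_S_add act_S_smult algebra_simps)
  qed
  obtain y where y: "degree y \<le> w" "act_T y = y" "k = smult p m1 + smult r m2 + (act_S w y - y)"
    using red[OF k(2,3,4)] by blast
  obtain z where z: "degree z \<le> w" "act_T z = z" "l = smult q m1 + smult x m2 + (act_S w z - z)"
    using red[OF l(2,3,4)] by blast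
  define k' l' where "k' = smult p m1 + smult r m2" "l' = smult q m1 + smult x m2"
  define cy cz where "cy = act_S w y - y" "cz = act_S w z - z"
  have ky: "k = k' + cy" and lz: "l = l' + cz" using y(3) z(3) by (simp_all add: k'_l'_def cy_cz_def)
  have pc: "period_poly w cy" "period_poly w cz"
    unfolding cy_cz_def by (intro coboundary_period(1) w y z)+
  have pk: "period_poly w k'" using period_poly_combine[OF k(1) pc(1), of 1 "-1"] by (simp add: ky)
  have pl: "period_poly w l'" using period_poly_combine[OF l(1) pc(2), of 1 "-1"] by (simp add: lz)
  have cob: "period_pairing w h cy = 0" "period_pairing w h cz = 0" if "period_poly w h" for h
    unfolding cy_cz_def using that w y z by (auto intro: coboundary_period(2))
  have kl': "period_pairing w k l = period_pairing w k' l'"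
    using cob(1)[OF l(1)] cob(2)[OF pk] period_pairing_swap[OF w l(1) pc(1)]
    by (simp add: ky period_pairing_add_left) (simp add: lz period_pairing_add_right)
  have m1: "m1 = smult (x / d) k' + smult (- r / d) l'" and m2: "m2 = smult (- q / d) k' + smult (p / d) l'"
  proof -
    have "smult (x / d) k' + smult (- r / d) l' = smult ((x * p - r * q) / d) m1" 
      unfolding k'_l'_def by (rule poly_ext) (simp add: algebra_simps diff_divide_distrib)
    moreover have "x * p - r * q = d" by (simp add: d_def algebra_simps)
    ultimately show "m1 = smult (x / d) k' + smult (- r / d) l'" using d0 by simp
    have "smult (- q / d) k' + smult (p / d) l' = smult ((p * x - q * r) / d) m2" 
      unfolding k'_l'_def by (rule poly_ext) (simp add: algebra_simps diff_divide_distrib)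
    thus "m2 = smult (- q / d) k' + smult (p / d) l'" using d0 by (simp add: d_def)
  qed
  have pm: "period_poly w m1" "period_poly w m2"
    by (subst m1, rule period_poly_combine[OF pk pl], subst m2, rule period_poly_combine[OF pk pl])
  have "period_pairing w k l = d * period_pairing w m1 m2"
    unfolding kl' k'_l'_def d_def
    using period_pairing_alternating[OF w pm(1)] period_pairing_alternating[OF w pm(2)] period_pairing_swap[OF w pm]
    by (simp add: period_pairing_add_left period_pairing_add_right period_pairing_smult_left period_pairing_smult_right algebra_simps)
  moreover have "period_pairing w m1 m2 \<in> K" by (rule period_pairing_over[OF K mK])
  ultimately show ?thesis using kl by (intro bexI[of _ "period_pairing w m1 m2"]) (auto simp: d_def)
qed

section \<open>Dehomogenization of cocycles\<close>

text \<open>Substituting \<open>a = 1\<close>, \<open>b = X\<close>.\<close>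
definition dehomogenize :: "complex poly poly \<Rightarrow> complex poly" where
  "dehomogenize P = (\<Sum>j\<le>degree P. monom (poly (coeff P j) 1) j)"

lemma coeff_dehomogenize: "coeff (dehomogenize P) j = poly (coeff P j) 1"
proof -
  have "coeff (dehomogenize P) j = (\<Sum>i\<le>degree P. if i = j then poly (coeff P j) 1 else 0)"
    unfolding dehomogenize_def coeff_sum coeff_monom by (intro sum.cong) auto
  thus ?thesis by (auto simp: sum.delta coeff_eq_0)
qed

lemma poly_dehomogenize: "poly (dehomogenize P) x = poly (poly P [:x:]) 1"
  by (simp add: dehomogenize_def poly_altdef[of P] poly_sum poly_monom poly_power)

lemma dehomogenize_add: "dehomogenize (P + Q) = dehomogenize P + dehomogenize Q" and dehomogenize_diff: "dehomogenize (P - Q) = dehomogenize P - dehomogenize Q"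
  and dehomogenize_smult: "dehomogenize (smult [:c:] P) = smult c (dehomogenize P)" and dehomogenize_zero: "dehomogenize 0 = 0"
  by (rule poly_eqI, simp add: coeff_dehomogenize)+

definition homogeneous :: "nat \<Rightarrow> complex poly poly \<Rightarrow> bool" where
  "homogeneous w P \<longleftrightarrow> (\<forall>i j. coeff (coeff P j) i \<noteq> 0 \<longrightarrow> i + j = w)"

lemma degree_dehomogenize:
  assumes "homogeneous w P" shows "degree (dehomogenize P) \<le> w"
proof (rule degree_le, intro allI impI)
  fix j assume "j > w"
  hence "coeff P j = 0" using assms by (intro poly_eqI) (force simp: homogeneous_def)
  thus "coeff (dehomogenize P) j = 0" by (simp add: coeff_dehomogenize)
qed

lemma poly_dehomogenize_double_sum:
  "poly (dehomogenize P) x = (\<Sum>j\<le>degree P. \<Sum>i\<le>degree (coeff P j). coeff (coeff P j) i * x ^ j)"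
  unfolding dehomogenize_def poly_sum poly_monom poly_altdef[of "coeff P _"] by (simp add: sum_distrib_right)

lemma poly_dehomogenize_subst:
  "poly (dehomogenize (subst_ab A B P)) x =
    (\<Sum>j\<le>degree P. \<Sum>i\<le>degree (coeff P j). coeff (coeff P j) i * (poly (dehomogenize A) x ^ i * poly (dehomogenize B) x ^ j))"
  by (simp add: poly_dehomogenize subst_ab_def poly_sum poly_power)

text \<open>The action by substitution in two variables becomes the one on polynomials in X.\<close>
lemma dehomogenize_slash_T: "dehomogenize (slash P (Tmat 1)) = act_T (dehomogenize P)"
proof (rule poly_ext)
  fix x
  have "poly (dehomogenize (slash P (Tmat 1))) x = (\<Sum>j\<le>degree P. \<Sum>i\<le>degree (coeff P j). coeff (coeff P j) i * (x + 1) ^ j)"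
    unfolding slash_def poly_dehomogenize_subst by (simp add: Tmat_def poly_dehomogenize add.commute)
  thus "poly (dehomogenize (slash P (Tmat 1))) x = poly (act_T (dehomogenize P)) x" by (simp add: poly_dehomogenize_double_sum)
qed

lemma dehomogenize_slash_S:
  assumes P: "homogeneous w P" shows "dehomogenize (slash P Smat) = act_S w (dehomogenize P)"
proof (rule poly_ext_nonzero)
  fix x :: complex assume x: "x \<noteq> 0"
  have "poly (dehomogenize (slash P Smat)) x = (\<Sum>j\<le>degree P. \<Sum>i\<le>degree (coeff P j). coeff (coeff P j) i * (x ^ i * (- 1) ^ j))"
    unfolding slash_def poly_dehomogenize_subst by (simp add: Smat_def poly_dehomogenize)
  also have "\<dots> = (\<Sum>j\<le>degree P. \<Sum>i\<le>degree (coeff P j). x ^ w * (coeff (coeff P j) i * (- 1 / x) ^ j))"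
  proof (intro sum.cong refl)
    fix i j
    show "coeff (coeff P j) i * (x ^ i * (- 1) ^ j) = x ^ w * (coeff (coeff P j) i * (- 1 / x) ^ j)"
    proof (cases "coeff (coeff P j) i = 0")
      case False
      hence "x ^ w = x ^ i * x ^ j" using P by (simp add: homogeneous_def flip: power_add)
      thus ?thesis using x unfolding power_divide by simp
    qed simp
  qed
  also have "\<dots> = poly (act_S w (dehomogenize P)) x"
    unfolding poly_act_S[OF degree_dehomogenize[OF P] x] poly_dehomogenize_double_sum by (simp only: sum_distrib_left)
  finally show "poly (dehomogenize (slash P Smat)) x = poly (act_S w (dehomogenize P)) x" .
qed

lemma Sym_rat_dehomogenize:
  assumes K: "complex_subfield K" and P: "P \<in> Sym_rat w"
  shows "homogeneous w P" "dehomogenize P \<in> poly_over K"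
proof -
  show "homogeneous w P" using P by (auto simp: Sym_rat_def homogeneous_def)
  have "coeff (coeff P j) i \<in> K" for i j using P subfield_rat[OF K] by (auto simp: Sym_rat_def)
  thus "dehomogenize P \<in> poly_over K"
    unfolding poly_over_def by (auto simp: coeff_dehomogenize poly_altdef intro!: subfield_sum[OF K])
qed

lemma B_cocycle_dehomogenize:
  assumes K: "complex_subfield K" and k: "k \<in> B_cocycles n K" and g: "\<gamma> \<in> SL2Z"
  shows "dehomogenize (k \<gamma>) \<in> poly_over K \<and> degree (dehomogenize (k \<gamma>)) \<le> 2 * n - 2"
  using k unfolding B_cocycles_def
proof (induction rule: span_over_induct)
  case zero
  show ?case using subfieldD(1)[OF K] by (simp add: dehomogenize_zero poly_over_def)
next
  case (add v c u)
  have u: "u \<gamma> \<in> Sym_rat (2 * n - 2)" using add(3) g by (simp add: cocycles_def)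
  have "dehomogenize ((cscale c u + v) \<gamma>) = smult c (dehomogenize (u \<gamma>)) + dehomogenize (v \<gamma>)"
    by (simp add: cscale_def dehomogenize_add dehomogenize_smult)
  moreover have "smult c (dehomogenize (u \<gamma>)) + dehomogenize (v \<gamma>) \<in> poly_over K"
    using add by (intro poly_over_add poly_over_smult K Sym_rat_dehomogenize(2)[OF K u]) auto
  moreover have "degree (smult c (dehomogenize (u \<gamma>)) + dehomogenize (v \<gamma>)) \<le> 2 * n - 2"
    using add(1) degree_dehomogenize[OF Sym_rat_dehomogenize(1)[OF K u]]
    by (intro degree_add_le) (auto intro: order_trans[OF degree_smult_le])
  ultimately show ?case by simp
qed

text \<open>Only the values at the generators S and T are compared.\<close>
lemma B_coboundary_dehomogenize:
  assumes k: "k \<in> B_coboundaries n UNIV"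
  shows "\<exists>v. degree v \<le> 2 * n - 2 \<and> dehomogenize (k Smat) = act_S (2 * n - 2) v - v \<and> dehomogenize (k (Tmat 1)) = act_T v - v"
  using k unfolding B_coboundaries_def
proof (induction rule: span_over_induct)
  case zero
  show ?case by (rule exI[of _ 0]) (simp add: dehomogenize_zero act_T_def act_S_def)
next
  case (add h c u)
  then obtain v where v: "degree v \<le> 2 * n - 2" "dehomogenize (h Smat) = act_S (2 * n - 2) v - v" "dehomogenize (h (Tmat 1)) = act_T v - v" by blast
  obtain V where V: "V \<in> Sym_rat (2 * n - 2)" "u = (\<lambda>\<gamma>. if \<gamma> \<in> SL2Z then slash V \<gamma> - V else 0)"
    using add(3) by (auto simp: coboundaries_def)
  have hV: "homogeneous (2 * n - 2) V" by (rule Sym_rat_dehomogenize(1)[OF complex_subfield_UNIV V(1)])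
  show ?case
  proof (intro exI[of _ "smult c (dehomogenize V) + v"] conjI)
    show "degree (smult c (dehomogenize V) + v) \<le> 2 * n - 2"
      using v(1) degree_dehomogenize[OF hV] by (intro degree_add_le) (auto intro: order_trans[OF degree_smult_le])
    show "dehomogenize ((cscale c u + h) Smat) = act_S (2 * n - 2) (smult c (dehomogenize V) + v) - (smult c (dehomogenize V) + v)"
      by (simp add: cscale_def V(2) Smat_in dehomogenize_add dehomogenize_smult dehomogenize_diff dehomogenize_slash_S[OF hV] v act_S_add act_S_smult smult_diff_right)
    show "dehomogenize ((cscale c u + h) (Tmat 1)) = act_T (smult c (dehomogenize V) + v) - (smult c (dehomogenize V) + v)"
      by (simp add: cscale_def V(2) Tmat_in[of 1] dehomogenize_add dehomogenize_smult dehomogenize_diff dehomogenize_slash_T v act_T_add act_T_smult smult_diff_right)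
  qed
qed

lemma matrix_inv_SL2:
  assumes A: "A \<in> SL2Z" shows "matrix_inv A = adj A"
proof -
  have "A ** matrix_inv A = mat 1 \<and> matrix_inv A ** A = mat 1"
    unfolding matrix_inv_def by (rule someI[of _ "adj A"]) (use mult_adj_SL2[OF A] in auto)
  hence "matrix_inv A = matrix_inv A ** (A ** adj A)" "matrix_inv A ** A = mat 1"
    using mult_adj_SL2(1)[OF A] by simp_all
  thus ?thesis by (metis matrix_mul_assoc matrix_mul_lid)
qed

lemma moebius_inv_S_T: "moebius (matrix_inv Smat) z = - 1 / z" "moebius (matrix_inv (Tmat 1)) z = z - 1"
  unfolding matrix_inv_SL2[OF Smat_in] matrix_inv_SL2[OF Tmat_in[of 1]]
  by (simp_all add: adj_def Smat_def Tmat_def moebius_def)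

section \<open>The cocycle of an Eichler integral\<close>

text \<open>The coefficient of \<open>a\<^sup>w\<^sup>-\<^sup>j b\<^sup>j\<close> in \<open>(z a - b)\<^sup>w\<close> agrees with that of \<open>X\<^sup>j\<close> in \<open>(X - z)\<^sup>w\<close>, as w is even.\<close>
lemma homogeneous_linear_power_coeff:
  assumes w: "even w" and j: "j \<le> w"
  shows "coeff (coeff (([:[:z:]:] * var_a - var_b) ^ w) j) i = (if i = w - j then coeff ([:- z, 1:] ^ w) j else 0)"
proof -
  have "[:[:z:]:] * var_a - var_b = [:[:0, z:], - 1:]" by simp
  hence "coeff (([:[:z:]:] * var_a - var_b) ^ w) j = of_nat (w choose j) * (- 1) ^ j * [:0, z:] ^ (w - j)"
    using coeff_linear_poly_power[OF j, of "[:0, z:]" "- 1"] by simp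
  also have "[:0, z:] = monom z 1" by (simp add: monom_altdef)
  also have "of_nat (w choose j) * (- 1) ^ j * monom z 1 ^ (w - j) = monom (of_nat (w choose j) * (- 1) ^ j * z ^ (w - j)) (w - j)"
    by (rule poly_ext) (simp add: poly_monom poly_power monom_power)
  also have "of_nat (w choose j) * (- 1) ^ j * z ^ (w - j) = coeff ([:- z, 1:] ^ w) j"
  proof -
    have "(- z) ^ (w - j) = (- 1) ^ (w - j) * z ^ (w - j)" by (rule power_minus)
    moreover have "even (w - j) \<longleftrightarrow> even j" using w j by auto
    hence "(- 1) ^ (w - j) = ((- 1) ^ j :: complex)" by (simp add: minus_one_power_iff)
    ultimately show ?thesis using coeff_linear_poly_power[OF j, of "- z" 1] by simp
  qed
  finally show ?thesis by (simp add: coeff_monom)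
qed

text \<open>The fundamental theorem of calculus along the segment, coefficient by coefficient.\<close>
lemma dehomogenize_comp_cocycle:
  assumes w: "w = 2 * n - 2" and n: "n \<ge> 1" and g: "\<gamma> \<in> SL2Z" and z0: "Im z0 > 0"
    and z1: "moebius (matrix_inv \<gamma>) z0 = z1" "Im z1 > 0"
    and E: "\<And>i z. Im z > 0 \<Longrightarrow> (E i has_field_derivative E (Suc i) z) (at z)"
      "\<And>z. Im z > 0 \<Longrightarrow> E (Suc w) z = fact w * (2 * of_real pi * \<i>) ^ Suc w * e z"
  shows "dehomogenize (comp_cocycle n z0 e \<gamma>) = eichler w E z0 - eichler w E z1"
proof -
  define C where "C = (2 * of_real pi * \<i>) ^ Suc w"
  have C0: "C \<noteq> 0" by (simp add: C_def)
  have ew: "even w" using w by simp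
  have Cn: "(2 * of_real pi * \<i>) ^ (2 * n - 1) = C"
  proof -
    have "2 * n - 1 = Suc w" using n w by simp
    thus ?thesis by (simp only: C_def)
  qed
  define L where "L = linepath z1 z0"
  define J where "J j = contour_integral L (\<lambda>z. e z * coeff ([:- z, 1:] ^ w) j)" for j
  have J: "C * J j = coeff (eichler w E z0) j - coeff (eichler w E z1) j" for j
  proof -
    define h where "h z = coeff (smult (E (Suc w) z / fact w) ([:- z, 1:] ^ w)) j" for z
    have L: "path_image L \<subseteq> upper"
      using closed_segment_subset[OF _ _ convex_upper, of z1 z0] z0 z1 by (simp add: L_def)
    have "(h has_contour_integral (coeff (eichler w E (pathfinish L)) j - coeff (eichler w E (pathstart L)) j)) L"
    proof (rule contour_integral_primitive[of upper])
      fix x assume "x \<in> upper"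
      thus "((\<lambda>z. coeff (eichler w E z) j) has_field_derivative h x) (at x within upper)"
        unfolding h_def using E(1) by (intro has_field_derivative_at_within[OF eichler_coeff_deriv]) simp
    qed (use L in \<open>simp_all add: L_def\<close>)
    moreover have "pathfinish L = z0" "pathstart L = z1" by (simp_all add: L_def)
    ultimately have "(h has_contour_integral (coeff (eichler w E z0) j - coeff (eichler w E z1) j)) L" by (simp only:)
    hence "((\<lambda>z. h z / C) has_contour_integral (coeff (eichler w E z0) j - coeff (eichler w E z1) j) / C) L"
      by (rule has_contour_integral_div)
    hence "((\<lambda>z. e z * coeff ([:- z, 1:] ^ w) j) has_contour_integral (coeff (eichler w E z0) j - coeff (eichler w E z1) j) / C) L"
    proof (rule has_contour_integral_eq)
      fix z assume "z \<in> path_image L"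
      hence "Im z > 0" using L by auto
      hence "E (Suc w) z = fact w * C * e z" unfolding C_def by (rule E(2))
      thus "h z / C = e z * coeff ([:- z, 1:] ^ w) j" using C0 by (simp add: h_def)
    qed
    hence "J j = (coeff (eichler w E z0) j - coeff (eichler w E z1) j) / C"
      unfolding J_def by (rule contour_integral_unique)
    thus ?thesis using C0 by simp
  qed
  define I where "I i j = contour_integral L (\<lambda>z. e z * coeff (coeff (([:[:z:]:] * var_a - var_b) ^ w) j) i)" for i j
  have I: "I i j = (if i = w - j then J j else 0)" if "j \<le> w" for i j
    unfolding I_def homogeneous_linear_power_coeff[OF ew that] J_def by (simp add: contour_integral_0)
  have comp: "comp_cocycle n z0 e \<gamma> = smult [:C:] (\<Sum>i\<le>w. \<Sum>j\<le>w. smult [:I i j:] (var_a ^ i * var_b ^ j))"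
    unfolding comp_cocycle_def I_def L_def Cn z1(1) w[symmetric] using g by simp
  show ?thesis
  proof (rule poly_ext)
    fix x
    have "poly (dehomogenize (comp_cocycle n z0 e \<gamma>)) x = C * (\<Sum>i\<le>w. \<Sum>j\<le>w. I i j * x ^ j)"
      unfolding comp poly_dehomogenize by (simp add: poly_sum poly_power)
    also have "(\<Sum>i\<le>w. \<Sum>j\<le>w. I i j * x ^ j) = (\<Sum>j\<le>w. \<Sum>i\<le>w. I i j * x ^ j)" by (rule sum.swap)
    also have "\<dots> = (\<Sum>j\<le>w. J j * x ^ j)"
    proof (rule sum.cong[OF refl])
      fix j assume "j \<in> {..w}"
      hence "(\<Sum>i\<le>w. I i j * x ^ j) = (\<Sum>i\<le>w. if i = w - j then J j * x ^ j else 0)"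
        by (intro sum.cong) (auto simp: I)
      thus "(\<Sum>i\<le>w. I i j * x ^ j) = J j * x ^ j" by (simp add: sum.delta)
    qed
    also have "C * \<dots> = (\<Sum>j\<le>w. (C * J j) * x ^ j)" by (simp add: sum_distrib_left mult.assoc)
    also have "\<dots> = poly (eichler w E z0 - eichler w E z1) x"
      by (simp add: J poly_coeff_sum[OF degree_eichler] right_diff_distrib sum_subtractf mult.commute)
    finally show "poly (dehomogenize (comp_cocycle n z0 e \<gamma>)) x = poly (eichler w E z0 - eichler w E z1) x" .
  qed
qed

text \<open>The factor w! compensates the one in the Taylor polynomial.\<close>
lemma eichler_integral_exists:
  assumes w: "w = 2 * n - 2" and n: "n \<ge> 1" and g: "modform (2 * int n) e G" "fls_nth G 0 = 0"
  obtains E where "\<And>i z. Im z > 0 \<Longrightarrow> (E i has_field_derivative E (Suc i) z) (at z)"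
    "\<And>i z. Im z > 0 \<Longrightarrow> E i (z + 1) = E i z"
    "\<And>z. Im z > 0 \<Longrightarrow> E (Suc w) (- 1 / z) = z ^ (w + 2) * E (Suc w) z"
    "\<And>z. Im z > 0 \<Longrightarrow> E (Suc w) z = fact w * (2 * of_real pi * \<i>) ^ Suc w * e z"
    "qexp (E 0) (fls_const (fact w) * fls_int (Suc w) G)"
proof -
  define h where "h z = fact w * eval_fls (fls_int (Suc w) G) (nome z)" for z
  have h: "qexp h (fls_const (fact w) * fls_int (Suc w) G)"
    unfolding h_def[abs_def] by (intro qexp_cmult qexp_fls_int[OF modform_qexp[OF g(1)]]) simp
  define E where "E i z = (2 * of_real pi * \<i>) ^ i * (qderiv ^^ i) h z" for i z
  have ex: "\<exists>H. qexp ((qderiv ^^ i) h) H" for i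
    using qexp_qderiv_funpow[OF h, of i] by metis
  have E1: "(E i has_field_derivative E (Suc i) z) (at z)" if z: "Im z > 0" for i z
    unfolding E_def[abs_def] by (rule qderiv_chain[OF h z])
  have E2: "E i (z + 1) = E i z" if z: "Im z > 0" for i z
  proof -
    obtain H where H: "qexp ((qderiv ^^ i) h) H" using ex by blast
    show ?thesis using qexp_eval[OF H z] qexp_eval[OF H, of "z + 1"] z by (simp add: E_def nome_plus_1)
  qed
  have E4: "E (Suc w) z = fact w * (2 * of_real pi * \<i>) ^ Suc w * e z" if z: "Im z > 0" for z
  proof -
    obtain H where H: "qexp ((qderiv ^^ Suc w) h) H"
      "\<And>m. fls_nth H m = of_int m ^ Suc w * fls_nth (fls_const (fact w) * fls_int (Suc w) G) m"
      by (rule qexp_qderiv_funpow[OF h, of "Suc w"], rule that)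
    have "H = fls_const (fact w) * G"
    proof (rule fls_eqI)
      fix m
      show "fls_nth H m = fls_nth (fls_const (fact w) * G) m"
        unfolding H(2) using g(2) by (cases "m = 0") simp_all
    qed
    hence "(qderiv ^^ Suc w) h z = fact w * e z"
      using qexp_eval[OF H(1) z] qexp_eval[OF qexp_cmult[OF modform_qexp[OF g(1)], of "fact w"] z] by simp
    thus ?thesis unfolding E_def by (simp only: mult_ac)
  qed
  have E3: "E (Suc w) (- 1 / z) = z ^ (w + 2) * E (Suc w) z" if z: "Im z > 0" for z
  proof -
    have "2 * int n = int (w + 2)" using w n by simp
    hence "e (- 1 / z) = z ^ (w + 2) * e z"
      using modformD[OF g(1) Smat_in z] by (simp only: moebius_S autfac_S power_int_of_nat)
    thus ?thesis unfolding E4[OF z] E4[OF Im_S[OF z]] by simp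
  qed
  have "E 0 = h" by (simp add: E_def fun_eq_iff)
  thus ?thesis using that[of E] E1 E2 E3 E4 h by simp
qed

text \<open>The comparison cocycle is the coboundary of the value of the Eichler integral at the base point plus
  the cocycle with the values k at S and 0 at T.\<close>
lemma comp_cocycle_relation:
  assumes w: "w = 2 * n - 2" and n: "n \<ge> 1" and z0: "Im z0 > 0"
    and E: "\<And>i z. Im z > 0 \<Longrightarrow> (E i has_field_derivative E (Suc i) z) (at z)"
      "\<And>i z. Im z > 0 \<Longrightarrow> E i (z + 1) = E i z"
      "\<And>z. Im z > 0 \<Longrightarrow> E (Suc w) z = fact w * (2 * of_real pi * \<i>) ^ Suc w * e z"
    and k: "\<And>z. Im z > 0 \<Longrightarrow> act_S w (eichler w E (- 1 / z)) = eichler w E z + k" "period_poly w k"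
    and rel: "comp_cocycle n z0 e - (cscale p c1 + cscale r c2) \<in> B_coboundaries n UNIV"
  obtains u where "k = smult p (dehomogenize (c1 Smat)) + smult r (dehomogenize (c2 Smat)) + (act_S w u - u)"
    "smult p (dehomogenize (c1 (Tmat 1))) + smult r (dehomogenize (c2 (Tmat 1))) + (act_T u - u) = 0" "degree u \<le> w"
proof -
  define a where "a = eichler w E z0"
  have ew: "even w" using w by simp
  obtain v where v: "degree v \<le> w"
    "dehomogenize ((comp_cocycle n z0 e - (cscale p c1 + cscale r c2)) Smat) = act_S w v - v"
    "dehomogenize ((comp_cocycle n z0 e - (cscale p c1 + cscale r c2)) (Tmat 1)) = act_T v - v"
    using B_coboundary_dehomogenize[OF rel] unfolding w[symmetric] by blast
  have S: "dehomogenize (comp_cocycle n z0 e Smat) = a - eichler w E (- 1 / z0)"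
    unfolding a_def by (rule dehomogenize_comp_cocycle[OF w n Smat_in z0 moebius_inv_S_T(1) Im_S[OF z0] E(1,3)])
  have T: "dehomogenize (comp_cocycle n z0 e (Tmat 1)) = a - eichler w E (z0 - 1)"
    unfolding a_def by (rule dehomogenize_comp_cocycle[OF w n Tmat_in[of 1] z0 moebius_inv_S_T(2) _ E(1,3)]) (use z0 in auto)
  have "eichler w E (- 1 / z0) = act_S w (a + k)"
    unfolding a_def k(1)[OF z0, symmetric] by (rule act_S_act_S[OF ew degree_eichler, symmetric])
  hence S': "eichler w E (- 1 / z0) = act_S w a - k" using k(2) by (simp add: act_S_add period_poly_def)
  have T': "eichler w E (z0 - 1) = act_T a"
  proof -
    have "E i (z0 - 1 + 1) = E i (z0 - 1)" for i by (rule E(2)) (use z0 in simp)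
    from eichler_act_T[of E "z0 - 1" w, OF this] show ?thesis by (simp add: a_def)
  qed
  have "a - (act_S w a - k) - (smult p (dehomogenize (c1 Smat)) + smult r (dehomogenize (c2 Smat))) = act_S w v - v"
    using v(2) unfolding S'[symmetric] S[symmetric] by (simp add: dehomogenize_add dehomogenize_diff dehomogenize_smult cscale_def)
  hence "k = smult p (dehomogenize (c1 Smat)) + smult r (dehomogenize (c2 Smat)) + (act_S w (v + a) - (v + a))"
    by (simp add: act_S_add algebra_simps)
  moreover have Teq: "a - act_T a - (smult p (dehomogenize (c1 (Tmat 1))) + smult r (dehomogenize (c2 (Tmat 1)))) = act_T v - v"
    using v(3) unfolding T'[symmetric] T[symmetric] by (simp add: dehomogenize_add dehomogenize_diff dehomogenize_smult cscale_def)
  have "smult p (dehomogenize (c1 (Tmat 1))) + smult r (dehomogenize (c2 (Tmat 1))) = (a - act_T a) - (act_T v - v)"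
    unfolding Teq[symmetric] by simp
  hence "smult p (dehomogenize (c1 (Tmat 1))) + smult r (dehomogenize (c2 (Tmat 1))) + (act_T (v + a) - (v + a)) = 0"
    by (simp only: act_T_add) simp
  moreover have "degree (v + a) \<le> w" using v(1) by (intro degree_add_le) (simp_all add: a_def degree_eichler)
  ultimately show ?thesis by (rule that)
qed

theorem theorem1p7:
  fixes n :: nat and f :: "complex \<Rightarrow> complex" and z0 :: complex and P :: "complex^2^2"
  assumes "n \<ge> 1"
    and "normalized_cuspidal_eigenform n f"
    and "Im z0 > 0"
    and "period_matrix n z0 f P"
  shows "\<exists>k \<in> coeff_field f. k \<noteq> 0 \<and> det P = (2 * of_real pi * \<i>) ^ (2*n-1) * k"
proof -
  define K where "K = coeff_field f"
  have K: "complex_subfield K" unfolding K_def coeff_field_def by (rule field_generated_subfield)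
  define w where "w = 2 * n - 2"
  have ew: "even w" by (simp add: w_def)
  have sw: "2 * n - 1 = Suc w" using assms(1) by (simp add: w_def)
  define C where "C = (2 * of_real pi * \<i>) ^ Suc w"
  obtain e1 e2 c1 c2 l where
    basis: "basis2_mod (coeff_field f) fscale (eigenspace_dR n f) (dR_exact n (coeff_field f)) e1 e2"
    and l: "l \<in> coeff_field f" "l \<noteq> 0" "e2 - fscale l f \<in> dR_exact n (coeff_field f)"
    and cs: "c1 \<in> B_cocycles n K" "c2 \<in> B_cocycles n K"
    and rel: "comp_cocycle n z0 e1 - (cscale (P $ 1 $ 1) c1 + cscale (P $ 2 $ 1) c2) \<in> B_coboundaries n UNIV"
      "comp_cocycle n z0 e2 - (cscale (P $ 1 $ 2) c1 + cscale (P $ 2 $ 2) c2) \<in> B_coboundaries n UNIV"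
    using assms(4) unfolding period_matrix_def by (auto simp: basis2_mod_def eigenspace_B_def K_def)
  obtain G1 G2 where G: "modform (2 * int n) e1 G1" "modform (2 * int n) e2 G2" "fls_nth G1 0 = 0" "fls_nth G2 0 = 0"
    "pair (Suc w) G2 G1 \<in> K" "pair (Suc w) G2 G1 \<noteq> 0"
    by (rule eigenclass_pairing[OF assms(1,2) basis l, folded K_def, unfolded sw], rule that)
  obtain E where E: "\<And>i z. Im z > 0 \<Longrightarrow> (E i has_field_derivative E (Suc i) z) (at z)"
    "\<And>i z. Im z > 0 \<Longrightarrow> E i (z + 1) = E i z"
    "\<And>z. Im z > 0 \<Longrightarrow> E (Suc w) (- 1 / z) = z ^ (w + 2) * E (Suc w) z"
    "\<And>z. Im z > 0 \<Longrightarrow> E (Suc w) z = fact w * (2 * of_real pi * \<i>) ^ Suc w * e1 z"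
    "qexp (E 0) (fls_const (fact w) * fls_int (Suc w) G1)"
    by (rule eichler_integral_exists[OF w_def assms(1) G(1,3)], rule that)
  obtain D where D: "\<And>i z. Im z > 0 \<Longrightarrow> (D i has_field_derivative D (Suc i) z) (at z)"
    "\<And>i z. Im z > 0 \<Longrightarrow> D i (z + 1) = D i z"
    "\<And>z. Im z > 0 \<Longrightarrow> D (Suc w) (- 1 / z) = z ^ (w + 2) * D (Suc w) z"
    "\<And>z. Im z > 0 \<Longrightarrow> D (Suc w) z = fact w * (2 * of_real pi * \<i>) ^ Suc w * e2 z"
    "qexp (D 0) (fls_const (fact w) * fls_int (Suc w) G2)"
    by (rule eichler_integral_exists[OF w_def assms(1) G(2,4)], rule that)
  obtain k1 where k1: "\<And>z. Im z > 0 \<Longrightarrow> act_S w (eichler w E (- 1 / z)) = eichler w E z + k1"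
    by (rule eichler_act_S[of w E, OF ew E(1,3)], assumption, assumption, rule that)
  obtain k2 where k2: "\<And>z. Im z > 0 \<Longrightarrow> act_S w (eichler w D (- 1 / z)) = eichler w D z + k2"
    by (rule eichler_act_S[of w D, OF ew D(1,3)], assumption, assumption, rule that)
  define c where "c = C * fact w * pair (Suc w) G2 G1"
  have q: "qexp (\<lambda>z. C * e2 z * E 0 z) (fls_const C * G2 * (fls_const (fact w) * fls_int (Suc w) G1))"
    by (intro qexp_mult qexp_cmult E(5) modform_qexp[OF G(2)])
  have c: "fls_nth (fls_const C * G2 * (fls_const (fact w) * fls_int (Suc w) G1)) 0 = c"
  proof -
    have "fls_const C * G2 * (fls_const (fact w) * fls_int (Suc w) G1) =
        fls_const (C * fact w) * (G2 * fls_int (Suc w) G1)"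
      by (simp only: fls_const_mult_const[symmetric] mult_ac)
    thus ?thesis by (simp only: c_def pair_def fls_mult_const_nth)
  qed
  obtain H where H: "\<And>z. Im z > 0 \<Longrightarrow> (H has_field_derivative C * e2 z * E 0 z) (at z)" "\<And>z. H (z + 1) - H z = c"
    using qexp_primitive[OF q] unfolding c by metis
  have Hd: "(H has_field_derivative D (Suc w) z / fact w * E 0 z) (at z)" if "Im z > 0" for z
  proof -
    have "D (Suc w) z = fact w * (C * e2 z)" using D(4)[OF that] unfolding C_def mult.assoc .
    hence "D (Suc w) z / fact w = C * e2 z" by simp
    thus ?thesis using H(1)[OF that] by (simp only:)
  qed
  note hab = haberland[of w E D H c k1 k2, OF ew E(1-3) D(1-3) Hd H(2) k1 k2]
  have pk: "period_poly w k1" "period_poly w k2" "c = - period_pairing w k1 k2 / 6" by (rule hab; assumption)+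
  obtain u where u: "k1 = smult (P $ 1 $ 1) (dehomogenize (c1 Smat)) + smult (P $ 2 $ 1) (dehomogenize (c2 Smat)) + (act_S w u - u)"
    "smult (P $ 1 $ 1) (dehomogenize (c1 (Tmat 1))) + smult (P $ 2 $ 1) (dehomogenize (c2 (Tmat 1))) + (act_T u - u) = 0" "degree u \<le> w"
    using comp_cocycle_relation[where E = E and e = e1 and k = k1, OF w_def assms(1,3) E(1,2,4) k1 pk(1) rel(1)] by blast
  obtain v where v: "k2 = smult (P $ 1 $ 2) (dehomogenize (c1 Smat)) + smult (P $ 2 $ 2) (dehomogenize (c2 Smat)) + (act_S w v - v)"
    "smult (P $ 1 $ 2) (dehomogenize (c1 (Tmat 1))) + smult (P $ 2 $ 2) (dehomogenize (c2 (Tmat 1))) + (act_T v - v) = 0" "degree v \<le> w"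
    using comp_cocycle_relation[where E = D and e = e2 and k = k2, OF w_def assms(1,3) D(1,2,4) k2 pk(2) rel(2)] by blast
  have c0: "c \<noteq> 0" using G(6) by (simp add: c_def C_def)
  hence nz: "period_pairing w k1 k2 \<noteq> 0" using pk(3) by auto
  note over = B_cocycle_dehomogenize[OF K cs(1) Smat_in, folded w_def] B_cocycle_dehomogenize[OF K cs(2) Smat_in, folded w_def]
    B_cocycle_dehomogenize[OF K cs(1) Tmat_in[of 1], folded w_def] B_cocycle_dehomogenize[OF K cs(2) Tmat_in[of 1], folded w_def]
  obtain x where x: "x \<in> K" "x \<noteq> 0" "period_pairing w k1 k2 = (P $ 1 $ 1 * P $ 2 $ 2 - P $ 1 $ 2 * P $ 2 $ 1) * x"
    using period_determinant[OF ew K _ _ _ _ _ _ _ _ pk(1) u pk(2) v nz] over by blast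
  have "det P * x = - 6 * c" using x(3) pk(3) by (simp add: det_2)
  hence "det P = C * (- 6 * fact w * pair (Suc w) G2 G1 / x)" using x(2) by (simp add: c_def field_simps)
  moreover have "- 6 * fact w * pair (Suc w) G2 G1 / x \<in> K"
    by (intro subfieldD(8)[OF K] subfieldD(4)[OF K] subfieldD(5)[OF K] subfield_numeral[OF K] subfield_fact[OF K] G(5) x(1))
  moreover have "- 6 * fact w * pair (Suc w) G2 G1 / x \<noteq> 0" using G(6) x(2) by simp
  ultimately show ?thesis unfolding K_def[symmetric] C_def sw by blast
qed

end
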